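(* There exists a constant $C_1>0$ such that the following holds. Let $\mu\ge0$, let $\Gamma$ be a measurable matrix function on $(-\infty,3)$ with $\|\Gamma\|_\infty\le\mu$, and let $r$ be a (weak finite-energy) solution of \[ r_{tt}-L_0r=C^*\Gamma(t)Cr\quad\text{on }(-\infty,3). \] Put \[ G=\mathcal N_{(-4,3)}(r),\qquad A=\mathcal N_{(-1,0)}(r),\qquad \Lambda=\log\frac{eG}{A}, \] and assume $A>0$. Then for every $T\le-4$, \[ \mathcal N_{(T,T+1)}(r)\le\exp\bigl(C_1(1+\mu^2+\Lambda)\bigr)\,\mathcal N_{(T-3,T)}(r). \] Consequently, for every $T\le-4$, \[ \mathcal N_{(T-3,T)}(r)\ge A\exp\bigl[-C_1(1+\mu^2+\Lambda)(1+|T|)\bigr]. \]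
   Context: Let $\omega(\varphi)=(\sin\varphi)^{1/2}$, $\mathcal H=L^2((0,\pi),\omega\,d\varphi)$, $\mathfrak a_0[f,g]=4\int_0^\pi\omega f'\,\overline{g'}\,d\varphi$ with form domain $\mathcal V=\{f\in\mathcal H:f\in H^1_{\mathrm{loc}}(0,\pi),\int_0^\pi\omega|f'|^2d\varphi<\infty\}$, $\|f\|_{\mathcal V}^2=\mathfrak a_0[f,f]+\|f\|_{\mathcal H}^2$, $\mathcal V^*$ the (anti)dual with pivot $\mathcal H$; $A_0$ is the operator of $\mathfrak a_0$ (also a bounded map $\mathcal V\to\mathcal V^*$), $A_0f=-4\omega^{-1}(\omega f')'$, and $L_0=A_0+\frac14I$. The trace operator $C:\mathcal V\to\mathbb C^2$, $Cf=(f(0),f(\pi))^{\mathsf T}$ (endpoint values), is bounded, with dual $C^*:\mathbb C^2\to\mathcal V^*$. $\Gamma$ takes values in $\mathbb C^{2\times2}$. Solutions are understood in the weak finite-energy sense on bounded intervals $J\subset(-\infty,3)$: $r\in L^2(J;\mathcal V)\cap H^1(J;\mathcal H)$, $r_{tt}\in L^2(J;\mathcal V^* )$, and the equation holds in $L^2(J;\mathcal V^* )$. (Equivalently $r=e^{t/2}w$ with $w$ a weak finite-energy solution of $w_{tt}+w_t-A_0w=C^*\Gamma Cw$.) For an interval $I$, $\mathcal N_I(r)=\|r\|_{L^2(I;\mathcal H)}$. *)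

theory Defs
  imports "HOL-Analysis.Analysis"
begin

section \<open>The weighted space and the form on the interval from 0 to pi\<close>

text \<open>
  Elements of the spaces below are functions \<^typ>\<open>real \<Rightarrow> complex\<close> regarded as representatives
  of their classes modulo equality almost everywhere on the open interval; values elsewhere are
  irrelevant. All norms are therefore seminorms on the carrier sets.
\<close>

definition \<omega> :: "real \<Rightarrow> real" where
  "\<omega> \<phi> = sqrt (sin \<phi>)"

definition wmeas :: "real measure" where
  "wmeas = density (lebesgue_on {0<..<pi}) (\<lambda>\<phi>. ennreal (\<omega> \<phi>))"

definition H :: "(real \<Rightarrow> complex) set" where
  "H = {f \<in> borel_measurable wmeas. integrable wmeas (\<lambda>\<phi>. (norm (f \<phi>))\<^sup>2)}"

definition innerH :: "(real \<Rightarrow> complex) \<Rightarrow> (real \<Rightarrow> complex) \<Rightarrow> complex" where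
  "innerH f g = (LINT \<phi>|wmeas. f \<phi> * cnj (g \<phi>))"

definition normH :: "(real \<Rightarrow> complex) \<Rightarrow> real" where
  "normH f = sqrt (LINT \<phi>|wmeas. (norm (f \<phi>))\<^sup>2)"

definition test_functions :: "real set \<Rightarrow> (real \<Rightarrow> real) set" where
  "test_functions U = {\<eta>. (\<forall>n x. (deriv ^^ n) \<eta> differentiable (at x)) \<and>
     (\<exists>K. compact K \<and> K \<subseteq> U \<and> (\<forall>x. x \<notin> K \<longrightarrow> \<eta> x = 0))}"

definition L2_loc :: "(real \<Rightarrow> complex) set" where
  "L2_loc = {f. \<forall>K. compact K \<and> K \<subseteq> {0<..<pi} \<longrightarrow>
     f \<in> borel_measurable (lebesgue_on K) \<and>
     integrable (lebesgue_on K) (\<lambda>\<phi>. (norm (f \<phi>))\<^sup>2)}"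

definition is_weak_deriv :: "(real \<Rightarrow> complex) \<Rightarrow> (real \<Rightarrow> complex) \<Rightarrow> bool" where
  "is_weak_deriv f g \<longleftrightarrow> (\<forall>\<eta> \<in> test_functions {0<..<pi}.
     (LINT \<phi>|lebesgue_on {0<..<pi}. deriv \<eta> \<phi> *\<^sub>R f \<phi>) =
     - (LINT \<phi>|lebesgue_on {0<..<pi}. \<eta> \<phi> *\<^sub>R g \<phi>))"

definition H1_loc :: "(real \<Rightarrow> complex) set" where
  "H1_loc = {f \<in> L2_loc. \<exists>g \<in> L2_loc. is_weak_deriv f g}"

text \<open>For \<open>f\<close> in \<open>H1_loc\<close> the weak derivative is unique up to a null set.\<close>

definition wderiv :: "(real \<Rightarrow> complex) \<Rightarrow> real \<Rightarrow> complex" where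
  "wderiv f = (SOME g. g \<in> L2_loc \<and> is_weak_deriv f g)"

definition a0 :: "(real \<Rightarrow> complex) \<Rightarrow> (real \<Rightarrow> complex) \<Rightarrow> complex" where
  "a0 f g = 4 * (LINT \<phi>|wmeas. wderiv f \<phi> * cnj (wderiv g \<phi>))"

definition V :: "(real \<Rightarrow> complex) set" where
  "V = {f \<in> H. f \<in> H1_loc \<and> integrable wmeas (\<lambda>\<phi>. (norm (wderiv f \<phi>))\<^sup>2)}"

definition normV :: "(real \<Rightarrow> complex) \<Rightarrow> real" where
  "normV f = sqrt (Re (a0 f f) + (normH f)\<^sup>2)"


section \<open>The antidual and the operators into it\<close>

text \<open>
  Bounded antilinear functionals on \<open>V\<close>; only their values on \<open>V\<close> matter. The pivot embedding of
  \<open>H\<close> sends \<open>f\<close> to the functional \<open>innerH f\<close>.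
\<close>

definition Vdual :: "((real \<Rightarrow> complex) \<Rightarrow> complex) set" where
  "Vdual = {F. (\<forall>f\<in>V. \<forall>g\<in>V. F (\<lambda>\<phi>. f \<phi> + g \<phi>) = F f + F g) \<and>
               (\<forall>c. \<forall>f\<in>V. F (\<lambda>\<phi>. c * f \<phi>) = cnj c * F f) \<and>
               (\<exists>B. \<forall>f\<in>V. norm (F f) \<le> B * normV f)}"

definition normVdual :: "((real \<Rightarrow> complex) \<Rightarrow> complex) \<Rightarrow> real" where
  "normVdual F = (SUP f \<in> {f \<in> V. normV f \<le> 1}. norm (F f))"

definition A0 :: "(real \<Rightarrow> complex) \<Rightarrow> (real \<Rightarrow> complex) \<Rightarrow> complex" where
  "A0 f = (\<lambda>v. a0 f v)"

definition L0 :: "(real \<Rightarrow> complex) \<Rightarrow> (real \<Rightarrow> complex) \<Rightarrow> complex" where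
  "L0 f = (\<lambda>v. A0 f v + 1 / 4 * innerH f v)"

text \<open>
  Every class in \<open>V\<close> has a representative that is continuous up to the endpoints, because
  \<open>1 / \<omega>\<close> is integrable; the endpoint values are those of this representative.
\<close>

definition cont_rep :: "(real \<Rightarrow> complex) \<Rightarrow> real \<Rightarrow> complex" where
  "cont_rep f = (SOME g. continuous_on {0..pi} g \<and>
                         (AE \<phi> in lebesgue_on {0<..<pi}. f \<phi> = g \<phi>))"

definition Ctr :: "(real \<Rightarrow> complex) \<Rightarrow> complex ^ 2" where
  "Ctr f = vector [cont_rep f 0, cont_rep f pi]"

definition Ctr_dual :: "complex ^ 2 \<Rightarrow> (real \<Rightarrow> complex) \<Rightarrow> complex" where
  "Ctr_dual z = (\<lambda>v. \<Sum>i\<in>UNIV. z $ i * cnj (Ctr v $ i))"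


section \<open>Bochner spaces and weak finite-energy solutions\<close>

text \<open>
  Square integrable functions of time with values in the space \<open>S\<close> normed by \<open>N\<close>: strong
  measurability (almost everywhere limit in \<open>N\<close> of simple functions) and square integrable norm.
\<close>

definition bochner_L2 :: "real set \<Rightarrow> 'x set \<Rightarrow> ('x \<Rightarrow> real) \<Rightarrow> (real \<Rightarrow> 'x::minus) \<Rightarrow> bool" where
  "bochner_L2 J S N u \<longleftrightarrow>
     (\<exists>s. (\<forall>n. simple_function (lebesgue_on J) (s n) \<and> (\<forall>t\<in>J. s n t \<in> S)) \<and>
          (AE t in lebesgue_on J. u t \<in> S \<and> (\<lambda>n. N (u t - s n t)) \<longlonglongrightarrow> 0)) \<and>
     integrable (lebesgue_on J) (\<lambda>t. (N (u t))\<^sup>2)"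

text \<open>
  \<open>w\<close> is the distributional time derivative of \<open>u\<close> on \<open>J\<close>, both functional-valued. The
  vector-valued identity is evaluated at each \<open>v\<close> in \<open>W\<close>, evaluation at \<open>v\<close> commuting with the
  Bochner integral. With \<open>W = H\<close> this is the derivative in \<open>H\<close> (through the inner product), with
  \<open>W = V\<close> the derivative in the antidual of \<open>V\<close>.
\<close>

definition has_weak_time_deriv ::
  "real set \<Rightarrow> 'x set \<Rightarrow> (real \<Rightarrow> 'x \<Rightarrow> complex) \<Rightarrow> (real \<Rightarrow> 'x \<Rightarrow> complex) \<Rightarrow> bool" where
  "has_weak_time_deriv J W u w \<longleftrightarrow> (\<forall>\<eta> \<in> test_functions J. \<forall>v\<in>W.
     (LINT t|lebesgue_on J. deriv \<eta> t *\<^sub>R u t v) =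
     - (LINT t|lebesgue_on J. \<eta> t *\<^sub>R w t v))"

text \<open>
  Solutions of \<open>r_tt - L0 r = C* \<Gamma> C r\<close> on the bounded interval \<open>J\<close>; the witnesses \<open>p\<close> and \<open>q\<close>
  are \<open>r_t\<close> and \<open>r_tt\<close>.
\<close>

definition weak_solution_on ::
  "real set \<Rightarrow> (real \<Rightarrow> complex ^ 2 ^ 2) \<Rightarrow> (real \<Rightarrow> real \<Rightarrow> complex) \<Rightarrow> bool" where
  "weak_solution_on J \<Gamma> r \<longleftrightarrow>
     bochner_L2 J V normV r \<and> bochner_L2 J H normH r \<and>
     (\<exists>p q. bochner_L2 J H normH p \<and>
            has_weak_time_deriv J H (\<lambda>t. innerH (r t)) (\<lambda>t. innerH (p t)) \<and>
            bochner_L2 J Vdual normVdual q \<and>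
            has_weak_time_deriv J V (\<lambda>t. innerH (p t)) q \<and>
            (AE t in lebesgue_on J. \<forall>v\<in>V.
               q t v - L0 (r t) v = Ctr_dual (\<Gamma> t *v Ctr (r t)) v))"

definition weak_solution ::
  "(real \<Rightarrow> complex ^ 2 ^ 2) \<Rightarrow> (real \<Rightarrow> real \<Rightarrow> complex) \<Rightarrow> bool" where
  "weak_solution \<Gamma> r \<longleftrightarrow> (\<forall>a b. a < b \<and> b \<le> 3 \<longrightarrow> weak_solution_on {a<..<b} \<Gamma> r)"

definition \<N> :: "real set \<Rightarrow> (real \<Rightarrow> real \<Rightarrow> complex) \<Rightarrow> real" where
  "\<N> I r = sqrt (LINT t|lebesgue_on I. (normH (r t))\<^sup>2)"

end

theory Submission
  imports Defs "HOL-Computational_Algebra.Polynomial"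
begin

text \<open>
  The statement is a quantitative unique continuation result: a solution that is visible on
  \<open>(-1, 0)\<close> cannot become too small in the past. It follows from a Carleman estimate with the
  linear weight \<open>exp (- \<tau> t)\<close>, where \<open>\<tau>\<close> lies in the middle of a gap of the spectrum of
  \<open>sqrt L0\<close>.

  Separation of variables. The eigenfunctions of \<open>A0\<close> are the Gegenbauer polynomials
  \<open>E n \<phi> = C_n^(1/4) (cos \<phi>)\<close> with eigenvalue \<open>4 n (n + 1/2)\<close>, so that \<open>L0\<close> has the
  eigenvalues \<open>(freq n)\<^sup>2\<close> with \<open>freq n = 2 n + 1/2\<close>. They form an orthonormal basis of \<open>H\<close>
  after normalisation, and their normalised boundary values are \<open>sqrt (bdry_sq n)\<close> at \<open>0\<close> and
  \<open>(-1)^n sqrt (bdry_sq n)\<close> at \<open>pi\<close>, with \<open>bdry_sq n\<close> of size \<open>sqrt n\<close>. The coefficients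
  \<open>r_n\<close> of a solution satisfy scalar equations
  \<open>r_n'' - (freq n)\<^sup>2 r_n = sqrt (bdry_sq n) (g_+ + (-1)^n g_-)\<close>, where \<open>(g_+, g_-)\<close> is
  \<open>\<Gamma> C r\<close> and is bounded pointwise by \<open>\<mu>\<close> times the traces of \<open>r\<close> (\<open>weak_mode\<close>,
  \<open>rflux_bound\<close>).

  The Carleman estimate. Cut \<open>r\<close> off by \<open>\<psi>\<close>, multiply by \<open>exp (- \<tau> t)\<close>, and take Fourier
  coefficients in \<open>t\<close>. The second derivative becomes multiplication by \<open>z\<^sup>2\<close> with \<open>Re z = \<tau>\<close>, and the
  symbol \<open>z\<^sup>2 - (freq n)\<^sup>2\<close> is at least \<open>norm z\<close> in modulus, because \<open>\<tau>\<close> has distance at least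
  one from every \<open>freq n\<close>. This controls the commutator terms \<open>2 z \<psi>'\<close> and \<open>\<psi>''\<close>. The boundary
  coupling is controlled through the compressed resolvent
  \<open>\<Sum>n. (\<plusminus>1)^n bdry_sq n / (z\<^sup>2 - (freq n)\<^sup>2)\<close>. Taking absolute values would give
  \<open>ln \<tau> / sqrt \<tau>\<close>; pairing the frequencies symmetric about \<open>\<tau>\<close> removes the logarithm, so the
  sum is \<open>O (1 / sqrt \<tau>)\<close> uniformly in \<open>Im z\<close> (\<open>trace_resolvent_bound\<close>). Hence the coupling
  term is absorbed as soon as \<open>\<tau>\<close> exceeds a constant times \<open>\<mu>\<^sup>2\<close>, which is where \<open>\<mu>\<^sup>2\<close> in the exponent
  comes from. The outcome is \<open>carleman\<close>: weighted norms of \<open>\<psi> r\<close> are bounded by those of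
  \<open>\<psi>' r\<close> and \<open>\<psi>'' r\<close>.

  Conclusion. With \<open>\<psi> = 1\<close> on \<open>[T - 1, 1]\<close> and supported in \<open>[T - 2, 2]\<close>, the right-hand side
  consists of a term from \<open>(T - 3, T)\<close> and a term from \<open>[1, 2]\<close>. The latter is bounded by \<open>G\<close>, with a
  weight that is smaller by the factor \<open>exp (- \<tau>)\<close> than the weight at time \<open>0\<close>. For \<open>\<tau>\<close> above \<open>ln (2 C G / A)\<close> the second term is at most half of
  what \<open>(-1, 0)\<close> contributes on the left, and it is absorbed (\<open>propagation_absorb\<close>). So \<open>\<tau>\<close> of
  size \<open>1 + \<mu>\<^sup>2 + \<Lambda>\<close> works. The same inequality, read on \<open>(T, T + 1)\<close> and on \<open>(-1, 0)\<close>, gives both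
  claims; the second one costs \<open>exp (\<tau> (2 + \<bar>T\<bar>))\<close> directly, without iterating the first.
\<close>

section \<open>The compressed resolvent sums\<close>

text \<open>
  The number \<open>binomial (2 n) n / 4 ^ n\<close>, which is the value at \<open>1\<close> of the \<open>n\<close>-th
  Gegenbauer polynomial of order \<open>1/4\<close>.
\<close>

primrec cbinom :: "nat \<Rightarrow> real" where
  "cbinom 0 = 1"
| "cbinom (Suc n) = cbinom n * (2 * real n + 1) / (2 * real n + 2)"

declare cbinom.simps(2) [simp del]

text \<open>
  The square roots of the eigenvalues of \<open>L0\<close>.
\<close>

definition freq :: "nat \<Rightarrow> real" where
  "freq n = 2 * real n + 1 / 2"

lemma freq_pos: "freq n > 0"
  by (simp add: freq_def)

lemma cbinom_pos: "cbinom n > 0"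
  by (induction n) (auto simp: cbinom.simps(2))

lemma cbinom_diff: "cbinom n - cbinom (Suc n) = cbinom n / (2 * real n + 2)"
  by (simp add: cbinom.simps(2) field_simps)

lemma cbinom_antimono: "m \<le> n \<Longrightarrow> cbinom n \<le> cbinom m"
proof (rule lift_Suc_antimono_le[of cbinom])
  show "cbinom n \<ge> cbinom (Suc n)" for n
  proof -
    have "0 \<le> cbinom n / (2 * real n + 2)" using cbinom_pos[of n] by (intro divide_nonneg_nonneg) auto
    then show ?thesis using cbinom_diff[of n] by linarith
  qed
qed

lemma cbinom_le_1: "cbinom n \<le> 1"
  using cbinom_antimono[of 0 n] by simp

text \<open>
  Since \<open>cbinom n\<close> behaves like \<open>1 / sqrt n\<close>, multiplication by \<open>n\<close> reverses its
  monotonicity. Both directions together bound the differences of \<open>cbinom\<close> near \<open>N\<close>.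
\<close>

lemma times_cbinom_mono:
  assumes "m \<le> n"
  shows "real m * cbinom m \<le> real n * cbinom n"
proof (rule lift_Suc_mono_le[of "\<lambda>n. real n * cbinom n", OF _ assms])
  fix n
  have "(2 * real n) * cbinom n \<le> (2 * real n + 1) * cbinom n"
    using cbinom_pos[of n] by (intro mult_right_mono) auto
  also have "\<dots> = 2 * (real (Suc n) * cbinom (Suc n))"
    by (simp add: cbinom.simps(2) field_simps)
  finally show "real n * cbinom n \<le> real (Suc n) * cbinom (Suc n)" by simp
qed

lemma sum_cbinom: "(\<Sum>j<n. cbinom j) = 2 * real n * cbinom n"
  by (induction n) (simp_all add: cbinom.simps(2) field_simps)

lemma cbinom_sq_le: "(cbinom n)\<^sup>2 * (2 * real n + 1) \<le> 1"
proof (induction n)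
  case (Suc n)
  let ?x = "real n"
  have "(cbinom (Suc n))\<^sup>2 * (2 * real (Suc n) + 1)
      = ((cbinom n)\<^sup>2 * (2 * ?x + 1)) * ((2 * ?x + 1) * (2 * ?x + 3) / (2 * ?x + 2)\<^sup>2)"
    by (simp add: cbinom.simps(2) power2_eq_square field_simps)
  also have "\<dots> \<le> 1 * 1"
  proof (rule mult_mono)
    show "(2 * ?x + 1) * (2 * ?x + 3) / (2 * ?x + 2)\<^sup>2 \<le> 1"
    proof -
      have "(2 * ?x + 1) * (2 * ?x + 3) \<le> (2 * ?x + 2)\<^sup>2" by (simp add: power2_eq_square algebra_simps)
      moreover have "(2 * ?x + 2)\<^sup>2 > 0" by simp
      ultimately show ?thesis by (simp add: divide_le_eq_1_pos)
    qed
  qed (use Suc in auto)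
  finally show ?case by simp
qed simp

lemma cbinom_diff_le_left:
  assumes "j < N"
  shows "cbinom j - cbinom N \<le> cbinom j * (real N - real j) / real N"
proof -
  have "real j * cbinom j \<le> real N * cbinom N" using times_cbinom_mono assms by simp
  then show ?thesis using assms by (simp add: field_simps)
qed

lemma sum_inverse_odd_squares: "(\<Sum>k<n. 1 / (2 * real k + 1)\<^sup>2) \<le> 2"
proof -
  have "(\<Sum>k<n. 1 / (2 * real k + 1)\<^sup>2) \<le> 2 - 2 / (real n + 1)"
  proof (induction n)
    case (Suc n)
    have "1 / (2 * real n + 1)\<^sup>2 \<le> 2 / ((real n + 1) * (real n + 2))"
    proof -
      have "(real n + 1) * (real n + 2) \<le> 2 * (2 * real n + 1)\<^sup>2"
        by (simp add: power2_eq_square algebra_simps)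
      then show ?thesis by (simp add: divide_simps) (auto simp: algebra_simps)?
    qed
    also have "\<dots> = 2 / (real n + 1) - 2 / (real n + 2)"
      by (simp add: field_simps)
    finally show ?case using Suc by (simp add: algebra_simps)
  qed simp
  also have "\<dots> \<le> 2" by simp
  finally show ?thesis .
qed

lemma sum_lorentzian_odd:
  assumes "x \<ge> (0::real)"
  shows "(\<Sum>k<n. x / (x\<^sup>2 + (2 * real k + 1)\<^sup>2)) \<le> 1"
proof (cases "x = 0")
  case False
  then have x: "x > 0" using assms by simp
  have "(\<Sum>k<n. x / (x\<^sup>2 + (2 * real k + 1)\<^sup>2)) \<le> 1 - x / (x + 2 * real n)"
  proof (induction n)
    case (Suc n)
    let ?m = "2 * real n + 1"
    have p: "0 < (x + ?m - 1) * (x + ?m + 1)" using x by (simp add: add_pos_nonneg)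
    have "(x + ?m - 1) * (x + ?m + 1) \<le> (x + ?m)\<^sup>2"
      by (simp add: power2_eq_square algebra_simps)
    also have "\<dots> \<le> 2 * (x\<^sup>2 + ?m\<^sup>2)"
      using zero_le_power2[of "x - ?m"] by (simp add: power2_eq_square algebra_simps)
    finally have q: "(x + ?m - 1) * (x + ?m + 1) \<le> 2 * (x\<^sup>2 + ?m\<^sup>2)" .
    have "x / (x\<^sup>2 + ?m\<^sup>2) = 2 * x / (2 * (x\<^sup>2 + ?m\<^sup>2))" by (rule mult_divide_mult_cancel_left[symmetric]) simp
    also have "\<dots> \<le> 2 * x / ((x + ?m - 1) * (x + ?m + 1))"
      using p q x by (intro divide_left_mono) (auto intro!: mult_pos_pos add_pos_nonneg)
    also have "\<dots> = x / (x + 2 * real n) - x / (x + 2 * real (Suc n))"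
      using x by (simp add: divide_simps add_pos_nonneg) (simp add: algebra_simps)?
    finally show ?case using Suc by simp
  qed (use x in simp)
  also have "\<dots> \<le> 1" using x by simp
  finally show ?thesis .
qed simp

text \<open>
  An alternating sum is controlled by the total variation of its terms: consecutive terms are
  paired, and for odd length one term is left over.
\<close>

lemma alternating_sum_bound:
  fixes g :: "nat \<Rightarrow> real"
  shows "\<bar>(\<Sum>k<n. (- 1) ^ k * g k) - (if odd n then g n else 0)\<bar> \<le> (\<Sum>k<n. \<bar>g (Suc k) - g k\<bar>)"
proof (induction n)
  case (Suc n)
  then show ?case by (cases "odd n") auto
qed simp

text \<open>
  The midpoint of the gap between \<open>freq N\<close> and \<open>freq (N + 1)\<close>. Its distances to the
  frequencies are the odd numbers, and they are symmetric about it.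
\<close>

definition tau :: "nat \<Rightarrow> real" where
  "tau N = 2 * real N + 3 / 2"

lemma tau_ge_1: "tau N \<ge> 1"
  by (simp add: tau_def)

lemma cbinom_le_tau: "cbinom N \<le> 2 / sqrt (tau N)"
proof -
  have "(cbinom N)\<^sup>2 * tau N \<le> (cbinom N)\<^sup>2 * (4 * (2 * real N + 1))"
    by (intro mult_left_mono) (auto simp: tau_def)
  also have "\<dots> \<le> 4" using cbinom_sq_le[of N] by (simp add: algebra_simps)
  finally have "sqrt ((cbinom N)\<^sup>2 * tau N) \<le> sqrt (2 ^ 2)" by (subst real_sqrt_le_iff) simp
  then have "cbinom N * sqrt (tau N) \<le> 2"
    using cbinom_pos[of N] by (simp add: real_sqrt_mult)
  then show ?thesis using tau_ge_1[of N] by (simp add: field_simps)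
qed

lemma norm_diff_freq:
  assumes "Re z = tau N"
  shows "(norm (z - of_real (freq n)))\<^sup>2 = (Im z)\<^sup>2 + (2 * (real N - real n) + 1)\<^sup>2"
  using assms by (simp add: cmod_power2 tau_def freq_def algebra_simps)

lemma norm_diff_freq_ge:
  assumes "Re z = tau N"
  shows "norm (z - of_real (freq n)) \<ge> \<bar>2 * (real N - real n) + 1\<bar>"
  using abs_Re_le_cmod[of "z - of_real (freq n)"] assms by (simp add: tau_def freq_def algebra_simps)

lemma odd_int_abs_ge_1: "\<bar>2 * (real N - real n) + 1\<bar> \<ge> 1"
proof -
  have "\<bar>2 * (int N - int n) + 1\<bar> \<ge> 1" by presburger
  then have "real_of_int \<bar>2 * (int N - int n) + 1\<bar> \<ge> 1" by linarith
  then show ?thesis by simp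
qed

lemma norm_add_freq:
  assumes "Re z = tau N"
  shows "norm (z + of_real (freq n)) \<ge> norm z" "norm (z + of_real (freq n)) \<ge> freq n + tau N"
proof -
  have "tau N \<ge> 0" "freq n \<ge> 0" using tau_ge_1[of N] freq_pos[of n] by simp_all
  then show "norm (z + of_real (freq n)) \<ge> norm z"
    using assms by (auto simp: cmod_def intro!: power_mono)
  show "norm (z + of_real (freq n)) \<ge> freq n + tau N"
    using abs_Re_le_cmod[of "z + of_real (freq n)"] assms by simp
qed

lemma z_ne_freq:
  assumes "Re z = tau N"
  shows "z - of_real (freq n) \<noteq> 0" "z + of_real (freq n) \<noteq> 0" "z\<^sup>2 - of_real ((freq n)\<^sup>2) \<noteq> 0"
proof -
  show a: "z - of_real (freq n) \<noteq> 0"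
    using norm_diff_freq_ge[OF assms, of n] odd_int_abs_ge_1[of N n] by force
  show b: "z + of_real (freq n) \<noteq> 0"
    using norm_add_freq(2)[OF assms, of n] tau_ge_1[of N] freq_pos[of n] by force
  have "z\<^sup>2 - of_real ((freq n)\<^sup>2) = (z - of_real (freq n)) * (z + of_real (freq n))"
    by (simp add: power2_eq_square algebra_simps)
  then show "z\<^sup>2 - of_real ((freq n)\<^sup>2) \<noteq> 0" using a b by simp
qed

text \<open>
  The spectral gap: \<open>z\<close> is at distance at least one from every frequency, and the other factor
  \<open>z + freq n\<close> is at least \<open>norm z\<close>. This gain of one power of \<open>norm z\<close> is what absorbs the first
  order commutator term.
\<close>

lemma norm_symbol_ge:
  assumes "Re z = tau N"
  shows "norm z \<le> norm (z\<^sup>2 - of_real ((freq n)\<^sup>2))" "1 \<le> norm (z\<^sup>2 - of_real ((freq n)\<^sup>2))"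
proof -
  have e: "z\<^sup>2 - of_real ((freq n)\<^sup>2) = (z - of_real (freq n)) * (z + of_real (freq n))"
    by (simp add: power2_eq_square algebra_simps)
  have "1 * norm z \<le> norm (z - of_real (freq n)) * norm (z + of_real (freq n))"
    using norm_diff_freq_ge[OF assms, of n] odd_int_abs_ge_1[of N n] norm_add_freq(1)[OF assms, of n]
    by (intro mult_mono) auto
  then show "norm z \<le> norm (z\<^sup>2 - of_real ((freq n)\<^sup>2))" by (simp only: e norm_mult mult_1)
  moreover have "1 \<le> norm z" using abs_Re_le_cmod[of z] assms tau_ge_1[of N] by simp
  ultimately show "1 \<le> norm (z\<^sup>2 - of_real ((freq n)\<^sup>2))" by simp
qed

lemma sum_shift_split:
  fixes F :: "nat \<Rightarrow> 'a::comm_monoid_add"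
  shows "(\<Sum>n<m + M. F n) = (\<Sum>k<m. F k) + (\<Sum>k<M. F (m + k))"
  by (induction M) (simp_all add: add.assoc)

lemma sum_two_sided:
  fixes F :: "nat \<Rightarrow> 'a::comm_monoid_add"
  shows "(\<Sum>n<N + 1 + M. F n) = (\<Sum>k<N + 1. F (N - k)) + (\<Sum>k<M. F (N + 1 + k))"
  unfolding sum_shift_split[of _ "N + 1" M]
  using sum.nat_diff_reindex[of F "N + 1"] by simp

text \<open>
  The cancellation that removes a logarithm. Frequencies symmetric about \<open>tau N\<close> are paired. With
  equal signs the real parts of \<open>1 / (z - freq n)\<close> cancel and the imaginary parts form a Lorentzian
  sum. With alternating signs the imaginary parts cancel, and the real parts form an alternating sum
  of bounded variation.
\<close>

lemma centered_cauchy_sum: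
  fixes z :: complex
  assumes z: "Re z = tau N" and s: "s = 1 \<or> s = (- 1 :: real)"
  shows "norm (\<Sum>n<2 * N + 2. of_real (s ^ n) / (z - of_real (freq n))) \<le> 10"
proof -
  define \<xi> where "\<xi> = Im z"
  define m where "m k = 2 * real k + 1" for k
  define g where "g k = 2 * m k / ((m k)\<^sup>2 + \<xi>\<^sup>2)" for k
  have mpos: "m k \<ge> 1" for k by (simp add: m_def)
  define F where "F n = of_real (s ^ n) / (z - of_real (freq n))" for n
  \<comment> \<open>The frequencies with indices \<open>N - k\<close> and \<open>N + 1 + k\<close> lie at the distances \<open>m k\<close> and \<open>- m k\<close> from \<open>tau N\<close>.\<close>
  have eq: "F (N - k) + F (N + 1 + k) = of_real (s ^ N) * (of_real (s ^ k) *
      (if s = 1 then - (2 * \<i> * of_real (\<xi> / ((m k)\<^sup>2 + \<xi>\<^sup>2))) else of_real (g k)))"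
    if "k < N + 1" for k
  proof -
    have z1: "z - of_real (freq (N - k)) = Complex (m k) \<xi>"
      using z that by (simp add: complex_eq_iff tau_def freq_def m_def \<xi>_def of_nat_diff)
    have z2: "z - of_real (freq (N + 1 + k)) = Complex (- m k) \<xi>"
      using z by (simp add: complex_eq_iff tau_def freq_def m_def \<xi>_def)
    have sk: "s ^ (N - k) = s ^ N * s ^ k"
    proof -
      have "s ^ N * s ^ k = s ^ (N - k) * (s ^ k * s ^ k)"
        using that by (metis (no_types) less_Suc_eq_le Suc_eq_plus1 le_add_diff_inverse2 mult.assoc power_add)
      moreover have "s ^ k * s ^ k = 1" using s by (auto simp flip: power_mult_distrib)
      ultimately show ?thesis by simp
    qed
    have p: "(m k)\<^sup>2 + \<xi>\<^sup>2 \<noteq> 0" using mpos[of k] by (simp add: sum_power2_eq_zero_iff)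
    have "F (N - k) + F (N + 1 + k)
        = of_real (s ^ N * s ^ k) * (1 / Complex (m k) \<xi> + of_real s / Complex (- m k) \<xi>)"
      unfolding F_def z1 z2 sk by (simp add: power_add algebra_simps add_divide_distrib)
    also have "1 / Complex (m k) \<xi> + of_real s / Complex (- m k) \<xi> =
      (if s = 1 then - (2 * \<i> * of_real (\<xi> / ((m k)\<^sup>2 + \<xi>\<^sup>2))) else of_real (g k))"
    proof -
      have "1 / Complex (m k) \<xi> = Complex (m k / ((m k)\<^sup>2 + \<xi>\<^sup>2)) (- \<xi> / ((m k)\<^sup>2 + \<xi>\<^sup>2))"
        "of_real s / Complex (- m k) \<xi> = Complex (- (s * m k / ((m k)\<^sup>2 + \<xi>\<^sup>2))) (- (s * \<xi> / ((m k)\<^sup>2 + \<xi>\<^sup>2)))"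
        by (simp_all add: complex_eq_iff Re_divide Im_divide)
      then show ?thesis using s by (auto simp: complex_eq_iff g_def)
    qed
    finally show ?thesis by simp
  qed
  have "2 * N + 2 = N + 1 + (N + 1)" by simp
  then have "(\<Sum>n<2 * N + 2. F n) = (\<Sum>k<N + 1. F (N - k)) + (\<Sum>k<N + 1. F (N + 1 + k))"
    by (simp only: sum_two_sided)
  also have "(\<Sum>k<N + 1. F (N - k)) + (\<Sum>k<N + 1. F (N + 1 + k)) = (\<Sum>k<N + 1. F (N - k) + F (N + 1 + k))"
    by (simp only: sum.distrib)
  also have "\<dots> = (\<Sum>k<N + 1. of_real (s ^ N) * (of_real (s ^ k) *
      (if s = 1 then - (2 * \<i> * of_real (\<xi> / ((m k)\<^sup>2 + \<xi>\<^sup>2))) else of_real (g k))))"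
    by (rule sum.cong) (use eq in auto)
  also have "norm \<dots> \<le> 10"
  proof (cases "s = 1")
    case True
    have nm: "norm (- (2 * \<i> * complex_of_real (\<xi> / ((m k)\<^sup>2 + \<xi>\<^sup>2)))) = 2 * (\<bar>\<xi>\<bar> / (\<bar>\<xi>\<bar>\<^sup>2 + (2 * real k + 1)\<^sup>2))" for k
      unfolding norm_minus_cancel norm_mult norm_of_real by (simp add: m_def add.commute)
    have "norm (\<Sum>k<N + 1. of_real (s ^ N) * (of_real (s ^ k) *
      (if s = 1 then - (2 * \<i> * of_real (\<xi> / ((m k)\<^sup>2 + \<xi>\<^sup>2))) else of_real (g k))))
      \<le> (\<Sum>k<N + 1. 2 * (\<bar>\<xi>\<bar> / (\<bar>\<xi>\<bar>\<^sup>2 + (2 * real k + 1)\<^sup>2)))"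
    proof (rule order_trans[OF norm_sum], rule sum_mono)
      fix k
      show "norm (of_real (s ^ N) * (of_real (s ^ k) *
      (if s = 1 then - (2 * \<i> * of_real (\<xi> / ((m k)\<^sup>2 + \<xi>\<^sup>2))) else of_real (g k))))
        \<le> 2 * (\<bar>\<xi>\<bar> / (\<bar>\<xi>\<bar>\<^sup>2 + (2 * real k + 1)\<^sup>2))"
        using nm[of k] True by simp
    qed
    also have "\<dots> \<le> 2 * 1"
      unfolding sum_distrib_left[symmetric] by (intro mult_left_mono sum_lorentzian_odd) auto
    finally show ?thesis by simp
  next
    case False
    then have s: "s = -1" using s by simp
    have d: "\<bar>g (Suc k) - g k\<bar> \<le> 4 * (1 / (2 * real k + 1)\<^sup>2)" for k
    proof -
      let ?a = "m k" and ?b = "m k + 2"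
      have p: "?a\<^sup>2 > 0" "?b\<^sup>2 + \<xi>\<^sup>2 > 0" "?a\<^sup>2 + \<xi>\<^sup>2 > 0" using mpos[of k]
        by (auto intro!: add_pos_nonneg zero_less_power)
      have "g (Suc k) - g k = 4 * (\<xi>\<^sup>2 - ?a * ?b) / ((?a\<^sup>2 + \<xi>\<^sup>2) * (?b\<^sup>2 + \<xi>\<^sup>2))"
        using p unfolding g_def m_def
        by (simp add: divide_simps) (simp add: power2_eq_square algebra_simps)
      also have "\<bar>\<dots>\<bar> = 4 * \<bar>\<xi>\<^sup>2 - ?a * ?b\<bar> / ((?a\<^sup>2 + \<xi>\<^sup>2) * (?b\<^sup>2 + \<xi>\<^sup>2))"
        using p unfolding abs_divide abs_mult by simp
      also have "\<dots> \<le> 4 * (?b\<^sup>2 + \<xi>\<^sup>2) / ((?a\<^sup>2 + \<xi>\<^sup>2) * (?b\<^sup>2 + \<xi>\<^sup>2))"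
      proof (intro divide_right_mono mult_left_mono)
        have "0 \<le> ?a * ?b" "?a * ?b \<le> ?b\<^sup>2" using mpos[of k] by (auto simp: power2_eq_square)
        then show "\<bar>\<xi>\<^sup>2 - ?a * ?b\<bar> \<le> ?b\<^sup>2 + \<xi>\<^sup>2" using zero_le_power2[of \<xi>] zero_le_power2[of ?b] by linarith
      qed (use p in auto)
      also have "\<dots> = 4 / (?a\<^sup>2 + \<xi>\<^sup>2)" using p by (intro nonzero_mult_divide_mult_cancel_right) linarith
      also have "\<dots> \<le> 4 / ?a\<^sup>2" using p by (intro divide_left_mono) (auto intro: mult_pos_pos)
      finally show ?thesis by (simp add: m_def)
    qed
    have g: "0 \<le> g k" "g k \<le> 2" for k
    proof -
      show "0 \<le> g k" using mpos[of k] by (simp add: g_def)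
      have "m k \<le> (m k)\<^sup>2 + \<xi>\<^sup>2" using mpos[of k]
      proof -
        have "1 * m k \<le> m k * m k" using mpos[of k] by (intro mult_right_mono) auto
        then show ?thesis unfolding power2_eq_square[of "m k"] using zero_le_power2[of \<xi>] by linarith
      qed
      then show "g k \<le> 2" using mpos[of k] by (simp add: g_def divide_le_eq)
    qed
    have "\<bar>\<Sum>k<N + 1. (- 1) ^ k * g k\<bar> \<le> (\<Sum>k<N + 1. \<bar>g (Suc k) - g k\<bar>) + 2"
      using alternating_sum_bound[of g "N + 1"] g[of "N + 1"] by (auto split: if_splits)
    also have "\<dots> \<le> (\<Sum>k<N + 1. 4 * (1 / (2 * real k + 1)\<^sup>2)) + 2"
      using d by (intro add_mono sum_mono) auto
    also have "\<dots> \<le> 4 * 2 + 2"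
      unfolding sum_distrib_left[symmetric] using sum_inverse_odd_squares[of "N + 1"] by linarith
    finally have b: "\<bar>\<Sum>k<N + 1. (- 1) ^ k * g k\<bar> \<le> 10" by simp
    have "(\<Sum>k<N + 1. of_real (s ^ N) * (of_real (s ^ k) *
      (if s = 1 then - (2 * \<i> * of_real (\<xi> / ((m k)\<^sup>2 + \<xi>\<^sup>2))) else of_real (g k))))
      = (\<Sum>k<N + 1. complex_of_real (s ^ N * ((- 1) ^ k * g k)))"
      by (rule sum.cong) (use s in simp_all)
    also have "\<dots> = complex_of_real (s ^ N * (\<Sum>k<N + 1. (- 1) ^ k * g k))"
      by (simp only: of_real_sum sum_distrib_left)
    also have "norm \<dots> = \<bar>\<Sum>k<N + 1. (- 1) ^ k * g k\<bar>"
      unfolding norm_of_real by (simp add: abs_mult s power_abs)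
    finally show ?thesis using b by simp
  qed
  finally show ?thesis by (simp add: F_def)
qed

lemma resolvent_term_split:
  fixes z :: complex
  assumes z: "Re z = tau N"
  shows "of_real (freq n) / (z\<^sup>2 - of_real ((freq n)\<^sup>2))
    = (1 / (z - of_real (freq n)) - 1 / (z + of_real (freq n))) / 2"
proof -
  have "z\<^sup>2 - of_real ((freq n)\<^sup>2) = (z - of_real (freq n)) * (z + of_real (freq n))"
    by (simp add: power2_eq_square algebra_simps)
  then show ?thesis using z_ne_freq[OF z, of n] by (simp add: divide_simps)
qed

text \<open>
  Beyond twice the frequency \<open>tau N\<close> the terms are of size \<open>cbinom n / n\<close>, which is a telescoping
  difference of \<open>cbinom\<close>.
\<close>

lemma resolvent_tail_bound:
  fixes z :: complex
  assumes z: "Re z = tau N" and n: "n \<ge> 2 * N + 2"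
  shows "norm (of_real (freq n * cbinom n) / (z\<^sup>2 - of_real ((freq n)\<^sup>2))) \<le> 8 * (cbinom n - cbinom (Suc n))"
proof -
  have l: "freq n \<ge> 2 * tau N" using n by (simp add: freq_def tau_def)
  have "norm (z - of_real (freq n)) \<ge> freq n - tau N"
    using abs_Re_le_cmod[of "z - of_real (freq n)"] z by simp
  then have "norm (z - of_real (freq n)) \<ge> freq n / 2" using l by simp
  moreover have "norm (z + of_real (freq n)) \<ge> freq n"
    using norm_add_freq(2)[OF z, of n] tau_ge_1[of N] by simp
  ultimately have "freq n / 2 * freq n \<le> norm ((z - of_real (freq n)) * (z + of_real (freq n)))"
    unfolding norm_mult using freq_pos[of n] by (intro mult_mono) auto
  also have "(z - of_real (freq n)) * (z + of_real (freq n)) = z\<^sup>2 - of_real ((freq n)\<^sup>2)"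
    by (simp add: power2_eq_square algebra_simps)
  finally have d: "freq n / 2 * freq n \<le> norm (z\<^sup>2 - of_real ((freq n)\<^sup>2))" .
  have "norm (of_real (freq n * cbinom n) / (z\<^sup>2 - of_real ((freq n)\<^sup>2)))
      = freq n * cbinom n / norm (z\<^sup>2 - of_real ((freq n)\<^sup>2))"
    unfolding norm_divide norm_of_real using freq_pos[of n] cbinom_pos[of n] by (simp add: abs_mult)
  also have "\<dots> \<le> freq n * cbinom n / (freq n / 2 * freq n)"
    using d freq_pos[of n] cbinom_pos[of n] less_le_trans[OF _ d, of 0]
    by (intro divide_left_mono) (auto intro!: mult_pos_pos simp del: zero_less_norm_iff)
  also have "\<dots> = 2 * cbinom n / freq n" using freq_pos[of n] by simp
  also have "\<dots> \<le> 8 * (cbinom n / (2 * real n + 2))"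
    using cbinom_pos[of n] by (simp add: freq_def divide_simps) (simp add: algebra_simps)?
  finally show ?thesis by (simp only: cbinom_diff)
qed

text \<open>
  Since \<open>bdry_sq n\<close> is a multiple of \<open>freq n * cbinom n\<close>, this is the bound for the compressed
  resolvent \<open>C (z\<^sup>2 - L0)^(-1) C*\<close>. The sum is cut at \<open>n = 2 N + 2\<close>, which makes the head symmetric
  about \<open>tau N\<close>. In the head, partial fractions split off the harmless factor
  \<open>1 / (z + freq n)\<close>; in the remaining sum over \<open>1 / (z - freq n)\<close> the coefficient \<open>cbinom n\<close> is
  replaced by its central value \<open>cbinom N\<close>. The error is summable because \<open>cbinom\<close> varies slowly, and
  the sum with constant coefficients is \<open>centered_cauchy_sum\<close>.
\<close>

lemma trace_resolvent_bound:
  fixes z :: complex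
  assumes z: "Re z = tau N" and s: "s = 1 \<or> s = (- 1 :: real)"
  defines "T \<equiv> \<lambda>n. of_real (s ^ n * freq n * cbinom n) / (z\<^sup>2 - of_real ((freq n)\<^sup>2))"
  shows "summable (\<lambda>n. norm (T n))" and "norm (suminf T) \<le> 32 / sqrt (tau N)"
proof -
  let ?n0 = "2 * N + 2"
  have n0: "?n0 = N + 1 + (N + 1)" by simp
  have abs_s: "\<bar>s ^ n\<bar> = 1" for n using s by (auto simp: power_abs)
  have nT: "norm (T n) = norm (of_real (freq n * cbinom n) / (z\<^sup>2 - of_real ((freq n)\<^sup>2)))" for n
    unfolding T_def norm_divide norm_of_real by (simp add: abs_mult abs_s)
  have "(\<lambda>n. cbinom n) \<longlonglongrightarrow> 0"
  proof (rule tendsto_sandwich[of "\<lambda>_. 0" _ _ "\<lambda>n. 2 / sqrt (tau n)"])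
    show "(\<lambda>n. 2 / sqrt (tau n)) \<longlonglongrightarrow> 0"
      unfolding tau_def
      by (intro tendsto_divide_0[OF tendsto_const] filterlim_at_top_imp_at_infinity
          filterlim_compose[OF sqrt_at_top] filterlim_at_top_mono[OF filterlim_real_sequentially])
         auto
  qed (use cbinom_pos cbinom_le_tau in \<open>auto intro!: always_eventually simp: less_imp_le\<close>)
  then have tele: "(\<lambda>n. cbinom n - cbinom (Suc n)) sums (cbinom 0 - 0)"
    by (rule telescope_sums')
  have sm: "summable (\<lambda>n. 8 * (cbinom n - cbinom (Suc n)))"
    using tele by (intro summable_mult) (rule sums_summable)
  have ev: "norm (norm (T n)) \<le> 8 * (cbinom n - cbinom (Suc n))" if "n \<ge> ?n0" for n
    using resolvent_tail_bound[OF z that] by (simp add: nT)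
  show summ: "summable (\<lambda>n. norm (T n))"
    by (rule summable_comparison_test'[OF sm ev])
  have sT: "summable T" using summ by (rule summable_norm_cancel)

  have tail: "norm (\<Sum>n. T (n + ?n0)) \<le> 8 * cbinom N"
  proof -
    have t: "(\<lambda>n. cbinom (n + ?n0) - cbinom (Suc (n + ?n0))) sums (cbinom (0 + ?n0) - 0)"
      using telescope_sums'[of "\<lambda>n. cbinom (n + ?n0)" 0] \<open>cbinom \<longlonglongrightarrow> 0\<close> LIMSEQ_ignore_initial_segment[of cbinom 0 ?n0]
      by simp
    have "norm (\<Sum>n. T (n + ?n0)) \<le> (\<Sum>n. norm (T (n + ?n0)))"
      by (intro summable_norm) (use summ summable_iff_shift[of "\<lambda>n. norm (T n)" ?n0] in simp)
    also have "\<dots> \<le> (\<Sum>n. 8 * (cbinom (n + ?n0) - cbinom (Suc (n + ?n0))))"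
    proof (intro suminf_le)
      show "summable (\<lambda>n. norm (T (n + ?n0)))" using summ summable_iff_shift[of "\<lambda>n. norm (T n)" ?n0] by simp
      show "summable (\<lambda>n. 8 * (cbinom (n + ?n0) - cbinom (Suc (n + ?n0))))"
        by (intro summable_mult sums_summable[OF t])
      show "norm (T (n + ?n0)) \<le> 8 * (cbinom (n + ?n0) - cbinom (Suc (n + ?n0)))" for n
        using ev[of "n + ?n0"] by simp
    qed
    also have "\<dots> = 8 * cbinom ?n0"
      using sums_unique[OF sums_mult[OF t, of 8]] by simp
    also have "\<dots> \<le> 8 * cbinom N" using cbinom_antimono[of N ?n0] by simp
    finally show ?thesis .
  qed

  have plus: "norm (\<Sum>n<?n0. of_real (s ^ n * cbinom n) / (z + of_real (freq n))) \<le> 8 / 3 * cbinom N"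
  proof -
    have "norm (\<Sum>n<?n0. of_real (s ^ n * cbinom n) / (z + of_real (freq n))) \<le> (\<Sum>n<?n0. cbinom n / tau N)"
    proof (rule order_trans[OF norm_sum], rule sum_mono)
      fix n
      have "norm (z + of_real (freq n)) \<ge> tau N"
        using norm_add_freq(2)[OF z, of n] freq_pos[of n] by simp
      then have "cbinom n / norm (z + of_real (freq n)) \<le> cbinom n / tau N"
        using cbinom_pos[of n] tau_ge_1[of N] by (intro divide_left_mono) (auto intro!: mult_pos_pos)
      then show "norm (of_real (s ^ n * cbinom n) / (z + of_real (freq n))) \<le> cbinom n / tau N"
        unfolding norm_divide norm_of_real using cbinom_pos[of n] by (simp add: abs_mult abs_s)
    qed
    also have "\<dots> = 2 * real ?n0 * cbinom ?n0 / tau N"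
      by (simp only: sum_divide_distrib[symmetric] sum_cbinom)
    also have "\<dots> \<le> 2 * real ?n0 * cbinom N / tau N"
      using cbinom_antimono[of N ?n0] tau_ge_1[of N] by (intro divide_right_mono mult_left_mono) auto
    also have "\<dots> \<le> 8 / 3 * cbinom N"
      using cbinom_pos[of N] tau_ge_1[of N] by (simp add: divide_le_eq) (simp add: tau_def algebra_simps)
    finally show ?thesis .
  qed

  \<comment> \<open>The majorant \<open>B\<close> uses that \<open>cbinom n - cbinom N\<close> is proportional to the distance from \<open>N\<close>, which cancels the denominator.\<close>
  have rest: "norm (\<Sum>n<?n0. of_real (s ^ n * (cbinom n - cbinom N)) / (z - of_real (freq n))) \<le> 2 * cbinom N"
  proof -
    define B where "B n = (if n < N then cbinom n / (2 * real N) else if n = N then 0 else cbinom N / (real N + 1))" for n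
    have "norm (\<Sum>n<?n0. of_real (s ^ n * (cbinom n - cbinom N)) / (z - of_real (freq n))) \<le> (\<Sum>n<?n0. B n)"
    proof (rule order_trans[OF norm_sum], rule sum_mono)
      fix n
      have low: "norm (z - of_real (freq n)) \<ge> \<bar>2 * (real N - real n) + 1\<bar>"
        by (rule norm_diff_freq_ge[OF z])
      have nn: "norm (of_real (s ^ n * (cbinom n - cbinom N)) / (z - of_real (freq n)))
        = \<bar>cbinom n - cbinom N\<bar> / norm (z - of_real (freq n))"
        unfolding norm_divide norm_of_real by (simp add: abs_mult abs_s del: of_real_mult of_real_power of_real_diff)
      consider "n < N" | "n = N" | "n > N" by linarith
      then show "norm (of_real (s ^ n * (cbinom n - cbinom N)) / (z - of_real (freq n))) \<le> B n"
      proof cases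
        case 1
        then have p: "0 < 2 * (real N - real n)" by simp
        have "\<bar>cbinom n - cbinom N\<bar> / norm (z - of_real (freq n))
            \<le> (cbinom n * (real N - real n) / real N) / (2 * (real N - real n))"
          using cbinom_diff_le_left[OF 1] cbinom_antimono[of n N] 1 low p cbinom_pos[of n] by (intro frac_le) auto
        also have "\<dots> = cbinom n / (2 * real N)" using 1 by (simp add: field_simps)
        finally show ?thesis using 1 unfolding nn by (simp add: B_def)
      next
        case 2
        then show ?thesis by (simp add: B_def)
      next
        case 3
        have "real N * cbinom N \<le> real n * cbinom n" using times_cbinom_mono[of N n] 3 by simp
        then have "cbinom N - cbinom n \<le> cbinom N * (real n - real N) / real n"
          using 3 by (simp add: field_simps)
        moreover have "cbinom n \<le> cbinom N" using cbinom_antimono[of N n] 3 by simp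
        moreover have "norm (z - of_real (freq n)) \<ge> real n - real N" "real n - real N > 0"
          using low 3 by auto
        ultimately have "\<bar>cbinom n - cbinom N\<bar> / norm (z - of_real (freq n))
            \<le> (cbinom N * (real n - real N) / real n) / (real n - real N)"
          using cbinom_pos[of N] 3 by (intro frac_le) auto
        also have "\<dots> = cbinom N / real n" using 3 by (simp add: field_simps)
        also have "\<dots> \<le> cbinom N / (real N + 1)"
          using 3 cbinom_pos[of N] by (intro divide_left_mono) auto
        finally show ?thesis using 3 unfolding nn by (simp add: B_def)
      qed
    qed
    also have "(\<Sum>n<?n0. B n) = (\<Sum>n<N + 1. B n) + (\<Sum>k<N + 1. B (N + 1 + k))"
      unfolding n0 by (rule sum_shift_split)
    also have "(\<Sum>n<N + 1. B n) = (\<Sum>n<N. cbinom n / (2 * real N))"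
      by (simp add: B_def)
    also have "\<dots> \<le> cbinom N"
      using cbinom_pos[of N] by (simp add: sum_divide_distrib[symmetric] sum_cbinom)
    also have "(\<Sum>k<N + 1. B (N + 1 + k)) = cbinom N"
      by (simp add: B_def add_divide_distrib[symmetric] algebra_simps) (simp add: field_simps)?
    finally show ?thesis by simp
  qed

  have main: "norm (\<Sum>n<?n0. of_real (s ^ n * cbinom N) / (z - of_real (freq n))) \<le> cbinom N * 10"
  proof -
    have "(\<Sum>n<?n0. of_real (s ^ n * cbinom N) / (z - of_real (freq n)))
      = of_real (cbinom N) * (\<Sum>n<?n0. of_real (s ^ n) / (z - of_real (freq n)))"
      unfolding sum_distrib_left by (intro sum.cong) auto
    also have "norm \<dots> = cbinom N * norm (\<Sum>n<?n0. of_real (s ^ n) / (z - of_real (freq n)))"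
      unfolding norm_mult norm_of_real using cbinom_pos[of N] by simp
    also have "\<dots> \<le> cbinom N * 10"
      using centered_cauchy_sum[OF z s] cbinom_pos[of N] by (intro mult_left_mono) auto
    finally show ?thesis .
  qed

  have head: "(\<Sum>n<?n0. T n) = ((\<Sum>n<?n0. of_real (s ^ n * cbinom N) / (z - of_real (freq n)))
     + (\<Sum>n<?n0. of_real (s ^ n * (cbinom n - cbinom N)) / (z - of_real (freq n)))
     - (\<Sum>n<?n0. of_real (s ^ n * cbinom n) / (z + of_real (freq n)))) / 2"
    unfolding sum.distrib[symmetric] sum_subtractf[symmetric] sum_divide_distrib
  proof (rule sum.cong[OF refl])
    fix n
    have "T n = of_real (s ^ n * cbinom n) * (of_real (freq n) / (z\<^sup>2 - of_real ((freq n)\<^sup>2)))"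
      by (simp add: T_def)
    also have "\<dots> = of_real (s ^ n * cbinom n) * ((1 / (z - of_real (freq n)) - 1 / (z + of_real (freq n))) / 2)"
      by (simp only: resolvent_term_split[OF z])
    finally show "T n = (of_real (s ^ n * cbinom N) / (z - of_real (freq n))
       + of_real (s ^ n * (cbinom n - cbinom N)) / (z - of_real (freq n))
       - of_real (s ^ n * cbinom n) / (z + of_real (freq n))) / 2"
      by (simp add: algebra_simps diff_divide_distrib add_divide_distrib)
  qed
  have tri: "norm ((x + y - w) / 2) \<le> (norm x + norm y + norm w) / 2" for x y w :: complex
    using norm_triangle_ineq4[of "x + y" w] norm_triangle_ineq[of x y] by (simp add: norm_divide)
  have "norm (\<Sum>n<?n0. T n) \<le> (cbinom N * 10 + 2 * cbinom N + 8 / 3 * cbinom N) / 2"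
    unfolding head using main rest plus by (intro order_trans[OF tri] divide_right_mono add_mono) simp_all
  moreover have "suminf T = (\<Sum>n. T (n + ?n0)) + (\<Sum>n<?n0. T n)"
    by (rule suminf_split_initial_segment[OF sT])
  ultimately have "norm (suminf T) \<le> 16 * cbinom N"
    using tail cbinom_pos[of N] norm_triangle_ineq[of "\<Sum>n. T (n + ?n0)" "\<Sum>n<?n0. T n"] by (simp add: algebra_simps)
  then show "norm (suminf T) \<le> 32 / sqrt (tau N)"
    using cbinom_le_tau[of N] by simp
qed

text \<open>
  The square summable companion of \<open>trace_resolvent_bound\<close>. It controls the traces of interior
  sources and, dually, the modes excited by the boundary fluxes. If \<open>Im z\<close> is large compared with \<open>tau N\<close>, the Lorentzian sum suffices. Otherwise the
  inverse odd squares concentrate the sum at \<open>n = N\<close>, where \<open>cbinom N\<close> is of size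
  \<open>1 / sqrt (tau N)\<close> and one factor \<open>norm z\<close> of size \<open>tau N\<close> remains.
\<close>

lemma resolvent_square_bound:
  fixes z :: complex
  assumes z: "Re z = tau N"
  shows "(\<Sum>n<M. freq n * cbinom n * (norm z)\<^sup>2 / (norm (z\<^sup>2 - of_real ((freq n)\<^sup>2)))\<^sup>2) \<le> 24 * sqrt (tau N)"
proof -
  define \<xi> where "\<xi> = \<bar>Im z\<bar>"
  define D where "D n = \<xi>\<^sup>2 + (2 * (real N - real n) + 1)\<^sup>2" for n
  define R where "R n = freq n * cbinom n * (norm z)\<^sup>2 / (norm (z\<^sup>2 - of_real ((freq n)\<^sup>2)))\<^sup>2" for n
  have D1: "D n \<ge> 1" for n
  proof -
    have "1 ^ 2 \<le> \<bar>2 * (real N - real n) + 1\<bar> ^ 2"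
      by (rule power_mono[OF odd_int_abs_ge_1]) simp
    then have "1 \<le> (2 * (real N - real n) + 1)\<^sup>2" unfolding power2_abs one_power2 .
    then show ?thesis unfolding D_def using zero_le_power2[of \<xi>] by linarith
  qed
  have qpos: "cbinom n / D n > 0" for n
    using cbinom_pos[of n] D1[of n] by (intro divide_pos_pos) auto
  \<comment> \<open>One factor \<open>z + freq n\<close> of the symbol absorbs \<open>freq n\<close>, the other one a factor \<open>norm z\<close>.\<close>
  have Rle: "R n \<le> norm z * (cbinom n / D n)" for n
  proof -
    let ?p = "norm (z + of_real (freq n))"
    have e: "z\<^sup>2 - of_real ((freq n)\<^sup>2) = (z - of_real (freq n)) * (z + of_real (freq n))"
      by (simp add: power2_eq_square algebra_simps)
    have d: "(norm (z - of_real (freq n)))\<^sup>2 = D n"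
      unfolding norm_diff_freq[OF z] D_def \<xi>_def by simp
    have pp: "?p > 0" using z_ne_freq(2)[OF z, of n] by simp
    have "freq n * norm z \<le> ?p * ?p"
      using norm_add_freq[OF z, of n] tau_ge_1[of N] freq_pos[of n] by (intro mult_mono) auto
    then have q: "freq n * norm z / ?p\<^sup>2 \<le> 1"
      using pp by (simp add: power2_eq_square divide_le_eq)
    have "R n = (freq n * norm z / ?p\<^sup>2) * (norm z * (cbinom n / D n))"
      unfolding R_def e norm_mult power_mult_distrib d by (simp add: power2_eq_square mult_ac)
    also have "\<dots> \<le> 1 * (norm z * (cbinom n / D n))"
      using q cbinom_pos[of n] D1[of n] by (intro mult_right_mono) (auto intro!: mult_nonneg_nonneg divide_nonneg_nonneg simp: less_imp_le)
    finally show ?thesis by simp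
  qed
  have R0: "0 \<le> R n" for n
    unfolding R_def using freq_pos[of n] cbinom_pos[of n] by (auto intro!: divide_nonneg_nonneg mult_nonneg_nonneg simp: less_imp_le)
  have Dl: "D (N - k) = \<xi>\<^sup>2 + (2 * real k + 1)\<^sup>2" if "k < N + 1" for k
    using that by (simp add: D_def of_nat_diff)
  have Dr: "D (N + 1 + k) = \<xi>\<^sup>2 + (2 * real k + 1)\<^sup>2" for k
    by (simp add: D_def power2_eq_square algebra_simps)
  have "(\<Sum>n<M. R n) \<le> (\<Sum>n<N + 1 + M. R n)"
    by (rule sum_mono2) (use R0 in auto)
  also have "\<dots> \<le> (\<Sum>n<N + 1 + M. norm z * (cbinom n / D n))"
    by (rule sum_mono) (rule Rle)
  also have "\<dots> = norm z * ((\<Sum>k<N + 1. cbinom (N - k) / D (N - k)) + (\<Sum>k<M. cbinom (N + 1 + k) / D (N + 1 + k)))"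
    by (simp only: sum_distrib_left[symmetric] sum_two_sided)
  also have "\<dots> \<le> 24 * sqrt (tau N)"
  proof (cases "\<xi> \<ge> tau N")
    case True
    have x0: "\<xi> \<ge> 0" by (simp add: \<xi>_def)
    have xp: "\<xi> > 0" using True tau_ge_1[of N] by simp
    have "norm z \<le> 2 * \<xi>"
      using cmod_le[of z] True z tau_ge_1[of N] by (simp add: \<xi>_def)
    moreover have "(\<Sum>k<N + 1. cbinom (N - k) / D (N - k)) \<le> (\<Sum>k<N + 1. 1 / \<xi> * (\<xi> / (\<xi>\<^sup>2 + (2 * real k + 1)\<^sup>2)))"
      using cbinom_le_1 xp by (intro sum_mono) (auto simp: Dl intro!: divide_right_mono)
    moreover have "(\<Sum>k<M. cbinom (N + 1 + k) / D (N + 1 + k)) \<le> (\<Sum>k<M. 1 / \<xi> * (\<xi> / (\<xi>\<^sup>2 + (2 * real k + 1)\<^sup>2)))"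
      using cbinom_le_1 xp unfolding Dr by (intro sum_mono) (auto intro!: divide_right_mono)
    moreover have "(\<Sum>k<n. 1 / \<xi> * (\<xi> / (\<xi>\<^sup>2 + (2 * real k + 1)\<^sup>2))) \<le> 1 / \<xi>" for n
    proof -
      have "(\<Sum>k<n. 1 / \<xi> * (\<xi> / (\<xi>\<^sup>2 + (2 * real k + 1)\<^sup>2))) = 1 / \<xi> * (\<Sum>k<n. \<xi> / (\<xi>\<^sup>2 + (2 * real k + 1)\<^sup>2))"
        by (rule sum_distrib_left[symmetric])
      also have "\<dots> \<le> 1 / \<xi> * 1" using xp x0 by (intro mult_left_mono sum_lorentzian_odd) auto
      finally show ?thesis by simp
    qed
    ultimately have "norm z \<le> 2 * \<xi>" "(\<Sum>k<N + 1. cbinom (N - k) / D (N - k)) \<le> 1 / \<xi>"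
        "(\<Sum>k<M. cbinom (N + 1 + k) / D (N + 1 + k)) \<le> 1 / \<xi>"
      by (blast intro: order_trans)+
    moreover have "(0::real) \<le> (\<Sum>k<N + 1. cbinom (N - k) / D (N - k))" "0 \<le> (\<Sum>k<M. cbinom (N + 1 + k) / D (N + 1 + k))"
      by (rule sum_nonneg[OF less_imp_le[OF qpos]])+
    ultimately have "norm z * ((\<Sum>k<N + 1. cbinom (N - k) / D (N - k)) + (\<Sum>k<M. cbinom (N + 1 + k) / D (N + 1 + k)))
        \<le> 2 * \<xi> * (1 / \<xi> + 1 / \<xi>)"
      using x0 by (intro mult_mono add_mono add_nonneg_nonneg) auto
    also have "\<dots> = 4" using xp by simp
    also have "\<dots> \<le> 24 * sqrt (tau N)" using tau_ge_1[of N] real_sqrt_ge_one[of "tau N"] by linarith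
    finally show ?thesis .
  next
    case False
    have nz: "norm z \<le> 2 * tau N"
      using cmod_le[of z] False z tau_ge_1[of N] by (simp add: \<xi>_def)
    have i2: "1 / (\<xi>\<^sup>2 + (2 * real k + 1)\<^sup>2) \<le> 1 / (2 * real k + 1)\<^sup>2" for k
      by (intro divide_left_mono) (auto intro!: mult_pos_pos add_nonneg_pos)
    have r: "(\<Sum>k<M. cbinom (N + 1 + k) / D (N + 1 + k)) \<le> 2 * cbinom N"
    proof -
      have "(\<Sum>k<M. cbinom (N + 1 + k) / D (N + 1 + k)) \<le> (\<Sum>k<M. cbinom N * (1 / (2 * real k + 1)\<^sup>2))"
      proof (rule sum_mono)
        fix k
        have "cbinom (N + 1 + k) * (1 / (\<xi>\<^sup>2 + (2 * real k + 1)\<^sup>2)) \<le> cbinom N * (1 / (2 * real k + 1)\<^sup>2)"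
          using i2[of k] cbinom_antimono[of N "N + 1 + k"] cbinom_pos[of N] by (intro mult_mono) auto
        then show "cbinom (N + 1 + k) / D (N + 1 + k) \<le> cbinom N * (1 / (2 * real k + 1)\<^sup>2)" unfolding Dr by simp
      qed
      also have "\<dots> \<le> cbinom N * 2"
        unfolding sum_distrib_left[symmetric] using sum_inverse_odd_squares cbinom_pos[of N] by (intro mult_left_mono) auto
      finally show ?thesis by simp
    qed
    have l: "(\<Sum>k<N + 1. cbinom (N - k) / D (N - k)) \<le> 4 * cbinom N"
    proof -
      have "(\<Sum>k<N + 1. cbinom (N - k) / D (N - k))
          \<le> (\<Sum>k<N + 1. cbinom N * (1 / (2 * real k + 1)\<^sup>2) + (if k = 0 then 0 else cbinom (N - k) / real N))"
      proof (rule sum_mono)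
        fix k assume "k \<in> {..<N + 1}"
        then have k: "k < N + 1" by simp
        have sq: "(1::real) \<le> (2 * real k + 1)\<^sup>2" "real k \<le> (2 * real k + 1)\<^sup>2"
          by (simp_all add: power2_eq_square algebra_simps)
        define c where "c = (if k = 0 then 0 else cbinom (N - k) / real N)"
        have c0: "c \<ge> 0" using cbinom_pos[of "N - k"] by (simp add: c_def)
        have "cbinom (N - k) - cbinom N \<le> c * real k"
          using cbinom_diff_le_left[of "N - k" N] k by (auto simp: of_nat_diff c_def)
        then have "cbinom (N - k) / (2 * real k + 1)\<^sup>2 \<le> (cbinom N + c * real k) / (2 * real k + 1)\<^sup>2"
          by (intro divide_right_mono) auto
        also have "\<dots> = cbinom N * (1 / (2 * real k + 1)\<^sup>2) + c * (real k / (2 * real k + 1)\<^sup>2)"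
          by (simp add: add_divide_distrib)
        also have "\<dots> \<le> cbinom N * (1 / (2 * real k + 1)\<^sup>2) + c * 1"
          using sq c0 by (intro add_left_mono mult_left_mono) (simp_all add: divide_le_eq_1)
        finally have *: "cbinom (N - k) / (2 * real k + 1)\<^sup>2
          \<le> cbinom N * (1 / (2 * real k + 1)\<^sup>2) + (if k = 0 then 0 else cbinom (N - k) / real N)"
          by (simp only: c_def mult_1_right)
        have "cbinom (N - k) * (1 / (\<xi>\<^sup>2 + (2 * real k + 1)\<^sup>2)) \<le> cbinom (N - k) * (1 / (2 * real k + 1)\<^sup>2)"
          using i2[of k] cbinom_pos[of "N - k"] by (intro mult_left_mono) auto
        then show "cbinom (N - k) / D (N - k) \<le> cbinom N * (1 / (2 * real k + 1)\<^sup>2) + (if k = 0 then 0 else cbinom (N - k) / real N)"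
          using * by (simp add: Dl[OF k])
      qed
      also have "\<dots> = cbinom N * (\<Sum>k<N + 1. 1 / (2 * real k + 1)\<^sup>2) + (\<Sum>k<N + 1. if k = 0 then 0 else cbinom (N - k) / real N)"
        by (simp only: sum.distrib sum_distrib_left)
      also have "(\<Sum>k<N + 1. if k = 0 then 0 else cbinom (N - k) / real N) = (\<Sum>k<N. cbinom (N - Suc k) / real N)"
        by (simp add: sum.lessThan_Suc_shift del: sum.lessThan_Suc)
      also have "\<dots> = (\<Sum>k<N. cbinom k) / real N"
        unfolding sum_divide_distrib[symmetric] using sum.nat_diff_reindex[of cbinom N] by simp
      also have "\<dots> \<le> 2 * cbinom N" using cbinom_pos[of N] by (simp add: sum_cbinom)
      also have "cbinom N * (\<Sum>k<N + 1. 1 / (2 * real k + 1)\<^sup>2) \<le> cbinom N * 2"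
        by (rule mult_left_mono[OF sum_inverse_odd_squares less_imp_le[OF cbinom_pos]])
      finally show ?thesis by simp
    qed
    have "(0::real) \<le> (\<Sum>k<N + 1. cbinom (N - k) / D (N - k))" "0 \<le> (\<Sum>k<M. cbinom (N + 1 + k) / D (N + 1 + k))"
      by (rule sum_nonneg[OF less_imp_le[OF qpos]])+
    then have "norm z * ((\<Sum>k<N + 1. cbinom (N - k) / D (N - k)) + (\<Sum>k<M. cbinom (N + 1 + k) / D (N + 1 + k)))
        \<le> (2 * tau N) * (4 * cbinom N + 2 * cbinom N)"
      using nz l r tau_ge_1[of N] by (intro mult_mono add_mono add_nonneg_nonneg) auto
    also have "\<dots> = 12 * tau N * cbinom N" by simp
    also have "\<dots> \<le> 12 * tau N * (2 / sqrt (tau N))"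
      using cbinom_le_tau[of N] tau_ge_1[of N] by (intro mult_left_mono) auto
    also have "\<dots> = 24 * (tau N / sqrt (tau N))" by simp
    also have "tau N / sqrt (tau N) = sqrt (tau N)" using tau_ge_1[of N] by (simp add: real_div_sqrt)
    finally show ?thesis .
  qed
  finally show ?thesis by (simp add: R_def)
qed

section \<open>Smooth functions and test functions\<close>

text \<open>
  Differentiability \<open>n\<close> times, by recursion on the derivative. Unlike a condition on iterates of
  \<open>deriv\<close>, this form passes through sums, products and compositions by induction, because the
  derivative may be supplied as any function with the right values on \<open>S\<close>.
\<close>

primrec Ck :: "nat \<Rightarrow> real set \<Rightarrow> (real \<Rightarrow> real) \<Rightarrow> bool" where
  "Ck 0 S f \<longleftrightarrow> True"
| "Ck (Suc n) S f \<longleftrightarrow> (\<exists>f'. (\<forall>x\<in>S. (f has_real_derivative f' x) (at x)) \<and> Ck n S f')"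

definition smooth :: "real set \<Rightarrow> (real \<Rightarrow> real) \<Rightarrow> bool" where
  "smooth S f \<longleftrightarrow> (\<forall>n. Ck n S f)"

lemma Ck_SucI: "(\<And>x. x \<in> S \<Longrightarrow> (f has_real_derivative f' x) (at x)) \<Longrightarrow> Ck n S f' \<Longrightarrow> Ck (Suc n) S f"
  by auto

lemma Ck_SucD: "Ck (Suc n) S f \<Longrightarrow> Ck n S f"
proof (induction n arbitrary: f)
  case (Suc n)
  then show ?case by (auto simp del: Ck.simps(2) simp: Ck.simps(2)[of "Suc n"] intro: Ck_SucI)
qed simp

lemma Ck_subset: "Ck n S f \<Longrightarrow> T \<subseteq> S \<Longrightarrow> Ck n T f"
proof (induction n arbitrary: f)
  case (Suc n)
  then show ?case by (simp, blast)
qed simp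

lemma Ck_cong:
  assumes "open S" "\<And>x. x \<in> S \<Longrightarrow> f x = g x" "Ck n S f"
  shows "Ck n S g"
proof (cases n)
  case (Suc m)
  then obtain f' where f': "\<And>x. x \<in> S \<Longrightarrow> (f has_real_derivative f' x) (at x)" "Ck m S f'"
    using assms(3) by auto
  have "(g has_real_derivative f' x) (at x)" if "x \<in> S" for x
    by (rule has_field_derivative_transform_within_open[OF f'(1)[OF that] assms(1) that assms(2)])
  then show ?thesis using Suc f'(2) by auto
qed simp

lemma Ck_const: "Ck n S (\<lambda>x. c)"
  by (induction n arbitrary: c) (auto intro!: exI[of _ "\<lambda>x. 0"])

lemma Ck_id: "Ck n S (\<lambda>x. x)"
  by (cases n) (auto intro!: exI[of _ "\<lambda>x. 1"] Ck_const derivative_eq_intros)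

lemma Ck_add: "Ck n S f \<Longrightarrow> Ck n S g \<Longrightarrow> Ck n S (\<lambda>x. f x + g x)"
proof (induction n arbitrary: f g)
  case (Suc n)
  then obtain f' g' where "\<And>x. x \<in> S \<Longrightarrow> (f has_real_derivative f' x) (at x)" "Ck n S f'"
    "\<And>x. x \<in> S \<Longrightarrow> (g has_real_derivative g' x) (at x)" "Ck n S g'" unfolding Ck.simps by blast
  then show ?case
    by (intro Ck_SucI[where f' = "\<lambda>x. f' x + g' x"] Suc.IH) (auto intro!: derivative_eq_intros)
qed simp

lemma Ck_mult: "Ck n S f \<Longrightarrow> Ck n S g \<Longrightarrow> Ck n S (\<lambda>x. f x * g x)"
proof (induction n arbitrary: f g)
  case (Suc n)
  then obtain f' g' where *: "\<And>x. x \<in> S \<Longrightarrow> (f has_real_derivative f' x) (at x)" "Ck n S f'"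
    "\<And>x. x \<in> S \<Longrightarrow> (g has_real_derivative g' x) (at x)" "Ck n S g'" unfolding Ck.simps by blast
  have "Ck n S (\<lambda>x. f' x * g x + f x * g' x)"
    using Suc.prems * by (intro Ck_add Suc.IH) (auto dest: Ck_SucD simp del: Ck.simps)
  then show ?case
    using * by (intro Ck_SucI[where f' = "\<lambda>x. f' x * g x + f x * g' x"]) (auto intro!: derivative_eq_intros)
qed simp

lemma Ck_compose: "Ck n U f \<Longrightarrow> Ck n S g \<Longrightarrow> (\<And>x. x \<in> S \<Longrightarrow> g x \<in> U) \<Longrightarrow> Ck n S (\<lambda>x. f (g x))"
proof (induction n arbitrary: f g)
  case (Suc n)
  then obtain f' g' where *: "\<And>x. x \<in> U \<Longrightarrow> (f has_real_derivative f' x) (at x)" "Ck n U f'"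
    "\<And>x. x \<in> S \<Longrightarrow> (g has_real_derivative g' x) (at x)" "Ck n S g'" unfolding Ck.simps by blast
  have "Ck n S (\<lambda>x. f' (g x) * g' x)"
    by (rule Ck_mult[OF Suc.IH[OF *(2) Ck_SucD[OF Suc.prems(2)] Suc.prems(3)] *(4)])
  moreover have "((\<lambda>x. f (g x)) has_real_derivative f' (g x) * g' x) (at x)" if "x \<in> S" for x
    using DERIV_chain2[OF *(1)[OF Suc.prems(3)[OF that]] *(3)[OF that]] .
  ultimately show ?case by (intro Ck_SucI)
qed simp

lemma smooth_const: "smooth S (\<lambda>x. c)"
  by (simp add: smooth_def Ck_const)

lemma smooth_id: "smooth S (\<lambda>x. x)"
  by (simp add: smooth_def Ck_id)

lemma smooth_add: "smooth S f \<Longrightarrow> smooth S g \<Longrightarrow> smooth S (\<lambda>x. f x + g x)"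
  by (simp add: smooth_def Ck_add)

lemma smooth_mult: "smooth S f \<Longrightarrow> smooth S g \<Longrightarrow> smooth S (\<lambda>x. f x * g x)"
  by (simp add: smooth_def Ck_mult)

lemma smooth_subset: "smooth S f \<Longrightarrow> T \<subseteq> S \<Longrightarrow> smooth T f"
  unfolding smooth_def using Ck_subset by blast

lemma smooth_compose:
  "smooth U f \<Longrightarrow> smooth S g \<Longrightarrow> (\<And>x. x \<in> S \<Longrightarrow> g x \<in> U) \<Longrightarrow> smooth S (\<lambda>x. f (g x))"
  unfolding smooth_def by (rule allI, rule Ck_compose[of _ U f S g]) auto

lemma smooth_cong: "open S \<Longrightarrow> (\<And>x. x \<in> S \<Longrightarrow> f x = g x) \<Longrightarrow> smooth S f \<Longrightarrow> smooth S g"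
  unfolding smooth_def by (rule allI, rule Ck_cong[of S f g]) auto

lemma smooth_cmult: "smooth S f \<Longrightarrow> smooth S (\<lambda>x. c * f x)"
  by (intro smooth_mult smooth_const)

lemma smooth_diff: "smooth S f \<Longrightarrow> smooth S g \<Longrightarrow> smooth S (\<lambda>x. f x - g x)"
  using smooth_add[of S f "\<lambda>x. - 1 * g x"] smooth_cmult[of S g "- 1"] by simp

lemma smooth_affine: "smooth S (\<lambda>x. a * x + b)"
  by (intro smooth_add smooth_mult smooth_const smooth_id)

lemma smooth_exp: "smooth S exp"
proof -
  have "Ck n S exp" for n
  proof (induction n)
    case (Suc n) then show ?case by (intro Ck_SucI[where f' = exp]) (auto intro: DERIV_exp)
  qed simp
  then show ?thesis by (simp add: smooth_def)
qed

lemma smooth_sin_cos: "smooth S sin" "smooth S cos"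
proof -
  have "Ck n S (\<lambda>x. sin (x + c))" for n c
  proof (induction n arbitrary: c)
    case (Suc n)
    have "sin (x + (c + pi / 2)) = cos (x + c)" for x
      using sin_add[of "x + c" "pi / 2"] by (simp add: add.assoc)
    then show ?case
      by (intro Ck_SucI[where f' = "\<lambda>x. sin (x + (c + pi / 2))", OF _ Suc])
         (auto intro!: derivative_eq_intros)
  qed simp
  then have *: "smooth S (\<lambda>x. sin (x + c))" for c by (simp add: smooth_def)
  show "smooth S sin" using *[of 0] by simp
  have "(\<lambda>x. sin (x + pi / 2)) = cos" by (auto simp: sin_add)
  then show "smooth S cos" using *[of "pi / 2"] by simp
qed

lemma smooth_inverse: "smooth (- {0}) inverse"
proof -
  have "Ck n (- {0}) inverse" for n
  proof (induction n)
    case (Suc n)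
    have "Ck n (- {0}) (\<lambda>x. - 1 * (inverse x * inverse x))"
      by (intro Ck_mult Ck_const Suc)
    then show ?case
      by (rule Ck_SucI[rotated]) (auto intro!: derivative_eq_intros)
  qed simp
  then show ?thesis by (simp add: smooth_def)
qed

lemma smooth_sqrt: "smooth {0<..} sqrt"
proof -
  have "Ck n {0<..} (\<lambda>x. x powr a)" for n a
  proof (induction n arbitrary: a)
    case (Suc n)
    have "Ck n {0<..} (\<lambda>x. a * x powr (a - 1))" by (intro Ck_mult Ck_const Suc)
    then show ?case
      by (rule Ck_SucI[rotated]) (auto intro!: derivative_eq_intros simp: powr_diff)
  qed simp
  then have "smooth {0<..} (\<lambda>x. x powr (1 / 2))" by (simp add: smooth_def)
  then show ?thesis by (rule smooth_cong[rotated 2]) (auto simp: powr_half_sqrt)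
qed

lemma Ck_Suc_deriv:
  assumes "open S"
  shows "Ck (Suc n) S f \<longleftrightarrow> (\<forall>x\<in>S. (f has_real_derivative deriv f x) (at x)) \<and> Ck n S (deriv f)"
proof
  assume "Ck (Suc n) S f"
  then obtain f' where f': "\<And>x. x \<in> S \<Longrightarrow> (f has_real_derivative f' x) (at x)" "Ck n S f'" by auto
  then have "deriv f x = f' x" if "x \<in> S" for x using that by (intro DERIV_imp_deriv)
  with f' show "(\<forall>x\<in>S. (f has_real_derivative deriv f x) (at x)) \<and> Ck n S (deriv f)"
    by (auto intro: Ck_cong[OF assms])
qed (blast intro: Ck_SucI)

lemma smooth_deriv:
  assumes "open S" "smooth S f"
  shows "smooth S (deriv f)" "x \<in> S \<Longrightarrow> (f has_real_derivative deriv f x) (at x)"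
  using assms Ck_Suc_deriv[OF assms(1)] unfolding smooth_def by blast+

text \<open>
  Smoothness is local. This glues a function that is smooth inside an interval to its extension by
  zero.
\<close>

lemma smooth_Un:
  assumes "open S" "open T" "smooth S f" "smooth T f"
  shows "smooth (S \<union> T) f"
proof -
  have "Ck n (S \<union> T) f" if "Ck n S f" "Ck n T f" for n f
    using that
  proof (induction n arbitrary: f)
    case (Suc n)
    then show ?case
      unfolding Ck_Suc_deriv[OF assms(1)] Ck_Suc_deriv[OF assms(2)] Ck_Suc_deriv[OF open_Un[OF assms(1,2)]] by blast
  qed simp
  then show ?thesis using assms by (simp add: smooth_def)
qed

lemma smooth_continuous: "smooth S f \<Longrightarrow> open S \<Longrightarrow> continuous_on S f"
  using smooth_deriv(2) by (meson DERIV_continuous_on has_field_derivative_at_within)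

lemma smooth_deriv_funpow: "smooth UNIV f \<Longrightarrow> smooth UNIV ((deriv ^^ n) f)"
  by (induction n) (auto intro: smooth_deriv)

lemma test_functionI:
  assumes "smooth UNIV f" "compact K" "K \<subseteq> U" "\<And>x. x \<notin> K \<Longrightarrow> f x = 0"
  shows "f \<in> test_functions U"
proof -
  have "(deriv ^^ n) f differentiable (at x)" for n x
    using smooth_deriv(2)[OF _ smooth_deriv_funpow[OF assms(1), of n], of x]
    by (auto simp: real_differentiable_def)
  then show ?thesis using assms(2-4) unfolding test_functions_def by blast
qed

text \<open>
  The functions \<open>p (1/x) exp (-1/x)\<close>, extended by zero. This class is closed under
  differentiation, so smoothness of all its members follows at once.
\<close>

definition flat_poly :: "real poly \<Rightarrow> real \<Rightarrow> real" where
  "flat_poly p x = (if x > 0 then poly p (1 / x) * exp (- (1 / x)) else 0)"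

lemma poly_times_exp_minus_at_top:
  fixes p :: "real poly"
  shows "((\<lambda>y. poly p y * exp (- y)) \<longlongrightarrow> 0) at_top"
proof -
  have "((\<lambda>y::real. \<Sum>i\<le>degree p. coeff p i * (y ^ i / exp y)) \<longlongrightarrow> (\<Sum>i\<le>degree p. coeff p i * 0)) at_top"
    by (intro tendsto_sum tendsto_mult tendsto_const tendsto_power_div_exp_0)
  then show ?thesis
    by (simp add: poly_altdef sum_distrib_right exp_minus divide_inverse mult.assoc)
qed

lemma flat_poly_deriv: "(flat_poly p has_real_derivative flat_poly ([:0, 0, 1:] * (p - pderiv p)) x) (at x)"
proof -
  consider "x > 0" | "x < 0" | "x = 0" by linarith
  then show ?thesis
  proof cases
    case 1
    have "((\<lambda>x. poly p (1 / x) * exp (- (1 / x))) has_real_derivative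
        flat_poly ([:0, 0, 1:] * (p - pderiv p)) x) (at x)"
      using 1 unfolding flat_poly_def
      by (auto intro!: derivative_eq_intros DERIV_chain2[OF poly_DERIV] simp: field_simps power2_eq_square)
    then show ?thesis
      by (rule has_field_derivative_transform_within_open[where S = "{0<..}"]) (use 1 in \<open>auto simp: flat_poly_def\<close>)
  next
    case 2
    have "((\<lambda>x. 0) has_real_derivative 0) (at x)" by simp
    then have "(flat_poly p has_real_derivative 0) (at x)"
      by (rule has_field_derivative_transform_within_open[where S = "{..<0}"]) (use 2 in \<open>auto simp: flat_poly_def\<close>)
    then show ?thesis using 2 by (simp add: flat_poly_def)
  next
    case 3
    have "((\<lambda>h. poly ([:0, 1:] * p) (inverse h) * exp (- inverse h)) \<longlongrightarrow> 0) (at_right 0)"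
      by (rule filterlim_compose[OF poly_times_exp_minus_at_top filterlim_inverse_at_top_right])
    then have r: "((\<lambda>h. flat_poly p h / h) \<longlongrightarrow> 0) (at_right 0)"
      by (rule Lim_transform_eventually)
         (auto simp: eventually_at_right_field flat_poly_def divide_inverse mult_ac intro!: exI[of _ 1])
    have l: "((\<lambda>h. flat_poly p h / h) \<longlongrightarrow> 0) (at_left 0)"
      by (rule Lim_transform_eventually[OF tendsto_const])
         (auto simp: eventually_at_left_field flat_poly_def intro!: exI[of _ "-1"])
    show ?thesis
      using filterlim_split_at[OF l r] 3 by (simp add: DERIV_def flat_poly_def)
  qed
qed

lemma smooth_flat_poly: "smooth UNIV (flat_poly p)"
proof -
  have "Ck n UNIV (flat_poly p)" for n
  proof (induction n arbitrary: p)
    case (Suc n)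
    show ?case by (rule Ck_SucI[OF flat_poly_deriv Suc])
  qed simp
  then show ?thesis by (simp add: smooth_def)
qed

definition smooth_step :: "real \<Rightarrow> real" where
  "smooth_step x = flat_poly 1 x / (flat_poly 1 x + flat_poly 1 (1 - x))"

lemma flat_nonneg: "flat_poly 1 x \<ge> 0" and flat_pos: "x > 0 \<Longrightarrow> flat_poly 1 x > 0"
  by (auto simp: flat_poly_def)

lemma smooth_step_denominator: "flat_poly 1 x + flat_poly 1 (1 - x) > 0"
  using flat_nonneg[of x] flat_nonneg[of "1 - x"] flat_pos[of x] flat_pos[of "1 - x"] by (cases "x > 0") auto

lemma smooth_step_eq: "x \<le> 0 \<Longrightarrow> smooth_step x = 0" "x \<ge> 1 \<Longrightarrow> smooth_step x = 1"
  using flat_pos[of x] by (auto simp: smooth_step_def flat_poly_def)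

lemma smooth_step_range: "0 \<le> smooth_step x" "smooth_step x \<le> 1"
  using smooth_step_denominator[of x] flat_nonneg[of x] flat_nonneg[of "1 - x"]
  by (auto simp: smooth_step_def divide_le_eq)

lemma smooth_smooth_step: "smooth UNIV smooth_step"
proof -
  have a: "smooth UNIV (\<lambda>x. flat_poly 1 (1 - x))"
    by (rule smooth_compose[OF smooth_flat_poly smooth_diff[OF smooth_const smooth_id]]) simp
  have "smooth UNIV (\<lambda>x. inverse (flat_poly 1 x + flat_poly 1 (1 - x)))"
    by (rule smooth_compose[OF smooth_inverse smooth_add[OF smooth_flat_poly a]])
       (use smooth_step_denominator in \<open>auto simp: less_le\<close>)
  from smooth_mult[OF smooth_flat_poly this] show ?thesis
    by (simp add: smooth_step_def[abs_def] divide_inverse)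
qed

lemma deriv_eq_0_of_const:
  assumes "open S" "x \<in> S" "\<And>y. y \<in> S \<Longrightarrow> f y = (c::real)"
  shows "deriv f x = 0"
  by (rule DERIV_imp_deriv, rule has_field_derivative_transform_within_open[OF DERIV_const[of c] assms(1,2)])
     (use assms(3) in auto)

lemma smooth_step_derivs_vanish:
  assumes "x < 0 \<or> x > 1"
  shows "deriv smooth_step x = 0" "deriv (deriv smooth_step) x = 0"
proof -
  have *: "deriv smooth_step y = 0" if "y < 0 \<or> y > 1" for y
    using that
  proof
    assume "y < 0" then show ?thesis
      by (intro deriv_eq_0_of_const[where S = "{..<0}" and c = 0]) (auto simp: smooth_step_eq)
  next
    assume "y > 1" then show ?thesis
      by (intro deriv_eq_0_of_const[where S = "{1<..}" and c = 1]) (auto simp: smooth_step_eq)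
  qed
  show "deriv smooth_step x = 0" using *[OF assms] .
  show "deriv (deriv smooth_step) x = 0"
    by (rule deriv_eq_0_of_const[where S = "{..<0} \<union> {1<..}" and c = 0]) (use * assms in auto)
qed

lemma smooth_step_derivs_bounded:
  obtains B where "B \<ge> 1" "\<And>x. \<bar>deriv smooth_step x\<bar> \<le> B" "\<And>x. \<bar>deriv (deriv smooth_step) x\<bar> \<le> B"
proof -
  have bd: "\<exists>B. \<forall>x. \<bar>f x\<bar> \<le> B"
    if "smooth UNIV f" "\<And>x. x < 0 \<or> x > 1 \<Longrightarrow> f x = 0" for f :: "real \<Rightarrow> real"
  proof -
    have "compact (f ` {0..1})"
      by (intro compact_continuous_image continuous_on_subset[OF smooth_continuous[OF that(1)]]) auto
    then have "\<exists>B. \<forall>x\<in>f ` {0..1}. \<bar>x\<bar> \<le> B"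
      using compact_imp_bounded[of "f ` {0..1}"] unfolding bounded_real by simp
    then obtain B where B: "\<And>x. x \<in> {0..1} \<Longrightarrow> \<bar>f x\<bar> \<le> B"
      by blast
    have "\<bar>f x\<bar> \<le> max B 0" for x
      using B[of x] that(2)[of x] by (cases "x < 0 \<or> x > 1") auto
    then show ?thesis by blast
  qed
  obtain B1 where "\<forall>x. \<bar>deriv smooth_step x\<bar> \<le> B1"
    using bd[OF smooth_deriv(1)[OF _ smooth_smooth_step]] smooth_step_derivs_vanish by auto
  moreover obtain B2 where "\<forall>x. \<bar>deriv (deriv smooth_step) x\<bar> \<le> B2"
    using bd[OF smooth_deriv(1)[OF _ smooth_deriv(1)[OF _ smooth_smooth_step]]] smooth_step_derivs_vanish by auto
  ultimately show ?thesis by (intro that[of "max 1 (max B1 B2)"]) (auto simp: le_max_iff_disj)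
qed

section \<open>Gegenbauer eigenfunctions\<close>

text \<open>
  The Gegenbauer polynomials of order \<open>1/4\<close>, defined by their three-term recurrence.
\<close>

fun geg :: "nat \<Rightarrow> real \<Rightarrow> real" where
  "geg 0 x = 1"
| "geg (Suc 0) x = x / 2"
| "geg (Suc (Suc n)) x = ((2 * real n + 5 / 2) * x * geg (Suc n) x - (real n + 1 / 2) * geg n x) / (real n + 2)"

fun geg' :: "nat \<Rightarrow> real \<Rightarrow> real" where
  "geg' 0 x = 0"
| "geg' (Suc 0) x = 1 / 2"
| "geg' (Suc (Suc n)) x = ((2 * real n + 5 / 2) * (geg (Suc n) x + x * geg' (Suc n) x)
     - (real n + 1 / 2) * geg' n x) / (real n + 2)"

lemma geg_recurrence:
  "(2 * real n + 5 / 2) * x * geg (Suc n) x = (real n + 2) * geg (Suc (Suc n)) x + (real n + 1 / 2) * geg n x"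
  by (simp add: field_simps)

lemma geg'_recurrence:
  "(real n + 2) * geg' (Suc (Suc n)) x
    = (2 * real n + 5 / 2) * (geg (Suc n) x + x * geg' (Suc n) x) - (real n + 1 / 2) * geg' n x"
  unfolding geg'.simps(3) times_divide_eq_right by (rule nonzero_mult_div_cancel_left) linarith

declare geg.simps(3) [simp del] geg'.simps(3) [simp del]

lemma has_real_derivative_geg: "(geg n has_real_derivative geg' n x) (at x)"
proof (induction n x rule: geg.induct)
  case (1 x)
  show ?case by (auto simp: geg.simps(1)[abs_def] intro!: derivative_eq_intros)
next
  case (2 x)
  show ?case by (auto simp: geg.simps(2)[abs_def] intro!: derivative_eq_intros)
next
  case (3 n x)
  have "((\<lambda>x. (2 * real n + 5 / 2) * x * geg (Suc n) x - (real n + 1 / 2) * geg n x) has_real_derivative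
      (2 * real n + 5 / 2) * (geg (Suc n) x + x * geg' (Suc n) x) - (real n + 1 / 2) * geg' n x) (at x)"
    by (rule derivative_eq_intros 3 refl | simp add: algebra_simps)+
  from DERIV_cdivide[OF this, of "real n + 2"] show ?case
    unfolding geg.simps(3)[abs_def] geg'.simps(3) .
qed

text \<open>
  The first order relations \<open>geg_lowering\<close> and \<open>geg_raising\<close> together encode the Gegenbauer
  differential equation; they are what survives of it without second derivatives.
\<close>

lemma geg_lowering: "(1 - x\<^sup>2) * geg' (Suc n) x = - (real n + 1) * x * geg (Suc n) x + (real n + 1 / 2) * geg n x"
proof (induction n rule: induct_nat_012)
  case 0 show ?case by (simp add: power2_eq_square field_simps)
next
  case 1
  show ?case
    by (simp add: geg'.simps(3) geg.simps(3) power2_eq_square field_simps)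
next
  case (ge2 n)
  let ?m = "real n + 1"
  have r1: "(real n + 3) * geg (Suc (Suc (Suc n))) x = (2 * real n + 9 / 2) * x * geg (Suc (Suc n)) x - (real n + 3 / 2) * geg (Suc n) x"
    using geg_recurrence[of "Suc n" x] by (simp add: algebra_simps)
  have r0: "(real n + 2) * geg (Suc (Suc n)) x = (2 * real n + 5 / 2) * x * geg (Suc n) x - (real n + 1 / 2) * geg n x"
    using geg_recurrence[of n x] by (simp add: algebra_simps)
  have d: "(real n + 3) * geg' (Suc (Suc (Suc n))) x
    = (2 * real n + 9 / 2) * (geg (Suc (Suc n)) x + x * geg' (Suc (Suc n)) x) - (real n + 3 / 2) * geg' (Suc n) x"
    using geg'_recurrence[of "Suc n" x] by (simp add: algebra_simps)
  have i1: "(1 - x\<^sup>2) * geg' (Suc n) x = - (real n + 1) * x * geg (Suc n) x + (real n + 1 / 2) * geg n x"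
    using ge2 by simp
  have i2: "(1 - x\<^sup>2) * geg' (Suc (Suc n)) x = - (real n + 2) * x * geg (Suc (Suc n)) x + (real n + 3 / 2) * geg (Suc n) x"
    using ge2 by (simp add: algebra_simps)
  have "(real n + 3) * ((1 - x\<^sup>2) * geg' (Suc (Suc (Suc n))) x)
     = (2 * real n + 9 / 2) * ((1 - x\<^sup>2) * geg (Suc (Suc n)) x + x * ((1 - x\<^sup>2) * geg' (Suc (Suc n)) x))
       - (real n + 3 / 2) * ((1 - x\<^sup>2) * geg' (Suc n) x)"
    using arg_cong[OF d, of "\<lambda>y. (1 - x\<^sup>2) * y"] by (simp add: algebra_simps add_divide_distrib diff_divide_distrib)
  also have "\<dots> = - (real n + 3) * x * ((2 * real n + 9 / 2) * x * geg (Suc (Suc n)) x - (real n + 3 / 2) * geg (Suc n) x)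
       + (real n + 5 / 2) * (real n + 3) * geg (Suc (Suc n)) x"
    unfolding i1 i2 using arg_cong[OF r0, of "\<lambda>y. (real n + 3 / 2) * y"]
    by (simp add: power2_eq_square algebra_simps add_divide_distrib diff_divide_distrib)
  also have "\<dots> = (real n + 3) * (- (real n + 3) * x * geg (Suc (Suc (Suc n))) x + (real n + 5 / 2) * geg (Suc (Suc n)) x)"
    unfolding r1[symmetric] by (simp add: algebra_simps)
  finally have "(1 - x\<^sup>2) * geg' (Suc (Suc (Suc n))) x
      = - (real n + 3) * x * geg (Suc (Suc (Suc n))) x + (real n + 5 / 2) * geg (Suc (Suc n)) x"
    by (subst (asm) mult_cancel_left) simp
  then show ?case by (simp add: algebra_simps)
qed

lemma geg_raising: "(1 - x\<^sup>2) * geg' n x = (real n + 1 / 2) * x * geg n x - (real n + 1) * geg (Suc n) x"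
proof (cases n)
  case (Suc m)
  show ?thesis using geg_lowering[of x m] geg_recurrence[of m x] unfolding Suc by (simp add: algebra_simps)
qed simp

lemma geg_1: "geg n 1 = cbinom n"
proof (induction n rule: induct_nat_012)
  case (ge2 n)
  have "c = c * p / q * q / p" if "p \<noteq> 0" "q \<noteq> 0" for c p q :: real using that by simp
  then have "cbinom n = cbinom (Suc n) * (2 * real n + 2) / (2 * real n + 1)"
    unfolding cbinom.simps(2) by this linarith+
  then show ?case
    using ge2 by (simp add: geg.simps(3)) (simp add: cbinom.simps(2)[of "Suc n"] divide_simps, simp add: algebra_simps)
qed (simp_all add: cbinom.simps(2))

lemma geg_uminus: "geg n (- x) = (- 1) ^ n * geg n x"
  by (induction n x rule: geg.induct) (simp_all add: geg.simps(3) algebra_simps diff_divide_distrib)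

lemma geg_minus_1: "geg n (- 1) = (- 1) ^ n * cbinom n"
  using geg_uminus[of n 1] by (simp add: geg_1)

lemma smooth_geg: "smooth S (geg n)"
proof -
  have "smooth UNIV (geg n)"
  proof (induction n rule: induct_nat_012)
    case 0 then show ?case by (simp add: geg.simps(1)[abs_def] smooth_const)
  next
    case 1 then show ?case
      using smooth_cmult[OF smooth_id, of UNIV "1 / 2"] by (simp add: geg.simps(2)[abs_def])
  next
    case (ge2 n)
    have "smooth UNIV (\<lambda>x. 1 / (real n + 2) * ((2 * real n + 5 / 2) * (x * geg (Suc n) x) - (real n + 1 / 2) * geg n x))"
      by (intro smooth_cmult smooth_diff smooth_mult smooth_id ge2)
    then show ?case by (simp add: geg.simps(3)[abs_def] mult.assoc)
  qed
  then show ?thesis by (rule smooth_subset) simp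
qed

text \<open>
  The eigenfunctions of the weighted operator: \<open>- (1 / \<omega>) (\<omega> E')' = ev n * E\<close>.
\<close>

definition E :: "nat \<Rightarrow> real \<Rightarrow> real" where
  "E n \<phi> = geg n (cos \<phi>)"

definition E' :: "nat \<Rightarrow> real \<Rightarrow> real" where
  "E' n \<phi> = - sin \<phi> * geg' n (cos \<phi>)"

definition ev :: "nat \<Rightarrow> real" where
  "ev n = real n * (real n + 1 / 2)"

lemma DERIV_E: "(E n has_real_derivative E' n \<phi>) (at \<phi>)"
  unfolding E_def[abs_def] E'_def
  by (rule DERIV_chain2[OF has_real_derivative_geg, of cos, THEN DERIV_cong]) (auto intro!: derivative_eq_intros)

lemma smooth_E: "smooth S (E n)"
  unfolding E_def[abs_def]
  by (rule smooth_compose[where U = UNIV and f = "geg n" and g = cos, OF smooth_geg smooth_sin_cos(2)]) simp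

lemma deriv_E: "deriv (E n) = E' n"
  by (rule ext) (rule DERIV_imp_deriv[OF DERIV_E])

lemma smooth_E': "smooth S (E' n)"
  using smooth_deriv(1)[OF open_UNIV smooth_E] by (auto simp: deriv_E intro: smooth_subset)

lemma continuous_E: "continuous_on S (E n)" "continuous_on S (E' n)"
  using smooth_continuous[OF smooth_E open_UNIV] smooth_continuous[OF smooth_E' open_UNIV]
  by (auto intro: continuous_on_subset)

lemma E_bounded: obtains B where "B \<ge> 1" "\<And>\<phi>. \<bar>E n \<phi>\<bar> \<le> B" "\<And>\<phi>. \<bar>E' n \<phi>\<bar> \<le> B * \<bar>sin \<phi>\<bar>"
proof -
  have g': "continuous_on {-1..1} (geg' n)"
  proof -
    have "deriv (geg n) = geg' n" by (rule ext) (rule DERIV_imp_deriv[OF has_real_derivative_geg])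
    then show ?thesis
      using smooth_continuous[OF smooth_deriv(1)[OF open_UNIV smooth_geg[of UNIV n]]]
      by (auto intro: continuous_on_subset)
  qed
  have bd: "\<exists>B. \<forall>x\<in>{-1..1}. \<bar>f x\<bar> \<le> B" if "continuous_on {-1..1} f" for f :: "real \<Rightarrow> real"
    using compact_imp_bounded[OF compact_continuous_image[OF that]] by (auto simp: bounded_real)
  obtain B1 where B1: "\<And>x. x \<in> {-1..1} \<Longrightarrow> \<bar>geg n x\<bar> \<le> B1"
    using bd[OF continuous_on_subset[OF smooth_continuous[OF smooth_geg[of UNIV n] open_UNIV] subset_UNIV]] by blast
  obtain B2 where B2: "\<And>x. x \<in> {-1..1} \<Longrightarrow> \<bar>geg' n x\<bar> \<le> B2"
    using bd[OF g'] by blast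
  show ?thesis
  proof (rule that[of "max 1 (max B1 B2)"])
    show "\<bar>E n \<phi>\<bar> \<le> max 1 (max B1 B2)" for \<phi>
      using B1[of "cos \<phi>"] by (simp add: E_def le_max_iff_disj)
    show "\<bar>E' n \<phi>\<bar> \<le> max 1 (max B1 B2) * \<bar>sin \<phi>\<bar>" for \<phi>
      unfolding E'_def abs_mult abs_minus_cancel
      using B2[of "cos \<phi>"] by (subst mult.commute, intro mult_right_mono) (auto simp: le_max_iff_disj)
  qed simp
qed

text \<open>
  The differential equation multiplied by \<open>sin\<^sup>2\<close>, so that it holds at the endpoints as well.
  It comes from differentiating the raising relation and then eliminating \<open>E (Suc n)\<close> by the lowering
  relation.
\<close>

lemma sin_sin_E'':
  assumes "(E' n has_real_derivative d) (at \<phi>)"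
  shows "(sin \<phi>)\<^sup>2 * d = - (1 / 2) * sin \<phi> * cos \<phi> * E' n \<phi> - ev n * (sin \<phi>)\<^sup>2 * E n \<phi>"
proof -
  have sq: "1 - (cos \<phi>)\<^sup>2 = (sin \<phi>)\<^sup>2" for \<phi> :: real by (simp add: sin_squared_eq)
  have up: "sin \<phi> * E' n \<phi> = (real n + 1) * E (Suc n) \<phi> - (real n + 1 / 2) * cos \<phi> * E n \<phi>" for \<phi>
    using geg_raising[of "cos \<phi>" n] unfolding sq by (simp add: E_def E'_def power2_eq_square algebra_simps)
  have low: "sin \<phi> * E' (Suc n) \<phi> = (real n + 1) * cos \<phi> * E (Suc n) \<phi> - (real n + 1 / 2) * E n \<phi>" for \<phi>
    using geg_lowering[of "cos \<phi>" n] unfolding sq by (simp add: E_def E'_def power2_eq_square algebra_simps)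
  have "((\<lambda>\<phi>. sin \<phi> * E' n \<phi>) has_real_derivative cos \<phi> * E' n \<phi> + sin \<phi> * d) (at \<phi>)"
    using assms by (auto intro!: derivative_eq_intros)
  moreover have "((\<lambda>\<phi>. sin \<phi> * E' n \<phi>) has_real_derivative
      (real n + 1) * E' (Suc n) \<phi> - (real n + 1 / 2) * (cos \<phi> * E' n \<phi> - sin \<phi> * E n \<phi>)) (at \<phi>)"
    unfolding up by (rule derivative_eq_intros DERIV_E refl | simp add: algebra_simps)+
  ultimately have "cos \<phi> * E' n \<phi> + sin \<phi> * d
      = (real n + 1) * E' (Suc n) \<phi> - (real n + 1 / 2) * (cos \<phi> * E' n \<phi> - sin \<phi> * E n \<phi>)"
    by (rule DERIV_unique)
  from arg_cong[OF this, of "\<lambda>y. sin \<phi> * y"]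
  have "sin \<phi> * (cos \<phi> * E' n \<phi> + sin \<phi> * d)
      = (real n + 1) * (sin \<phi> * E' (Suc n) \<phi>) - (real n + 1 / 2) * (cos \<phi> * (sin \<phi> * E' n \<phi>) - (sin \<phi>)\<^sup>2 * E n \<phi>)"
    by (simp add: power2_eq_square algebra_simps add_divide_distrib diff_divide_distrib)
  also have "\<dots> = cos \<phi> * ((real n + 1) * ((real n + 1) * E (Suc n) \<phi>)) - (real n + 1) * (real n + 1 / 2) * E n \<phi>
      - (real n + 1 / 2) * (cos \<phi> * (sin \<phi> * E' n \<phi>) - (sin \<phi>)\<^sup>2 * E n \<phi>)"
    unfolding low by (simp add: algebra_simps)
  also have "(real n + 1) * E (Suc n) \<phi> = sin \<phi> * E' n \<phi> + (real n + 1 / 2) * cos \<phi> * E n \<phi>"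
    unfolding up by simp
  also have "cos \<phi> * ((real n + 1) * (sin \<phi> * E' n \<phi> + (real n + 1 / 2) * cos \<phi> * E n \<phi>)) - (real n + 1) * (real n + 1 / 2) * E n \<phi>
      - (real n + 1 / 2) * (cos \<phi> * (sin \<phi> * E' n \<phi>) - (sin \<phi>)\<^sup>2 * E n \<phi>)
    = 1 / 2 * cos \<phi> * sin \<phi> * E' n \<phi> - ((real n + 1) * (real n + 1 / 2)) * (1 - (cos \<phi>)\<^sup>2) * E n \<phi> + (real n + 1 / 2) * (sin \<phi>)\<^sup>2 * E n \<phi>"
    by (simp add: power2_eq_square algebra_simps add_divide_distrib diff_divide_distrib)
  finally show ?thesis
    unfolding sq ev_def by (simp add: power2_eq_square algebra_simps add_divide_distrib diff_divide_distrib)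
qed

lemma E_ode:
  assumes "sin \<phi> \<noteq> 0"
  shows "(E' n has_real_derivative - (cos \<phi> / (2 * sin \<phi>)) * E' n \<phi> - ev n * E n \<phi>) (at \<phi>)"
proof -
  have d: "(E' n has_real_derivative deriv (E' n) \<phi>) (at \<phi>)"
    by (rule smooth_deriv(2)[OF open_UNIV smooth_E']) simp
  have "(sin \<phi>)\<^sup>2 * deriv (E' n) \<phi> = (sin \<phi>)\<^sup>2 * (- (cos \<phi> / (2 * sin \<phi>)) * E' n \<phi> - ev n * E n \<phi>)"
    unfolding sin_sin_E''[OF d] using assms by (simp add: power2_eq_square right_diff_distrib)
  then have "deriv (E' n) \<phi> = - (cos \<phi> / (2 * sin \<phi>)) * E' n \<phi> - ev n * E n \<phi>"
    using assms by simp
  then show ?thesis using d by simp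
qed

lemma E_at_ends: "E n 0 = cbinom n" "E n pi = (- 1) ^ n * cbinom n" "E' n 0 = 0" "E' n pi = 0"
  by (simp_all add: E_def E'_def geg_1 geg_minus_1)

text \<open>
  Sonin's argument: \<open>E\<^sup>2 + E'\<^sup>2 / ev n\<close> has derivative \<open>- cot \<phi> * E'\<^sup>2 / ev n\<close>, so it decreases on
  the left half and increases on the right half of the interval. Its values at the endpoints are
  \<open>(cbinom n)\<^sup>2\<close>.
\<close>

lemma E_bound:
  assumes "\<phi> \<in> {0..pi}"
  shows "\<bar>E n \<phi>\<bar> \<le> cbinom n"
proof (cases "n = 0")
  case True
  then show ?thesis by (simp add: E_def)
next
  case False
  define S where "S \<phi> = (E n \<phi>)\<^sup>2 + (E' n \<phi>)\<^sup>2 / ev n" for \<phi>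
  have ev: "ev n > 0" using False by (simp add: ev_def)
  have cont: "continuous_on A S" for A
    unfolding S_def using continuous_E ev by (auto intro!: continuous_intros)
  have dS: "(S has_real_derivative - (cos \<phi> / sin \<phi>) * (E' n \<phi>)\<^sup>2 / ev n) (at \<phi>)" if "0 < \<phi>" "\<phi> < pi" for \<phi>
  proof -
    have s: "sin \<phi> \<noteq> 0" using sin_gt_zero[OF that] by simp
    show ?thesis unfolding S_def
      by (rule derivative_eq_intros DERIV_E E_ode[OF s] refl | use ev s in \<open>simp add: field_simps power2_eq_square\<close>)+
  qed
  have "S \<phi> \<le> (cbinom n)\<^sup>2"
  proof (cases "\<phi> \<le> pi / 2")
    case True
    have "S \<phi> \<le> S 0"
    proof (rule DERIV_nonpos_imp_decreasing_open[where f = S and a = 0 and b = \<phi>])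
      show "0 \<le> \<phi>" using assms by simp
      fix x assume x: "0 < x" "x < \<phi>"
      then have "0 < x" "x < pi" "cos x \<ge> 0" "sin x > 0"
        using True pi_gt_zero by (auto intro!: cos_ge_zero sin_gt_zero)
      then show "\<exists>y. (S has_real_derivative y) (at x) \<and> y \<le> 0"
        using ev dS[of x] by (intro exI[of _ "- (cos x / sin x) * (E' n x)\<^sup>2 / ev n"])
          (auto intro!: divide_nonneg_nonneg mult_nonneg_nonneg)
    qed (rule cont)
    then show ?thesis by (simp add: S_def E_at_ends)
  next
    case False
    have "S \<phi> \<le> S pi"
    proof (rule DERIV_nonneg_imp_increasing_open[where f = S and a = \<phi> and b = pi])
      show "\<phi> \<le> pi" using assms by simp
      fix x assume x: "\<phi> < x" "x < pi"
      then have *: "0 < x" "x < pi" "sin x > 0" "cos x \<le> 0"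
        using False pi_gt_zero cos_ge_zero[of "pi - x"] by (auto intro!: sin_gt_zero simp: cos_diff)
      then have "- (cos x / sin x) * (E' n x)\<^sup>2 / ev n \<ge> 0"
        using ev by (intro divide_nonneg_nonneg mult_nonneg_nonneg) (auto simp: divide_nonpos_pos)
      then show "\<exists>y. (S has_real_derivative y) (at x) \<and> 0 \<le> y"
        using dS[OF *(1,2)] by blast
    qed (rule cont)
    moreover have "((- 1) ^ n)\<^sup>2 = (1::real)" by (cases "even n") auto
    ultimately show ?thesis by (simp add: S_def E_at_ends power_mult_distrib)
  qed
  moreover have "0 \<le> (E' n \<phi>)\<^sup>2 / ev n" using ev by (intro divide_nonneg_pos) auto
  ultimately have "(E n \<phi>)\<^sup>2 \<le> (cbinom n)\<^sup>2" unfolding S_def by linarith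
  then show ?thesis unfolding abs_le_square_iff[symmetric] using cbinom_pos[of n] by simp
qed

section \<open>Square integrable functions and Parseval\<close>

text \<open>
  Square integrable functions as plain functions on an arbitrary measure space, so that the same facts
  serve for the weighted interval and for time intervals.
\<close>

definition sq_int :: "'a measure \<Rightarrow> ('a \<Rightarrow> complex) \<Rightarrow> bool" where
  "sq_int M f \<longleftrightarrow> f \<in> borel_measurable M \<and> integrable M (\<lambda>x. (norm (f x))\<^sup>2)"

definition ip :: "'a measure \<Rightarrow> ('a \<Rightarrow> complex) \<Rightarrow> ('a \<Rightarrow> complex) \<Rightarrow> complex" where
  "ip M f g = (LINT x|M. f x * cnj (g x))"

definition nsq :: "'a measure \<Rightarrow> ('a \<Rightarrow> complex) \<Rightarrow> real" where
  "nsq M f = (LINT x|M. (norm (f x))\<^sup>2)"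

lemma nsq_nonneg: "nsq M f \<ge> 0"
  by (simp add: nsq_def)

lemma two_mult_norm_le: "2 * (norm x * norm y) \<le> (norm (x::complex))\<^sup>2 + (norm (y::complex))\<^sup>2"
  using zero_le_power2[of "norm x - norm y"] by (simp add: power2_eq_square algebra_simps)

lemma sq_int_integrable:
  assumes "sq_int M f" "sq_int M g"
  shows "integrable M (\<lambda>x. f x * cnj (g x))"
proof (rule Bochner_Integration.integrable_bound)
  show "integrable M (\<lambda>x. (norm (f x))\<^sup>2 + (norm (g x))\<^sup>2)"
    using assms by (simp add: sq_int_def)
  have [measurable]: "f \<in> borel_measurable M" "g \<in> borel_measurable M" using assms by (simp_all add: sq_int_def)
  show "(\<lambda>x. f x * cnj (g x)) \<in> borel_measurable M"
  proof -
    have "(\<lambda>x. cnj (g x)) \<in> borel_measurable M"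
      by (rule measurable_compose[OF _ borel_measurable_continuous_onI[of cnj]]) (auto intro!: continuous_intros)
    then show ?thesis by measurable
  qed
  show "AE x in M. norm (f x * cnj (g x)) \<le> norm ((norm (f x))\<^sup>2 + (norm (g x))\<^sup>2)"
  proof (rule AE_I2)
    fix x
    show "norm (f x * cnj (g x)) \<le> norm ((norm (f x))\<^sup>2 + (norm (g x))\<^sup>2)"
      unfolding norm_mult complex_mod_cnj real_norm_def
      using two_mult_norm_le[of "f x" "g x"] mult_nonneg_nonneg[OF norm_ge_zero norm_ge_zero, of "f x" "g x"] by linarith
  qed
qed

lemma sq_int_bound:
  assumes "f \<in> borel_measurable M" "integrable M g" "\<And>x. x \<in> space M \<Longrightarrow> (norm (f x))\<^sup>2 \<le> g x"
  shows "sq_int M f"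
  unfolding sq_int_def
proof
  show "integrable M (\<lambda>x. (norm (f x))\<^sup>2)"
    by (rule Bochner_Integration.integrable_bound[OF assms(2)])
       (use assms(1,3) in \<open>auto intro!: AE_I2 order_trans[OF _ abs_ge_self]\<close>)
qed (use assms in simp)

lemma norm_add_sq_le: "(norm (x + y))\<^sup>2 \<le> 2 * (norm x)\<^sup>2 + 2 * (norm (y::complex))\<^sup>2"
proof -
  have "(norm (x + y))\<^sup>2 \<le> (norm x + norm y)\<^sup>2" by (intro power_mono norm_triangle_ineq) auto
  also have "\<dots> \<le> 2 * (norm x)\<^sup>2 + 2 * (norm y)\<^sup>2"
    using two_mult_norm_le[of x y] by (simp add: power2_sum)
  finally show ?thesis .
qed

lemma sq_int_add:
  assumes "sq_int M f" "sq_int M g"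
  shows "sq_int M (\<lambda>x. f x + g x)"
  by (rule sq_int_bound[of _ _ "\<lambda>x. 2 * (norm (f x))\<^sup>2 + 2 * (norm (g x))\<^sup>2"])
     (use assms norm_add_sq_le in \<open>auto simp: sq_int_def\<close>)

lemma sq_int_cmult:
  assumes "sq_int M f"
  shows "sq_int M (\<lambda>x. c * f x)"
  using assms by (auto simp: sq_int_def norm_mult power_mult_distrib)

lemma sq_int_diff:
  assumes "sq_int M f" "sq_int M g"
  shows "sq_int M (\<lambda>x. f x - g x)"
  using sq_int_add[OF assms(1) sq_int_cmult[OF assms(2), of "- 1"]] by simp

lemma sq_int_sum:
  assumes "finite I" "\<And>i. i \<in> I \<Longrightarrow> sq_int M (f i)"
  shows "sq_int M (\<lambda>x. \<Sum>i\<in>I. f i x)"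
  using assms
proof (induction I rule: finite_induct)
  case empty
  show ?case by (simp add: sq_int_def)
next
  case (insert i I)
  then show ?case by (simp add: sq_int_add)
qed

lemma ip_self: "ip M f f = of_real (nsq M f)"
  by (simp add: ip_def nsq_def complex_norm_square[symmetric] del: of_real_power)

lemma ip_cnj: "cnj (ip M f g) = ip M g f"
  unfolding ip_def Bochner_Integration.integral_cnj[symmetric] by (simp add: mult.commute del: Bochner_Integration.integral_cnj)

lemma ip_diff_left:
  assumes "sq_int M f" "sq_int M g" "sq_int M h"
  shows "ip M (\<lambda>x. f x - g x) h = ip M f h - ip M g h"
  using sq_int_integrable[OF assms(1,3)] sq_int_integrable[OF assms(2,3)] by (simp add: ip_def algebra_simps)

lemma ip_sum_left:
  fixes f :: "'i \<Rightarrow> 'a \<Rightarrow> complex" and d :: "'i \<Rightarrow> complex"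
  assumes "finite I" "\<And>i. i \<in> I \<Longrightarrow> sq_int M (f i)" "sq_int M h"
  shows "ip M (\<lambda>x. \<Sum>i\<in>I. d i * f i x) h = (\<Sum>i\<in>I. d i * ip M (f i) h)"
proof -
  have "ip M (\<lambda>x. \<Sum>i\<in>I. d i * f i x) h = (LINT x|M. (\<Sum>i\<in>I. d i * (f i x * cnj (h x))))"
    by (simp add: ip_def sum_distrib_right mult.assoc)
  also have "\<dots> = (\<Sum>i\<in>I. LINT x|M. d i * (f i x * cnj (h x)))"
    using assms by (intro Bochner_Integration.integral_sum integrable_mult_right sq_int_integrable) auto
  finally show ?thesis by (simp add: ip_def)
qed

lemma bessel_identity:
  fixes e :: "'i \<Rightarrow> 'a \<Rightarrow> complex" and d :: "'i \<Rightarrow> complex"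
  assumes I: "finite I" and f: "sq_int M f" and e: "\<And>i. i \<in> I \<Longrightarrow> sq_int M (e i)"
    and on: "\<And>i j. i \<in> I \<Longrightarrow> j \<in> I \<Longrightarrow> ip M (e i) (e j) = (if i = j then 1 else 0)"
  shows "nsq M (\<lambda>x. f x - (\<Sum>i\<in>I. d i * e i x))
    = nsq M f - (\<Sum>i\<in>I. (norm (ip M f (e i)))\<^sup>2) + (\<Sum>i\<in>I. (norm (ip M f (e i) - d i))\<^sup>2)"
proof -
  let ?s = "\<lambda>x. \<Sum>i\<in>I. d i * e i x"
  let ?c = "\<lambda>i. ip M f (e i)"
  have s: "sq_int M ?s" by (intro sq_int_sum I sq_int_cmult e)
  have fs: "sq_int M (\<lambda>x. f x - ?s x)" by (rule sq_int_diff[OF f s])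
  have sf: "ip M ?s f = (\<Sum>i\<in>I. d i * cnj (?c i))"
    using ip_sum_left[OF I e f, where d = d] by (simp add: ip_cnj)
  have se: "ip M ?s (e j) = d j" if "j \<in> I" for j
  proof -
    have "ip M ?s (e j) = (\<Sum>i\<in>I. d i * ip M (e i) (e j))"
      by (rule ip_sum_left[OF I _ e[OF that]]) (rule e)
    also have "\<dots> = (\<Sum>i\<in>I. if i = j then d i else 0)"
      by (rule sum.cong) (use on that in auto)
    also have "\<dots> = d j" using that I by simp
    finally show ?thesis .
  qed
  have ss: "ip M ?s ?s = (\<Sum>i\<in>I. d i * cnj (d i))"
  proof -
    have "ip M ?s ?s = (\<Sum>i\<in>I. d i * ip M (e i) ?s)" by (rule ip_sum_left[OF I _ s]) (rule e)
    also have "\<dots> = (\<Sum>i\<in>I. d i * cnj (d i))"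
    proof (rule sum.cong[OF refl])
      fix i assume "i \<in> I"
      then show "d i * ip M (e i) ?s = d i * cnj (d i)"
        using ip_cnj[of M ?s "e i"] se by metis
    qed
    finally show ?thesis .
  qed
  have fx: "ip M f (\<lambda>x. f x - ?s x) = cnj (ip M f f - ip M ?s f)"
    unfolding ip_diff_left[OF f s f, symmetric] by (rule ip_cnj[symmetric])
  have sx: "ip M ?s (\<lambda>x. f x - ?s x) = cnj (ip M f ?s - ip M ?s ?s)"
    unfolding ip_diff_left[OF f s s, symmetric] by (rule ip_cnj[symmetric])
  have fs': "ip M f ?s = cnj (ip M ?s f)" by (rule ip_cnj[symmetric])
  have c1: "cnj (\<Sum>i\<in>I. d i * cnj (?c i)) = (\<Sum>i\<in>I. cnj (d i) * ?c i)" by simp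
  have c2: "cnj (\<Sum>i\<in>I. d i * cnj (d i)) = (\<Sum>i\<in>I. d i * cnj (d i))" by (simp add: mult.commute)
  have "of_real (nsq M (\<lambda>x. f x - ?s x)) = ip M (\<lambda>x. f x - ?s x) (\<lambda>x. f x - ?s x)"
    by (rule ip_self[symmetric])
  also have "\<dots> = ip M f (\<lambda>x. f x - ?s x) - ip M ?s (\<lambda>x. f x - ?s x)"
    by (rule ip_diff_left[OF f s fs])
  also have "\<dots> = of_real (nsq M f) - (\<Sum>i\<in>I. cnj (d i) * ?c i) - (\<Sum>i\<in>I. d i * cnj (?c i)) + (\<Sum>i\<in>I. d i * cnj (d i))"
    unfolding fx sx fs' ss sf complex_cnj_diff complex_cnj_cnj c1 c2 ip_self[of M f] complex_cnj_complex_of_real by simp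
  also have "\<dots> = of_real (nsq M f - (\<Sum>i\<in>I. (norm (?c i))\<^sup>2) + (\<Sum>i\<in>I. (norm (?c i - d i))\<^sup>2))"
  proof -
    have *: "complex_of_real ((norm (?c i - d i))\<^sup>2) = of_real ((norm (?c i))\<^sup>2) - cnj (d i) * ?c i - d i * cnj (?c i) + d i * cnj (d i)" for i
      unfolding complex_norm_square by (simp add: algebra_simps)
    show ?thesis unfolding of_real_add of_real_diff of_real_sum *
      by (simp add: sum.distrib sum_subtractf)
  qed
  finally show ?thesis by (simp only: of_real_eq_iff)
qed

lemma bessel_inequality:
  fixes e :: "'i \<Rightarrow> 'a \<Rightarrow> complex"
  assumes "finite I" "sq_int M f" "\<And>i. i \<in> I \<Longrightarrow> sq_int M (e i)"
    and "\<And>i j. i \<in> I \<Longrightarrow> j \<in> I \<Longrightarrow> ip M (e i) (e j) = (if i = j then 1 else 0)"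
  shows "(\<Sum>i\<in>I. (norm (ip M f (e i)))\<^sup>2) \<le> nsq M f"
  using bessel_identity[OF assms, of "\<lambda>i. ip M f (e i)"] nsq_nonneg[of M "\<lambda>x. f x - (\<Sum>i\<in>I. ip M f (e i) * e i x)"]
  by simp

lemma cauchy_schwarz_ip:
  assumes f: "sq_int M f" and g: "sq_int M g"
  shows "norm (ip M f g) \<le> sqrt (nsq M f) * sqrt (nsq M g)"
proof (cases "nsq M g = 0")
  case True
  then have "AE x in M. (norm (g x))\<^sup>2 = 0"
    using g integral_nonneg_eq_0_iff_AE[of M "\<lambda>x. (norm (g x))\<^sup>2"] by (simp add: nsq_def sq_int_def)
  then have "AE x in M. f x * cnj (g x) = 0" by (auto elim: AE_mp)
  then have "ip M f g = 0" unfolding ip_def by (rule integral_eq_zero_AE)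
  then show ?thesis by (simp add: True)
next
  case False
  define k where "k = sqrt (nsq M g)"
  have k: "k > 0" using False nsq_nonneg[of M g] by (simp add: k_def)
  define e where "e x = of_real (1 / k) * g x" for x
  have e: "sq_int M e" unfolding e_def[abs_def] by (rule sq_int_cmult[OF g])
  have fe: "ip M f e = of_real (1 / k) * ip M f g" by (simp add: ip_def e_def)
  have "ip M e e = 1"
  proof -
    have "nsq M e = (1 / k)\<^sup>2 * nsq M g" by (simp add: nsq_def e_def norm_mult norm_divide power_mult_distrib power_divide)
    also have "\<dots> = 1" using k nsq_nonneg[of M g] by (simp add: k_def power_divide)
    finally show ?thesis by (simp add: ip_self)
  qed
  then have "(norm (ip M f e))\<^sup>2 \<le> nsq M f"
    using bessel_inequality[of "{0::nat}" M f "\<lambda>_. e"] f e by simp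
  then have "norm (ip M f e) \<le> sqrt (nsq M f)" by (rule real_le_rsqrt)
  moreover have "norm (ip M f e) = norm (ip M f g) / k"
    unfolding fe norm_mult norm_of_real using k by simp
  ultimately show ?thesis using k by (simp add: k_def field_simps)
qed

lemma parseval_of_approximation:
  fixes e :: "nat \<Rightarrow> 'a \<Rightarrow> complex"
  assumes f: "sq_int M f" and e: "\<And>n. sq_int M (e n)"
    and on: "\<And>i j. ip M (e i) (e j) = (if i = j then 1 else 0)"
    and ap: "\<And>\<epsilon>. \<epsilon> > 0 \<Longrightarrow> \<exists>m d. nsq M (\<lambda>x. f x - (\<Sum>n<m. d n * e n x)) < \<epsilon>"
  shows "(\<lambda>n. (norm (ip M f (e n)))\<^sup>2) sums nsq M f"
proof -
  let ?S = "\<lambda>m. \<Sum>n<m. (norm (ip M f (e n)))\<^sup>2"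
  have le: "?S m \<le> nsq M f" for m
    by (rule bessel_inequality[OF _ f e on]) simp
  have mono: "?S m \<le> ?S k" if "m \<le> k" for m k
    by (rule sum_mono2) (use that in auto)
  have "?S \<longlonglongrightarrow> nsq M f"
  proof (rule LIMSEQ_I)
    fix \<epsilon> :: real assume "\<epsilon> > 0"
    then obtain m d where md: "nsq M (\<lambda>x. f x - (\<Sum>n<m. d n * e n x)) < \<epsilon>" using ap by blast
    have "nsq M f - ?S m < \<epsilon>"
      using md bessel_identity[OF _ f e on, of "{..<m}" d] sum_nonneg[of "{..<m}" "\<lambda>n. (norm (ip M f (e n) - d n))\<^sup>2"] by simp
    then have "norm (?S k - nsq M f) < \<epsilon>" if "k \<ge> m" for k
      using le[of k] mono[OF that] by simp
    then show "\<exists>no. \<forall>k\<ge>no. norm (?S k - nsq M f) < \<epsilon>" by blast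
  qed
  then show ?thesis by (simp add: sums_def)
qed

text \<open>
  Radial truncation to the ball of radius \<open>B\<close>. It is continuous, so truncations of continuous
  approximants are still continuous.
\<close>

definition clamp_ball :: "real \<Rightarrow> complex \<Rightarrow> complex" where
  "clamp_ball B z = z / of_real (max 1 (norm z / B))"

lemma clamp_ball:
  assumes "B > 0"
  shows "norm (clamp_ball B z) \<le> B" "norm z \<le> B \<Longrightarrow> clamp_ball B z = z" "norm (z - clamp_ball B z) \<le> norm z"
    "continuous_on UNIV (clamp_ball B)"
proof -
  let ?m = "max 1 (norm z / B)"
  have m: "?m \<ge> 1" "norm z \<le> B * ?m" using assms by (auto simp: field_simps max_def)
  have n: "norm (clamp_ball B z) = norm z / ?m" unfolding clamp_ball_def norm_divide norm_of_real using m by simp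
  show "norm (clamp_ball B z) \<le> B" unfolding n using m assms by (simp add: divide_le_eq mult.commute)
  show "norm z \<le> B \<Longrightarrow> clamp_ball B z = z" using assms by (simp add: clamp_ball_def max_def)
  have "z - clamp_ball B z = of_real (1 - 1 / ?m) * z" by (simp add: clamp_ball_def algebra_simps)
  also have "norm \<dots> = (1 - 1 / ?m) * norm z"
    unfolding norm_mult norm_of_real using divide_le_eq_1_pos[of ?m 1] m(1) by (subst abs_of_nonneg) simp_all
  also have "\<dots> \<le> 1 * norm z" using m by (intro mult_right_mono) auto
  finally show "norm (z - clamp_ball B z) \<le> norm z" by simp
  show "continuous_on UNIV (clamp_ball B)"
    unfolding clamp_ball_def[abs_def]
    using assms by (intro continuous_intros) (auto simp: max_def)
qed

text \<open>
  Functions that agree on \<open>S\<close> with a finite linear combination of the \<open>e n\<close>.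
\<close>

definition fspan :: "'a set \<Rightarrow> (nat \<Rightarrow> 'a \<Rightarrow> complex) \<Rightarrow> ('a \<Rightarrow> complex) set" where
  "fspan S e = {p. \<exists>m d. \<forall>x\<in>S. p x = (\<Sum>n<m. d n * e n x)}"

lemma fspan_basis: "e n \<in> fspan S e"
  unfolding fspan_def
  by (intro CollectI exI[of _ "Suc n"] exI[of _ "\<lambda>k. if k = n then 1 else 0"] ballI) (simp add: if_distrib[of "\<lambda>t. t * _"] cong: if_cong)

lemma fspan_cmult: "p \<in> fspan S e \<Longrightarrow> (\<lambda>x. c * p x) \<in> fspan S e"
proof -
  assume "p \<in> fspan S e"
  then obtain m d where "\<forall>x\<in>S. p x = (\<Sum>n<m. d n * e n x)" unfolding fspan_def by blast
  then have "\<forall>x\<in>S. c * p x = (\<Sum>n<m. (c * d n) * e n x)" by (simp add: sum_distrib_left mult.assoc)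
  then show ?thesis unfolding fspan_def by (intro CollectI exI)
qed

lemma fspan_add: "p \<in> fspan S e \<Longrightarrow> q \<in> fspan S e \<Longrightarrow> (\<lambda>x. p x + q x) \<in> fspan S e"
proof -
  assume "p \<in> fspan S e" "q \<in> fspan S e"
  then obtain m d m' d' where *: "\<forall>x\<in>S. p x = (\<Sum>n<m. d n * e n x)" "\<forall>x\<in>S. q x = (\<Sum>n<m'. d' n * e n x)"
    unfolding fspan_def by blast
  have pad: "(\<Sum>n<m. d n * e n x) = (\<Sum>n<max m k. (if n < m then d n else 0) * e n x)" for m k :: nat and d x
    by (rule sum.mono_neutral_cong_left) auto
  have "\<forall>x\<in>S. p x + q x = (\<Sum>n<max m m'. ((if n < m then d n else 0) + (if n < m' then d' n else 0)) * e n x)"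
    using * pad[where m = m and k = m' and d = d] pad[where m = m' and k = m and d = d'] by (simp add: max.commute distrib_right sum.distrib)
  then show ?thesis unfolding fspan_def by (intro CollectI exI)
qed

lemma fspan_sum: "finite I \<Longrightarrow> (\<And>i. i \<in> I \<Longrightarrow> p i \<in> fspan S e) \<Longrightarrow> (\<lambda>x. \<Sum>i\<in>I. p i x) \<in> fspan S e"
proof (induction I rule: finite_induct)
  case empty
  show ?case unfolding fspan_def by (auto intro!: exI[of _ 0])
qed (simp add: fspan_add)

lemma fspan_cong: "p \<in> fspan S e \<Longrightarrow> (\<And>x. x \<in> S \<Longrightarrow> q x = p x) \<Longrightarrow> q \<in> fspan S e"
  unfolding fspan_def by auto

lemma fspan_mult_closed:
  assumes "\<And>n. (\<lambda>x. c x * e n x) \<in> fspan S e" and p: "p \<in> fspan S e"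
  shows "(\<lambda>x. c x * p x) \<in> fspan S e"
proof -
  obtain m d where md: "\<forall>x\<in>S. p x = (\<Sum>n<m. d n * e n x)" using p unfolding fspan_def by blast
  have "(\<lambda>x. \<Sum>n<m. d n * (c x * e n x)) \<in> fspan S e"
    by (intro fspan_sum fspan_cmult assms(1)) simp
  then show ?thesis by (rule fspan_cong) (use md in \<open>simp add: sum_distrib_left mult_ac\<close>)
qed

lemma fspan_polynomial:
  fixes c :: "'a \<Rightarrow> real"
  assumes one: "(\<lambda>x. 1) \<in> fspan S e" and c: "\<And>n. (\<lambda>x. of_real (c x) * e n x) \<in> fspan S e"
    and q: "real_polynomial_function q"
  shows "(\<lambda>x. of_real (q (c x))) \<in> fspan S e"
proof -
  obtain a n where q: "q = (\<lambda>x. \<Sum>i\<le>n. a i * x ^ i)"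
    using q unfolding real_polynomial_function_iff_sum by blast
  have "(\<lambda>x. of_real (c x) ^ i) \<in> fspan S e" for i
  proof (induction i)
    case (Suc i)
    from fspan_mult_closed[OF c this] show ?case by simp
  qed (simp add: one)
  then have "(\<lambda>x. \<Sum>i\<le>n. of_real (a i) * of_real (c x) ^ i) \<in> fspan S e"
    by (intro fspan_sum fspan_cmult) auto
  then show ?thesis by (simp add: q)
qed

text \<open>
  Completeness for orthonormal systems of polynomials in one injective function \<open>c\<close>, such as cosines
  or Gegenbauer polynomials of \<open>cos\<close>. The recurrence puts every polynomial in \<open>c\<close> into the span.
  A square integrable function is approximated by a bounded one, that one by a bounded continuous
  function \<open>h\<close>, and \<open>h\<close> is a continuous function of \<open>c\<close>, hence by the Weierstrass theorem uniformly
  close to a polynomial in \<open>c\<close>.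
\<close>

lemma parseval_of_recurrence:
  fixes e :: "nat \<Rightarrow> real \<Rightarrow> complex" and c :: "real \<Rightarrow> real"
  assumes M: "finite_measure M" "sets M = sets (lebesgue_on {a<..<b})"
    and ac: "\<And>N. N \<in> null_sets lebesgue \<Longrightarrow> AE x in M. x \<notin> N"
    and c: "continuous_on {a..b} c" "inj_on c {a..b}"
    and e: "\<And>n. sq_int M (e n)" "\<And>i j. ip M (e i) (e j) = (if i = j then 1 else 0)"
    and one: "(\<lambda>x. 1) \<in> fspan {a<..<b} e"
    and rec: "\<And>n. (\<lambda>x. of_real (c x) * e n x) \<in> fspan {a<..<b} e"
    and f: "sq_int M f"
  shows "(\<lambda>n. (norm (ip M f (e n)))\<^sup>2) sums nsq M f"
proof (rule parseval_of_approximation[OF f e])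
  fix \<epsilon> :: real assume eps: "\<epsilon> > 0"
  interpret finite_measure M by fact
  have sp: "space M = {a<..<b}" using sets_eq_imp_space_eq[OF M(2)] by simp
  have meas: "borel_measurable M = borel_measurable (lebesgue_on {a<..<b})"
    by (rule measurable_cong_sets[OF M(2) refl])
  have fm[measurable]: "f \<in> borel_measurable M" using f by (simp add: sq_int_def)
  have contM: "g \<in> borel_measurable M" if "continuous_on UNIV g" for g :: "real \<Rightarrow> complex"
    unfolding meas by (rule continuous_imp_measurable_on_sets_lebesgue) (use that in \<open>auto intro: continuous_on_subset\<close>)
  have clM: "(\<lambda>x. clamp_ball B (g x)) \<in> borel_measurable M" if "B > 0" "g \<in> borel_measurable M" for B g
    using borel_measurable_continuous_onI[OF clamp_ball(4)[OF that(1)]] that(2) by measurable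
  \<comment> \<open>A measurable function is an almost everywhere limit of continuous ones; truncation makes the limit dominated.\<close>
  have "f measurable_on {a<..<b}"
    using fm unfolding meas by (subst measurable_on_iff_borel_measurable) auto
  then obtain N g where N: "negligible N" and g: "\<And>n. continuous_on UNIV (g n)"
    and lim: "\<And>x. x \<notin> N \<Longrightarrow> (\<lambda>n. g n x) \<longlonglongrightarrow> (if x \<in> {a<..<b} then f x else 0)"
    unfolding measurable_on_def by blast
  have "AE x in M. x \<notin> N" using N ac by (simp add: negligible_iff_null_sets)
  then have lim': "AE x in M. (\<lambda>n. g n x) \<longlonglongrightarrow> f x"
    using AE_space by eventually_elim (use lim sp in fastforce)

  define K where "K n = real (Suc n)" for n
  have K: "K n > 0" for n by (simp add: K_def)
  have "(\<lambda>n. LINT x|M. (norm (f x - clamp_ball (K n) (f x)))\<^sup>2) \<longlonglongrightarrow> (LINT x|M. 0)"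
  proof (rule integral_dominated_convergence)
    show "integrable M (\<lambda>x. (norm (f x))\<^sup>2)" using f by (simp add: sq_int_def)
    show "(\<lambda>x. (norm (f x - clamp_ball (K n) (f x)))\<^sup>2) \<in> borel_measurable M" for n
      using clM[OF K fm] by measurable
    show "AE x in M. (\<lambda>n. (norm (f x - clamp_ball (K n) (f x)))\<^sup>2) \<longlonglongrightarrow> 0"
    proof (rule AE_I2)
      fix x
      obtain n0 where n0: "norm (f x) \<le> real n0" using real_arch_simple by blast
      then have "f x - clamp_ball (K n) (f x) = 0" if "n \<ge> n0" for n
        using that clamp_ball(2)[OF K, of "f x" n] by (simp add: K_def)
      then show "(\<lambda>n. (norm (f x - clamp_ball (K n) (f x)))\<^sup>2) \<longlonglongrightarrow> 0"
        by (intro tendsto_eventually eventually_sequentiallyI[of n0]) simp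
    qed
    show "AE x in M. norm ((norm (f x - clamp_ball (K n) (f x)))\<^sup>2) \<le> (norm (f x))\<^sup>2" for n
      using clamp_ball(3)[OF K] by (auto intro!: AE_I2 power_mono)
  qed simp
  then have "\<forall>\<^sub>F n in sequentially. (LINT x|M. (norm (f x - clamp_ball (K n) (f x)))\<^sup>2) < \<epsilon> / 16"
    using eps by (intro order_tendstoD(2)) auto
  then obtain n1 where n1: "(LINT x|M. (norm (f x - clamp_ball (K n1) (f x)))\<^sup>2) < \<epsilon> / 16"
    by (meson eventually_happens sequentially_bot)
  define B where "B = K n1"
  have B: "B > 0" using K by (simp add: B_def)

  have "(\<lambda>n. LINT x|M. (norm (clamp_ball B (f x) - clamp_ball B (g n x)))\<^sup>2) \<longlonglongrightarrow> (LINT x|M. 0)"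
  proof (rule integral_dominated_convergence)
    show "integrable M (\<lambda>x. (2 * B)\<^sup>2)" by simp
    show "(\<lambda>x. (norm (clamp_ball B (f x) - clamp_ball B (g n x)))\<^sup>2) \<in> borel_measurable M" for n
      using clM[OF B fm] clM[OF B contM[OF g]] by measurable
    show "AE x in M. (\<lambda>n. (norm (clamp_ball B (f x) - clamp_ball B (g n x)))\<^sup>2) \<longlonglongrightarrow> 0"
      using lim'
    proof eventually_elim
      case (elim x)
      have "(\<lambda>n. clamp_ball B (g n x)) \<longlonglongrightarrow> clamp_ball B (f x)"
        by (rule continuous_on_tendsto_compose[OF clamp_ball(4)[OF B] elim]) auto
      then have "(\<lambda>n. (norm (clamp_ball B (f x) - clamp_ball B (g n x)))\<^sup>2) \<longlonglongrightarrow> (norm (clamp_ball B (f x) - clamp_ball B (f x)))\<^sup>2"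
        by (intro tendsto_intros)
      then show ?case by simp
    qed
    have "norm (clamp_ball B z - clamp_ball B z') \<le> 2 * B" for z z'
      using norm_triangle_ineq4[of "clamp_ball B z" "clamp_ball B z'"] clamp_ball(1)[OF B, of z] clamp_ball(1)[OF B, of z'] by simp
    from power_mono[OF this norm_ge_zero, of _ _ 2]
    show "AE x in M. norm ((norm (clamp_ball B (f x) - clamp_ball B (g n x)))\<^sup>2) \<le> (2 * B)\<^sup>2" for n
      by (intro AE_I2) simp
  qed simp
  then have "\<forall>\<^sub>F n in sequentially. (LINT x|M. (norm (clamp_ball B (f x) - clamp_ball B (g n x)))\<^sup>2) < \<epsilon> / 16"
    using eps by (intro order_tendstoD(2)) auto
  then obtain n2 where n2: "(LINT x|M. (norm (clamp_ball B (f x) - clamp_ball B (g n2 x)))\<^sup>2) < \<epsilon> / 16"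
    by (meson eventually_happens sequentially_bot)
  define h where "h x = clamp_ball B (g n2 x)" for x
  have hc: "continuous_on UNIV h"
    unfolding h_def by (rule continuous_on_compose2[OF clamp_ball(4)[OF B] g]) simp

  define \<delta> where "\<delta> = sqrt (\<epsilon> / (32 * (measure M (space M) + 1)))"
  have mpos: "measure M (space M) + 1 > 0" by (simp add: add_nonneg_pos)
  have \<delta>: "\<delta> > 0" using eps mpos by (simp add: \<delta>_def)
  \<comment> \<open>As \<open>c\<close> is injective on a compact interval, \<open>h\<close> factors through \<open>c\<close> continuously.\<close>
  define ci where "ci = the_inv_into {a..b} c"
  have cic: "continuous_on (c ` {a..b}) ci"
    unfolding ci_def by (rule continuous_on_inv_into[OF c(1) _ c(2)]) simp
  have cok: "compact (c ` {a..b})" by (rule compact_continuous_image[OF c(1)]) simp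
  have "continuous_on (c ` {a..b}) (\<lambda>y. Re (h (ci y)))" "continuous_on (c ` {a..b}) (\<lambda>y. Im (h (ci y)))"
    by (intro continuous_intros continuous_on_compose2[OF hc cic] subset_UNIV)+
  then obtain q1 q2 where q: "real_polynomial_function q1" "\<And>y. y \<in> c ` {a..b} \<Longrightarrow> \<bar>Re (h (ci y)) - q1 y\<bar> < \<delta>"
     "real_polynomial_function q2" "\<And>y. y \<in> c ` {a..b} \<Longrightarrow> \<bar>Im (h (ci y)) - q2 y\<bar> < \<delta>"
    using Stone_Weierstrass_real_polynomial_function[OF cok _ \<delta>] by metis
  define p where "p x = of_real (q1 (c x)) + \<i> * of_real (q2 (c x))" for x
  have "p \<in> fspan {a<..<b} e"
    unfolding p_def[abs_def] by (intro fspan_add fspan_cmult fspan_polynomial[OF one rec] q)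
  then obtain m d where md: "\<forall>x\<in>{a<..<b}. p x = (\<Sum>n<m. d n * e n x)" unfolding fspan_def by blast
  have hp: "(norm (h x - p x))\<^sup>2 \<le> 2 * \<delta>\<^sup>2" if x: "x \<in> {a<..<b}" for x
  proof -
    have "ci (c x) = x" using x the_inv_into_f_f[OF c(2), of x] by (simp add: ci_def)
    then have "\<bar>Re (h x) - q1 (c x)\<bar> \<le> \<delta>" "\<bar>Im (h x) - q2 (c x)\<bar> \<le> \<delta>"
      using q(2)[of "c x"] q(4)[of "c x"] x by auto
    then have "(Re (h x) - q1 (c x))\<^sup>2 \<le> \<delta>\<^sup>2" "(Im (h x) - q2 (c x))\<^sup>2 \<le> \<delta>\<^sup>2"
      using \<delta> by (auto simp: abs_le_square_iff[symmetric])
    then show ?thesis by (simp add: cmod_power2 p_def)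
  qed
  let ?s = "\<lambda>x. \<Sum>n<m. d n * e n x"
  have ssq: "sq_int M ?s" by (intro sq_int_sum sq_int_cmult e) simp
  have bnd: "(norm (f x - ?s x))\<^sup>2 \<le> 4 * (norm (f x - clamp_ball B (f x)))\<^sup>2 + 4 * (norm (clamp_ball B (f x) - h x))\<^sup>2 + 4 * \<delta>\<^sup>2"
    if "x \<in> space M" for x
  proof -
    have eq: "f x - ?s x = ((f x - clamp_ball B (f x)) + (clamp_ball B (f x) - h x)) + (h x - p x)"
      using md that sp by auto
    have "(norm (f x - ?s x))\<^sup>2 \<le> 2 * (norm ((f x - clamp_ball B (f x)) + (clamp_ball B (f x) - h x)))\<^sup>2 + 2 * (norm (h x - p x))\<^sup>2"
      unfolding eq by (rule norm_add_sq_le)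
    then show ?thesis
      using norm_add_sq_le[of "f x - clamp_ball B (f x)" "clamp_ball B (f x) - h x"] hp[of x] that sp by simp
  qed
  have i1: "integrable M (\<lambda>x. (norm (f x - clamp_ball B (f x)))\<^sup>2)"
  proof (rule Bochner_Integration.integrable_bound)
    show "integrable M (\<lambda>x. (norm (f x))\<^sup>2)" using f by (simp add: sq_int_def)
    show "(\<lambda>x. (norm (f x - clamp_ball B (f x)))\<^sup>2) \<in> borel_measurable M" using clM[OF B fm] by measurable
  qed (use clamp_ball(3)[OF B] in \<open>auto intro!: AE_I2 power_mono\<close>)
  have i2: "integrable M (\<lambda>x. (norm (clamp_ball B (f x) - h x))\<^sup>2)"
  proof (rule Bochner_Integration.integrable_bound)
    show "integrable M (\<lambda>x. (2 * B)\<^sup>2)" by simp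
    show "(\<lambda>x. (norm (clamp_ball B (f x) - h x))\<^sup>2) \<in> borel_measurable M" using clM[OF B fm] contM[OF hc] by measurable
    have "norm (clamp_ball B z - clamp_ball B z') \<le> 2 * B" for z z'
      using norm_triangle_ineq4[of "clamp_ball B z" "clamp_ball B z'"] clamp_ball(1)[OF B, of z] clamp_ball(1)[OF B, of z'] by simp
    from power_mono[OF this norm_ge_zero, of _ _ 2]
    show "AE x in M. norm ((norm (clamp_ball B (f x) - h x))\<^sup>2) \<le> norm ((2 * B)\<^sup>2)"
      by (intro AE_I2) (simp add: h_def)
  qed
  have "nsq M (\<lambda>x. f x - ?s x) \<le> (LINT x|M. 4 * (norm (f x - clamp_ball B (f x)))\<^sup>2 + 4 * (norm (clamp_ball B (f x) - h x))\<^sup>2 + 4 * \<delta>\<^sup>2)"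
    unfolding nsq_def
  proof (rule integral_mono)
    show "integrable M (\<lambda>x. (norm (f x - ?s x))\<^sup>2)" using sq_int_diff[OF f ssq] by (simp add: sq_int_def)
  qed (use i1 i2 bnd in auto)
  also have "\<dots> = 4 * (LINT x|M. (norm (f x - clamp_ball B (f x)))\<^sup>2) + 4 * (LINT x|M. (norm (clamp_ball B (f x) - h x))\<^sup>2) + 4 * \<delta>\<^sup>2 * measure M (space M)"
    using i1 i2 by simp
  also have "\<dots> < 4 * (\<epsilon> / 16) + 4 * (\<epsilon> / 16) + \<epsilon> / 8"
  proof -
    have "4 * \<delta>\<^sup>2 * measure M (space M) \<le> 4 * \<delta>\<^sup>2 * (measure M (space M) + 1)" by (intro mult_left_mono) auto
    also have "\<dots> = \<epsilon> / 8"
    proof -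
      have "4 * (sqrt (\<epsilon> / (32 * E_flux)))\<^sup>2 * E_flux = \<epsilon> / 8" if "E_flux > 0" for E_flux using that eps by simp
      then show ?thesis unfolding \<delta>_def using mpos by blast
    qed
    finally show ?thesis using n1 n2 by (simp add: B_def h_def)
  qed
  also have "\<dots> < \<epsilon>" using eps by simp
  finally show "\<exists>m d. nsq M (\<lambda>x. f x - (\<Sum>n<m. d n * e n x)) < \<epsilon>" by blast
qed

section \<open>Fourier coefficients on an interval\<close>

lemma ftc_integral:
  fixes F f :: "real \<Rightarrow> real"
  assumes "a \<le> b" "\<And>x. (F has_real_derivative f x) (at x)" "continuous_on {a..b} f"
  shows "integrable (lebesgue_on {a<..<b}) f" "(LINT x|lebesgue_on {a<..<b}. f x) = F b - F a"
proof -
  have "f absolutely_integrable_on {a..b}"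
    using absolutely_integrable_continuous_real[OF assms(3)] .
  then have *: "f absolutely_integrable_on {a<..<b}"
    by (rule set_integrable_subset) auto
  then show i: "integrable (lebesgue_on {a<..<b}) f"
    by (simp add: integrable_restrict_space set_integrable_def)
  have "(f has_integral (F b - F a)) {a..b}"
    by (rule fundamental_theorem_of_calculus[OF assms(1)])
       (use assms(2) in \<open>auto simp: has_real_derivative_iff_has_vector_derivative[symmetric] intro: has_field_derivative_at_within\<close>)
  then have "(f has_integral (F b - F a)) {a<..<b}"
    by (simp add: has_integral_Icc_iff_Ioo)
  then show "(LINT x|lebesgue_on {a<..<b}. f x) = F b - F a"
    using lebesgue_integral_eq_integral[OF i] by (simp add: integral_unique)
qed

lemma finite_measure_interval: "finite_measure (lebesgue_on {a<..<b::real})"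
  by (rule finite_measure_lebesgue_on) simp

lemma measurable_interval_continuous:
  fixes g :: "real \<Rightarrow> 'b::topological_space"
  assumes "continuous_on UNIV g"
  shows "g \<in> borel_measurable (lebesgue_on {a<..<b})"
  by (rule continuous_imp_measurable_on_sets_lebesgue) (use assms in \<open>auto intro: continuous_on_subset\<close>)

lemma AE_not_in_null_lebesgue_on:
  assumes "N \<in> null_sets lebesgue" "S \<in> sets lebesgue"
  shows "AE x in lebesgue_on S. x \<notin> N"
  using AE_not_in[OF assms(1)] assms(2) by (subst AE_restrict_space_iff) auto

definition cosb :: "real \<Rightarrow> real \<Rightarrow> nat \<Rightarrow> real \<Rightarrow> real" where
  "cosb a L k t = cos (real k * (pi * (t - a) / L))"

text \<open>
  The squared norm of the \<open>k\<close>-th cosine on an interval of length \<open>L\<close>.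
\<close>

definition cosn :: "real \<Rightarrow> nat \<Rightarrow> real" where
  "cosn L k = (if k = 0 then L else L / 2)"

lemma continuous_cosb: "continuous_on S (cosb a L k)"
  unfolding cosb_def[abs_def] divide_inverse by (intro continuous_intros)

lemma integral_frequency_double:
  fixes j :: int and a L :: real
  assumes L: "L > 0" and j: "j \<noteq> 0"
  defines "\<theta> \<equiv> \<lambda>t. of_int j * (pi * (t - a) / L)"
  shows "integrable (lebesgue_on {a<..<a+2*L}) (\<lambda>t. cos (\<theta> t))"
    "(LINT t|lebesgue_on {a<..<a+2*L}. cos (\<theta> t)) = 0"
    "integrable (lebesgue_on {a<..<a+2*L}) (\<lambda>t. sin (\<theta> t))"
    "(LINT t|lebesgue_on {a<..<a+2*L}. sin (\<theta> t)) = 0"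
proof -
  let ?q = "L / (of_int j * pi)"
  have d: "((\<lambda>t. ?q * sin (\<theta> t)) has_real_derivative cos (\<theta> t)) (at t)"
    "((\<lambda>t. - (?q * cos (\<theta> t))) has_real_derivative sin (\<theta> t)) (at t)" for t
    using L j unfolding \<theta>_def by (auto intro!: derivative_eq_intros simp: field_simps)
  have c: "continuous_on S (\<lambda>t. cos (\<theta> t))" "continuous_on S (\<lambda>t. sin (\<theta> t))" for S
    unfolding \<theta>_def divide_inverse by (intro continuous_intros)+
  have e: "\<theta> a = 0" "\<theta> (a + 2 * L) = of_int j * (2 * pi)" using L by (simp_all add: \<theta>_def)
  have e2: "sin (of_int j * (2 * pi)) = 0" "cos (of_int j * (2 * pi)) = 1"
    using sin_int_2pin[of j] cos_int_2pin[of j] by (simp_all add: mult_ac)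
  have ab: "a \<le> a + 2 * L" using L by simp
  show "integrable (lebesgue_on {a<..<a+2*L}) (\<lambda>t. cos (\<theta> t))" by (rule ftc_integral(1)[OF ab d(1) c(1)])
  show "integrable (lebesgue_on {a<..<a+2*L}) (\<lambda>t. sin (\<theta> t))" by (rule ftc_integral(1)[OF ab d(2) c(2)])
  show "(LINT t|lebesgue_on {a<..<a+2*L}. cos (\<theta> t)) = 0"
    unfolding ftc_integral(2)[OF ab d(1) c(1)] e e2 by simp
  show "(LINT t|lebesgue_on {a<..<a+2*L}. sin (\<theta> t)) = 0"
    unfolding ftc_integral(2)[OF ab d(2) c(2)] e e2 by simp
qed

lemma integral_cos_frequency:
  fixes j :: int
  assumes L: "L > 0" and j: "j \<noteq> 0"
  shows "integrable (lebesgue_on {a<..<a+L}) (\<lambda>t. cos (of_int j * (pi * (t - a) / L)))"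
    "(LINT t|lebesgue_on {a<..<a+L}. cos (of_int j * (pi * (t - a) / L))) = 0"
proof -
  let ?F = "\<lambda>t. L / (of_int j * pi) * sin (of_int j * (pi * (t - a) / L))"
  have d: "(?F has_real_derivative cos (of_int j * (pi * (t - a) / L))) (at t)" for t
    using L j by (auto intro!: derivative_eq_intros simp: field_simps)
  have c: "continuous_on {a..a+L} (\<lambda>t. cos (of_int j * (pi * (t - a) / L)))"
    unfolding divide_inverse by (intro continuous_intros)
  show "integrable (lebesgue_on {a<..<a+L}) (\<lambda>t. cos (of_int j * (pi * (t - a) / L)))"
    by (rule ftc_integral(1)[OF _ d c]) (use L in simp)
  have "sin (of_int j * pi) = 0" by (simp add: sin_zero_iff_int2)
  then show "(LINT t|lebesgue_on {a<..<a+L}. cos (of_int j * (pi * (t - a) / L))) = 0"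
    using ftc_integral(2)[OF _ d c] L by (simp add: field_simps)
qed

lemma integral_one_interval: "a \<le> b \<Longrightarrow> (LINT t|lebesgue_on {a<..<b}. c::real) = c * (b - a)"
  by (simp add: measure_restrict_space)

lemma cosb_orthogonal:
  assumes L: "L > 0"
  shows "(LINT t|lebesgue_on {a<..<a+L}. cosb a L j t * cosb a L k t) = (if j = k then cosn L j else 0)"
proof -
  let ?M = "lebesgue_on {a<..<a+L}"
  let ?c = "\<lambda>i t. cos (of_int i * (pi * (t - a) / L))"
  interpret finite_measure ?M by (rule finite_measure_interval)
  have int: "integrable ?M (?c i)" for i
  proof (cases "i = 0")
    case True then show ?thesis by simp
  qed (rule integral_cos_frequency[OF L])
  have val: "integral\<^sup>L ?M (?c i) = (if i = 0 then L else 0)" for i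
    using integral_cos_frequency(2)[OF L, of i a] integral_one_interval[of a "a + L" 1] L by simp
  have "cos (real j * \<theta>) * cos (real k * \<theta>) = 1 / 2 * cos (of_int (int j - int k) * \<theta>) + 1 / 2 * cos (of_int (int j + int k) * \<theta>)" for \<theta>
    by (simp add: cos_times_cos left_diff_distrib distrib_right add_divide_distrib)
  then have "cosb a L j t * cosb a L k t = 1 / 2 * ?c (int j - int k) t + 1 / 2 * ?c (int j + int k) t" for t
    unfolding cosb_def .
  then have "(LINT t|?M. cosb a L j t * cosb a L k t) = 1 / 2 * integral\<^sup>L ?M (?c (int j - int k)) + 1 / 2 * integral\<^sup>L ?M (?c (int j + int k))"
    using int[of "int j - int k"] int[of "int j + int k"] by simp
  also have "\<dots> = (if j = k then cosn L j else 0)"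
    unfolding val by (auto simp: cosn_def)
  finally show ?thesis .
qed

definition cose :: "real \<Rightarrow> real \<Rightarrow> nat \<Rightarrow> real \<Rightarrow> complex" where
  "cose a L k t = of_real (cosb a L k t / sqrt (cosn L k))"

lemma cosn_pos: "L > 0 \<Longrightarrow> cosn L k > 0"
  by (simp add: cosn_def)

lemma sq_int_bounded_continuous:
  fixes g :: "real \<Rightarrow> complex"
  assumes "continuous_on UNIV g" "\<And>x. x \<in> {a<..<b} \<Longrightarrow> norm (g x) \<le> B"
  shows "sq_int (lebesgue_on {a<..<b}) g"
proof -
  interpret finite_measure "lebesgue_on {a<..<b}" by (rule finite_measure_interval)
  show ?thesis
    by (rule sq_int_bound[where g = "\<lambda>_. B\<^sup>2"])
       (use measurable_interval_continuous[OF assms(1)] assms(2) in \<open>auto intro!: power_mono\<close>)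
qed

lemma sq_int_cose: "sq_int (lebesgue_on {b<..<c}) (cose a L k)"
proof (rule sq_int_bounded_continuous[where B = "1 / \<bar>sqrt (cosn L k)\<bar>"])
  show "continuous_on UNIV (cose a L k)"
    unfolding cose_def[abs_def] divide_inverse by (intro continuous_intros continuous_cosb)
  show "norm (cose a L k x) \<le> 1 / \<bar>sqrt (cosn L k)\<bar>" for x
    unfolding cose_def norm_of_real abs_divide by (intro divide_right_mono) (auto simp: cosb_def)
qed

lemma cose_orthonormal:
  assumes L: "L > 0"
  shows "ip (lebesgue_on {a<..<a+L}) (cose a L j) (cose a L k) = (if j = k then 1 else 0)"
proof -
  have "ip (lebesgue_on {a<..<a+L}) (cose a L j) (cose a L k)
      = (LINT t|lebesgue_on {a<..<a+L}. complex_of_real (1 / (sqrt (cosn L j) * sqrt (cosn L k)) * (cosb a L j t * cosb a L k t)))"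
    by (simp add: ip_def cose_def)
  also have "\<dots> = of_real (1 / (sqrt (cosn L j) * sqrt (cosn L k)) * (LINT t|lebesgue_on {a<..<a+L}. cosb a L j t * cosb a L k t))"
    by (simp only: integral_complex_of_real integral_mult_right_zero)
  also have "1 / (sqrt (cosn L j) * sqrt (cosn L k)) * (LINT t|lebesgue_on {a<..<a+L}. cosb a L j t * cosb a L k t) = (if j = k then 1 else 0)"
    using cosn_pos[OF L, of j] cosn_pos[OF L, of k] by (simp add: cosb_orthogonal[OF L])
  finally show ?thesis by simp
qed

lemma cos_parseval:
  assumes L: "L > 0" and f: "sq_int (lebesgue_on {a<..<a+L}) f"
  shows "(\<lambda>k. (norm (ip (lebesgue_on {a<..<a+L}) f (cose a L k)))\<^sup>2) sums nsq (lebesgue_on {a<..<a+L}) f"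
proof (rule parseval_of_recurrence[where c = "cosb a L 1"])
  show "inj_on (cosb a L 1) {a..a+L}"
  proof (rule inj_onI)
    fix x y assume xy: "x \<in> {a..a+L}" "y \<in> {a..a+L}" "cosb a L 1 x = cosb a L 1 y"
    have r: "0 \<le> pi * (z - a) / L" "pi * (z - a) / L \<le> pi" if "z \<in> {a..a+L}" for z
    proof -
      have "0 \<le> (z - a) / L" "(z - a) / L \<le> 1" using that L by (auto simp: divide_le_eq)
      then have "0 \<le> pi * ((z - a) / L)" "pi * ((z - a) / L) \<le> pi * 1"
        by (auto intro!: mult_left_mono mult_nonneg_nonneg simp del: times_divide_eq_right)
      then show "0 \<le> pi * (z - a) / L" "pi * (z - a) / L \<le> pi" by simp_all
    qed
    have "pi * (x - a) / L = pi * (y - a) / L"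
      using cos_inj_pi[OF r[OF xy(1)] r[OF xy(2)]] xy(3) by (simp add: cosb_def)
    then show "x = y" using L by simp
  qed
  let ?S = "{a<..<a+L}"
  have cn: "(\<lambda>t. of_real (cosb a L k t)) \<in> fspan ?S (cose a L)" for k
    by (rule fspan_cong[OF fspan_cmult[OF fspan_basis[of "cose a L" k], of "of_real (sqrt (cosn L k))"]])
       (use cosn_pos[OF L, of k] in \<open>simp add: cose_def\<close>)
  show "(\<lambda>x. 1) \<in> fspan ?S (cose a L)"
    using cn[of 0] by (simp add: cosb_def)
  show "(\<lambda>x. of_real (cosb a L 1 x) * cose a L n x) \<in> fspan ?S (cose a L)" for n
  proof (cases n)
    case 0
    show ?thesis
      by (rule fspan_cong[OF fspan_cmult[OF cn[of 1], of "of_real (1 / sqrt (cosn L 0))"]])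
         (simp add: 0 cose_def cosb_def)
  next
    case (Suc m)
    have "cos (real 1 * \<theta>) * cos (real n * \<theta>) = 1 / 2 * cos (real m * \<theta>) + 1 / 2 * cos (real (Suc n) * \<theta>)" for \<theta>
    proof -
      have "real 1 * \<theta> - real n * \<theta> = - (real m * \<theta>)" "real 1 * \<theta> + real n * \<theta> = real (Suc n) * \<theta>"
        by (simp_all add: Suc algebra_simps)
      then show ?thesis unfolding cos_times_cos by (simp only: cos_minus add_divide_distrib)
    qed
    then have "cosb a L 1 x * cosb a L n x = 1 / 2 * cosb a L m x + 1 / 2 * cosb a L (Suc n) x" for x
      unfolding cosb_def .
    then have "cosb a L 1 x * (cosb a L n x / sqrt (cosn L n)) = 1 / (2 * sqrt (cosn L n)) * (cosb a L m x + cosb a L (Suc n) x)" for x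
      by (simp add: add_divide_distrib)
    then have *: "of_real (cosb a L 1 x) * cose a L n x
       = of_real (1 / (2 * sqrt (cosn L n))) * (of_real (cosb a L m x) + of_real (cosb a L (Suc n) x))" for x
      unfolding cose_def of_real_mult[symmetric] of_real_add[symmetric] by (simp only:)
    show ?thesis unfolding * by (intro fspan_cmult fspan_add cn)
  qed
qed (use f in \<open>auto intro: finite_measure_interval AE_not_in_null_lebesgue_on continuous_cosb sq_int_cose simp: cose_orthonormal[OF L]\<close>)

text \<open>
  Fourier coefficients on an interval of length \<open>L\<close>, with respect to the exponentials of period
  \<open>2 L\<close>. They are redundant by a factor two. Both the even and the odd half are complete on the
  interval, so an upper and a lower Parseval inequality hold without any condition at the endpoints.
\<close>

definition fourier :: "real \<Rightarrow> real \<Rightarrow> (real \<Rightarrow> complex) \<Rightarrow> int \<Rightarrow> complex" where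
  "fourier a L f k = (LINT t|lebesgue_on {a<..<a+L}. f t * exp (- \<i> * of_real (of_int k * (pi * (t - a) / L))))"

lemma sq_int_exp: "sq_int (lebesgue_on {b<..<c}) (\<lambda>t. exp (\<i> * of_real (of_int k * (pi * (t - a) / L))))"
  by (rule sq_int_bounded_continuous[where B = 1]) (auto intro!: continuous_intros simp: divide_inverse)

lemma cnj_exp_phase: "cnj (exp (\<i> * of_real x)) = exp (- \<i> * of_real x)"
  by (simp add: exp_cnj)

text \<open>
  The exponentials are orthogonal on the doubled interval, to which \<open>f\<close> is extended by zero.
\<close>

lemma fourier_bessel:
  assumes L: "L > 0" and f: "sq_int (lebesgue_on {a<..<a+L}) f" and K: "finite K"
  shows "(\<Sum>k\<in>K. (norm (fourier a L f k))\<^sup>2) \<le> 2 * L * nsq (lebesgue_on {a<..<a+L}) f"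
proof -
  let ?M = "lebesgue_on {a<..<a+2*L}"
  define w where "w k t = exp (\<i> * of_real (of_int k * (pi * (t - a) / L)))" for k :: int and t :: real
  define c where "c = 1 / sqrt (2 * L)"
  define e where "e k t = of_real c * w k t" for k t
  define f2 where "f2 t = (if t \<in> {a<..<a+L} then f t else 0)" for t
  have we: "sq_int ?M (w k)" for k unfolding w_def by (rule sq_int_exp)
  have e: "sq_int ?M (e k)" for k unfolding e_def[abs_def] by (rule sq_int_cmult[OF we])
  have sub: "{a<..<a+L} \<subseteq> {a<..<a+2*L}" using L by auto
  have ext: "integral\<^sup>L ?M (\<lambda>t. if t \<in> {a<..<a+L} then g t else 0) = integral\<^sup>L (lebesgue_on {a<..<a+L}) g"
    for g :: "real \<Rightarrow> 'b::euclidean_space"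
    by (rule integral_restrict[OF sub]) auto
  have f2: "sq_int ?M f2"
    unfolding sq_int_def
  proof
    show "f2 \<in> borel_measurable ?M"
      unfolding f2_def
      using f sub by (subst borel_measurable_if_lebesgue_on) (auto simp: sq_int_def)
    have "integrable lebesgue (\<lambda>t. if t \<in> {a<..<a+L} then (norm (f t))\<^sup>2 else 0)"
      using f by (subst Lebesgue_Measure.integrable_restrict_UNIV) (auto simp: sq_int_def)
    also have "(\<lambda>t. if t \<in> {a<..<a+L} then (norm (f t))\<^sup>2 else 0) = (\<lambda>t. if t \<in> {a<..<a+2*L} then (norm (f2 t))\<^sup>2 else 0)"
      using sub by (auto simp: f2_def fun_eq_iff)
    finally show "integrable ?M (\<lambda>t. (norm (f2 t))\<^sup>2)"
      by (subst (asm) Lebesgue_Measure.integrable_restrict_UNIV) auto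
  qed
  have n2: "nsq ?M f2 = nsq (lebesgue_on {a<..<a+L}) f"
    unfolding nsq_def ext[symmetric] by (intro Bochner_Integration.integral_cong) (auto simp: f2_def)
  have ww: "ip ?M (w j) (w k) = (if j = k then of_real (2 * L) else 0)" for j k
  proof -
    let ?\<theta> = "\<lambda>t. of_int (j - k) * (pi * (t - a) / L)"
    have "w j t * cnj (w k t) = of_real (cos (?\<theta> t)) + \<i> * of_real (sin (?\<theta> t))" for t
    proof -
      have "w j t * cnj (w k t) = exp (\<i> * of_real (?\<theta> t))"
        unfolding w_def cnj_exp_phase mult_exp_exp by (simp add: algebra_simps diff_divide_distrib)
      then show ?thesis by (simp only: exp_Euler cos_of_real sin_of_real)
    qed
    then have *: "ip ?M (w j) (w k) = (LINT t|?M. of_real (cos (?\<theta> t)) + \<i> * of_real (sin (?\<theta> t)))"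
      unfolding ip_def by simp
    show ?thesis
    proof (cases "j = k")
      case True
      then show ?thesis unfolding * using L by (simp add: measure_restrict_space scaleR_conv_of_real)
    next
      case False
      then have jk: "j - k \<noteq> 0" by simp
      note q = integral_frequency_double[OF L jk, of a]
      have "(LINT t|?M. complex_of_real (cos (?\<theta> t)) + \<i> * complex_of_real (sin (?\<theta> t)))
        = complex_of_real (LINT t|?M. cos (?\<theta> t)) + \<i> * complex_of_real (LINT t|?M. sin (?\<theta> t))"
        by (subst Bochner_Integration.integral_add)
           (use q in \<open>auto intro!: integrable_mult_right simp del: of_int_diff simp: integral_complex_of_real\<close>)
      then show ?thesis using False unfolding * q(2) q(4) by simp
    qed
  qed
  have on: "ip ?M (e j) (e k) = (if j = k then 1 else 0)" for j k
  proof -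
    have "e j t * cnj (e k t) = of_real (c * c) * (w j t * cnj (w k t))" for t by (simp add: e_def)
    then have "ip ?M (e j) (e k) = of_real (c * c) * ip ?M (w j) (w k)"
      unfolding ip_def by (simp only: integral_mult_right_zero)
    moreover have "c * c = 1 / (2 * L)" using L by (simp add: c_def)
    ultimately show ?thesis using L by (simp add: ww)
  qed
  have fourier: "fourier a L f k = of_real (sqrt (2 * L)) * ip ?M f2 (e k)" for k
  proof -
    have "f2 t * cnj (e k t) = of_real c * (f2 t * cnj (w k t))" for t by (simp add: e_def)
    then have "ip ?M f2 (e k) = of_real c * (LINT t|?M. f2 t * cnj (w k t))"
      unfolding ip_def by (simp only: integral_mult_right_zero)
    also have "(LINT t|?M. f2 t * cnj (w k t)) = (LINT t|?M. (if t \<in> {a<..<a+L} then f t * cnj (w k t) else 0))"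
      by (intro Bochner_Integration.integral_cong) (auto simp: f2_def)
    also have "\<dots> = fourier a L f k"
      unfolding ext fourier_def w_def cnj_exp_phase ..
    finally show ?thesis using L by (simp add: c_def)
  qed
  have "(\<Sum>k\<in>K. (norm (fourier a L f k))\<^sup>2) = 2 * L * (\<Sum>k\<in>K. (norm (ip ?M f2 (e k)))\<^sup>2)"
    unfolding fourier norm_mult power_mult_distrib sum_distrib_left using L by simp
  also have "\<dots> \<le> 2 * L * nsq ?M f2"
    using L by (intro mult_left_mono bessel_inequality K f2 e on) auto
  finally show ?thesis by (simp add: n2)
qed

text \<open>
  The cosine coefficients are averages of the coefficients with indices \<open>k\<close> and \<open>- k\<close>, and the
  cosines are complete on the interval. Finite index sets throughout avoid infinite double sums.
\<close>

lemma fourier_lower_bound: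
  assumes L: "L > 0" and I: "finite I" and f: "\<And>n. n \<in> I \<Longrightarrow> sq_int (lebesgue_on {a<..<a+L}) (f n)"
    and X: "\<And>K. finite K \<Longrightarrow> (\<Sum>k\<in>K. \<Sum>n\<in>I. (norm (fourier a L (f n) k))\<^sup>2) \<le> X"
  shows "(\<Sum>n\<in>I. nsq (lebesgue_on {a<..<a+L}) (f n)) \<le> 2 / L * X"
proof -
  let ?M = "lebesgue_on {a<..<a+L}"
  have c: "(norm (ip ?M g (cose a L k)))\<^sup>2 \<le> 1 / L * ((norm (fourier a L g (int k)))\<^sup>2 + (norm (fourier a L g (- int k)))\<^sup>2)"
    if g: "sq_int ?M g" for g k
  proof -
    have i: "integrable ?M (\<lambda>t. g t * exp (- \<i> * of_real (of_int j * (pi * (t - a) / L))))" for j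
      using sq_int_integrable[OF g sq_int_exp[of a "a+L" j a L]] unfolding cnj_exp_phase .
    have tc: "of_real (cosb a L k t) = (exp (- \<i> * of_real (of_int (int k) * (pi * (t - a) / L))) + exp (- \<i> * of_real (of_int (- int k) * (pi * (t - a) / L)))) / 2" for t
      using cos_exp_eq[of "of_real (real k * (pi * (t - a) / L))"] unfolding cosb_def cos_of_real[symmetric]
      by (simp add: add.commute)
    have cz: "cnj (cose a L k t) = of_real (1 / (2 * sqrt (cosn L k))) * (exp (- \<i> * of_real (of_int (int k) * (pi * (t - a) / L))) + exp (- \<i> * of_real (of_int (- int k) * (pi * (t - a) / L))))" for t
    proof -
      have "cnj (cose a L k t) = of_real (1 / sqrt (cosn L k)) * of_real (cosb a L k t)" by (simp add: cose_def)
      then show ?thesis unfolding tc by simp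
    qed
    have "g t * (c * (x + y)) = c * (g t * x + g t * y)" for t and c x y :: complex by (simp add: algebra_simps)
    then have "ip ?M g (cose a L k) = of_real (1 / (2 * sqrt (cosn L k))) * (LINT t|?M. g t * exp (- \<i> * of_real (of_int (int k) * (pi * (t - a) / L))) + g t * exp (- \<i> * of_real (of_int (- int k) * (pi * (t - a) / L))))"
      unfolding ip_def cz by (simp only: integral_mult_right_zero)
    also have "\<dots> = of_real (1 / (2 * sqrt (cosn L k))) * (fourier a L g (int k) + fourier a L g (- int k))"
      unfolding fourier_def by (subst Bochner_Integration.integral_add[OF i i]) (rule refl)
    finally have e: "ip ?M g (cose a L k) = of_real (1 / (2 * sqrt (cosn L k))) * (fourier a L g (int k) + fourier a L g (- int k))" .
    have "(norm (ip ?M g (cose a L k)))\<^sup>2 = 1 / (4 * cosn L k) * (norm (fourier a L g (int k) + fourier a L g (- int k)))\<^sup>2"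
      unfolding e norm_mult norm_of_real power_mult_distrib using cosn_pos[OF L, of k]
      by (simp add: power_divide power_mult_distrib)
    also have "\<dots> \<le> 1 / (4 * (L / 2)) * (2 * (norm (fourier a L g (int k)))\<^sup>2 + 2 * (norm (fourier a L g (- int k)))\<^sup>2)"
      using L by (intro mult_mono norm_add_sq_le frac_le) (auto simp: cosn_def)
    finally show ?thesis using L by (simp add: field_simps)
  qed
  let ?P = "\<lambda>m. \<Sum>n\<in>I. \<Sum>k<m. (norm (ip ?M (f n) (cose a L k)))\<^sup>2"
  have "?P \<longlonglongrightarrow> (\<Sum>n\<in>I. nsq ?M (f n))"
    using cos_parseval[OF L f] by (intro tendsto_sum) (simp add: sums_def)
  moreover have "?P m \<le> 2 / L * X" for m
  proof -
    let ?T = "\<lambda>k. \<Sum>n\<in>I. (norm (fourier a L (f n) k))\<^sup>2"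
    have "?P m \<le> (\<Sum>n\<in>I. \<Sum>k<m. 1 / L * ((norm (fourier a L (f n) (int k)))\<^sup>2 + (norm (fourier a L (f n) (- int k)))\<^sup>2))"
      by (intro sum_mono c f) auto
    also have "\<dots> = (\<Sum>k<m. \<Sum>n\<in>I. 1 / L * ((norm (fourier a L (f n) (int k)))\<^sup>2 + (norm (fourier a L (f n) (- int k)))\<^sup>2))"
      by (rule sum.swap)
    also have "\<dots> = 1 / L * ((\<Sum>k<m. ?T (int k)) + (\<Sum>k<m. ?T (- int k)))"
      by (simp only: sum_distrib_left sum.distrib distrib_left)
    also have "(\<Sum>k<m. ?T (int k)) = (\<Sum>k\<in>int ` {..<m}. ?T k)"
      by (subst sum.reindex) (auto simp: inj_on_def)
    also have "(\<Sum>k<m. ?T (- int k)) = (\<Sum>k\<in>(\<lambda>k. - int k) ` {..<m}. ?T k)"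
      by (subst sum.reindex) (auto simp: inj_on_def)
    also have "1 / L * ((\<Sum>k\<in>int ` {..<m}. ?T k) + (\<Sum>k\<in>(\<lambda>k. - int k) ` {..<m}. ?T k)) \<le> 1 / L * (X + X)"
      using L by (intro mult_left_mono add_mono X) auto
    finally show ?thesis by simp
  qed
  ultimately show ?thesis
    by (intro LIMSEQ_le_const2) auto
qed

section \<open>The weighted space and weak derivatives\<close>

lemma sq_int_subset:
  assumes "sq_int (lebesgue_on T) f" "S \<subseteq> T" "S \<in> sets lebesgue" "T \<in> sets lebesgue"
  shows "sq_int (lebesgue_on S) f"
proof -
  have "set_integrable lebesgue T (\<lambda>x. (norm (f x))\<^sup>2)"
    using assms by (simp add: sq_int_def integrable_restrict_space set_integrable_def)
  then have "set_integrable lebesgue S (\<lambda>x. (norm (f x))\<^sup>2)"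
    by (rule set_integrable_subset) (use assms in auto)
  then have "integrable (lebesgue_on S) (\<lambda>x. (norm (f x))\<^sup>2)"
    using assms(3) by (simp add: integrable_restrict_space set_integrable_def)
  moreover have "f \<in> borel_measurable (lebesgue_on S)"
    using assms(1) measurable_restrict_mono[OF _ assms(2)] unfolding sq_int_def by blast
  ultimately show ?thesis by (simp add: sq_int_def)
qed

lemma sq_int_imp_integrable:
  assumes "finite_measure M" "sq_int M f"
  shows "integrable M f"
proof -
  interpret finite_measure M by fact
  have "sq_int M (\<lambda>_. 1)" by (simp add: sq_int_def)
  from sq_int_integrable[OF assms(2) this] show ?thesis by simp
qed

lemma nsq_eq_0_imp_AE:
  assumes "sq_int M f" "nsq M f = 0"
  shows "AE x in M. f x = 0"
proof -
  have "AE x in M. (norm (f x))\<^sup>2 = 0"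
    using assms integral_nonneg_eq_0_iff_AE[of M "\<lambda>x. (norm (f x))\<^sup>2"] by (simp add: nsq_def sq_int_def)
  then show ?thesis by eventually_elim simp
qed

lemma omega_pos: "x \<in> {0<..<pi} \<Longrightarrow> \<omega> x > 0"
  by (simp add: \<omega>_def sin_gt_zero)

lemma omega_le_1: "\<omega> x \<le> 1"
  unfolding \<omega>_def by (metis real_sqrt_le_1_iff sin_le_one)

lemma omega_sq: "x \<in> {0<..<pi} \<Longrightarrow> (\<omega> x)\<^sup>2 = sin x"
  using sin_gt_zero[of x] by (simp add: \<omega>_def)

lemma continuous_omega: "continuous_on S \<omega>"
  unfolding \<omega>_def[abs_def] by (intro continuous_intros)

lemma measurable_omega: "\<omega> \<in> borel_measurable (lebesgue_on {0<..<pi})"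
  by (rule measurable_interval_continuous[OF continuous_omega])

lemma space_wmeas: "space wmeas = {0<..<pi}"
  by (simp add: wmeas_def)

lemma sets_wmeas: "sets wmeas = sets (lebesgue_on {0<..<pi})"
  by (simp add: wmeas_def)

lemma measurable_wmeas: "borel_measurable wmeas = borel_measurable (lebesgue_on {0<..<pi})"
  by (rule measurable_cong_sets[OF sets_wmeas refl])

lemma AE_omega_nonneg: "AE x in lebesgue_on {0<..<pi}. 0 \<le> \<omega> x"
  by (rule AE_I2) (auto intro!: less_imp_le omega_pos)

lemma integral_wmeas:
  fixes f :: "real \<Rightarrow> 'b::{banach, second_countable_topology}"
  assumes "f \<in> borel_measurable (lebesgue_on {0<..<pi})"
  shows "integral\<^sup>L wmeas f = (LINT x|lebesgue_on {0<..<pi}. \<omega> x *\<^sub>R f x)"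
    "integrable wmeas f \<longleftrightarrow> integrable (lebesgue_on {0<..<pi}) (\<lambda>x. \<omega> x *\<^sub>R f x)"
  unfolding wmeas_def
  by (rule integral_density[OF assms measurable_omega AE_omega_nonneg],
      rule integrable_density[OF assms measurable_omega AE_omega_nonneg])

lemma AE_wmeas: "(AE x in wmeas. P x) \<longleftrightarrow> (AE x in lebesgue_on {0<..<pi}. P x)"
proof -
  have [measurable]: "\<omega> \<in> borel_measurable (lebesgue_on {0<..<pi})" by (rule measurable_omega)
  have "(AE x in wmeas. P x) \<longleftrightarrow> (AE x in lebesgue_on {0<..<pi}. 0 < ennreal (\<omega> x) \<longrightarrow> P x)"
    unfolding wmeas_def by (rule AE_density) measurable
  also have "\<dots> \<longleftrightarrow> (AE x in lebesgue_on {0<..<pi}. P x)"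
    by (rule AE_cong) (use omega_pos in auto)
  finally show ?thesis .
qed

lemma finite_measure_wmeas: "finite_measure wmeas"
proof
  have [measurable]: "\<omega> \<in> borel_measurable (lebesgue_on {0<..<pi})" by (rule measurable_omega)
  interpret finite_measure "lebesgue_on {0<..<pi}" by (rule finite_measure_interval)
  have "emeasure wmeas (space wmeas) = (\<integral>\<^sup>+x. ennreal (\<omega> x) * indicator (space (lebesgue_on {0<..<pi})) x \<partial>lebesgue_on {0<..<pi})"
    unfolding wmeas_def space_density by (rule emeasure_density) auto
  also have "\<dots> \<le> (\<integral>\<^sup>+x. 1 \<partial>lebesgue_on {0<..<pi})"
    by (intro nn_integral_mono) (auto simp: indicator_def omega_le_1 ennreal_le_1)
  also have "\<dots> < \<infinity>"
    using emeasure_finite[of "space (lebesgue_on {0<..<pi})"] by (simp add: less_top[symmetric])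
  finally show "emeasure wmeas (space wmeas) \<noteq> \<infinity>" by simp
qed

lemma H_iff: "f \<in> H \<longleftrightarrow> sq_int wmeas f"
  by (simp add: H_def sq_int_def)

lemma innerH_eq: "innerH f g = ip wmeas f g"
  by (simp add: innerH_def ip_def)

lemma normH_sq: "(normH f)\<^sup>2 = nsq wmeas f"
  by (simp add: normH_def nsq_def)

lemma sq_int_wmeas_bounded:
  fixes g :: "real \<Rightarrow> complex"
  assumes "continuous_on UNIV g" "\<And>x. x \<in> {0<..<pi} \<Longrightarrow> norm (g x) \<le> B"
  shows "sq_int wmeas g"
proof -
  interpret finite_measure wmeas by (rule finite_measure_wmeas)
  show ?thesis
    by (rule sq_int_bound[where g = "\<lambda>_. B\<^sup>2"])
       (use measurable_interval_continuous[OF assms(1)] assms(2) in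
         \<open>auto simp: measurable_wmeas space_wmeas intro!: power_mono\<close>)
qed

lemma L2_loc_iff: "f \<in> L2_loc \<longleftrightarrow> (\<forall>K. compact K \<and> K \<subseteq> {0<..<pi} \<longrightarrow> sq_int (lebesgue_on K) f)"
  by (simp add: L2_loc_def sq_int_def)

lemma L2_loc_diff: "f \<in> L2_loc \<Longrightarrow> g \<in> L2_loc \<Longrightarrow> (\<lambda>x. f x - g x) \<in> L2_loc"
  by (simp add: L2_loc_iff sq_int_diff)

lemma L2_loc_measurable:
  assumes "g \<in> L2_loc"
  shows "g \<in> borel_measurable (lebesgue_on {0<..<pi})"
proof -
  define K where "K i = {1 / real (i + 1)..pi - 1 / real (i + 1)}" for i
  have K: "compact (K i)" "K i \<subseteq> {0<..<pi}" for i
  proof -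
    have p: "1 / real (i + 1) > 0" by simp
    show "K i \<subseteq> {0<..<pi}"
    proof
      fix x assume "x \<in> K i"
      then have "1 / real (i + 1) \<le> x" "x \<le> pi - 1 / real (i + 1)" unfolding K_def by simp_all
      then have "0 < x" "x < pi" using p by linarith+
      then show "x \<in> {0<..<pi}" by simp
    qed
  qed (simp add: K_def)
  show ?thesis
  proof (rule borel_measurable_LIMSEQ_metric)
    show "(\<lambda>x. if x \<in> K i then g x else 0) \<in> borel_measurable (lebesgue_on {0<..<pi})" for i
      using assms K[of i] by (subst borel_measurable_if_lebesgue_on) (auto simp: L2_loc_def fmeasurableD[OF lmeasurable_compact])
    fix x assume "x \<in> space (lebesgue_on {0<..<pi})"
    then have x: "0 < x" "x < pi" by auto
    obtain i0 :: nat where i0: "1 / real (i0 + 1) < min x (pi - x)"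
      using reals_Archimedean[of "min x (pi - x)"] x by (auto simp: inverse_eq_divide)
    have "x \<in> K i" if "i \<ge> i0" for i
    proof -
      have "1 / real (i + 1) \<le> 1 / real (i0 + 1)" using that by (intro divide_left_mono) auto
      then show ?thesis using i0 by (auto simp: K_def)
    qed
    then show "(\<lambda>i. if x \<in> K i then g x else 0) \<longlonglongrightarrow> g x"
      by (intro tendsto_eventually eventually_sequentiallyI[of i0]) auto
  qed
qed

lemma test_functionD:
  assumes "\<eta> \<in> test_functions U"
  shows "(\<eta> has_real_derivative deriv \<eta> x) (at x)" "continuous_on S \<eta>" "continuous_on S (deriv \<eta>)"
proof -
  have d: "(deriv ^^ n) \<eta> differentiable (at x)" for n x using assms by (simp add: test_functions_def)
  show "(\<eta> has_real_derivative deriv \<eta> x) (at x)"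
    using d[of 0 x] by (simp add: DERIV_deriv_iff_real_differentiable)
  show "continuous_on S \<eta>"
    using d[of 0] by (auto intro!: continuous_at_imp_continuous_on differentiable_imp_continuous_within)
  show "continuous_on S (deriv \<eta>)"
    using d[of 1] by (auto intro!: continuous_at_imp_continuous_on differentiable_imp_continuous_within)
qed

lemma test_function_integrable:
  assumes \<eta>: "\<eta> \<in> test_functions {0<..<pi}" and g: "g \<in> L2_loc"
  shows "integrable (lebesgue_on {0<..<pi}) (\<lambda>x. \<eta> x *\<^sub>R g x)"
proof -
  obtain K where K: "compact K" "K \<subseteq> {0<..<pi}" "\<And>x. x \<notin> K \<Longrightarrow> \<eta> x = 0"
    using \<eta> by (auto simp: test_functions_def)
  have KS: "K \<in> sets lebesgue" using K(1) by (simp add: compact_imp_closed)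
  have "sq_int (lebesgue_on K) g" using g K by (simp add: L2_loc_iff)
  moreover have fin: "finite_measure (lebesgue_on K)"
    by (rule finite_measure_lebesgue_on) (rule lmeasurable_compact[OF K(1)])
  ultimately have gi: "integrable (lebesgue_on K) g" by (intro sq_int_imp_integrable)
  have "continuous_on K \<eta>" by (rule test_functionD(2)[OF \<eta>])
  then have "bounded (\<eta> ` K)" using K(1) by (intro compact_imp_bounded compact_continuous_image)
  then obtain B where B: "\<And>x. x \<in> K \<Longrightarrow> \<bar>\<eta> x\<bar> \<le> B" unfolding bounded_iff by auto
  have "integrable (lebesgue_on K) (\<lambda>x. \<eta> x *\<^sub>R g x)"
  proof (rule Bochner_Integration.integrable_bound)
    show "integrable (lebesgue_on K) (\<lambda>x. B * norm (g x))" using gi by auto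
    show "(\<lambda>x. \<eta> x *\<^sub>R g x) \<in> borel_measurable (lebesgue_on K)"
      using continuous_imp_measurable_on_sets_lebesgue[OF test_functionD(2)[OF \<eta>] KS] gi
      by (intro borel_measurable_scaleR) auto
    show "AE x in lebesgue_on K. norm (\<eta> x *\<^sub>R g x) \<le> norm (B * norm (g x))"
      using B by (auto intro!: AE_I2 mult_right_mono simp: abs_mult order_trans[OF B abs_ge_self])
  qed
  then have "integrable lebesgue (\<lambda>x. if x \<in> K then \<eta> x *\<^sub>R g x else 0)"
    by (subst Lebesgue_Measure.integrable_restrict_UNIV[OF KS])
  also have "(\<lambda>x. if x \<in> K then \<eta> x *\<^sub>R g x else 0) = (\<lambda>x. if x \<in> {0<..<pi} then \<eta> x *\<^sub>R g x else 0)"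
    using K by (auto simp: fun_eq_iff)
  finally show ?thesis by (subst (asm) Lebesgue_Measure.integrable_restrict_UNIV) auto
qed

lemma smooth_cosb: "smooth UNIV (cosb a L k)"
proof -
  have "smooth UNIV (\<lambda>t. cos ((real k * pi / L) * t + (- (real k * pi * a / L))))"
    by (rule smooth_compose[where f = cos and U = UNIV, OF smooth_sin_cos(2) smooth_affine]) simp
  then show ?thesis by (simp add: cosb_def[abs_def] algebra_simps diff_divide_distrib)
qed

definition window :: "real \<Rightarrow> real \<Rightarrow> nat \<Rightarrow> real \<Rightarrow> real" where
  "window a b j x = smooth_step (real j * (x - a)) * smooth_step (real j * (b - x))"

lemma smooth_window: "smooth UNIV (window a b j)"
proof -
  have "smooth UNIV (\<lambda>x. smooth_step (real j * x + (- (real j * a))))" "smooth UNIV (\<lambda>x. smooth_step ((- real j) * x + real j * b))"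
    by (rule smooth_compose[where f = smooth_step and U = UNIV, OF smooth_smooth_step smooth_affine], simp)+
  from smooth_mult[OF this] show ?thesis by (simp add: window_def[abs_def] algebra_simps)
qed

lemma window_range: "0 \<le> window a b j x" "window a b j x \<le> 1"
  unfolding window_def using smooth_step_range by (auto intro!: mult_le_one)

lemma window_outside: "x \<notin> {a<..<b} \<Longrightarrow> window a b j x = 0"
  by (auto simp: window_def smooth_step_eq mult_nonneg_nonpos not_less)

lemma window_tendsto:
  assumes "x \<in> {a<..<b}"
  shows "\<forall>\<^sub>F j in sequentially. window a b j x = 1"
proof -
  obtain j0 where j0: "1 / min (x - a) (b - x) \<le> real j0" using real_arch_simple by blast
  have m: "min (x - a) (b - x) > 0" using assms by auto
  have "window a b j x = 1" if "j \<ge> j0" for j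
  proof -
    have "1 \<le> real j0 * min (x - a) (b - x)" using j0 m by (simp add: divide_le_eq)
    also have "\<dots> \<le> real j * min (x - a) (b - x)" using that m by (intro mult_right_mono) auto
    finally have "1 \<le> real j * min (x - a) (b - x)" .
    moreover have "real j * min (x - a) (b - x) \<le> real j * (x - a)" "real j * min (x - a) (b - x) \<le> real j * (b - x)"
      by (intro mult_left_mono; simp)+
    ultimately show ?thesis by (simp add: window_def smooth_step_eq)
  qed
  then show ?thesis by (intro eventually_sequentiallyI[of j0])
qed

text \<open>
  On a compact subinterval the function is orthogonal to every cosine: multiplying a cosine by
  cutoffs that converge to the indicator of the subinterval yields test functions. Completeness of the
  cosines then gives zero.
\<close>

lemma test_function_separation:
  assumes u: "u \<in> L2_loc" and z: "\<And>\<eta>. \<eta> \<in> test_functions {0<..<pi} \<Longrightarrow> (LINT x|lebesgue_on {0<..<pi}. \<eta> x *\<^sub>R u x) = 0"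
  shows "AE x in lebesgue_on {0<..<pi}. u x = 0"
proof -
  have local: "AE x in lebesgue. x \<in> {a<..<b} \<longrightarrow> u x = 0" if ab: "0 < a" "a < b" "b < pi" for a b
  proof -
    define L where "L = b - a"
    have L: "L > 0" "b = a + L" using ab by (auto simp: L_def)
    let ?M = "lebesgue_on {a<..<a+L}"
    have sub: "{a<..<a+L} \<subseteq> {0<..<pi}" using ab L by auto
    have um: "sq_int ?M u"
    proof (rule sq_int_subset)
      have "{a..b} \<subseteq> {0<..<pi}" using ab by auto
      then show "sq_int (lebesgue_on {a..b}) u" using u compact_Icc unfolding L2_loc_iff by blast
    qed (use L in auto)
    have ui: "integrable ?M u" by (rule sq_int_imp_integrable[OF finite_measure_interval um])
    have cont_meas: "g \<in> borel_measurable ?M" if "continuous_on UNIV g" for g :: "real \<Rightarrow> real"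
      by (rule measurable_interval_continuous[OF that])
    have zero: "ip ?M u (cose a L k) = 0" for k
    proof -
      define \<eta> where "\<eta> j x = window a b j x * cosb a L k x" for j x
      have sm: "smooth UNIV (\<eta> j)" for j
        unfolding \<eta>_def[abs_def] by (intro smooth_mult smooth_window smooth_cosb)
      have "\<eta> j \<in> test_functions {0<..<pi}" for j
        by (rule test_functionI[OF sm, of "{a..b}"]) (use ab window_outside in \<open>auto simp: \<eta>_def\<close>)
      then have "(LINT x|lebesgue_on {0<..<pi}. \<eta> j x *\<^sub>R u x) = 0" for j by (rule z)
      moreover have "(LINT x|lebesgue_on {0<..<pi}. \<eta> j x *\<^sub>R u x) = (LINT x|?M. \<eta> j x *\<^sub>R u x)" for j
      proof -
        have "(LINT x|lebesgue_on {0<..<pi}. \<eta> j x *\<^sub>R u x) = (LINT x|lebesgue_on {0<..<pi}. (if x \<in> {a<..<a+L} then \<eta> j x *\<^sub>R u x else 0))"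
          by (intro Bochner_Integration.integral_cong) (use window_outside L in \<open>auto simp: \<eta>_def\<close>)
        then show ?thesis using integral_restrict[OF sub, of "\<lambda>x. \<eta> j x *\<^sub>R u x"] by simp
      qed
      ultimately have zj: "(LINT x|?M. \<eta> j x *\<^sub>R u x) = 0" for j by simp
      have "(\<lambda>j. LINT x|?M. \<eta> j x *\<^sub>R u x) \<longlonglongrightarrow> (LINT x|?M. cosb a L k x *\<^sub>R u x)"
      proof (rule integral_dominated_convergence)
        show "(\<lambda>x. cosb a L k x *\<^sub>R u x) \<in> borel_measurable ?M"
          using cont_meas[OF continuous_cosb] ui by (intro borel_measurable_scaleR) auto
        show "(\<lambda>x. \<eta> j x *\<^sub>R u x) \<in> borel_measurable ?M" for j
          using cont_meas[OF smooth_continuous[OF sm open_UNIV]] ui by (intro borel_measurable_scaleR) auto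
        show "integrable ?M (\<lambda>x. norm (u x))" using ui by (rule integrable_norm)
        show "AE x in ?M. (\<lambda>j. \<eta> j x *\<^sub>R u x) \<longlonglongrightarrow> cosb a L k x *\<^sub>R u x"
        proof (rule AE_I2)
          fix x assume "x \<in> space ?M"
          then have "x \<in> {a<..<b}" using L by simp
          from window_tendsto[OF this] show "(\<lambda>j. \<eta> j x *\<^sub>R u x) \<longlonglongrightarrow> cosb a L k x *\<^sub>R u x"
            by (intro tendsto_eventually) (auto elim!: eventually_mono simp: \<eta>_def)
        qed
        show "AE x in ?M. norm (\<eta> j x *\<^sub>R u x) \<le> norm (u x)" for j
        proof (rule AE_I2)
          fix x
          have "\<bar>\<eta> j x\<bar> \<le> 1 * 1"
            unfolding \<eta>_def abs_mult using window_range[of a b j x] by (intro mult_mono) (auto simp: cosb_def)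
          then show "norm (\<eta> j x *\<^sub>R u x) \<le> norm (u x)"
            using mult_right_mono[of "\<bar>\<eta> j x\<bar>" 1 "norm (u x)"] by simp
        qed
      qed
      then have "(LINT x|?M. cosb a L k x *\<^sub>R u x) = 0"
        unfolding zj by (simp add: LIMSEQ_const_iff)
      moreover have "ip ?M u (cose a L k) = of_real (1 / sqrt (cosn L k)) * (LINT x|?M. cosb a L k x *\<^sub>R u x)"
      proof -
        have "u x * cnj (cose a L k x) = of_real (1 / sqrt (cosn L k)) * (cosb a L k x *\<^sub>R u x)" for x
          by (simp add: cose_def scaleR_conv_of_real)
        then show ?thesis unfolding ip_def by (simp only: integral_mult_right_zero)
      qed
      ultimately show ?thesis by simp
    qed
    have "(\<lambda>k. 0) sums nsq ?M u" using cos_parseval[OF L(1) um] unfolding zero by simp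
    then have "nsq ?M u = 0" using sums_unique2 sums_zero by blast
    then have "AE x in ?M. u x = 0" by (rule nsq_eq_0_imp_AE[OF um])
    then show ?thesis using L by (subst (asm) AE_restrict_space_iff) auto
  qed
  have "AE x in lebesgue. \<forall>i::nat. x \<in> {1 / real (i + 2)<..<pi - 1 / real (i + 2)} \<longrightarrow> u x = 0"
    unfolding AE_all_countable
  proof
    fix i :: nat
    have "1 / real (i + 2) \<le> 1 / 2" by (intro divide_left_mono) auto
    moreover have "1 / real (i + 2) > 0" by simp
    ultimately show "AE x in lebesgue. x \<in> {1 / real (i + 2)<..<pi - 1 / real (i + 2)} \<longrightarrow> u x = 0"
      using pi_gt3 by (intro local) linarith+
  qed
  then have "AE x in lebesgue. x \<in> {0<..<pi} \<longrightarrow> u x = 0"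
  proof eventually_elim
    case (elim x)
    show ?case
    proof
      assume x: "x \<in> {0<..<pi}"
      obtain i :: nat where i: "1 / real (i + 1) < min x (pi - x)"
        using reals_Archimedean[of "min x (pi - x)"] x by (auto simp: inverse_eq_divide)
      moreover have "1 / real (i + 2) \<le> 1 / real (i + 1)" by (intro divide_left_mono) auto
      ultimately show "u x = 0" using elim[rule_format, of i] by auto
    qed
  qed
  then show ?thesis by (subst AE_restrict_space_iff) auto
qed

lemma weak_deriv_unique:
  assumes "g1 \<in> L2_loc" "g2 \<in> L2_loc" "is_weak_deriv f g1" "is_weak_deriv f g2"
  shows "AE x in lebesgue_on {0<..<pi}. g1 x = g2 x"
proof -
  have "AE x in lebesgue_on {0<..<pi}. g1 x - g2 x = 0"
  proof (rule test_function_separation)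
    show "(\<lambda>x. g1 x - g2 x) \<in> L2_loc" using assms by (intro L2_loc_diff)
    fix \<eta> assume \<eta>: "\<eta> \<in> test_functions {0<..<pi}"
    have "(LINT x|lebesgue_on {0<..<pi}. \<eta> x *\<^sub>R (g1 x - g2 x)) = (LINT x|lebesgue_on {0<..<pi}. \<eta> x *\<^sub>R g1 x) - (LINT x|lebesgue_on {0<..<pi}. \<eta> x *\<^sub>R g2 x)"
      unfolding scaleR_diff_right using assms by (intro Bochner_Integration.integral_diff test_function_integrable[OF \<eta>])
    also have "\<dots> = 0"
      using bspec[OF assms(3)[unfolded is_weak_deriv_def] \<eta>] bspec[OF assms(4)[unfolded is_weak_deriv_def] \<eta>] by simp
    finally show "(LINT x|lebesgue_on {0<..<pi}. \<eta> x *\<^sub>R (g1 x - g2 x)) = 0" .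
  qed
  then show ?thesis by simp
qed

text \<open>
  Complex-valued copies of the eigenfunctions and their derivatives, for use in \<open>H\<close>.
\<close>

definition Ec :: "nat \<Rightarrow> real \<Rightarrow> complex" where "Ec n x = of_real (E n x)"
definition E'c :: "nat \<Rightarrow> real \<Rightarrow> complex" where "E'c n x = of_real (E' n x)"

lemma sq_int_Ec: "sq_int wmeas (Ec n)" "sq_int wmeas (E'c n)"
proof -
  obtain B where B: "B \<ge> 1" "\<And>\<phi>. \<bar>E n \<phi>\<bar> \<le> B" "\<And>\<phi>. \<bar>E' n \<phi>\<bar> \<le> B * \<bar>sin \<phi>\<bar>" by (rule E_bounded[of n]) blast
  have "B * \<bar>sin \<phi>\<bar> \<le> B * 1" for \<phi> using B(1) by (intro mult_left_mono) auto
  then have B': "\<bar>E' n \<phi>\<bar> \<le> B" for \<phi> using B(3)[of \<phi>] by (metis mult.right_neutral order_trans)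
  show "sq_int wmeas (Ec n)" unfolding Ec_def[abs_def]
    by (rule sq_int_wmeas_bounded[where B = B]) (use B in \<open>auto intro!: continuous_intros continuous_E\<close>)
  show "sq_int wmeas (E'c n)" unfolding E'c_def[abs_def]
    by (rule sq_int_wmeas_bounded[where B = B]) (use B' in \<open>auto intro!: continuous_intros continuous_E\<close>)
qed

lemma continuous_L2_loc:
  fixes g :: "real \<Rightarrow> complex"
  assumes "continuous_on UNIV g"
  shows "g \<in> L2_loc"
  unfolding L2_loc_iff
proof (intro allI impI)
  fix K :: "real set" assume K: "compact K \<and> K \<subseteq> {0<..<pi}"
  have "bounded (g ` {0..pi})"
    using assms by (intro compact_imp_bounded compact_continuous_image continuous_on_subset[OF assms]) auto
  then have "\<exists>B. \<forall>x\<in>{0..pi}. norm (g x) \<le> B" unfolding bounded_iff by auto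
  then obtain B where B: "\<And>x. x \<in> {0..pi} \<Longrightarrow> norm (g x) \<le> B" by blast
  have "sq_int (lebesgue_on {0<..<pi}) g"
    by (rule sq_int_bounded_continuous[OF assms, where B = B]) (use B in auto)
  then show "sq_int (lebesgue_on K) g"
    by (rule sq_int_subset) (use K in \<open>auto simp: fmeasurableD[OF lmeasurable_compact]\<close>)
qed

lemma is_weak_deriv_E: "is_weak_deriv (Ec n) (E'c n)"
  unfolding is_weak_deriv_def
proof
  fix \<eta> assume \<eta>: "\<eta> \<in> test_functions {0<..<pi}"
  note d = test_functionD[OF \<eta>]
  have ends: "\<eta> 0 = 0" "\<eta> pi = 0" using \<eta> by (auto simp: test_functions_def)
  have D: "((\<lambda>x. \<eta> x * E n x) has_real_derivative deriv \<eta> x * E n x + \<eta> x * E' n x) (at x)" for x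
    by (rule derivative_eq_intros d(1) DERIV_E refl | simp)+
  have i: "integrable (lebesgue_on {0<..<pi}) f" if "continuous_on {0..pi} f" for f :: "real \<Rightarrow> real"
  proof -
    have "f absolutely_integrable_on {0<..<pi}"
      by (rule set_integrable_subset[OF absolutely_integrable_continuous_real[OF that]]) auto
    then show ?thesis by (simp add: integrable_restrict_space set_integrable_def)
  qed
  have i1: "integrable (lebesgue_on {0<..<pi}) (\<lambda>x. deriv \<eta> x * E n x)" by (intro i continuous_on_mult d continuous_E)
  have i2: "integrable (lebesgue_on {0<..<pi}) (\<lambda>x. \<eta> x * E' n x)" by (intro i continuous_on_mult d continuous_E)
  have "(LINT x|lebesgue_on {0<..<pi}. deriv \<eta> x * E n x + \<eta> x * E' n x) = \<eta> pi * E n pi - \<eta> 0 * E n 0"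
    by (rule ftc_integral(2)[OF _ D]) (auto intro!: continuous_intros d continuous_E)
  then have "(LINT x|lebesgue_on {0<..<pi}. deriv \<eta> x * E n x) = - (LINT x|lebesgue_on {0<..<pi}. \<eta> x * E' n x)"
    using Bochner_Integration.integral_add[OF i1 i2] by (simp add: ends)
  then have "complex_of_real (LINT x|lebesgue_on {0<..<pi}. deriv \<eta> x * E n x) = - complex_of_real (LINT x|lebesgue_on {0<..<pi}. \<eta> x * E' n x)"
    by simp
  then show "(LINT \<phi>|lebesgue_on {0<..<pi}. deriv \<eta> \<phi> *\<^sub>R Ec n \<phi>) = - (LINT \<phi>|lebesgue_on {0<..<pi}. \<eta> \<phi> *\<^sub>R E'c n \<phi>)"
    unfolding integral_complex_of_real[symmetric] by (simp add: Ec_def E'c_def scaleR_conv_of_real)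
qed

lemma H1_loc_wderiv:
  assumes "f \<in> H1_loc"
  shows "wderiv f \<in> L2_loc" "is_weak_deriv f (wderiv f)"
proof -
  have "\<exists>g. g \<in> L2_loc \<and> is_weak_deriv f g" using assms by (auto simp: H1_loc_def)
  from someI_ex[OF this] show "wderiv f \<in> L2_loc" "is_weak_deriv f (wderiv f)"
    unfolding wderiv_def by blast+
qed

lemma Ec_L2_loc: "Ec n \<in> L2_loc" "E'c n \<in> L2_loc"
  unfolding Ec_def[abs_def] E'c_def[abs_def] by (intro continuous_L2_loc continuous_intros continuous_E)+

lemma Ec_H1_loc: "Ec n \<in> H1_loc"
  using Ec_L2_loc is_weak_deriv_E by (auto simp: H1_loc_def)

lemma wderiv_Ec: "AE x in wmeas. wderiv (Ec n) x = E'c n x"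
  unfolding AE_wmeas
  by (rule weak_deriv_unique[OF H1_loc_wderiv(1)[OF Ec_H1_loc] Ec_L2_loc(2) H1_loc_wderiv(2)[OF Ec_H1_loc] is_weak_deriv_E])

lemma V_wderiv:
  assumes "f \<in> V"
  shows "sq_int wmeas f" "sq_int wmeas (wderiv f)" "is_weak_deriv f (wderiv f)" "wderiv f \<in> L2_loc"
  using assms H1_loc_wderiv[of f] L2_loc_measurable[of "wderiv f"]
  by (auto simp: V_def H_iff sq_int_def measurable_wmeas)

lemma Ec_V: "Ec n \<in> V"
proof -
  have "integrable wmeas (\<lambda>x. (norm (wderiv (Ec n) x))\<^sup>2)"
  proof (subst integrable_cong_AE)
    show "integrable wmeas (\<lambda>x. (norm (E'c n x))\<^sup>2)" using sq_int_Ec(2) by (simp add: sq_int_def)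
    show "AE x in wmeas. (norm (wderiv (Ec n) x))\<^sup>2 = (norm (E'c n x))\<^sup>2" using wderiv_Ec[of n] by eventually_elim simp
    have [measurable]: "wderiv (Ec n) \<in> borel_measurable wmeas"
      using L2_loc_measurable[OF H1_loc_wderiv(1)[OF Ec_H1_loc]] by (simp add: measurable_wmeas)
    show "(\<lambda>x. (norm (wderiv (Ec n) x))\<^sup>2) \<in> borel_measurable wmeas" by measurable
    have [measurable]: "E'c n \<in> borel_measurable wmeas" using sq_int_Ec(2) by (simp add: sq_int_def)
    show "(\<lambda>x. (norm (E'c n x))\<^sup>2) \<in> borel_measurable wmeas" by measurable
  qed
  then show ?thesis using sq_int_Ec(1) Ec_H1_loc by (simp add: V_def H_iff)
qed

section \<open>Pairing with eigenfunctions in the form\<close>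

text \<open>
  A smooth cutoff that vanishes within distance \<open>1 / j\<close> of the endpoints.
\<close>

definition cutoff :: "nat \<Rightarrow> real \<Rightarrow> real" where
  "cutoff j x = smooth_step (real j * x - 1) * smooth_step (real j * (pi - x) - 1)"

definition cutoff' :: "nat \<Rightarrow> real \<Rightarrow> real" where
  "cutoff' j x = real j * deriv smooth_step (real j * x - 1) * smooth_step (real j * (pi - x) - 1)
     - smooth_step (real j * x - 1) * (real j * deriv smooth_step (real j * (pi - x) - 1))"

lemma DERIV_smooth_step: "(smooth_step has_real_derivative deriv smooth_step x) (at x)"
  by (rule smooth_deriv(2)[OF open_UNIV smooth_smooth_step]) simp

lemma DERIV_cutoff: "(cutoff j has_real_derivative cutoff' j x) (at x)"
proof -
  have 1: "((\<lambda>x. smooth_step (real j * x - 1)) has_real_derivative deriv smooth_step (real j * x - 1) * real j) (at x)"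
    by (rule DERIV_chain2[OF DERIV_smooth_step]) (auto intro!: derivative_eq_intros)
  have 2: "((\<lambda>x. smooth_step (real j * (pi - x) - 1)) has_real_derivative deriv smooth_step (real j * (pi - x) - 1) * (- real j)) (at x)"
    by (rule DERIV_chain2[OF DERIV_smooth_step]) (auto intro!: derivative_eq_intros)
  show ?thesis
    unfolding cutoff_def[abs_def] cutoff'_def by (rule DERIV_cong[OF DERIV_mult[OF 1 2]]) (simp add: algebra_simps)
qed

lemma smooth_cutoff: "smooth UNIV (cutoff j)"
proof -
  have "smooth UNIV (\<lambda>x. smooth_step (real j * x + (- 1)))" "smooth UNIV (\<lambda>x. smooth_step ((- real j) * x + (real j * pi - 1)))"
    by (rule smooth_compose[where f = smooth_step and U = UNIV, OF smooth_smooth_step smooth_affine], simp)+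
  from smooth_mult[OF this] show ?thesis by (simp add: cutoff_def[abs_def] algebra_simps)
qed

lemma cutoff_range: "0 \<le> cutoff j x" "cutoff j x \<le> 1"
  unfolding cutoff_def using smooth_step_range by (auto intro!: mult_le_one)

lemma cutoff_outside:
  assumes "j > 0" "x < 1 / real j \<or> x > pi - 1 / real j"
  shows "cutoff j x = 0"
proof -
  have "real j * x < 1 \<or> real j * (pi - x) < 1" using assms by (auto simp: field_simps)
  then show ?thesis by (auto simp: cutoff_def smooth_step_eq)
qed

lemma cutoff_eventually:
  assumes "x \<in> {0<..<pi}"
  shows "\<forall>\<^sub>F j in sequentially. cutoff j x = 1 \<and> cutoff' j x = 0"
proof -
  have m: "min x (pi - x) > 0" using assms by auto
  obtain j0 where j0: "3 / min x (pi - x) \<le> real j0" using real_arch_simple by blast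
  show ?thesis
  proof (rule eventually_sequentiallyI[of j0])
    fix j assume "j0 \<le> j"
    have "3 \<le> real j0 * min x (pi - x)" using j0 m by (simp add: divide_le_eq)
    also have "\<dots> \<le> real j * min x (pi - x)" using \<open>j0 \<le> j\<close> m by (intro mult_right_mono) auto
    finally have "3 \<le> real j * min x (pi - x)" .
    moreover have "real j * min x (pi - x) \<le> real j * x" "real j * min x (pi - x) \<le> real j * (pi - x)"
      by (intro mult_left_mono; simp)+
    ultimately have "real j * x - 1 > 1" "real j * (pi - x) - 1 > 1" by linarith+
    then show "cutoff j x = 1 \<and> cutoff' j x = 0"
      by (simp add: cutoff_def cutoff'_def smooth_step_eq smooth_step_derivs_vanish)
  qed
qed

text \<open>
  The derivative of the cutoff is of size \<open>j\<close>, but it lives where \<open>sin\<close> is of size \<open>1 / j\<close>. The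
  flux of an eigenfunction vanishes at this rate, which makes the endpoint contributions bounded.
\<close>

lemma cutoff'_sin_bound:
  assumes B: "\<And>x. \<bar>deriv smooth_step x\<bar> \<le> B" and x: "x \<in> {0<..<pi}"
  shows "\<bar>cutoff' j x\<bar> * sin x \<le> 4 * B"
proof -
  have s: "0 < sin x" using x by (simp add: sin_gt_zero)
  have B0: "B \<ge> 0" using B[of 0] by simp
  have key: "real j * \<bar>deriv smooth_step (real j * y - 1)\<bar> * sin x \<le> 2 * B" if "sin x \<le> y" for y
  proof (cases "real j * y - 1 > 1")
    case True
    then show ?thesis using B0 by (simp add: smooth_step_derivs_vanish)
  next
    case False
    have "real j * \<bar>deriv smooth_step (real j * y - 1)\<bar> * sin x \<le> real j * B * y"
      using B that s B0 by (intro mult_mono mult_left_mono) auto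
    also have "\<dots> = (real j * y) * B" by simp
    also have "\<dots> \<le> 2 * B" using False B0 by (intro mult_right_mono) auto
    finally show ?thesis .
  qed
  have 1: "real j * \<bar>deriv smooth_step (real j * x - 1)\<bar> * sin x \<le> 2 * B"
    by (rule key) (use x in \<open>auto intro: sin_x_le_x\<close>)
  have 2: "real j * \<bar>deriv smooth_step (real j * (pi - x) - 1)\<bar> * sin x \<le> 2 * B"
    by (rule key) (use x sin_x_le_x[of "pi - x"] in auto)
  have "\<bar>cutoff' j x\<bar> \<le> real j * \<bar>deriv smooth_step (real j * x - 1)\<bar> * 1 + 1 * (real j * \<bar>deriv smooth_step (real j * (pi - x) - 1)\<bar>)"
    unfolding cutoff'_def
    by (rule order_trans[OF abs_triangle_ineq4], unfold abs_mult, intro add_mono mult_mono)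
       (use smooth_step_range in \<open>auto simp: abs_of_nonneg\<close>)
  then have "\<bar>cutoff' j x\<bar> * sin x \<le> (real j * \<bar>deriv smooth_step (real j * x - 1)\<bar> * 1 + 1 * (real j * \<bar>deriv smooth_step (real j * (pi - x) - 1)\<bar>)) * sin x"
    using s by (intro mult_right_mono) auto
  then show ?thesis using 1 2 by (simp add: distrib_right)
qed

text \<open>
  The flux, whose derivative is \<open>- ev n * \<omega> * E n\<close>.
\<close>

definition E_flux :: "nat \<Rightarrow> real \<Rightarrow> real" where "E_flux n x = \<omega> x * E' n x"

lemma DERIV_E_flux:
  assumes "x \<in> {0<..<pi}"
  shows "(E_flux n has_real_derivative - ev n * (\<omega> x * E n x)) (at x)"
proof -
  have s: "sin x > 0" using assms by (simp add: sin_gt_zero)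
  have w: "(\<omega> has_real_derivative \<omega> x * (cos x / (2 * sin x))) (at x)"
  proof -
    have "(\<omega> has_real_derivative cos x * (inverse (sqrt (sin x)) / 2)) (at x)"
      unfolding \<omega>_def[abs_def] using s by (auto intro!: derivative_eq_intros)
    also have "cos x * (inverse (sqrt (sin x)) / 2) = \<omega> x * (cos x / (2 * sin x))"
    proof -
      have "sin x = \<omega> x * \<omega> x" "\<omega> x > 0" using omega_sq[OF assms] omega_pos[OF assms] by (simp_all add: power2_eq_square)
      then show ?thesis unfolding \<omega>_def[symmetric] by (simp add: field_simps)
    qed
    finally show ?thesis .
  qed
  show ?thesis
    unfolding E_flux_def[abs_def] using s
    by (intro DERIV_cong[OF DERIV_mult[OF w E_ode]]) (auto simp: algebra_simps)
qed

lemma smooth_E_flux: "smooth {0<..<pi} (E_flux n)"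
  unfolding E_flux_def[abs_def] \<omega>_def
  by (intro smooth_mult smooth_E' smooth_compose[where f = sqrt and g = sin, OF smooth_sqrt smooth_sin_cos(1)])
     (auto simp: sin_gt_zero)

lemma cutoff_E_flux_test:
  assumes "j > 0"
  shows "(\<lambda>x. cutoff j x * E_flux n x) \<in> test_functions {0<..<pi}" "smooth UNIV (\<lambda>x. cutoff j x * E_flux n x)"
proof -
  define K where "K = {1 / real j..pi - 1 / real j}"
  have K: "K \<subseteq> {0<..<pi}"
  proof
    fix x assume "x \<in> K"
    then have "1 / real j \<le> x" "x \<le> pi - 1 / real j" unfolding K_def by simp_all
    moreover have "1 / real j > 0" using assms by simp
    ultimately have "0 < x" "x < pi" by linarith+
    then show "x \<in> {0<..<pi}" by simp
  qed
  have out: "cutoff j x * E_flux n x = 0" if "x \<notin> K" for x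
    using cutoff_outside[OF assms, of x] that by (auto simp: K_def)
  have 1: "smooth {0<..<pi} (\<lambda>x. cutoff j x * E_flux n x)"
    by (intro smooth_mult smooth_E_flux smooth_subset[OF smooth_cutoff]) auto
  have 2: "smooth (- K) (\<lambda>x. cutoff j x * E_flux n x)"
    by (rule smooth_cong[OF _ _ smooth_const[of _ 0]]) (use out in \<open>auto simp: K_def\<close>)
  have "smooth ({0<..<pi} \<union> - K) (\<lambda>x. cutoff j x * E_flux n x)"
    by (rule smooth_Un[OF _ _ 1 2]) (auto simp: K_def)
  moreover have "{0<..<pi} \<union> - K = UNIV" using K by auto
  ultimately show s: "smooth UNIV (\<lambda>x. cutoff j x * E_flux n x)" by simp
  show "(\<lambda>x. cutoff j x * E_flux n x) \<in> test_functions {0<..<pi}"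
    by (rule test_functionI[OF s _ K out]) (simp add: K_def)
qed

text \<open>
  Integration by parts against an eigenfunction. The flux \<open>\<omega> E'\<close> is not a test function, since its
  support reaches the endpoints; it is approximated by its products with cutoffs. Where the cutoff
  varies, \<open>E'\<close> is of size \<open>sin\<close>, so the extra term is dominated by \<open>\<omega>\<close> and converges to zero pointwise.
  No boundary term appears: the eigenfunctions satisfy the natural boundary condition of the form.
\<close>

lemma weak_pairing:
  assumes f: "f \<in> V"
  shows "ip wmeas (wderiv f) (E'c n) = of_real (ev n) * ip wmeas f (Ec n)"
proof -
  let ?M = "lebesgue_on {0<..<pi}"
  let ?g = "wderiv f"
  note Vf = V_wderiv[OF f]
  obtain B where B: "B \<ge> 1" "\<And>\<phi>. \<bar>E n \<phi>\<bar> \<le> B" "\<And>\<phi>. \<bar>E' n \<phi>\<bar> \<le> B * \<bar>sin \<phi>\<bar>" by (rule E_bounded[of n]) blast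
  obtain B1 where B1: "B1 \<ge> 1" "\<And>x. \<bar>deriv smooth_step x\<bar> \<le> B1" by (rule smooth_step_derivs_bounded) blast
  define \<eta> where "\<eta> i x = cutoff (Suc i) x * E_flux n x" for i x
  have test: "\<eta> i \<in> test_functions {0<..<pi}" for i
    unfolding \<eta>_def[abs_def] by (rule cutoff_E_flux_test) simp
  have d\<eta>: "deriv (\<eta> i) x = cutoff' (Suc i) x * E_flux n x - cutoff (Suc i) x * (ev n * (\<omega> x * E n x))" if "x \<in> {0<..<pi}" for i x
    unfolding \<eta>_def[abs_def]
    by (rule DERIV_imp_deriv, rule DERIV_cong[OF DERIV_mult[OF DERIV_cutoff DERIV_E_flux[OF that]]]) (simp add: algebra_simps)
  have evn: "ev n \<ge> 0" by (simp add: ev_def)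
  define C where "C = 4 * B1 * B + ev n * B"
  have Wb: "\<bar>E_flux n x\<bar> \<le> B * \<omega> x" if x: "x \<in> {0<..<pi}" for x
  proof -
    have "B * \<bar>sin x\<bar> \<le> B * 1" using B(1) by (intro mult_left_mono) auto
    then have "\<bar>E' n x\<bar> \<le> B" using B(3)[of x] by linarith
    then show ?thesis using omega_pos[OF x] by (simp add: E_flux_def abs_mult mult.commute mult_left_mono)
  qed
  \<comment> \<open>The majorant for dominated convergence.\<close>
  have db: "\<bar>deriv (\<eta> i) x\<bar> \<le> C * \<omega> x" if x: "x \<in> {0<..<pi}" for i x
  proof -
    have s: "sin x > 0" using x by (simp add: sin_gt_zero)
    note o = omega_pos[OF x]
    have "\<bar>cutoff' (Suc i) x * E_flux n x\<bar> = \<omega> x * (\<bar>cutoff' (Suc i) x\<bar> * \<bar>E' n x\<bar>)"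
      using o by (simp add: E_flux_def abs_mult)
    also have "\<dots> \<le> \<omega> x * (\<bar>cutoff' (Suc i) x\<bar> * (B * sin x))"
      using o s B(3)[of x] by (intro mult_left_mono) auto
    also have "\<dots> = \<omega> x * (B * (\<bar>cutoff' (Suc i) x\<bar> * sin x))" by simp
    also have "\<dots> \<le> \<omega> x * (B * (4 * B1))"
      using o B(1) cutoff'_sin_bound[OF B1(2) x, of "Suc i"] by (intro mult_left_mono) auto
    finally have 1: "\<bar>cutoff' (Suc i) x * E_flux n x\<bar> \<le> 4 * B1 * B * \<omega> x" by (simp add: mult_ac)
    have "\<bar>cutoff (Suc i) x * (ev n * (\<omega> x * E n x))\<bar> \<le> 1 * (ev n * (\<omega> x * B))"
      unfolding abs_mult using cutoff_range[of "Suc i" x] evn o B(1,2) by (intro mult_mono) auto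
    then show ?thesis using 1 unfolding d\<eta>[OF x] C_def by (simp add: algebra_simps)
  qed
  have meas_c: "h \<in> borel_measurable ?M" if "continuous_on UNIV h" for h :: "real \<Rightarrow> real"
    by (rule measurable_interval_continuous[OF that])
  have fm: "f \<in> borel_measurable ?M" and gm: "?g \<in> borel_measurable ?M"
    using Vf(1,2) by (auto simp: sq_int_def measurable_wmeas)
  have dom: "integrable ?M (\<lambda>x. c * (\<omega> x * norm (h x)))" if "sq_int wmeas h" for h :: "real \<Rightarrow> complex" and c
  proof -
    have "integrable wmeas (\<lambda>x. norm (h x))"
      using sq_int_imp_integrable[OF finite_measure_wmeas that] by (rule integrable_norm)
    moreover have "(\<lambda>x. norm (h x)) \<in> borel_measurable ?M"
      using that by (auto simp: sq_int_def measurable_wmeas)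
    ultimately have "integrable ?M (\<lambda>x. \<omega> x *\<^sub>R norm (h x))" by (subst (asm) integral_wmeas(2))
    then show ?thesis by simp
  qed
  have L1: "(\<lambda>i. LINT x|?M. deriv (\<eta> i) x *\<^sub>R f x) \<longlonglongrightarrow> (LINT x|?M. (- (ev n * (\<omega> x * E n x))) *\<^sub>R f x)"
  proof (rule integral_dominated_convergence)
    show "(\<lambda>x. (- (ev n * (\<omega> x * E n x))) *\<^sub>R f x) \<in> borel_measurable ?M"
      by (rule borel_measurable_scaleR[OF meas_c fm]) (intro continuous_intros continuous_omega continuous_E)
    show "(\<lambda>x. deriv (\<eta> i) x *\<^sub>R f x) \<in> borel_measurable ?M" for i
      using meas_c[OF test_functionD(3)[OF test]] fm by (intro borel_measurable_scaleR)
    show "integrable ?M (\<lambda>x. C * (\<omega> x * norm (f x)))" by (rule dom[OF Vf(1)])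
    show "AE x in ?M. (\<lambda>i. deriv (\<eta> i) x *\<^sub>R f x) \<longlonglongrightarrow> (- (ev n * (\<omega> x * E n x))) *\<^sub>R f x"
    proof (rule AE_I2)
      fix x assume "x \<in> space ?M"
      then have x: "x \<in> {0<..<pi}" by simp
      have "\<forall>\<^sub>F i in sequentially. cutoff (Suc i) x = 1 \<and> cutoff' (Suc i) x = 0"
        using cutoff_eventually[OF x] by (subst eventually_sequentially_Suc)
      then show "(\<lambda>i. deriv (\<eta> i) x *\<^sub>R f x) \<longlonglongrightarrow> (- (ev n * (\<omega> x * E n x))) *\<^sub>R f x"
        by (intro tendsto_eventually) (auto elim!: eventually_mono simp: d\<eta>[OF x])
    qed
    show "AE x in ?M. norm (deriv (\<eta> i) x *\<^sub>R f x) \<le> C * (\<omega> x * norm (f x))" for i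
      using db by (intro AE_I2) (auto simp: mult.assoc[symmetric] intro!: mult_right_mono)
  qed
  have L2: "(\<lambda>i. LINT x|?M. \<eta> i x *\<^sub>R ?g x) \<longlonglongrightarrow> (LINT x|?M. E_flux n x *\<^sub>R ?g x)"
  proof (rule integral_dominated_convergence)
    show "(\<lambda>x. E_flux n x *\<^sub>R ?g x) \<in> borel_measurable ?M"
      using meas_c[of "E_flux n"] gm unfolding E_flux_def[abs_def]
      by (intro borel_measurable_scaleR) (auto intro!: continuous_intros continuous_omega continuous_E)
    show "(\<lambda>x. \<eta> i x *\<^sub>R ?g x) \<in> borel_measurable ?M" for i
      using meas_c[OF test_functionD(2)[OF test]] gm by (intro borel_measurable_scaleR)
    show "integrable ?M (\<lambda>x. B * (\<omega> x * norm (?g x)))" by (rule dom[OF Vf(2)])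
    show "AE x in ?M. (\<lambda>i. \<eta> i x *\<^sub>R ?g x) \<longlonglongrightarrow> E_flux n x *\<^sub>R ?g x"
    proof (rule AE_I2)
      fix x assume "x \<in> space ?M"
      then have x: "x \<in> {0<..<pi}" by simp
      have "\<forall>\<^sub>F i in sequentially. cutoff (Suc i) x = 1 \<and> cutoff' (Suc i) x = 0"
        using cutoff_eventually[OF x] by (subst eventually_sequentially_Suc)
      then show "(\<lambda>i. \<eta> i x *\<^sub>R ?g x) \<longlonglongrightarrow> E_flux n x *\<^sub>R ?g x"
        by (intro tendsto_eventually) (auto elim!: eventually_mono simp: \<eta>_def)
    qed
    show "AE x in ?M. norm (\<eta> i x *\<^sub>R ?g x) \<le> B * (\<omega> x * norm (?g x))" for i
    proof (rule AE_I2)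
      fix x assume "x \<in> space ?M"
      then have x: "x \<in> {0<..<pi}" by simp
      have "\<bar>\<eta> i x\<bar> \<le> 1 * (B * \<omega> x)"
        unfolding \<eta>_def abs_mult using cutoff_range[of "Suc i" x] Wb[OF x] by (intro mult_mono) auto
      then show "norm (\<eta> i x *\<^sub>R ?g x) \<le> B * (\<omega> x * norm (?g x))"
        using mult_right_mono[of "\<bar>\<eta> i x\<bar>" "B * \<omega> x" "norm (?g x)"] by (simp add: mult.assoc)
    qed
  qed
  have "(\<lambda>i. LINT x|?M. deriv (\<eta> i) x *\<^sub>R f x) = (\<lambda>i. - (LINT x|?M. \<eta> i x *\<^sub>R ?g x))"
    using Vf(3) test unfolding is_weak_deriv_def by blast
  from LIMSEQ_unique[OF L1[unfolded this] tendsto_minus[OF L2]]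
  have "(LINT x|?M. (- (ev n * (\<omega> x * E n x))) *\<^sub>R f x) = - (LINT x|?M. E_flux n x *\<^sub>R ?g x)" .
  then have eq: "(LINT x|?M. E_flux n x *\<^sub>R ?g x) = (LINT x|?M. (ev n * (\<omega> x * E n x)) *\<^sub>R f x)"
    by simp
  have "ip wmeas ?g (E'c n) = (LINT x|?M. E_flux n x *\<^sub>R ?g x)"
  proof -
    have "(\<lambda>x. ?g x * cnj (E'c n x)) \<in> borel_measurable ?M"
      using sq_int_integrable[OF Vf(2) sq_int_Ec(2)] by (auto simp: measurable_wmeas[symmetric])
    then show ?thesis unfolding ip_def
      by (subst integral_wmeas(1)) (auto simp: E_flux_def E'c_def scaleR_conv_of_real mult_ac intro!: Bochner_Integration.integral_cong)
  qed
  moreover have "of_real (ev n) * ip wmeas f (Ec n) = (LINT x|?M. (ev n * (\<omega> x * E n x)) *\<^sub>R f x)"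
  proof -
    have m: "(\<lambda>x. f x * cnj (Ec n x)) \<in> borel_measurable ?M"
      using sq_int_integrable[OF Vf(1) sq_int_Ec(1)] by (auto simp: measurable_wmeas[symmetric])
    have "of_real (ev n) * ip wmeas f (Ec n) = (LINT x|?M. of_real (ev n) * (\<omega> x *\<^sub>R (f x * cnj (Ec n x))))"
      unfolding ip_def integral_wmeas(1)[OF m] by (simp only: integral_mult_right_zero)
    then show ?thesis by (simp add: Ec_def scaleR_conv_of_real mult_ac)
  qed
  ultimately show ?thesis using eq by simp
qed

section \<open>Eigenfunction expansion and traces\<close>

lemma integrable_wmeas_continuous:
  fixes g :: "real \<Rightarrow> real"
  assumes "continuous_on UNIV g"
  shows "integrable wmeas g"
proof -
  have "bounded (g ` {0..pi})"
    by (intro compact_imp_bounded compact_continuous_image continuous_on_subset[OF assms]) auto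
  then have "\<exists>B. \<forall>x\<in>{0..pi}. norm (g x) \<le> B" unfolding bounded_iff by auto
  then obtain B where B: "\<And>x. x \<in> {0..pi} \<Longrightarrow> norm (g x) \<le> B" by blast
  interpret finite_measure wmeas by (rule finite_measure_wmeas)
  show ?thesis
    by (rule integrable_const_bound[where B = B])
       (use B measurable_interval_continuous[OF assms] in \<open>auto intro!: AE_I2 simp: space_wmeas measurable_wmeas\<close>)
qed

text \<open>
  The inner product of the weighted space for real functions.
\<close>

definition real_ip :: "(real \<Rightarrow> real) \<Rightarrow> (real \<Rightarrow> real) \<Rightarrow> real" where
  "real_ip f g = (LINT x|wmeas. f x * g x)"

definition E_normsq :: "nat \<Rightarrow> real" where "E_normsq n = real_ip (E n) (E n)"

lemma ip_Ec: "ip wmeas (Ec m) (Ec n) = of_real (real_ip (E m) (E n))"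
  unfolding ip_def real_ip_def integral_complex_of_real[symmetric] by (simp add: Ec_def)

lemma ip_E'c: "ip wmeas (E'c m) (E'c n) = of_real (real_ip (E' m) (E' n))"
  unfolding ip_def real_ip_def integral_complex_of_real[symmetric] by (simp add: E'c_def)

lemma real_ip_commute: "real_ip f g = real_ip g f"
  by (simp add: real_ip_def mult.commute)

lemma real_ip_E': "real_ip (E' m) (E' n) = ev n * real_ip (E m) (E n)"
proof -
  have "ip wmeas (wderiv (Ec m)) (E'c n) = ip wmeas (E'c m) (E'c n)"
    unfolding ip_def
  proof (rule integral_cong_AE)
    show "AE x in wmeas. wderiv (Ec m) x * cnj (E'c n x) = E'c m x * cnj (E'c n x)"
      using wderiv_Ec[of m] by eventually_elim simp
  qed (use sq_int_integrable[OF V_wderiv(2)[OF Ec_V] sq_int_Ec(2)] sq_int_integrable[OF sq_int_Ec(2) sq_int_Ec(2)] in auto)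
  then have "complex_of_real (real_ip (E' m) (E' n)) = of_real (ev n * real_ip (E m) (E n))"
    using weak_pairing[OF Ec_V, of m n] unfolding ip_E'c ip_Ec by simp
  then show ?thesis by (simp only: of_real_eq_iff)
qed

lemma ev_strict_mono: "m < n \<Longrightarrow> ev m < ev n"
  unfolding ev_def by (intro mult_strict_mono') auto

text \<open>
  The form is symmetric, and \<open>E m\<close>, \<open>E n\<close> belong to different eigenvalues.
\<close>

lemma real_ip_E_orthogonal: "m \<noteq> n \<Longrightarrow> real_ip (E m) (E n) = 0"
proof -
  assume mn: "m \<noteq> n"
  have "ev n * real_ip (E m) (E n) = ev m * real_ip (E m) (E n)"
    using real_ip_E'[of m n] real_ip_E'[of n m] real_ip_commute by metis
  moreover have "ev n \<noteq> ev m" using mn ev_strict_mono[of m n] ev_strict_mono[of n m] by (cases m n rule: linorder_cases) auto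
  ultimately show ?thesis by simp
qed

lemma E_recurrence:
  "(2 * real n + 5 / 2) * (cos x * E (Suc n) x) = (real n + 2) * E (Suc (Suc n)) x + (real n + 1 / 2) * E n x"
  using geg_recurrence[of n "cos x"] by (simp add: E_def)

lemma E_0: "E 0 x = 1" and E_1: "E (Suc 0) x = cos x / 2"
  by (simp_all add: E_def)

lemma integrable_E_E: "integrable wmeas (\<lambda>x. E m x * E n x)"
  by (intro integrable_wmeas_continuous continuous_on_mult continuous_E)

text \<open>
  The integral of \<open>cos * E (n + 1) * E n\<close> is computed by applying the three-term recurrence to
  either factor.
\<close>

lemma E_normsq_Suc: "(real n + 5 / 4) * E_normsq (Suc n) = (real n + 1 / 4) * E_normsq n * ((2 * real n + 1) / (2 * real n + 2))"
proof -
  define X where "X = (LINT x|wmeas. cos x * E (Suc n) x * E n x)"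
  have intc: "integrable wmeas (\<lambda>x. cos x * E (Suc n) x * E n x)"
    by (intro integrable_wmeas_continuous continuous_intros continuous_E)
  have 1: "(2 * real n + 5 / 2) * X = (real n + 1 / 2) * E_normsq n"
  proof -
    have "(2 * real n + 5 / 2) * X = (LINT x|wmeas. (2 * real n + 5 / 2) * (cos x * E (Suc n) x * E n x))"
      by (simp only: X_def integral_mult_right_zero)
    also have "\<dots> = (LINT x|wmeas. (real n + 2) * (E (Suc (Suc n)) x * E n x) + (real n + 1 / 2) * (E n x * E n x))"
    proof (rule Bochner_Integration.integral_cong[OF refl])
      fix x
      show "(2 * real n + 5 / 2) * (cos x * E (Suc n) x * E n x) = (real n + 2) * (E (Suc (Suc n)) x * E n x) + (real n + 1 / 2) * (E n x * E n x)"
        using arg_cong[OF E_recurrence[of n x], of "\<lambda>y. y * E n x"] by (simp add: algebra_simps)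
    qed
    also have "\<dots> = (real n + 2) * real_ip (E (Suc (Suc n))) (E n) + (real n + 1 / 2) * E_normsq n"
      unfolding real_ip_def E_normsq_def using integrable_E_E by simp
    finally show ?thesis by (simp add: real_ip_E_orthogonal)
  qed
  have 2: "(2 * real n + 1 / 2) * X = (real n + 1) * E_normsq (Suc n)"
  proof (cases n)
    case 0
    have "cos x * E (Suc n) x * E n x = 2 * (E (Suc 0) x * E (Suc 0) x)" for x by (simp add: 0 E_0 E_1)
    then have "X = 2 * E_normsq (Suc 0)" unfolding X_def E_normsq_def real_ip_def by (simp only: integral_mult_right_zero)
    then show ?thesis by (simp add: 0)
  next
    case (Suc m)
    have "(2 * real m + 5 / 2) * X = (LINT x|wmeas. (2 * real m + 5 / 2) * (cos x * E (Suc n) x * E n x))"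
      by (simp only: X_def integral_mult_right_zero)
    also have "\<dots> = (LINT x|wmeas. (real m + 2) * (E (Suc n) x * E (Suc n) x) + (real m + 1 / 2) * (E m x * E (Suc n) x))"
    proof (rule Bochner_Integration.integral_cong[OF refl])
      fix x
      show "(2 * real m + 5 / 2) * (cos x * E (Suc n) x * E n x) = (real m + 2) * (E (Suc n) x * E (Suc n) x) + (real m + 1 / 2) * (E m x * E (Suc n) x)"
        using arg_cong[OF E_recurrence[of m x], of "\<lambda>y. y * E (Suc n) x"] by (simp add: Suc algebra_simps)
    qed
    also have "\<dots> = (real m + 2) * E_normsq (Suc n) + (real m + 1 / 2) * real_ip (E m) (E (Suc n))"
      unfolding real_ip_def E_normsq_def using integrable_E_E by simp
    also have "real_ip (E m) (E (Suc n)) = 0" by (rule real_ip_E_orthogonal) (simp add: Suc)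
    finally have "(2 * real m + 5 / 2) * X = (real m + 2) * E_normsq (Suc n)" by simp
    moreover have "2 * real m + 5 / 2 = 2 * real n + 1 / 2" "real m + 2 = real n + 1" by (simp_all add: Suc)
    ultimately show ?thesis by (simp only:)
  qed
  have X: "X = (real n + 1) * E_normsq (Suc n) / (2 * real n + 1 / 2)" using 2 by (simp add: field_simps)
  have p: "2 * real n + 1 / 2 > 0" "2 * real n + 2 > 0" by simp_all
  have "(2 * real n + 5 / 2) * ((2 * real n + 1 / 2) * X) = (2 * real n + 1 / 2) * ((2 * real n + 5 / 2) * X)" by simp
  then have "(2 * real n + 5 / 2) * ((real n + 1) * E_normsq (Suc n)) = (2 * real n + 1 / 2) * ((real n + 1 / 2) * E_normsq n)"
    unfolding 1 2 .
  then have "(2 * real n + 2) * ((real n + 5 / 4) * E_normsq (Suc n)) = (real n + 1 / 4) * E_normsq n * (2 * real n + 1)"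
    by (simp add: algebra_simps add_divide_distrib)
  then show ?thesis using p(2) by (simp add: eq_divide_eq mult.commute)
qed

lemma E_normsq_eq: "2 * freq n * E_normsq n = E_normsq 0 * cbinom n"
proof (induction n)
  case 0 show ?case by (simp add: freq_def)
next
  case (Suc n)
  have "2 * freq (Suc n) * E_normsq (Suc n) = 4 * ((real n + 5 / 4) * E_normsq (Suc n))" by (simp add: freq_def)
  also have "\<dots> = (2 * freq n * E_normsq n) * ((2 * real n + 1) / (2 * real n + 2))"
    unfolding E_normsq_Suc by (simp add: freq_def)
  also have "\<dots> = E_normsq 0 * cbinom (Suc n)" unfolding Suc by (simp add: cbinom.simps(2))
  finally show ?case .
qed

lemma nsq_Ec: "nsq wmeas (Ec n) = E_normsq n"
  by (simp add: nsq_def E_normsq_def real_ip_def Ec_def power2_eq_square)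

lemma E_normsq_0_pos: "E_normsq 0 > 0"
proof -
  have "E_normsq 0 \<noteq> 0"
  proof
    assume "E_normsq 0 = 0"
    then have "AE x in wmeas. Ec 0 x = 0" using nsq_eq_0_imp_AE[OF sq_int_Ec(1), of 0] by (simp add: nsq_Ec)
    then have "AE x in lebesgue_on {0<..<pi}. (1::real) = 0" unfolding AE_wmeas by eventually_elim (simp add: Ec_def E_0)
    then have "(LINT x|lebesgue_on {0<..<pi}. (1::real)) = 0" by (rule integral_eq_zero_AE)
    then show False using integral_one_interval[of 0 pi 1] by simp
  qed
  moreover have "E_normsq 0 \<ge> 0" using nsq_nonneg[of wmeas "Ec 0"] by (simp add: nsq_Ec)
  ultimately show ?thesis by simp
qed

lemma E_normsq_pos: "E_normsq n > 0"
proof -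
  have "2 * freq n * E_normsq n > 0" unfolding E_normsq_eq using E_normsq_0_pos cbinom_pos[of n] by simp
  then show ?thesis using freq_pos[of n] by (simp add: zero_less_mult_iff)
qed

definition eigfn :: "nat \<Rightarrow> real \<Rightarrow> complex" where
  "eigfn n x = of_real (1 / sqrt (E_normsq n)) * Ec n x"

text \<open>
  The square of the boundary value of the normalised eigenfunction.
\<close>

definition bdry_sq :: "nat \<Rightarrow> real" where "bdry_sq n = 2 * freq n * cbinom n / E_normsq 0"

lemma bdry_sq_pos: "bdry_sq n > 0"
  unfolding bdry_sq_def using freq_pos[of n] cbinom_pos[of n] E_normsq_0_pos by simp

lemma sqrt_bdry_sq: "cbinom n / sqrt (E_normsq n) = sqrt (bdry_sq n)"
proof -
  have "bdry_sq n = (cbinom n)\<^sup>2 / E_normsq n"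
    using E_normsq_eq[of n] E_normsq_pos[of n] E_normsq_0_pos by (simp add: bdry_sq_def field_simps power2_eq_square)
  then show ?thesis using cbinom_pos[of n] by (simp add: real_sqrt_divide)
qed

lemma sq_int_eigfn: "sq_int wmeas (eigfn n)"
  unfolding eigfn_def[abs_def] by (rule sq_int_cmult[OF sq_int_Ec(1)])

lemma continuous_eigfn: "continuous_on S (eigfn n)"
  unfolding eigfn_def[abs_def] Ec_def by (intro continuous_intros continuous_E)

lemma eigfn_orthonormal: "ip wmeas (eigfn m) (eigfn n) = (if m = n then 1 else 0)"
proof -
  have "eigfn m x * cnj (eigfn n x) = of_real (1 / sqrt (E_normsq m) * (1 / sqrt (E_normsq n))) * (Ec m x * cnj (Ec n x))" for x
    by (simp add: eigfn_def)
  then have "ip wmeas (eigfn m) (eigfn n) = of_real (1 / sqrt (E_normsq m) * (1 / sqrt (E_normsq n))) * ip wmeas (Ec m) (Ec n)"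
    unfolding ip_def by (simp only: integral_mult_right_zero)
  also have "\<dots> = of_real (1 / sqrt (E_normsq m) * (1 / sqrt (E_normsq n)) * real_ip (E m) (E n))"
    by (simp add: ip_Ec)
  also have "1 / sqrt (E_normsq m) * (1 / sqrt (E_normsq n)) * real_ip (E m) (E n) = (if m = n then 1 else 0)"
    using real_ip_E_orthogonal[of m n] E_normsq_pos[of n] by (auto simp: E_normsq_def[symmetric])
  finally show ?thesis by simp
qed

lemma eigfn_ends: "eigfn n 0 = of_real (sqrt (bdry_sq n))" "eigfn n pi = of_real ((- 1) ^ n * sqrt (bdry_sq n))"
  unfolding sqrt_bdry_sq[symmetric] by (simp_all add: eigfn_def Ec_def E_at_ends)

lemma eigfn_bound: "x \<in> {0..pi} \<Longrightarrow> norm (eigfn n x) \<le> sqrt (bdry_sq n)"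
proof -
  assume "x \<in> {0..pi}"
  then have "\<bar>E n x\<bar> / sqrt (E_normsq n) \<le> cbinom n / sqrt (E_normsq n)"
    using E_bound[of x n] E_normsq_pos[of n] by (intro divide_right_mono) auto
  then show ?thesis
    unfolding sqrt_bdry_sq[symmetric] eigfn_def Ec_def norm_mult norm_of_real using E_normsq_pos[of n] by (simp add: less_imp_le)
qed

definition eigcoeff :: "(real \<Rightarrow> complex) \<Rightarrow> nat \<Rightarrow> complex" where "eigcoeff f n = ip wmeas f (eigfn n)"

lemma eigcoeff_Ec: "eigcoeff f n = of_real (1 / sqrt (E_normsq n)) * ip wmeas f (Ec n)"
proof -
  have "f x * cnj (eigfn n x) = of_real (1 / sqrt (E_normsq n)) * (f x * cnj (Ec n x))" for x by (simp add: eigfn_def)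
  then show ?thesis unfolding eigcoeff_def ip_def by (simp only: integral_mult_right_zero)
qed

lemma parseval_H:
  assumes "sq_int wmeas f"
  shows "(\<lambda>n. (norm (eigcoeff f n))\<^sup>2) sums nsq wmeas f"
  unfolding eigcoeff_def
proof (rule parseval_of_recurrence[where c = cos and a = 0 and b = pi, OF finite_measure_wmeas sets_wmeas])
  show "AE x in wmeas. x \<notin> N" if "N \<in> null_sets lebesgue" for N
    unfolding AE_wmeas by (rule AE_not_in_null_lebesgue_on[OF that]) simp
  show "inj_on cos {0..pi}" by (rule inj_onI) (auto intro: cos_inj_pi)
  have Esp: "Ec n \<in> fspan {0<..<pi} eigfn" for n
    by (rule fspan_cong[OF fspan_cmult[OF fspan_basis[of eigfn n], of "of_real (sqrt (E_normsq n))"]])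
       (use E_normsq_pos[of n] in \<open>simp add: eigfn_def\<close>)
  show "(\<lambda>x. 1) \<in> fspan {0<..<pi} eigfn" using Esp[of 0] by (simp add: Ec_def[abs_def] E_0)
  show "(\<lambda>x. of_real (cos x) * eigfn n x) \<in> fspan {0<..<pi} eigfn" for n
  proof (cases n)
    case 0
    show ?thesis
      by (rule fspan_cong[OF fspan_cmult[OF Esp[of "Suc 0"], of "of_real (2 / sqrt (E_normsq 0))"]])
         (simp add: 0 eigfn_def Ec_def E_0 E_1)
  next
    case (Suc m)
    let ?k = "2 * real m + 5 / 2"
    have "cos x * E n x = (real m + 2) / ?k * E (Suc n) x + (real m + 1 / 2) / ?k * E m x" for x
    proof -
      have k: "?k \<noteq> 0" by linarith
      have "cos x * E n x = ((real m + 2) * E (Suc n) x + (real m + 1 / 2) * E m x) / ?k"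
        unfolding E_recurrence[of m x, folded Suc, symmetric] using k by simp
      also have "\<dots> = (real m + 2) * E (Suc n) x / ?k + (real m + 1 / 2) * E m x / ?k" by (rule add_divide_distrib)
      finally show ?thesis by (simp only: times_divide_eq_left)
    qed
    then have "1 / sqrt (E_normsq n) * (cos x * E n x) = 1 / sqrt (E_normsq n) * ((real m + 2) / ?k * E (Suc n) x + (real m + 1 / 2) / ?k * E m x)" for x
      by simp
    then have "complex_of_real (1 / sqrt (E_normsq n) * (cos x * E n x)) = of_real (1 / sqrt (E_normsq n) * ((real m + 2) / ?k * E (Suc n) x + (real m + 1 / 2) / ?k * E m x))" for x
      by (simp only:)
    then have *: "of_real (cos x) * eigfn n x = of_real (1 / sqrt (E_normsq n)) * (of_real ((real m + 2) / ?k) * Ec (Suc n) x + of_real ((real m + 1 / 2) / ?k) * Ec m x)" for x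
      unfolding eigfn_def Ec_def by (simp only: of_real_mult of_real_add mult_ac)
    show ?thesis unfolding * by (intro fspan_cmult fspan_add Esp)
  qed
qed (use assms in \<open>auto intro!: sq_int_eigfn continuous_intros simp: eigfn_orthonormal\<close>)

lemma bessel_H:
  assumes "sq_int wmeas f"
  shows "(\<Sum>n<m. (norm (eigcoeff f n))\<^sup>2) \<le> nsq wmeas f"
  unfolding eigcoeff_def by (rule bessel_inequality[OF _ assms sq_int_eigfn eigfn_orthonormal]) simp

lemma Re_a0: "Re (a0 f f) = 4 * nsq wmeas (wderiv f)"
  using ip_self[of wmeas "wderiv f"] by (simp add: a0_def ip_def)

lemma normV_sq: "(normV f)\<^sup>2 = 4 * nsq wmeas (wderiv f) + nsq wmeas f"
  by (simp add: normV_def Re_a0 normH_sq nsq_nonneg)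

lemma normV_nonneg: "normV f \<ge> 0"
  by (simp add: normV_def Re_a0 normH_sq nsq_nonneg)

lemma freq_sq: "(freq n)\<^sup>2 = 4 * ev n + 1 / 4"
  by (simp add: freq_def ev_def power2_eq_square algebra_simps)

text \<open>
  The functions \<open>E' n\<close> for \<open>n > 0\<close> are again orthogonal, with squared norm \<open>ev n * E_normsq n\<close>, and
  \<open>weak_pairing\<close> identifies the coefficients of \<open>wderiv f\<close> with those of \<open>f\<close>. So this is Bessel's
  inequality for the derivative, added to that for the function.
\<close>

lemma energy_bessel:
  assumes f: "f \<in> V"
  shows "(\<Sum>n<m. (freq n)\<^sup>2 * (norm (eigcoeff f n))\<^sup>2) \<le> (normV f)\<^sup>2"
proof -
  note Vf = V_wderiv[OF f]
  define e where "e n x = of_real (1 / sqrt (ev n * E_normsq n)) * E'c n x" for n x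
  have evp: "ev n > 0" if "n > 0" for n using ev_strict_mono[OF that] by (simp add: ev_def)
  have e: "sq_int wmeas (e n)" for n unfolding e_def[abs_def] by (rule sq_int_cmult[OF sq_int_Ec(2)])
  have on: "ip wmeas (e i) (e j) = (if i = j then 1 else 0)" if "j > 0" for i j
  proof -
    have "e i x * cnj (e j x) = of_real (1 / sqrt (ev i * E_normsq i) * (1 / sqrt (ev j * E_normsq j))) * (E'c i x * cnj (E'c j x))" for x
      by (simp add: e_def)
    then have "ip wmeas (e i) (e j) = of_real (1 / sqrt (ev i * E_normsq i) * (1 / sqrt (ev j * E_normsq j))) * ip wmeas (E'c i) (E'c j)"
      unfolding ip_def by (simp only: integral_mult_right_zero)
    also have "\<dots> = of_real (1 / sqrt (ev i * E_normsq i) * (1 / sqrt (ev j * E_normsq j)) * (ev j * real_ip (E i) (E j)))"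
      by (simp only: ip_E'c real_ip_E' of_real_mult)
    also have "1 / sqrt (ev i * E_normsq i) * (1 / sqrt (ev j * E_normsq j)) * (ev j * real_ip (E i) (E j)) = (if i = j then 1 else 0)"
      using real_ip_E_orthogonal[of i j] E_normsq_pos[of j] evp[OF that] by (auto simp: E_normsq_def[symmetric] real_sqrt_mult[symmetric] simp del: real_sqrt_mult)
    finally show ?thesis by simp
  qed
  have c: "(norm (ip wmeas (wderiv f) (e n)))\<^sup>2 = ev n * (norm (eigcoeff f n))\<^sup>2" if "n > 0" for n
  proof -
    have "wderiv f x * cnj (e n x) = of_real (1 / sqrt (ev n * E_normsq n)) * (wderiv f x * cnj (E'c n x))" for x
      by (simp add: e_def)
    then have "ip wmeas (wderiv f) (e n) = of_real (1 / sqrt (ev n * E_normsq n)) * ip wmeas (wderiv f) (E'c n)"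
      unfolding ip_def by (simp only: integral_mult_right_zero)
    also have "\<dots> = of_real (1 / sqrt (ev n * E_normsq n) * ev n) * ip wmeas f (Ec n)"
      by (simp add: weak_pairing[OF f])
    also have "1 / sqrt (ev n * E_normsq n) * ev n = sqrt (ev n) * (1 / sqrt (E_normsq n))"
      using evp[OF that] E_normsq_pos[of n] by (simp add: real_sqrt_mult field_simps)
    also have "of_real (sqrt (ev n) * (1 / sqrt (E_normsq n))) * ip wmeas f (Ec n) = of_real (sqrt (ev n)) * eigcoeff f n"
      unfolding eigcoeff_Ec by (simp only: of_real_mult mult.assoc)
    finally show ?thesis using evp[OF that] by (simp add: norm_mult power_mult_distrib)
  qed
  have "(\<Sum>n<m. ev n * (norm (eigcoeff f n))\<^sup>2) = (\<Sum>n\<in>{0<..<m}. ev n * (norm (eigcoeff f n))\<^sup>2)"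
    by (rule sum.mono_neutral_right) (auto simp: ev_def)
  also have "\<dots> = (\<Sum>n\<in>{0<..<m}. (norm (ip wmeas (wderiv f) (e n)))\<^sup>2)"
    by (rule sum.cong) (auto simp: c)
  also have "\<dots> \<le> nsq wmeas (wderiv f)"
    by (rule bessel_inequality[OF _ Vf(2) e on]) auto
  finally have d: "(\<Sum>n<m. ev n * (norm (eigcoeff f n))\<^sup>2) \<le> nsq wmeas (wderiv f)" .
  have "(\<Sum>n<m. (freq n)\<^sup>2 * (norm (eigcoeff f n))\<^sup>2) = 4 * (\<Sum>n<m. ev n * (norm (eigcoeff f n))\<^sup>2) + 1 / 4 * (\<Sum>n<m. (norm (eigcoeff f n))\<^sup>2)"
    by (simp add: freq_sq distrib_right sum.distrib sum_distrib_left mult.assoc)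
  also have "\<dots> \<le> (normV f)\<^sup>2"
    unfolding normV_sq using d bessel_H[OF Vf(1), of m] nsq_nonneg[of wmeas f] by linarith
  finally show ?thesis .
qed

lemma sum_bdry_sq_freq: "(\<Sum>n<m. bdry_sq n / (freq n)\<^sup>2) \<le> 8 / E_normsq 0"
proof -
  have "bdry_sq n / (freq n)\<^sup>2 \<le> 8 / E_normsq 0 * (cbinom n - cbinom (Suc n))" for n
  proof -
    have "bdry_sq n / (freq n)\<^sup>2 = 1 / E_normsq 0 * (2 * cbinom n / freq n)"
      using freq_pos[of n] by (simp add: bdry_sq_def power2_eq_square)
    also have "\<dots> \<le> 1 / E_normsq 0 * (8 * (cbinom n - cbinom (Suc n)))"
    proof (rule mult_left_mono)
      have "2 * cbinom n / freq n \<le> 8 * (cbinom n / (2 * real n + 2))"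
        using cbinom_pos[of n] by (simp add: freq_def divide_simps) (simp add: algebra_simps)?
      then show "2 * cbinom n / freq n \<le> 8 * (cbinom n - cbinom (Suc n))" by (simp only: cbinom_diff)
    qed (use E_normsq_0_pos in simp)
    finally show ?thesis by simp
  qed
  then have "(\<Sum>n<m. bdry_sq n / (freq n)\<^sup>2) \<le> (\<Sum>n<m. 8 / E_normsq 0 * (cbinom n - cbinom (Suc n)))" by (rule sum_mono)
  also have "\<dots> = 8 / E_normsq 0 * (\<Sum>n<m. cbinom n - cbinom (Suc n))" by (rule sum_distrib_left[symmetric])
  also have "(\<Sum>n<m. cbinom n - cbinom (Suc n)) = cbinom 0 - cbinom m" by (rule sum_lessThan_telescope')
  also have "8 / E_normsq 0 * (cbinom 0 - cbinom m) \<le> 8 / E_normsq 0 * 1"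
    using E_normsq_0_pos cbinom_pos[of m] by (intro mult_left_mono) auto
  finally show ?thesis by simp
qed

text \<open>
  The trace is bounded on \<open>V\<close> by the Cauchy-Schwarz inequality, because
  \<open>bdry_sq n / (freq n)\<^sup>2\<close> is summable.
\<close>

lemma trace_sum_bound:
  assumes f: "f \<in> V"
  shows "(\<Sum>n<m. norm (eigcoeff f n) * sqrt (bdry_sq n)) \<le> sqrt (8 / E_normsq 0) * normV f"
proof -
  have "(\<Sum>n<m. norm (eigcoeff f n) * sqrt (bdry_sq n))\<^sup>2 = (\<Sum>n<m. (freq n * norm (eigcoeff f n)) * (sqrt (bdry_sq n) / freq n))\<^sup>2"
    using freq_pos by (intro arg_cong[where f = "\<lambda>y. y\<^sup>2"] sum.cong) (auto simp: less_imp_neq[symmetric])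
  also have "\<dots> \<le> (\<Sum>n<m. (freq n * norm (eigcoeff f n))\<^sup>2) * (\<Sum>n<m. (sqrt (bdry_sq n) / freq n)\<^sup>2)"
    by (rule Cauchy_Schwarz_ineq_sum)
  also have "\<dots> = (\<Sum>n<m. (freq n)\<^sup>2 * (norm (eigcoeff f n))\<^sup>2) * (\<Sum>n<m. bdry_sq n / (freq n)\<^sup>2)"
    using bdry_sq_pos by (simp add: power_mult_distrib power_divide less_imp_le)
  also have "\<dots> \<le> (normV f)\<^sup>2 * (8 / E_normsq 0)"
    using energy_bessel[OF f] sum_bdry_sq_freq E_normsq_0_pos by (intro mult_mono sum_nonneg) (auto intro!: divide_nonneg_nonneg less_imp_le[OF bdry_sq_pos])
  also have "\<dots> = (sqrt (8 / E_normsq 0) * normV f)\<^sup>2" using E_normsq_0_pos by (simp add: power_mult_distrib)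
  finally show ?thesis
    by (rule power2_le_imp_le) (use E_normsq_0_pos normV_nonneg in \<open>auto intro!: mult_nonneg_nonneg\<close>)
qed

lemma summable_trace:
  assumes f: "f \<in> V"
  shows "summable (\<lambda>n. norm (eigcoeff f n) * sqrt (bdry_sq n))"
  by (rule summableI_nonneg_bounded[OF _ trace_sum_bound[OF f]]) (simp add: less_imp_le[OF bdry_sq_pos])

lemma continuous_eq_of_AE:
  fixes g h :: "real \<Rightarrow> complex"
  assumes "continuous_on {0..pi} g" "continuous_on {0..pi} h" "AE x in lebesgue_on {0<..<pi}. g x = h x"
    and x: "x \<in> {0..pi}"
  shows "g x = h x"
proof -
  define Z where "Z = {x \<in> {0..pi}. g x - h x = 0}"
  have cl: "closed Z" unfolding Z_def
    by (rule continuous_closed_preimage_constant) (use assms in \<open>auto intro!: continuous_intros\<close>)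
  have "AE x in lebesgue. x \<in> {0<..<pi} \<longrightarrow> g x = h x"
    using assms(3) by (subst (asm) AE_restrict_space_iff) auto
  then have "AE x in lebesgue. x \<in> {0<..<pi} \<longrightarrow> x \<in> Z"
    by eventually_elim (auto simp: Z_def)
  then have "AE x\<in>{0<..<pi} in lebesgue. x \<in> Z" .
  then have "{0<..<pi} \<subseteq> Z"
    using mem_closed_if_AE_lebesgue_open[of "{0<..<pi}" Z] cl open_greaterThanLessThan by blast
  then have "closure {0<..<pi} \<subseteq> Z" using cl by (rule closure_minimal)
  then show ?thesis using x by (auto simp: Z_def)
qed

text \<open>
  The eigenfunction series converges uniformly on the closed interval, by \<open>trace_sum_bound\<close> and the
  fact that eigenfunctions are largest at the endpoints. So its sum is a continuous representative, and
  continuous representatives are unique.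
\<close>

lemma cont_rep_series:
  assumes f: "f \<in> V" and x: "x \<in> {0..pi}"
  shows "cont_rep f x = (\<Sum>n. eigcoeff f n * eigfn n x)"
proof -
  define F where "F x = (\<Sum>n. eigcoeff f n * eigfn n x)" for x
  define S where "S m x = (\<Sum>n<m. eigcoeff f n * eigfn n x)" for m x
  note fq = V_wderiv(1)[OF f]
  have "uniform_limit {0..pi} S F sequentially"
    unfolding S_def F_def
    by (rule Weierstrass_m_test[OF _ summable_trace[OF f]])
       (use eigfn_bound in \<open>auto simp: norm_mult intro!: mult_left_mono\<close>)
  note ul = this
  have Sc: "continuous_on A (S m)" for A m unfolding S_def[abs_def] by (intro continuous_intros continuous_eigfn)
  have Fc: "continuous_on {0..pi} F" by (rule uniform_limit_theorem[OF _ ul]) (auto intro!: always_eventually Sc)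
  interpret finite_measure wmeas by (rule finite_measure_wmeas)
  have Sq: "sq_int wmeas (S m)" for m unfolding S_def[abs_def] by (intro sq_int_sum sq_int_cmult sq_int_eigfn) simp
  have Fm: "F \<in> borel_measurable wmeas"
    unfolding measurable_wmeas
    by (rule continuous_imp_measurable_on_sets_lebesgue[OF continuous_on_subset[OF Fc]]) auto
  have "bounded (F ` {0..pi})" by (intro compact_imp_bounded compact_continuous_image Fc) simp
  then have "\<exists>B. \<forall>x\<in>{0..pi}. norm (F x) \<le> B" unfolding bounded_iff by auto
  then obtain B where B: "\<And>x. x \<in> {0..pi} \<Longrightarrow> norm (F x) \<le> B" by blast
  have Fq: "sq_int wmeas F"
    by (rule sq_int_bound[where g = "\<lambda>_. B\<^sup>2", OF Fm]) (use B in \<open>auto simp: space_wmeas intro!: power_mono\<close>)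
  have fF: "sq_int wmeas (\<lambda>x. f x - F x)" by (rule sq_int_diff[OF fq Fq])
  have "nsq wmeas (\<lambda>x. f x - F x) \<le> \<epsilon>" if eps: "\<epsilon> > 0" for \<epsilon>
  proof -
    define W0 where "W0 = measure wmeas (space wmeas)"
    define \<delta> where "\<delta> = sqrt (\<epsilon> / (4 * (W0 + 1)))"
    have W0: "W0 \<ge> 0" by (simp add: W0_def)
    have \<delta>: "\<delta> > 0" using eps W0 by (simp add: \<delta>_def add_nonneg_pos)
    have 1: "\<forall>\<^sub>F m in sequentially. \<forall>x\<in>{0..pi}. dist (S m x) (F x) < \<delta>"
      using ul \<delta> by (rule uniform_limitD)
    have id: "nsq wmeas (\<lambda>x. f x - S m x) = nsq wmeas f - (\<Sum>n<m. (norm (eigcoeff f n))\<^sup>2)" for m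
      using bessel_identity[OF _ fq sq_int_eigfn eigfn_orthonormal, of "{..<m}" "eigcoeff f"] by (simp add: S_def eigcoeff_def)
    have "(\<lambda>m. nsq wmeas f - (\<Sum>n<m. (norm (eigcoeff f n))\<^sup>2)) \<longlonglongrightarrow> nsq wmeas f - nsq wmeas f"
      using parseval_H[OF fq] by (intro tendsto_intros) (simp add: sums_def)
    then have 2: "\<forall>\<^sub>F m in sequentially. nsq wmeas (\<lambda>x. f x - S m x) < \<epsilon> / 4"
      unfolding id using eps by (intro order_tendstoD(2)) auto
    obtain m where m: "\<forall>x\<in>{0..pi}. dist (S m x) (F x) < \<delta>" "nsq wmeas (\<lambda>x. f x - S m x) < \<epsilon> / 4"
      using eventually_happens'[OF sequentially_bot eventually_conj[OF 1 2]] by blast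
    have i1: "integrable wmeas (\<lambda>x. (norm (f x - S m x))\<^sup>2)" using sq_int_diff[OF fq Sq] by (simp add: sq_int_def)
    have "nsq wmeas (\<lambda>x. f x - F x) \<le> (LINT x|wmeas. 2 * (norm (f x - S m x))\<^sup>2 + 2 * \<delta>\<^sup>2)"
      unfolding nsq_def
    proof (rule integral_mono)
      show "integrable wmeas (\<lambda>x. (norm (f x - F x))\<^sup>2)" using fF by (simp add: sq_int_def)
      show "integrable wmeas (\<lambda>x. 2 * (norm (f x - S m x))\<^sup>2 + 2 * \<delta>\<^sup>2)" using i1 by simp
      fix x assume "x \<in> space wmeas"
      then have "norm (S m x - F x) \<le> \<delta>" using m(1) by (auto simp: space_wmeas dist_norm intro: less_imp_le)
      then have "(norm (S m x - F x))\<^sup>2 \<le> \<delta>\<^sup>2" by (intro power_mono) auto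
      then show "(norm (f x - F x))\<^sup>2 \<le> 2 * (norm (f x - S m x))\<^sup>2 + 2 * \<delta>\<^sup>2"
        using norm_add_sq_le[of "f x - S m x" "S m x - F x"] by simp
    qed
    also have "\<dots> = 2 * nsq wmeas (\<lambda>x. f x - S m x) + 2 * \<delta>\<^sup>2 * W0"
      using i1 by (simp add: nsq_def W0_def)
    also have "2 * \<delta>\<^sup>2 * W0 \<le> \<epsilon> / 2"
    proof -
      have "2 * \<delta>\<^sup>2 * W0 \<le> 2 * \<delta>\<^sup>2 * (W0 + 1)" by (intro mult_left_mono) auto
      also have "\<dots> = \<epsilon> / 2"
      proof -
        have "2 * (sqrt (\<epsilon> / (4 * w)))\<^sup>2 * w = \<epsilon> / 2" if "w > 0" for w using that eps by simp
        moreover have "W0 + 1 > 0" using W0 by simp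
        ultimately show ?thesis unfolding \<delta>_def by blast
      qed
      finally show ?thesis .
    qed
    finally show ?thesis using m(2) by simp
  qed
  note small = this
  have "nsq wmeas (\<lambda>x. f x - F x) \<le> 0"
  proof (rule field_le_epsilon)
    fix e :: real assume "e > 0"
    from small[OF this] show "nsq wmeas (\<lambda>x. f x - F x) \<le> 0 + e" by simp
  qed
  then have "nsq wmeas (\<lambda>x. f x - F x) = 0" using nsq_nonneg[of wmeas "\<lambda>x. f x - F x"] by linarith
  from nsq_eq_0_imp_AE[OF fF this] have "AE x in lebesgue_on {0<..<pi}. f x = F x"
    unfolding AE_wmeas by eventually_elim simp
  with Fc have ex: "continuous_on {0..pi} F \<and> (AE x in lebesgue_on {0<..<pi}. f x = F x)" by blast
  have sel: "continuous_on {0..pi} (cont_rep f) \<and> (AE x in lebesgue_on {0<..<pi}. f x = cont_rep f x)"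
    unfolding cont_rep_def by (rule someI[of _ F]) (rule ex)
  have "AE x in lebesgue_on {0<..<pi}. cont_rep f x = F x"
    using conjunct2[OF ex] conjunct2[OF sel] by eventually_elim simp
  from continuous_eq_of_AE[OF _ Fc this x] sel show ?thesis by (simp add: F_def)
qed

text \<open>
  The boundary values of \<open>f\<close> as series, at \<open>0\<close> for \<open>s = 1\<close> and at \<open>pi\<close> for \<open>s = -1\<close>.
\<close>

definition end_trace :: "real \<Rightarrow> (real \<Rightarrow> complex) \<Rightarrow> complex" where
  "end_trace s f = (\<Sum>n. of_real (s ^ n * sqrt (bdry_sq n)) * eigcoeff f n)"

lemma Ctr_eq:
  assumes "f \<in> V"
  shows "Ctr f $ 1 = end_trace 1 f" "Ctr f $ 2 = end_trace (- 1) f"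
  using cont_rep_series[OF assms, of 0] cont_rep_series[OF assms, of pi]
  by (simp_all add: Ctr_def end_trace_def eigfn_ends mult.commute)

lemma end_trace_sums:
  assumes "f \<in> V" "\<bar>s\<bar> = 1"
  shows "(\<lambda>n. of_real (s ^ n * sqrt (bdry_sq n)) * eigcoeff f n) sums end_trace s f"
    "norm (\<Sum>n<m. of_real (s ^ n * sqrt (bdry_sq n)) * eigcoeff f n) \<le> sqrt (8 / E_normsq 0) * normV f"
proof -
  have nt: "norm (of_real (s ^ n * sqrt (bdry_sq n)) * eigcoeff f n) = norm (eigcoeff f n) * sqrt (bdry_sq n)" for n
    unfolding norm_mult norm_of_real using assms(2) less_imp_le[OF bdry_sq_pos] by (simp add: abs_mult power_abs)
  have "summable (\<lambda>n. norm (of_real (s ^ n * sqrt (bdry_sq n)) * eigcoeff f n))"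
    unfolding nt by (rule summable_trace[OF assms(1)])
  then have "summable (\<lambda>n. of_real (s ^ n * sqrt (bdry_sq n)) * eigcoeff f n)" by (rule summable_norm_cancel)
  then show "(\<lambda>n. of_real (s ^ n * sqrt (bdry_sq n)) * eigcoeff f n) sums end_trace s f" unfolding end_trace_def by (rule summable_sums)
  show "norm (\<Sum>n<m. of_real (s ^ n * sqrt (bdry_sq n)) * eigcoeff f n) \<le> sqrt (8 / E_normsq 0) * normV f"
    by (rule order_trans[OF norm_sum]) (simp only: nt trace_sum_bound[OF assms(1)])
qed

section \<open>The Carleman estimate for the modes\<close>

text \<open>
  The complex frequency seen by the \<open>k\<close>-th Fourier coefficient of \<open>exp (- tau N * t) * v\<close>.
\<close>

definition zfreq :: "nat \<Rightarrow> real \<Rightarrow> int \<Rightarrow> complex" where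
  "zfreq N L k = Complex (tau N) (of_int k * pi / L)"

lemma Re_zfreq: "Re (zfreq N L k) = tau N"
  by (simp add: zfreq_def)

lemma norm_zfreq: "norm (zfreq N L k) \<ge> tau N" "norm (zfreq N L k) \<ge> 1"
  using abs_Re_le_cmod[of "zfreq N L k"] tau_ge_1[of N] by (simp_all add: Re_zfreq)

text \<open>
  The constants of the Carleman estimate. The first one is chosen so that the coupling term has
  coefficient at most \<open>1/2\<close> once \<open>tau N\<close> is at least \<open>tau_threshold * \<mu>\<^sup>2\<close>.
\<close>

definition tau_threshold :: real where "tau_threshold = 48 * (64 / E_normsq 0)\<^sup>2"
definition trace_const :: real where "trace_const = 23040 / E_normsq 0"
definition carleman_const :: real where "carleman_const = 768 * trace_const / (E_normsq 0 * tau_threshold) + 80"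

lemma tau_threshold_pos: "tau_threshold > 0" and trace_const_pos: "trace_const > 0" and carleman_const_pos: "carleman_const > 0"
proof -
  show k: "tau_threshold > 0" using E_normsq_0_pos by (simp add: tau_threshold_def)
  show k1: "trace_const > 0" using E_normsq_0_pos by (simp add: trace_const_def)
  show "carleman_const > 0" using k k1 E_normsq_0_pos by (simp add: carleman_const_def add_pos_pos)
qed

lemma trace_resolvent_bdry_sq:
  fixes N :: nat and L :: real
  assumes s: "s = 1 \<or> s = (- 1 :: real)"
  defines "T \<equiv> \<lambda>k n. of_real (s ^ n * bdry_sq n) / ((zfreq N L k)\<^sup>2 - of_real ((freq n)\<^sup>2))"
  shows "(\<lambda>m. \<Sum>n<m. T k n) \<longlonglongrightarrow> suminf (T k)" "(norm (suminf (T k)))\<^sup>2 \<le> (64 / E_normsq 0)\<^sup>2 / tau N"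
proof -
  let ?U = "\<lambda>n. of_real (s ^ n * freq n * cbinom n) / ((zfreq N L k)\<^sup>2 - of_real ((freq n)\<^sup>2))"
  note b = trace_resolvent_bound[OF Re_zfreq[of N L k] s]
  have sU: "summable ?U" by (rule summable_norm_cancel[OF b(1)])
  have TU: "T k = (\<lambda>n. of_real (2 / E_normsq 0) * ?U n)"
    by (simp add: T_def bdry_sq_def fun_eq_iff mult_ac)
  have sT: "summable (T k)" unfolding TU by (rule summable_mult[OF sU])
  then show "(\<lambda>m. \<Sum>n<m. T k n) \<longlonglongrightarrow> suminf (T k)" by (rule summable_LIMSEQ)
  have "suminf (T k) = of_real (2 / E_normsq 0) * suminf ?U" unfolding TU by (rule suminf_mult[OF sU])
  then have "norm (suminf (T k)) = 2 / E_normsq 0 * norm (suminf ?U)"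
    unfolding norm_mult norm_of_real using E_normsq_0_pos by (simp only: norm_mult norm_of_real) simp
  also have "\<dots> \<le> 2 / E_normsq 0 * (32 / sqrt (tau N))"
    using b(2) E_normsq_0_pos by (intro mult_left_mono) auto
  finally have "(norm (suminf (T k)))\<^sup>2 \<le> (2 / E_normsq 0 * (32 / sqrt (tau N)))\<^sup>2" by (rule power_mono) simp
  also have "\<dots> = (64 / E_normsq 0)\<^sup>2 / tau N"
    using tau_ge_1[of N] by (simp add: power_mult_distrib power_divide)
  finally show "(norm (suminf (T k)))\<^sup>2 \<le> (64 / E_normsq 0)\<^sup>2 / tau N" .
qed

lemma bdry_sq_resolvent_square:
  "(\<Sum>n<m. bdry_sq n * (norm (zfreq N L k))\<^sup>2 / (norm ((zfreq N L k)\<^sup>2 - of_real ((freq n)\<^sup>2)))\<^sup>2) \<le> 48 / E_normsq 0 * sqrt (tau N)"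
proof -
  have "(\<Sum>n<m. bdry_sq n * (norm (zfreq N L k))\<^sup>2 / (norm ((zfreq N L k)\<^sup>2 - of_real ((freq n)\<^sup>2)))\<^sup>2)
    = 2 / E_normsq 0 * (\<Sum>n<m. freq n * cbinom n * (norm (zfreq N L k))\<^sup>2 / (norm ((zfreq N L k)\<^sup>2 - of_real ((freq n)\<^sup>2)))\<^sup>2)"
    unfolding sum_distrib_left by (rule sum.cong) (simp_all add: bdry_sq_def)
  also have "\<dots> \<le> 2 / E_normsq 0 * (24 * sqrt (tau N))"
    using E_normsq_0_pos by (intro mult_left_mono resolvent_square_bound[OF Re_zfreq]) auto
  finally show ?thesis by simp
qed

lemma norm_add3_sq_le: "(norm (x + y + w))\<^sup>2 \<le> 3 * (norm x)\<^sup>2 + 3 * (norm y)\<^sup>2 + 3 * (norm (w::complex))\<^sup>2"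
proof -
  have "(norm (x + y + w))\<^sup>2 \<le> (norm x + norm y + norm w)\<^sup>2"
    by (intro power_mono order_trans[OF norm_triangle_ineq] add_mono norm_triangle_ineq) auto
  also have "\<dots> \<le> 3 * (norm x)\<^sup>2 + 3 * (norm y)\<^sup>2 + 3 * (norm w)\<^sup>2"
    using two_mult_norm_le[of x y] two_mult_norm_le[of y w] two_mult_norm_le[of x w]
    by (simp add: power2_eq_square algebra_simps)
  finally show ?thesis .
qed

text \<open>
  The heart of the proof. The functions \<open>v n\<close> are the localised weighted modes, \<open>f1 n\<close> and \<open>f2 n\<close>
  the modes with \<open>\<psi>'\<close> and \<open>\<psi>''\<close> in place of \<open>\<psi>\<close>, and \<open>c\<close>, \<open>h\<close> the traces and the boundary fluxes
  at the two ends \<open>s = 1\<close> and \<open>s = -1\<close>. Solve each mode by division by the symbol. Summation over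
  modes expresses the traces through the fluxes, with the compressed resolvent as coefficient, and
  through the sources \<open>f1\<close>, \<open>f2\<close>. As \<open>h\<close> is bounded by \<open>\<mu>\<close> times \<open>c\<close> and the coefficient is
  \<open>O (1 / sqrt \<tau>)\<close>, the flux term is absorbed for \<open>\<tau>\<close> large compared with \<open>\<mu>\<^sup>2\<close>. This bounds the
  traces by \<open>sqrt \<tau> * B\<close>, and the modes follow by inserting the fluxes into the solved equations:
  the powers of \<open>\<tau>\<close> cancel against \<open>\<mu>\<^sup>2 \<le> \<tau> / tau_threshold\<close>.
\<close>

lemma carleman_modes:
  fixes v f1 f2 :: "nat \<Rightarrow> real \<Rightarrow> complex" and c h :: "real \<Rightarrow> real \<Rightarrow> complex" and a L :: real and N :: nat
  defines "M \<equiv> lebesgue_on {a<..<a+L}"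
  assumes L: "L > 0"
    and sqv: "\<And>n. sq_int M (v n)" and sqf1: "\<And>n. sq_int M (f1 n)" and sqf2: "\<And>n. sq_int M (f2 n)"
    and sqc: "\<And>s. sq_int M (c s)" and sqh: "\<And>s. sq_int M (h s)"
    and modes: "\<And>n k. ((zfreq N L k)\<^sup>2 - of_real ((freq n)\<^sup>2)) * fourier a L (v n) k
       = of_real (sqrt (bdry_sq n)) * (fourier a L (h 1) k + of_real ((- 1) ^ n) * fourier a L (h (- 1)) k)
         + 2 * zfreq N L k * fourier a L (f1 n) k - fourier a L (f2 n) k"
    and trace: "\<And>s k. s = 1 \<or> s = - 1 \<Longrightarrow> (\<lambda>n. of_real (s ^ n * sqrt (bdry_sq n)) * fourier a L (v n) k) sums fourier a L (c s) k"
    and coupling: "nsq M (h 1) + nsq M (h (- 1)) \<le> \<mu>\<^sup>2 * (nsq M (c 1) + nsq M (c (- 1)))"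
    and B1: "\<And>m. (\<Sum>n<m. nsq M (f1 n)) \<le> B" and B2: "\<And>m. (\<Sum>n<m. nsq M (f2 n)) \<le> B"
    and tau: "tau N \<ge> tau_threshold * \<mu>\<^sup>2"
  shows "(\<Sum>n<m. nsq M (v n)) \<le> carleman_const * B"
proof -
  let ?F = "fourier a L"
  define z where "z k = zfreq N L k" for k
  define D where "D k n = (z k)\<^sup>2 - of_real ((freq n)\<^sup>2)" for k n
  define q where "q k n = 2 * z k * ?F (f1 n) k - ?F (f2 n) k" for k n
  define \<tau> where "\<tau> = tau N"
  define h0 where "h0 = E_normsq 0"
  \<comment> \<open>\<open>S\<close> majorises the commutator terms \<open>q\<close> relative to \<open>norm z\<close>.\<close>
  define S where "S k n = 8 * (norm (?F (f1 n) k))\<^sup>2 + 2 * (norm (?F (f2 n) k))\<^sup>2" for k n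
  have h0: "h0 > 0" using E_normsq_0_pos by (simp add: h0_def)
  have \<tau>: "\<tau> \<ge> 1" using tau_ge_1[of N] by (simp add: \<tau>_def)
  have B0: "B \<ge> 0" using B1[of 0] by simp
  have D: "norm (z k) \<le> norm (D k n)" "1 \<le> norm (D k n)" "D k n \<noteq> 0" for k n
    using norm_symbol_ge[OF Re_zfreq[of N L k], of n] z_ne_freq(3)[OF Re_zfreq[of N L k], of n] by (simp_all add: D_def z_def)
  have zn: "norm (z k) \<ge> \<tau>" "norm (z k) \<ge> 1" for k using norm_zfreq by (simp_all add: z_def \<tau>_def)
  have vk: "?F (v n) k = of_real (sqrt (bdry_sq n)) * (?F (h 1) k + of_real ((- 1) ^ n) * ?F (h (- 1)) k) / D k n + q k n / D k n" for n k
  proof -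
    have "D k n * ?F (v n) k = of_real (sqrt (bdry_sq n)) * (?F (h 1) k + of_real ((- 1) ^ n) * ?F (h (- 1)) k) + q k n"
      using modes[of k n] unfolding z_def[symmetric] D_def[symmetric] q_def by simp
    then have "?F (v n) k = (of_real (sqrt (bdry_sq n)) * (?F (h 1) k + of_real ((- 1) ^ n) * ?F (h (- 1)) k) + q k n) / D k n"
      using D(3)[of k n] by (simp only: nonzero_eq_divide_eq mult.commute not_False_eq_True)
    then show ?thesis by (simp only: add_divide_distrib)
  qed
  have q: "(norm (q k n))\<^sup>2 \<le> (norm (z k))\<^sup>2 * S k n" for k n
  proof -
    have "(norm (q k n))\<^sup>2 \<le> 2 * (norm (2 * z k * ?F (f1 n) k))\<^sup>2 + 2 * (norm (- ?F (f2 n) k))\<^sup>2"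
      unfolding q_def diff_conv_add_uminus by (rule norm_add_sq_le)
    also have "\<dots> = 8 * ((norm (z k))\<^sup>2 * (norm (?F (f1 n) k))\<^sup>2) + 2 * (1 * (norm (?F (f2 n) k))\<^sup>2)"
      by (simp add: norm_mult power_mult_distrib)
    also have "\<dots> \<le> 8 * ((norm (z k))\<^sup>2 * (norm (?F (f1 n) k))\<^sup>2) + 2 * ((norm (z k))\<^sup>2 * (norm (?F (f2 n) k))\<^sup>2)"
      using zn(2)[of k] by (intro add_left_mono mult_left_mono mult_right_mono) (auto intro: one_le_power)
    finally show ?thesis by (simp add: S_def algebra_simps)
  qed
  have Ssum: "(\<Sum>k\<in>K. \<Sum>n<m. S k n) \<le> 20 * L * B" if K: "finite K" for K m
  proof -
    have f: "(\<Sum>k\<in>K. \<Sum>n<m. (norm (?F (g n) k))\<^sup>2) \<le> 2 * L * B"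
      if g: "\<And>n. sq_int M (g n)" and gB: "(\<Sum>n<m. nsq M (g n)) \<le> B" for g
    proof -
      have "(\<Sum>k\<in>K. \<Sum>n<m. (norm (?F (g n) k))\<^sup>2) = (\<Sum>n<m. \<Sum>k\<in>K. (norm (?F (g n) k))\<^sup>2)" by (rule sum.swap)
      also have "\<dots> \<le> (\<Sum>n<m. 2 * L * nsq M (g n))"
        unfolding M_def by (intro sum_mono fourier_bessel L K) (use g in \<open>simp add: M_def\<close>)
      also have "\<dots> = 2 * L * (\<Sum>n<m. nsq M (g n))" by (rule sum_distrib_left[symmetric])
      also have "\<dots> \<le> 2 * L * B" using L gB by (intro mult_left_mono) auto
      finally show ?thesis .
    qed
    have "(\<Sum>k\<in>K. \<Sum>n<m. S k n) = 8 * (\<Sum>k\<in>K. \<Sum>n<m. (norm (?F (f1 n) k))\<^sup>2) + 2 * (\<Sum>k\<in>K. \<Sum>n<m. (norm (?F (f2 n) k))\<^sup>2)"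
      by (simp only: S_def sum.distrib sum_distrib_left)
    then show ?thesis using f[OF sqf1 B1[of m]] f[OF sqf2 B2[of m]] by simp
  qed
  have hb: "(\<Sum>k\<in>K. (norm (?F (h s) k))\<^sup>2) \<le> 2 * L * nsq M (h s)" if "finite K" for K s
    unfolding M_def by (rule fourier_bessel[OF L _ that]) (use sqh in \<open>simp add: M_def\<close>)
  define Hs where "Hs = nsq M (h 1) + nsq M (h (- 1))"
  define Cs where "Cs = nsq M (c 1) + nsq M (c (- 1))"
  have Hs0: "Hs \<ge> 0" "Cs \<ge> 0" by (simp_all add: Hs_def Cs_def nsq_nonneg)
  have HC: "Hs \<le> \<mu>\<^sup>2 * Cs" using coupling by (simp add: Hs_def Cs_def)
  define Q0 where "Q0 = 48 / h0 * sqrt \<tau> * (20 * L * B)"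

  \<comment> \<open>The traces through fluxes and sources: the first two terms carry the compressed resolvents with signs \<open>s\<close> and \<open>- s\<close>, the last one is estimated by the Cauchy-Schwarz inequality over the modes.\<close>
  have cbound: "(\<Sum>k\<in>K. (norm (?F (c s) k))\<^sup>2) \<le> 3 * ((64 / h0)\<^sup>2 / \<tau>) * (2 * L * Hs) + 3 * Q0"
    if K: "finite K" and s: "s = 1 \<or> s = - 1" for K s
  proof -
    define T where "T \<sigma> k n = of_real (\<sigma> ^ n * bdry_sq n) / D k n" for \<sigma> :: real and k n
    define Qm where "Qm m k = (\<Sum>n<m. of_real (s ^ n * sqrt (bdry_sq n)) * q k n / D k n)" for m k
    define P where "P m k = (\<Sum>n<m. of_real (s ^ n * sqrt (bdry_sq n)) * ?F (v n) k)" for m k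
    have ms: "- s = 1 \<or> - s = - 1" using s by auto
    have P: "P m k = (\<Sum>n<m. T s k n) * ?F (h 1) k + (\<Sum>n<m. T (- s) k n) * ?F (h (- 1)) k + Qm m k" for m k
      unfolding P_def Qm_def sum_distrib_right sum.distrib[symmetric]
    proof (rule sum.cong[OF refl])
      fix n
      have sq: "complex_of_real (sqrt (bdry_sq n)) * complex_of_real (sqrt (bdry_sq n)) = of_real (bdry_sq n)"
        using bdry_sq_pos[of n] by (simp flip: of_real_mult)
      have "of_real (s ^ n * sqrt (bdry_sq n)) * ?F (v n) k
        = of_real (s ^ n) * (complex_of_real (sqrt (bdry_sq n)) * complex_of_real (sqrt (bdry_sq n))) * (?F (h 1) k + of_real ((- 1) ^ n) * ?F (h (- 1)) k) / D k n + of_real (s ^ n * sqrt (bdry_sq n)) * q k n / D k n"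
        unfolding vk by (simp add: algebra_simps)
      also have "\<dots> = T s k n * ?F (h 1) k + T (- s) k n * ?F (h (- 1)) k + of_real (s ^ n * sqrt (bdry_sq n)) * q k n / D k n"
        unfolding sq T_def power_minus[of s n] by (simp add: algebra_simps add_divide_distrib)
      finally show "of_real (s ^ n * sqrt (bdry_sq n)) * ?F (v n) k
        = T s k n * ?F (h 1) k + T (- s) k n * ?F (h (- 1)) k + of_real (s ^ n * sqrt (bdry_sq n)) * q k n / D k n" .
    qed
    have Qb: "(norm (Qm m k))\<^sup>2 \<le> 48 / h0 * sqrt \<tau> * (\<Sum>n<m. S k n)" for m k
    proof -
      have "norm (Qm m k) \<le> (\<Sum>n<m. (sqrt (bdry_sq n) * norm (z k) / norm (D k n)) * (norm (q k n) / norm (z k)))"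
        unfolding Qm_def
      proof (rule order_trans[OF norm_sum], rule sum_mono)
        fix n
        have z0: "norm (z k) > 0" using zn(2)[of k] by linarith
        have "norm (of_real (s ^ n * sqrt (bdry_sq n)) * q k n / D k n) = sqrt (bdry_sq n) * norm (q k n) / norm (D k n)"
          unfolding norm_divide norm_mult norm_of_real abs_mult using s bdry_sq_pos[of n] by (auto simp: power_abs)
        then show "norm (of_real (s ^ n * sqrt (bdry_sq n)) * q k n / D k n) \<le> (sqrt (bdry_sq n) * norm (z k) / norm (D k n)) * (norm (q k n) / norm (z k))"
          using z0 by (simp only:) simp
      qed
      then have "(norm (Qm m k))\<^sup>2 \<le> (\<Sum>n<m. (sqrt (bdry_sq n) * norm (z k) / norm (D k n)) * (norm (q k n) / norm (z k)))\<^sup>2"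
        by (rule power_mono) simp
      also have "\<dots> \<le> (\<Sum>n<m. (sqrt (bdry_sq n) * norm (z k) / norm (D k n))\<^sup>2) * (\<Sum>n<m. (norm (q k n) / norm (z k))\<^sup>2)"
        by (rule Cauchy_Schwarz_ineq_sum)
      also have "\<dots> \<le> (48 / h0 * sqrt \<tau>) * (\<Sum>n<m. S k n)"
      proof (rule mult_mono)
        have "(sqrt (bdry_sq n) * norm (z k) / norm (D k n))\<^sup>2 = bdry_sq n * (norm (z k))\<^sup>2 / (norm (D k n))\<^sup>2" for n
          using bdry_sq_pos[of n] by (simp add: power_mult_distrib power_divide)
        then show "(\<Sum>n<m. (sqrt (bdry_sq n) * norm (z k) / norm (D k n))\<^sup>2) \<le> 48 / h0 * sqrt \<tau>"
          using bdry_sq_resolvent_square[where m = m and N = N and L = L and k = k] by (simp only: z_def D_def h0_def \<tau>_def)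
        show "(\<Sum>n<m. (norm (q k n) / norm (z k))\<^sup>2) \<le> (\<Sum>n<m. S k n)"
        proof (rule sum_mono)
          fix n
          have "norm (z k) > 0" using zn(2)[of k] by linarith
          then show "(norm (q k n) / norm (z k))\<^sup>2 \<le> S k n"
            using q[of k n] by (simp add: power_divide divide_le_eq mult.commute)
        qed
      qed (use h0 \<tau> in \<open>auto intro!: sum_nonneg\<close>)
      finally show ?thesis .
    qed
    have Ts: "(\<lambda>m. \<Sum>n<m. T \<sigma> k n) \<longlonglongrightarrow> suminf (T \<sigma> k)" "(norm (suminf (T \<sigma> k)))\<^sup>2 \<le> (64 / h0)\<^sup>2 / \<tau>"
      if "\<sigma> = 1 \<or> \<sigma> = - 1" for \<sigma> k
      using trace_resolvent_bdry_sq[OF that, where N = N and L = L and k = k]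
      by (simp_all add: T_def[abs_def] D_def z_def h0_def \<tau>_def)
    have "(\<lambda>m. \<Sum>k\<in>K. (norm (P m k))\<^sup>2) \<longlonglongrightarrow> (\<Sum>k\<in>K. (norm (?F (c s) k))\<^sup>2)"
      using trace[OF s] unfolding sums_def P_def by (intro tendsto_intros) auto
    moreover have "(\<lambda>m. (\<Sum>k\<in>K. 3 * ((norm (\<Sum>n<m. T s k n))\<^sup>2 * (norm (?F (h 1) k))\<^sup>2) + 3 * ((norm (\<Sum>n<m. T (- s) k n))\<^sup>2 * (norm (?F (h (- 1)) k))\<^sup>2)) + 3 * Q0)
       \<longlonglongrightarrow> (\<Sum>k\<in>K. 3 * ((norm (suminf (T s k)))\<^sup>2 * (norm (?F (h 1) k))\<^sup>2) + 3 * ((norm (suminf (T (- s) k)))\<^sup>2 * (norm (?F (h (- 1)) k))\<^sup>2)) + 3 * Q0"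
      by (intro tendsto_intros Ts s ms)
    moreover have "(\<Sum>k\<in>K. (norm (P m k))\<^sup>2) \<le> (\<Sum>k\<in>K. 3 * ((norm (\<Sum>n<m. T s k n))\<^sup>2 * (norm (?F (h 1) k))\<^sup>2) + 3 * ((norm (\<Sum>n<m. T (- s) k n))\<^sup>2 * (norm (?F (h (- 1)) k))\<^sup>2)) + 3 * Q0" for m
    proof -
      have "(\<Sum>k\<in>K. (norm (P m k))\<^sup>2) \<le> (\<Sum>k\<in>K. (3 * ((norm (\<Sum>n<m. T s k n))\<^sup>2 * (norm (?F (h 1) k))\<^sup>2) + 3 * ((norm (\<Sum>n<m. T (- s) k n))\<^sup>2 * (norm (?F (h (- 1)) k))\<^sup>2)) + 3 * (48 / h0 * sqrt \<tau> * (\<Sum>n<m. S k n)))"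
      proof (rule sum_mono)
        fix k
        show "(norm (P m k))\<^sup>2 \<le> (3 * ((norm (\<Sum>n<m. T s k n))\<^sup>2 * (norm (?F (h 1) k))\<^sup>2) + 3 * ((norm (\<Sum>n<m. T (- s) k n))\<^sup>2 * (norm (?F (h (- 1)) k))\<^sup>2)) + 3 * (48 / h0 * sqrt \<tau> * (\<Sum>n<m. S k n))"
          using norm_add3_sq_le[of "(\<Sum>n<m. T s k n) * ?F (h 1) k" "(\<Sum>n<m. T (- s) k n) * ?F (h (- 1)) k" "Qm m k"] Qb[of m k]
          unfolding P norm_mult power_mult_distrib by linarith
      qed
      also have "\<dots> = (\<Sum>k\<in>K. 3 * ((norm (\<Sum>n<m. T s k n))\<^sup>2 * (norm (?F (h 1) k))\<^sup>2) + 3 * ((norm (\<Sum>n<m. T (- s) k n))\<^sup>2 * (norm (?F (h (- 1)) k))\<^sup>2)) + 3 * (48 / h0 * sqrt \<tau> * (\<Sum>k\<in>K. \<Sum>n<m. S k n))"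
        by (simp only: sum.distrib sum_distrib_left)
      also have "3 * (48 / h0 * sqrt \<tau> * (\<Sum>k\<in>K. \<Sum>n<m. S k n)) \<le> 3 * Q0"
        unfolding Q0_def using h0 \<tau> by (intro mult_left_mono Ssum K) auto
      finally show ?thesis by simp
    qed
    ultimately have "(\<Sum>k\<in>K. (norm (?F (c s) k))\<^sup>2) \<le> (\<Sum>k\<in>K. 3 * ((norm (suminf (T s k)))\<^sup>2 * (norm (?F (h 1) k))\<^sup>2) + 3 * ((norm (suminf (T (- s) k)))\<^sup>2 * (norm (?F (h (- 1)) k))\<^sup>2)) + 3 * Q0"
      by (intro LIMSEQ_le) auto
    also have "(\<Sum>k\<in>K. 3 * ((norm (suminf (T s k)))\<^sup>2 * (norm (?F (h 1) k))\<^sup>2) + 3 * ((norm (suminf (T (- s) k)))\<^sup>2 * (norm (?F (h (- 1)) k))\<^sup>2))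
      \<le> (\<Sum>k\<in>K. 3 * (((64 / h0)\<^sup>2 / \<tau>) * (norm (?F (h 1) k))\<^sup>2) + 3 * (((64 / h0)\<^sup>2 / \<tau>) * (norm (?F (h (- 1)) k))\<^sup>2))"
      by (intro sum_mono add_mono mult_left_mono mult_right_mono Ts s ms) auto
    also have "\<dots> = 3 * ((64 / h0)\<^sup>2 / \<tau>) * ((\<Sum>k\<in>K. (norm (?F (h 1) k))\<^sup>2) + (\<Sum>k\<in>K. (norm (?F (h (- 1)) k))\<^sup>2))"
      by (simp only: sum.distrib sum_distrib_left distrib_left mult.assoc)
    also have "\<dots> \<le> 3 * ((64 / h0)\<^sup>2 / \<tau>) * (2 * L * Hs)"
      using hb[OF K, of 1] hb[OF K, of "- 1"] \<tau> h0 unfolding Hs_def distrib_left[of "2 * L"]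
      by (intro mult_left_mono add_mono) auto
    finally show ?thesis by simp
  qed
  have cL: "nsq M (c s) \<le> 2 / L * (3 * ((64 / h0)\<^sup>2 / \<tau>) * (2 * L * Hs) + 3 * Q0)" if s: "s = 1 \<or> s = - 1" for s
  proof -
    have "(\<Sum>n\<in>{()}. nsq (lebesgue_on {a<..<a+L}) (c s)) \<le> 2 / L * (3 * ((64 / h0)\<^sup>2 / \<tau>) * (2 * L * Hs) + 3 * Q0)"
    proof (rule fourier_lower_bound[OF L, where f = "\<lambda>_::unit. c s"])
      fix K :: "int set" assume "finite K"
      from cbound[OF this s] show "(\<Sum>k\<in>K. \<Sum>n\<in>{()}. (norm (?F (c s) k))\<^sup>2) \<le> 3 * ((64 / h0)\<^sup>2 / \<tau>) * (2 * L * Hs) + 3 * Q0"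
        by (simp only: sum.insert finite.emptyI empty_iff sum.empty add_0_right not_False_eq_True)
    qed (use sqc in \<open>auto simp: M_def\<close>)
    then show ?thesis
      unfolding M_def by (simp only: sum.insert finite.emptyI empty_iff sum.empty add_0_right not_False_eq_True)
  qed
  \<comment> \<open>Absorption of the coupling term.\<close>
  have "Cs \<le> 2 * (2 / L * (3 * ((64 / h0)\<^sup>2 / \<tau>) * (2 * L * Hs) + 3 * Q0))"
    using cL[OF disjI1[OF refl]] cL[OF disjI2[OF refl]] unfolding Cs_def by linarith
  also have "\<dots> = 24 * ((64 / h0)\<^sup>2 / \<tau>) * Hs + 12 / L * Q0" using L by (simp add: field_simps)
  also have "\<dots> \<le> 24 * ((64 / h0)\<^sup>2 / \<tau>) * (\<mu>\<^sup>2 * Cs) + 12 / L * Q0"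
    using HC \<tau> h0 by (intro add_right_mono mult_left_mono) auto
  also have "24 * ((64 / h0)\<^sup>2 / \<tau>) * (\<mu>\<^sup>2 * Cs) \<le> 1 / 2 * Cs"
  proof -
    have "24 * ((64 / h0)\<^sup>2 / \<tau>) * (\<mu>\<^sup>2 * Cs) = 1 / 2 * (tau_threshold * \<mu>\<^sup>2 / \<tau>) * Cs"
      by (simp add: tau_threshold_def h0_def)
    also have "\<dots> \<le> 1 / 2 * 1 * Cs"
      using tau \<tau> Hs0 by (intro mult_right_mono mult_left_mono) (auto simp: \<tau>_def divide_le_eq)
    finally show ?thesis by simp
  qed
  finally have "Cs \<le> 24 / L * Q0" by simp
  also have "24 / L * Q0 = trace_const * sqrt \<tau> * B" using L by (simp add: Q0_def trace_const_def h0_def)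
  finally have Cs: "Cs \<le> trace_const * sqrt \<tau> * B" .

  \<comment> \<open>Back to the modes, now that the fluxes are known to be bounded by the traces.\<close>
  define X where "X = 4 * (48 / h0 * sqrt \<tau> / \<tau>\<^sup>2) * (2 * L * Hs) + 2 * (20 * L * B)"
  have "(\<Sum>k\<in>K. \<Sum>n<m. (norm (?F (v n) k))\<^sup>2) \<le> X" if K: "finite K" for K
  proof -
    have one: "(\<Sum>n<m. (norm (?F (v n) k))\<^sup>2) \<le> 4 * (48 / h0 * sqrt \<tau> / \<tau>\<^sup>2) * ((norm (?F (h 1) k))\<^sup>2 + (norm (?F (h (- 1)) k))\<^sup>2) + 2 * (\<Sum>n<m. S k n)" for k
    proof -
      let ?HH = "(norm (?F (h 1) k))\<^sup>2 + (norm (?F (h (- 1)) k))\<^sup>2"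
      have t: "(norm (?F (v n) k))\<^sup>2 \<le> 4 * (bdry_sq n / (norm (D k n))\<^sup>2) * ?HH + 2 * S k n" for n
      proof -
        have "(norm (?F (v n) k))\<^sup>2 \<le> 2 * (norm (of_real (sqrt (bdry_sq n)) * (?F (h 1) k + of_real ((- 1) ^ n) * ?F (h (- 1)) k) / D k n))\<^sup>2 + 2 * (norm (q k n / D k n))\<^sup>2"
          unfolding vk by (rule norm_add_sq_le)
        also have "(norm (of_real (sqrt (bdry_sq n)) * (?F (h 1) k + of_real ((- 1) ^ n) * ?F (h (- 1)) k) / D k n))\<^sup>2
            = bdry_sq n / (norm (D k n))\<^sup>2 * (norm (?F (h 1) k + of_real ((- 1) ^ n) * ?F (h (- 1)) k))\<^sup>2"
          unfolding norm_divide norm_mult[of "of_real (sqrt (bdry_sq n))"] norm_of_real power_divide power_mult_distrib using bdry_sq_pos[of n] by simp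
        also have "\<dots> \<le> bdry_sq n / (norm (D k n))\<^sup>2 * (2 * ?HH)"
        proof (rule mult_left_mono)
          show "(norm (?F (h 1) k + of_real ((- 1) ^ n) * ?F (h (- 1)) k))\<^sup>2 \<le> 2 * ?HH"
            using norm_add_sq_le[of "?F (h 1) k" "of_real ((- 1) ^ n) * ?F (h (- 1)) k"]
            unfolding norm_mult norm_of_real by (simp add: power_abs)
        qed (use bdry_sq_pos[of n] in simp)
        also have "(norm (q k n / D k n))\<^sup>2 \<le> S k n"
        proof -
          have d0: "norm (D k n) > 0" using D(2)[of k n] by linarith
          have S0: "S k n \<ge> 0" by (simp add: S_def)
          have "(norm (q k n))\<^sup>2 \<le> (norm (z k))\<^sup>2 * S k n" by (rule q)
          also have "\<dots> \<le> (norm (D k n))\<^sup>2 * S k n"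
            using D(1)[of k n] S0 by (intro mult_right_mono power_mono) auto
          finally show ?thesis using d0 by (simp add: norm_divide power_divide divide_le_eq mult.commute)
        qed
        also have "2 * (bdry_sq n / (norm (D k n))\<^sup>2 * (2 * ?HH)) = 4 * (bdry_sq n / (norm (D k n))\<^sup>2) * ?HH" by simp
        finally show ?thesis by simp
      qed
      have "(\<Sum>n<m. (norm (?F (v n) k))\<^sup>2) \<le> (\<Sum>n<m. 4 * (bdry_sq n / (norm (D k n))\<^sup>2) * ?HH + 2 * S k n)"
        by (rule sum_mono) (rule t)
      also have "\<dots> = 4 * (\<Sum>n<m. bdry_sq n / (norm (D k n))\<^sup>2) * ?HH + 2 * (\<Sum>n<m. S k n)"
        by (simp only: sum.distrib sum_distrib_left sum_distrib_right)
      also have "(\<Sum>n<m. bdry_sq n / (norm (D k n))\<^sup>2) \<le> 48 / h0 * sqrt \<tau> / \<tau>\<^sup>2"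
      proof -
        have z0: "norm (z k) > 0" using zn(2)[of k] by linarith
        have "(\<Sum>n<m. bdry_sq n / (norm (D k n))\<^sup>2) = (\<Sum>n<m. bdry_sq n * (norm (z k))\<^sup>2 / (norm (D k n))\<^sup>2) / (norm (z k))\<^sup>2"
          unfolding sum_divide_distrib using z0 by (intro sum.cong) auto
        also have "\<dots> \<le> (48 / h0 * sqrt \<tau>) / \<tau>\<^sup>2"
          using bdry_sq_resolvent_square[where m = m and N = N and L = L and k = k] zn(1)[of k] \<tau> h0
          by (intro frac_le power_mono) (auto simp: z_def D_def h0_def \<tau>_def)
        finally show ?thesis .
      qed
      finally show ?thesis by (simp add: mult_left_mono mult_right_mono)
    qed
    have "(\<Sum>k\<in>K. \<Sum>n<m. (norm (?F (v n) k))\<^sup>2) \<le> (\<Sum>k\<in>K. 4 * (48 / h0 * sqrt \<tau> / \<tau>\<^sup>2) * ((norm (?F (h 1) k))\<^sup>2 + (norm (?F (h (- 1)) k))\<^sup>2) + 2 * (\<Sum>n<m. S k n))"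
      by (rule sum_mono) (rule one)
    also have "\<dots> = 4 * (48 / h0 * sqrt \<tau> / \<tau>\<^sup>2) * ((\<Sum>k\<in>K. (norm (?F (h 1) k))\<^sup>2) + (\<Sum>k\<in>K. (norm (?F (h (- 1)) k))\<^sup>2)) + 2 * (\<Sum>k\<in>K. \<Sum>n<m. S k n)"
      by (simp only: sum.distrib sum_distrib_left distrib_left)
    also have "\<dots> \<le> X"
      unfolding X_def Hs_def distrib_left[of "2 * L"] using hb[OF K, of 1] hb[OF K, of "- 1"] \<tau> h0 Ssum[OF K]
      by (intro add_mono mult_left_mono) auto
    finally show ?thesis .
  qed
  then have "(\<Sum>n<m. nsq M (v n)) \<le> 2 / L * X"
    unfolding M_def by (intro fourier_lower_bound[OF L]) (use sqv in \<open>auto simp: M_def\<close>)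
  also have "2 / L * X = 768 / h0 * (sqrt \<tau> / \<tau>\<^sup>2 * Hs) + 80 * B" using L by (simp add: X_def field_simps)
  also have "sqrt \<tau> / \<tau>\<^sup>2 * Hs \<le> trace_const / tau_threshold * B"
  proof -
    have "Hs \<le> \<mu>\<^sup>2 * (trace_const * sqrt \<tau> * B)"
      using HC mult_left_mono[OF Cs, of "\<mu>\<^sup>2"] by simp
    then have "sqrt \<tau> / \<tau>\<^sup>2 * Hs \<le> sqrt \<tau> / \<tau>\<^sup>2 * (\<mu>\<^sup>2 * (trace_const * sqrt \<tau> * B))"
      using \<tau> by (intro mult_left_mono) auto
    also have "\<dots> = (\<mu>\<^sup>2 / \<tau>) * (trace_const * B) * ((sqrt \<tau> * sqrt \<tau>) / \<tau>)"
    proof -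
      have "s / t\<^sup>2 * (m * (K * s * b)) = (m / t) * (K * b) * ((s * s) / t)" for s t m K b :: real
        by (simp add: power2_eq_square mult_ac)
      then show ?thesis .
    qed
    also have "(sqrt \<tau> * sqrt \<tau>) / \<tau> = 1" using \<tau> by simp
    also have "(\<mu>\<^sup>2 / \<tau>) * (trace_const * B) * 1 \<le> (1 / tau_threshold) * (trace_const * B) * 1"
      using tau \<tau> tau_threshold_pos trace_const_pos B0 by (intro mult_right_mono) (auto simp: \<tau>_def field_simps)
    finally show ?thesis by simp
  qed
  then have "768 / h0 * (sqrt \<tau> / \<tau>\<^sup>2 * Hs) + 80 * B \<le> 768 / h0 * (trace_const / tau_threshold * B) + 80 * B"
    using h0 by (intro add_right_mono mult_left_mono) auto
  also have "\<dots> = carleman_const * B" by (simp add: carleman_const_def h0_def algebra_simps)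
  finally show ?thesis .
qed

section \<open>Modes of a solution\<close>

text \<open>
  Completeness of the Lebesgue measure: modification on a null set preserves measurability.
\<close>

lemma measurable_AE_lebesgue_on:
  fixes f g :: "real \<Rightarrow> 'b::euclidean_space"
  assumes f: "f \<in> borel_measurable (lebesgue_on S)" and S: "S \<in> sets lebesgue"
    and ae: "AE x in lebesgue_on S. f x = g x"
  shows "g \<in> borel_measurable (lebesgue_on S)"
proof -
  have "(\<lambda>x. if x \<in> S then f x else 0) \<in> borel_measurable lebesgue"
    using f S by (rule borel_measurable_if_I)
  moreover have "AE x in lebesgue. x \<in> S \<longrightarrow> f x = g x"
    using ae S by (subst (asm) AE_restrict_space_iff) auto
  then have "AE x in lebesgue. (if x \<in> S then f x else 0) = (if x \<in> S then g x else 0)"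
    by eventually_elim auto
  ultimately have "(\<lambda>x. if x \<in> S then g x else 0) \<in> borel_measurable lebesgue"
    by (rule borel_measurable_AE)
  then show ?thesis by (rule borel_measurable_if_D)
qed

lemma measurable_AE_limit_lebesgue_on:
  fixes f :: "nat \<Rightarrow> real \<Rightarrow> 'b::euclidean_space"
  assumes f: "\<And>n. f n \<in> borel_measurable (lebesgue_on S)" and S: "S \<in> sets lebesgue"
    and ae: "AE x in lebesgue_on S. (\<lambda>n. f n x) \<longlonglongrightarrow> g x"
  shows "g \<in> borel_measurable (lebesgue_on S)"
proof (rule measurable_AE_lebesgue_on[OF _ S])
  show "(\<lambda>x. lim (\<lambda>n. f n x)) \<in> borel_measurable (lebesgue_on S)"
    by (rule borel_measurable_lim_metric) (rule f)
  show "AE x in lebesgue_on S. lim (\<lambda>n. f n x) = g x"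
    using ae by eventually_elim (rule limI)
qed

lemma sq_int_bound_AE:
  assumes "f \<in> borel_measurable M" "integrable M g" "AE x in M. (norm (f x))\<^sup>2 \<le> g x"
  shows "sq_int M f"
  unfolding sq_int_def
proof
  show "integrable M (\<lambda>x. (norm (f x))\<^sup>2)"
  proof (rule Bochner_Integration.integrable_bound[OF assms(2)])
    show "(\<lambda>x. (norm (f x))\<^sup>2) \<in> borel_measurable M" using assms(1) by measurable
    show "AE x in M. norm ((norm (f x))\<^sup>2) \<le> norm (g x)"
      using assms(3) by eventually_elim simp
  qed
qed (use assms in simp)

lemma deriv_test_function:
  assumes "\<eta> \<in> test_functions U"
  shows "deriv \<eta> \<in> test_functions U"
proof -
  obtain K where K: "compact K" "K \<subseteq> U" "\<And>x. x \<notin> K \<Longrightarrow> \<eta> x = 0"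
    using assms by (auto simp: test_functions_def)
  have "(deriv ^^ n) (deriv \<eta>) differentiable (at x)" for n x
    using assms unfolding test_functions_def by (auto simp: funpow_swap1 dest!: spec[of _ "Suc n"])
  moreover have "deriv \<eta> x = 0" if "x \<notin> K" for x
    by (rule deriv_eq_0_of_const[where S = "- K" and c = 0]) (use K that in \<open>auto intro: compact_imp_closed\<close>)
  ultimately show ?thesis using K(1,2) unfolding test_functions_def by blast
qed

lemma eigcoeff_single: "eigcoeff (Ec n) m = (if m = n then of_real (sqrt (E_normsq n)) else 0)"
proof -
  have "eigcoeff (Ec n) m = of_real (1 / sqrt (E_normsq m) * real_ip (E n) (E m))"
    unfolding eigcoeff_Ec ip_Ec by simp
  also have "1 / sqrt (E_normsq m) * real_ip (E n) (E m) = (if m = n then sqrt (E_normsq n) else 0)"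
    using real_ip_E_orthogonal[of n m] E_normsq_pos[of n] by (auto simp: E_normsq_def[symmetric] real_div_sqrt)
  finally show ?thesis by simp
qed

lemma Ctr_Ec: "Ctr (Ec n) $ 1 = of_real (cbinom n)" "Ctr (Ec n) $ 2 = of_real ((- 1) ^ n * cbinom n)"
proof -
  have "cont_rep (Ec n) x = Ec n x" if "x \<in> {0..pi}" for x
  proof -
    have "cont_rep (Ec n) x = (\<Sum>m. eigcoeff (Ec n) m * eigfn m x)" by (rule cont_rep_series[OF Ec_V that])
    also have "\<dots> = (\<Sum>m\<in>{n}. eigcoeff (Ec n) m * eigfn m x)"
      by (rule suminf_finite) (auto simp: eigcoeff_single)
    also have "\<dots> = Ec n x" using E_normsq_pos[of n] by (simp add: eigcoeff_single eigfn_def)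
    finally show ?thesis .
  qed
  then show "Ctr (Ec n) $ 1 = of_real (cbinom n)" "Ctr (Ec n) $ 2 = of_real ((- 1) ^ n * cbinom n)"
    by (simp_all add: Ctr_def Ec_def E_at_ends)
qed

text \<open>
  The weak form of the eigenvalue equation for \<open>L0\<close>, with the eigenfunction as test element.
\<close>

lemma L0_Ec:
  assumes "f \<in> V"
  shows "L0 f (Ec n) = of_real ((freq n)\<^sup>2) * ip wmeas f (Ec n)"
proof -
  have "ip wmeas (wderiv f) (wderiv (Ec n)) = ip wmeas (wderiv f) (E'c n)"
    unfolding ip_def
  proof (rule integral_cong_AE)
    show "AE x in wmeas. wderiv f x * cnj (wderiv (Ec n) x) = wderiv f x * cnj (E'c n x)"
      using wderiv_Ec[of n] by eventually_elim simp
  qed (use sq_int_integrable[OF V_wderiv(2)[OF assms] V_wderiv(2)[OF Ec_V]] sq_int_integrable[OF V_wderiv(2)[OF assms] sq_int_Ec(2)] in auto)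
  then have "A0 f (Ec n) = 4 * (of_real (ev n) * ip wmeas f (Ec n))"
    using weak_pairing[OF assms, of n] by (simp add: A0_def a0_def ip_def)
  then show ?thesis
    by (simp add: L0_def innerH_eq freq_sq algebra_simps)
qed

lemma norm_matrix_vector_le:
  fixes A :: "complex ^ 2 ^ 2"
  assumes "onorm (\<lambda>z. A *v z) \<le> \<mu>"
  shows "(norm ((A *v x) $ 1))\<^sup>2 + (norm ((A *v x) $ 2))\<^sup>2 \<le> \<mu>\<^sup>2 * ((norm (x $ 1))\<^sup>2 + (norm (x $ 2))\<^sup>2)"
proof -
  have "linear (\<lambda>z. A *v z)"
    by (rule linearI) (simp_all add: matrix_vector_right_distrib vec_eq_iff matrix_vector_mult_def sum_2 algebra_simps)
  then have bl: "bounded_linear (\<lambda>z. A *v z)" by (simp add: linear_conv_bounded_linear)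
  have sq: "(norm y)\<^sup>2 = (norm (y $ 1))\<^sup>2 + (norm (y $ 2))\<^sup>2" for y :: "complex ^ 2"
    by (simp add: norm_vec_def L2_set_def sum_2)
  have "norm (A *v x) \<le> onorm (\<lambda>z. A *v z) * norm x" by (rule onorm[OF bl])
  also have "\<dots> \<le> \<mu> * norm x" using assms by (rule mult_right_mono) simp
  finally have "(norm (A *v x))\<^sup>2 \<le> (\<mu> * norm x)\<^sup>2" by (rule power_mono) simp
  then show ?thesis unfolding power_mult_distrib sq .
qed

text \<open>
  A weak solution on one bounded time interval, with the bound for the coupling matrix.
\<close>

locale solution =
  fixes a b :: real and r :: "real \<Rightarrow> real \<Rightarrow> complex" and \<Gamma> :: "real \<Rightarrow> complex ^ 2 ^ 2" and \<mu> :: real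
  assumes ab: "a < b" and sol: "weak_solution_on {a<..<b} \<Gamma> r"
    and Gm: "\<Gamma> \<in> borel_measurable (lebesgue_on {a<..<b})"
    and Gb: "AE t in lebesgue_on {a<..<b}. onorm (\<lambda>z. \<Gamma> t *v z) \<le> \<mu>"
begin

abbreviation "M \<equiv> lebesgue_on {a<..<b}"

lemma finM: "finite_measure M"
  by (rule finite_measure_interval)

lemma r_V: "AE t in M. r t \<in> V" and normV_int: "integrable M (\<lambda>t. (normV (r t))\<^sup>2)"
  and r_H: "AE t in M. r t \<in> H" and normH_int: "integrable M (\<lambda>t. (normH (r t))\<^sup>2)"
  using sol unfolding weak_solution_on_def bochner_L2_def by (auto elim: AE_mp)

text \<open>
  A solution is an almost everywhere limit of simple functions in norm, so its pairing with a fixed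
  element is a limit of measurable functions.
\<close>

lemma ip_measurable:
  assumes g: "sq_int wmeas g"
  shows "(\<lambda>t. ip wmeas (r t) g) \<in> borel_measurable M"
proof -
  obtain s where s: "\<And>n. simple_function M (s n)" "\<And>n t. t \<in> {a<..<b} \<Longrightarrow> s n t \<in> H"
    and lim: "AE t in M. r t \<in> H \<and> (\<lambda>n. normH (r t - s n t)) \<longlonglongrightarrow> 0"
    using sol unfolding weak_solution_on_def bochner_L2_def by blast
  show ?thesis
  proof (rule measurable_AE_limit_lebesgue_on)
    show "(\<lambda>t. ip wmeas (s n t) g) \<in> borel_measurable M" for n
      by (rule borel_measurable_simple_function) (rule simple_function_compose1[OF s(1)])
    show "AE t in M. (\<lambda>n. ip wmeas (s n t) g) \<longlonglongrightarrow> ip wmeas (r t) g"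
      using lim AE_space
    proof eventually_elim
      case (elim t)
      then have t: "t \<in> {a<..<b}" and rt: "sq_int wmeas (r t)" by (auto simp: H_iff)
      have st: "sq_int wmeas (s n t)" for n using s(2)[OF t] by (simp add: H_iff)
      have bd: "norm (ip wmeas (s n t) g - ip wmeas (r t) g) \<le> normH (r t - s n t) * sqrt (nsq wmeas g)" for n
      proof -
        have "ip wmeas (r t) g - ip wmeas (s n t) g = ip wmeas (\<lambda>x. r t x - s n t x) g"
          by (rule ip_diff_left[OF rt st g, symmetric])
        then have "norm (ip wmeas (r t) g - ip wmeas (s n t) g) \<le> sqrt (nsq wmeas (\<lambda>x. r t x - s n t x)) * sqrt (nsq wmeas g)"
          using cauchy_schwarz_ip[OF sq_int_diff[OF rt st] g] by simp
        then show ?thesis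
          by (simp add: normH_def nsq_def fun_diff_def norm_minus_commute)
      qed
      have "(\<lambda>n. normH (r t - s n t) * sqrt (nsq wmeas g)) \<longlonglongrightarrow> 0"
        using tendsto_mult_left_zero[of "\<lambda>n. normH (r t - s n t)"] elim by blast
      then have "(\<lambda>n. ip wmeas (s n t) g - ip wmeas (r t) g) \<longlonglongrightarrow> 0"
        by (rule Lim_null_comparison[OF always_eventually[OF allI[OF bd]]])
      then show ?case by (rule LIM_zero_cancel)
    qed
  qed simp
qed

text \<open>
  The coefficients of the solution in the normalised eigenbasis.
\<close>

definition rmode :: "nat \<Rightarrow> real \<Rightarrow> complex" where "rmode n t = eigcoeff (r t) n"

lemma rmode_measurable: "rmode n \<in> borel_measurable M"
  unfolding rmode_def[abs_def] eigcoeff_def by (rule ip_measurable[OF sq_int_eigfn])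

lemma rmode_bessel: "AE t in M. \<forall>m. (\<Sum>n<m. (norm (rmode n t))\<^sup>2) \<le> (normH (r t))\<^sup>2"
  using r_H by eventually_elim (use bessel_H in \<open>auto simp: H_iff rmode_def normH_sq\<close>)

lemma rmode_parseval: "AE t in M. (\<lambda>n. (norm (rmode n t))\<^sup>2) sums (normH (r t))\<^sup>2"
  using r_H by eventually_elim (use parseval_H in \<open>auto simp: H_iff rmode_def normH_sq\<close>)

lemma sq_int_rmode: "sq_int M (rmode n)"
proof (rule sq_int_bound_AE[OF rmode_measurable normH_int])
  show "AE t in M. (norm (rmode n t))\<^sup>2 \<le> (normH (r t))\<^sup>2"
    using rmode_bessel
  proof eventually_elim
    case (elim t)
    have "(norm (rmode n t))\<^sup>2 \<le> (\<Sum>n<Suc n. (norm (rmode n t))\<^sup>2)"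
      by (rule member_le_sum) auto
    then show ?case using elim by (blast intro: order_trans)
  qed
qed

text \<open>
  The endpoint values of the solution, at \<open>0\<close> for \<open>s = 1\<close> and at \<open>pi\<close> for \<open>s = -1\<close>; \<open>rflux\<close> uses the
  same convention for the components of \<open>\<Gamma> C r\<close>.
\<close>

definition rtrace :: "real \<Rightarrow> real \<Rightarrow> complex" where "rtrace s t = end_trace s (r t)"

lemma rtrace_measurable: "rtrace s \<in> borel_measurable M"
  unfolding rtrace_def[abs_def] end_trace_def
  by (intro borel_measurable_suminf borel_measurable_times borel_measurable_const) (use rmode_measurable in \<open>simp add: rmode_def[abs_def]\<close>)

lemma rtrace_bound:
  assumes "\<bar>s\<bar> = 1"
  shows "AE t in M. (norm (rtrace s t))\<^sup>2 \<le> 8 / E_normsq 0 * (normV (r t))\<^sup>2"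
  using r_V
proof eventually_elim
  case (elim t)
  have "norm (rtrace s t) \<le> sqrt (8 / E_normsq 0) * normV (r t)"
  proof (rule LIMSEQ_le_const2)
    show "(\<lambda>m. norm (\<Sum>n<m. of_real (s ^ n * sqrt (bdry_sq n)) * eigcoeff (r t) n)) \<longlonglongrightarrow> norm (rtrace s t)"
      using end_trace_sums(1)[OF elim assms] unfolding rtrace_def sums_def by (rule tendsto_norm)
    show "\<exists>N. \<forall>n\<ge>N. norm (\<Sum>n<n. of_real (s ^ n * sqrt (bdry_sq n)) * eigcoeff (r t) n) \<le> sqrt (8 / E_normsq 0) * normV (r t)"
      using end_trace_sums(2)[OF elim assms] by blast
  qed
  then have "(norm (rtrace s t))\<^sup>2 \<le> (sqrt (8 / E_normsq 0) * normV (r t))\<^sup>2" by (rule power_mono) simp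
  then show ?case using E_normsq_0_pos by (simp add: power_mult_distrib)
qed

lemma sq_int_rtrace: "\<bar>s\<bar> = 1 \<Longrightarrow> sq_int M (rtrace s)"
  by (rule sq_int_bound_AE[OF rtrace_measurable _ rtrace_bound]) (use normV_int in auto)

definition rflux :: "real \<Rightarrow> real \<Rightarrow> complex" where
  "rflux s t = (if s = 1 then (\<Gamma> t *v Ctr (r t)) $ 1 else (\<Gamma> t *v Ctr (r t)) $ 2)"

lemma rflux_measurable: "rflux s \<in> borel_measurable M"
proof -
  have G: "(\<lambda>t. \<Gamma> t $ i $ j) \<in> borel_measurable M" for i j
    by (rule measurable_compose[OF Gm borel_measurable_continuous_onI]) (intro continuous_intros)
  define i :: 2 where "i = (if s = 1 then 1 else 2)"
  show ?thesis
  proof (rule measurable_AE_lebesgue_on)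
    show "(\<lambda>t. \<Gamma> t $ i $ 1 * rtrace 1 t + \<Gamma> t $ i $ 2 * rtrace (- 1) t) \<in> borel_measurable M"
      by (intro borel_measurable_add borel_measurable_times G rtrace_measurable)
    show "AE t in M. \<Gamma> t $ i $ 1 * rtrace 1 t + \<Gamma> t $ i $ 2 * rtrace (- 1) t = rflux s t"
      using r_V by eventually_elim (auto simp: rflux_def i_def matrix_vector_mult_def sum_2 Ctr_eq rtrace_def)
  qed simp
qed

lemma rflux_bound: "AE t in M. (norm (rflux 1 t))\<^sup>2 + (norm (rflux (- 1) t))\<^sup>2 \<le> \<mu>\<^sup>2 * ((norm (rtrace 1 t))\<^sup>2 + (norm (rtrace (- 1) t))\<^sup>2)"
  using r_V Gb
proof eventually_elim
  case (elim t)
  from norm_matrix_vector_le[OF elim(2), of "Ctr (r t)"] show ?case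
    by (simp add: rflux_def Ctr_eq[OF elim(1)] rtrace_def)
qed

lemma sq_int_rflux:
  assumes "s = 1 \<or> s = - 1"
  shows "sq_int M (rflux s)"
proof (rule sq_int_bound_AE[OF rflux_measurable])
  show "integrable M (\<lambda>t. \<mu>\<^sup>2 * ((norm (rtrace 1 t))\<^sup>2 + (norm (rtrace (- 1) t))\<^sup>2))"
    using sq_int_rtrace[of 1] sq_int_rtrace[of "- 1"] by (simp add: sq_int_def)
  show "AE t in M. (norm (rflux s t))\<^sup>2 \<le> \<mu>\<^sup>2 * ((norm (rtrace 1 t))\<^sup>2 + (norm (rtrace (- 1) t))\<^sup>2)"
    using rflux_bound
  proof eventually_elim
    case (elim t)
    have "(norm (rflux s t))\<^sup>2 \<le> (norm (rflux 1 t))\<^sup>2 + (norm (rflux (- 1) t))\<^sup>2" using assms by auto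
    then show ?case using elim by (rule order_trans)
  qed
qed

text \<open>
  Testing the equation with an eigenfunction reduces it to a scalar equation for each mode, in the
  sense of distributions. The two weak derivatives in time, in \<open>H\<close> and in the antidual of \<open>V\<close>, are
  applied one after the other.
\<close>

lemma weak_mode:
  assumes \<eta>: "\<eta> \<in> test_functions {a<..<b}"
  shows "(LINT t|M. deriv (deriv \<eta>) t *\<^sub>R rmode n t)
    = (LINT t|M. \<eta> t *\<^sub>R (of_real ((freq n)\<^sup>2) * rmode n t + of_real (sqrt (bdry_sq n)) * (rflux 1 t + of_real ((- 1) ^ n) * rflux (- 1) t)))"
proof -
  obtain p q where W1: "has_weak_time_deriv {a<..<b} H (\<lambda>t. innerH (r t)) (\<lambda>t. innerH (p t))"
    and W2: "has_weak_time_deriv {a<..<b} V (\<lambda>t. innerH (p t)) q"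
    and eqn: "AE t in M. \<forall>v\<in>V. q t v - L0 (r t) v = Ctr_dual (\<Gamma> t *v Ctr (r t)) v"
    using sol unfolding weak_solution_on_def by blast
  let ?u = "\<lambda>t. ip wmeas (r t) (Ec n)"
  let ?G = "\<lambda>t. of_real ((freq n)\<^sup>2) * ?u t + of_real (cbinom n) * (rflux 1 t + of_real ((- 1) ^ n) * rflux (- 1) t)"
  have um: "?u \<in> borel_measurable M" by (rule ip_measurable[OF sq_int_Ec(1)])
  have Gm': "?G \<in> borel_measurable M"
    by (intro borel_measurable_add borel_measurable_times borel_measurable_const um rflux_measurable)
  have qG: "AE t in M. ?G t = q t (Ec n)"
    using eqn r_V
  proof eventually_elim
    case (elim t)
    have "q t (Ec n) = L0 (r t) (Ec n) + Ctr_dual (\<Gamma> t *v Ctr (r t)) (Ec n)"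
      using elim(1)[rule_format, OF Ec_V[of n]] by (simp add: algebra_simps)
    also have "Ctr_dual (\<Gamma> t *v Ctr (r t)) (Ec n) = of_real (cbinom n) * (rflux 1 t + of_real ((- 1) ^ n) * rflux (- 1) t)"
      by (simp add: Ctr_dual_def sum_2 Ctr_Ec rflux_def algebra_simps)
    finally show ?case by (simp add: L0_Ec[OF elim(2)])
  qed
  have qm: "(\<lambda>t. q t (Ec n)) \<in> borel_measurable M"
    by (rule measurable_AE_lebesgue_on[OF Gm' _ qG]) simp
  have \<eta>m: "\<eta> \<in> borel_measurable M"
    by (rule measurable_interval_continuous[OF test_functionD(2)[OF \<eta>]])
  have "(LINT t|M. deriv (deriv \<eta>) t *\<^sub>R ?u t) = - (LINT t|M. deriv \<eta> t *\<^sub>R innerH (p t) (Ec n))"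
    using W1 deriv_test_function[OF \<eta>] sq_int_Ec(1)[of n] unfolding has_weak_time_deriv_def innerH_eq by (auto simp: H_iff)
  also have "\<dots> = (LINT t|M. \<eta> t *\<^sub>R q t (Ec n))"
    using W2 \<eta> Ec_V[of n] unfolding has_weak_time_deriv_def by simp
  also have "\<dots> = (LINT t|M. \<eta> t *\<^sub>R ?G t)"
    by (rule integral_cong_AE) (use qG qm Gm' \<eta>m in \<open>auto intro!: borel_measurable_scaleR elim!: AE_mp\<close>)
  finally have eq: "(LINT t|M. deriv (deriv \<eta>) t *\<^sub>R ?u t) = (LINT t|M. \<eta> t *\<^sub>R ?G t)" .
  let ?c = "complex_of_real (1 / sqrt (E_normsq n))"
  have "(LINT t|M. deriv (deriv \<eta>) t *\<^sub>R rmode n t) = (LINT t|M. ?c * (deriv (deriv \<eta>) t *\<^sub>R ?u t))"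
    by (simp add: rmode_def eigcoeff_Ec)
  also have "\<dots> = ?c * (LINT t|M. \<eta> t *\<^sub>R ?G t)" by (simp only: integral_mult_right_zero eq)
  also have "\<dots> = (LINT t|M. ?c * (\<eta> t *\<^sub>R ?G t))" by (simp only: integral_mult_right_zero)
  also have "\<dots> = (LINT t|M. \<eta> t *\<^sub>R (of_real ((freq n)\<^sup>2) * rmode n t + of_real (sqrt (bdry_sq n)) * (rflux 1 t + of_real ((- 1) ^ n) * rflux (- 1) t)))"
  proof (rule Bochner_Integration.integral_cong[OF refl])
    fix t
    have "complex_of_real (sqrt (bdry_sq n)) = ?c * of_real (cbinom n)" unfolding sqrt_bdry_sq[symmetric] by simp
    then show "?c * (\<eta> t *\<^sub>R ?G t) = \<eta> t *\<^sub>R (of_real ((freq n)\<^sup>2) * rmode n t + of_real (sqrt (bdry_sq n)) * (rflux 1 t + of_real ((- 1) ^ n) * rflux (- 1) t))"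
      unfolding rmode_def eigcoeff_Ec by (simp only: scaleR_conv_of_real) (simp add: algebra_simps)
  qed
  finally show ?thesis .
qed

end

section \<open>The Carleman estimate for solutions\<close>

lemma sq_int_continuous_mult:
  fixes h u :: "real \<Rightarrow> complex"
  assumes h: "continuous_on UNIV h" and u: "sq_int (lebesgue_on {a<..<b}) u"
  shows "sq_int (lebesgue_on {a<..<b}) (\<lambda>t. h t * u t)"
proof -
  have "bounded (h ` {a..b})"
    by (intro compact_imp_bounded compact_continuous_image continuous_on_subset[OF h]) auto
  then have "\<exists>B. \<forall>x\<in>{a..b}. norm (h x) \<le> B" unfolding bounded_iff by auto
  then obtain B where B: "\<And>x. x \<in> {a..b} \<Longrightarrow> norm (h x) \<le> B" by blast
  show ?thesis
  proof (rule sq_int_bound[where g = "\<lambda>t. B\<^sup>2 * (norm (u t))\<^sup>2"])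
    show "(\<lambda>t. h t * u t) \<in> borel_measurable (lebesgue_on {a<..<b})"
      using measurable_interval_continuous[OF h] u by (intro borel_measurable_times) (auto simp: sq_int_def)
    show "integrable (lebesgue_on {a<..<b}) (\<lambda>t. B\<^sup>2 * (norm (u t))\<^sup>2)" using u by (simp add: sq_int_def)
    fix t assume "t \<in> space (lebesgue_on {a<..<b})"
    then have "norm (h t) \<le> B" using B[of t] by simp
    then show "(norm (h t * u t))\<^sup>2 \<le> B\<^sup>2 * (norm (u t))\<^sup>2"
      unfolding norm_mult power_mult_distrib by (intro mult_right_mono power_mono) auto
  qed
qed

context solution
begin

text \<open>
  The Carleman weight, normalised to one at the left end of the interval.
\<close>

definition weight :: "nat \<Rightarrow> real \<Rightarrow> real" where "weight N t = exp (- tau N * (t - a))"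

definition localized :: "nat \<Rightarrow> (real \<Rightarrow> real) \<Rightarrow> (real \<Rightarrow> complex) \<Rightarrow> real \<Rightarrow> complex" where
  "localized N \<phi> u t = of_real (\<phi> t * weight N t) * u t"

definition \<xi> :: "int \<Rightarrow> real" where "\<xi> k = of_int k * pi / (b - a)"

text \<open>
  Weight times exponential is not real, whereas test functions are; \<open>damped_cos\<close> and
  \<open>damped_sin\<close> are its real and negative imaginary part.
\<close>

definition damped_cos :: "nat \<Rightarrow> int \<Rightarrow> real \<Rightarrow> real" where "damped_cos N k t = weight N t * cos (\<xi> k * (t - a))"
definition damped_sin :: "nat \<Rightarrow> int \<Rightarrow> real \<Rightarrow> real" where "damped_sin N k t = weight N t * sin (\<xi> k * (t - a))"
definition damped_phase :: "nat \<Rightarrow> int \<Rightarrow> real \<Rightarrow> complex" where "damped_phase N k t = of_real (damped_cos N k t) - \<i> * of_real (damped_sin N k t)"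

lemma smooth_damped: "smooth UNIV (damped_cos N k)" "smooth UNIV (damped_sin N k)"
proof -
  have w: "smooth UNIV (\<lambda>t. exp (- tau N * t + tau N * a))"
    by (rule smooth_compose[where U = UNIV and f = exp, OF smooth_exp smooth_affine]) simp
  have c: "smooth UNIV (\<lambda>t. cos (\<xi> k * t + (- (\<xi> k * a))))"
    by (rule smooth_compose[where U = UNIV and f = cos, OF smooth_sin_cos(2) smooth_affine]) simp
  have s: "smooth UNIV (\<lambda>t. sin (\<xi> k * t + (- (\<xi> k * a))))"
    by (rule smooth_compose[where U = UNIV and f = sin, OF smooth_sin_cos(1) smooth_affine]) simp
  show "smooth UNIV (damped_cos N k)" "smooth UNIV (damped_sin N k)"
    using smooth_mult[OF w c] smooth_mult[OF w s] by (simp_all add: damped_cos_def[abs_def] damped_sin_def[abs_def] weight_def algebra_simps)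
qed

lemma DERIV_damped:
  "(damped_cos N k has_real_derivative - tau N * damped_cos N k t - \<xi> k * damped_sin N k t) (at t)"
  "(damped_sin N k has_real_derivative - tau N * damped_sin N k t + \<xi> k * damped_cos N k t) (at t)"
  unfolding damped_cos_def[abs_def] damped_sin_def[abs_def] weight_def
  by (rule derivative_eq_intros refl | simp add: algebra_simps)+

lemma continuous_damped_phase: "continuous_on UNIV (damped_phase N k)"
  unfolding damped_phase_def[abs_def]
  by (intro continuous_intros smooth_continuous[OF smooth_damped(1) open_UNIV] smooth_continuous[OF smooth_damped(2) open_UNIV])

lemma continuous_weight: "continuous_on S (weight N)"
  unfolding weight_def[abs_def] by (intro continuous_intros)

lemma sq_int_localized:
  assumes "continuous_on UNIV \<phi>" "sq_int M u"
  shows "sq_int M (localized N \<phi> u)"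
  unfolding localized_def[abs_def]
  by (rule sq_int_continuous_mult[OF _ assms(2)]) (intro continuous_intros assms(1) continuous_weight)

lemma integrable_damped_phase:
  assumes "continuous_on UNIV \<phi>" "sq_int M u"
  shows "integrable M (\<lambda>t. of_real (\<phi> t) * (damped_phase N k t * u t))"
proof -
  have "sq_int M (\<lambda>t. (of_real (\<phi> t) * damped_phase N k t) * u t)"
    by (rule sq_int_continuous_mult[OF _ assms(2)]) (intro continuous_intros assms(1) continuous_damped_phase)
  from sq_int_imp_integrable[OF finM this] show ?thesis by (simp add: mult.assoc)
qed

lemma fourier_localized: "fourier a (b - a) (localized N \<phi> u) k = (LINT t|M. of_real (\<phi> t) * (damped_phase N k t * u t))"
proof -
  have "localized N \<phi> u t * exp (- \<i> * of_real (of_int k * (pi * (t - a) / (b - a)))) = of_real (\<phi> t) * (damped_phase N k t * u t)" for t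
  proof -
    have th: "of_int k * (pi * (t - a) / (b - a)) = \<xi> k * (t - a)" by (simp add: \<xi>_def)
    have ex: "exp (- \<i> * complex_of_real (\<xi> k * (t - a))) = of_real (cos (\<xi> k * (t - a))) - \<i> * of_real (sin (\<xi> k * (t - a)))"
      unfolding cnj_exp_phase[symmetric] exp_Euler cos_of_real sin_of_real by simp
    show ?thesis unfolding th ex by (simp add: localized_def damped_phase_def damped_cos_def damped_sin_def algebra_simps)
  qed
  then show ?thesis unfolding fourier_def by simp
qed

text \<open>
  The mode equation on the Fourier side. The test functions are \<open>\<psi>\<close> times the real and imaginary
  part of the damped exponential; two differentiations of the product produce the symbol \<open>z\<^sup>2\<close> and
  the commutator terms with \<open>2 z \<psi>'\<close> and \<open>\<psi>''\<close>.
\<close>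

lemma mode_fourier:
  fixes N :: nat
  assumes \<psi>: "smooth UNIV \<psi>" "compact K" "K \<subseteq> {a<..<b}" "\<And>x. x \<notin> K \<Longrightarrow> \<psi> x = 0"
  defines "z \<equiv> zfreq N (b - a)"
  shows "((z k)\<^sup>2 - of_real ((freq n)\<^sup>2)) * fourier a (b - a) (localized N \<psi> (rmode n)) k
       = of_real (sqrt (bdry_sq n)) * (fourier a (b - a) (localized N \<psi> (rflux 1)) k + of_real ((- 1) ^ n) * fourier a (b - a) (localized N \<psi> (rflux (- 1))) k)
         + 2 * z k * fourier a (b - a) (localized N (deriv \<psi>) (rmode n)) k - fourier a (b - a) (localized N (deriv (deriv \<psi>)) (rmode n)) k"
proof -
  let ?\<tau> = "tau N" and ?x = "\<xi> k"
  let ?\<psi>1 = "deriv \<psi>" and ?\<psi>2 = "deriv (deriv \<psi>)"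
  let ?A = "damped_cos N k" and ?B = "damped_sin N k"
  have s1: "smooth UNIV ?\<psi>1" by (rule smooth_deriv(1)[OF open_UNIV \<psi>(1)])
  have d0: "(\<psi> has_real_derivative ?\<psi>1 t) (at t)" for t by (rule smooth_deriv(2)[OF open_UNIV \<psi>(1)]) simp
  have d1: "(?\<psi>1 has_real_derivative ?\<psi>2 t) (at t)" for t by (rule smooth_deriv(2)[OF open_UNIV s1]) simp
  have c: "continuous_on UNIV \<psi>" "continuous_on UNIV ?\<psi>1" "continuous_on UNIV ?\<psi>2"
    by (rule smooth_continuous[OF _ open_UNIV], rule \<psi>(1) s1 smooth_deriv(1)[OF open_UNIV s1])+
  define \<eta>1 where "\<eta>1 t = \<psi> t * ?A t" for t
  define \<eta>2 where "\<eta>2 t = \<psi> t * ?B t" for t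
  have t1: "\<eta>1 \<in> test_functions {a<..<b}" "\<eta>2 \<in> test_functions {a<..<b}"
    unfolding \<eta>1_def[abs_def] \<eta>2_def[abs_def]
    by (rule test_functionI[OF _ \<psi>(2,3)], rule smooth_mult[OF \<psi>(1)], rule smooth_damped, simp add: \<psi>(4))+
  have e1: "deriv \<eta>1 = (\<lambda>t. ?\<psi>1 t * ?A t + \<psi> t * (- ?\<tau> * ?A t - ?x * ?B t))"
    unfolding \<eta>1_def[abs_def]
    by (rule ext, rule DERIV_imp_deriv, rule DERIV_cong[OF DERIV_mult[OF d0 DERIV_damped(1)]]) (simp add: algebra_simps)
  have e2: "deriv \<eta>2 = (\<lambda>t. ?\<psi>1 t * ?B t + \<psi> t * (- ?\<tau> * ?B t + ?x * ?A t))"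
    unfolding \<eta>2_def[abs_def]
    by (rule ext, rule DERIV_imp_deriv, rule DERIV_cong[OF DERIV_mult[OF d0 DERIV_damped(2)]]) (simp add: algebra_simps)
  have f1: "deriv (deriv \<eta>1) t = ?\<psi>2 t * ?A t + 2 * ?\<psi>1 t * (- ?\<tau> * ?A t - ?x * ?B t) + \<psi> t * ((?\<tau>\<^sup>2 - ?x\<^sup>2) * ?A t + 2 * ?\<tau> * ?x * ?B t)" for t
    unfolding e1
    by (rule DERIV_imp_deriv, (rule derivative_eq_intros d0 d1 DERIV_damped refl)+) (simp add: power2_eq_square algebra_simps)
  have f2: "deriv (deriv \<eta>2) t = ?\<psi>2 t * ?B t + 2 * ?\<psi>1 t * (- ?\<tau> * ?B t + ?x * ?A t) + \<psi> t * ((?\<tau>\<^sup>2 - ?x\<^sup>2) * ?B t - 2 * ?\<tau> * ?x * ?A t)" for t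
    unfolding e2
    by (rule DERIV_imp_deriv, (rule derivative_eq_intros d0 d1 DERIV_damped refl)+) (simp add: power2_eq_square algebra_simps)
  have zz: "z k = of_real ?\<tau> + \<i> * of_real ?x" unfolding z_def zfreq_def \<xi>_def by (simp add: complex_eq_iff)
  let ?u = "rmode n"
  let ?G = "\<lambda>t. of_real ((freq n)\<^sup>2) * ?u t + of_real (sqrt (bdry_sq n)) * (rflux 1 t + of_real ((- 1) ^ n) * rflux (- 1) t)"
  have G: "sq_int M ?G"
    by (intro sq_int_add sq_int_cmult sq_int_rmode sq_int_rflux) auto
  have int: "integrable M (\<lambda>t. \<phi> t *\<^sub>R w t)" if "continuous_on UNIV \<phi>" "sq_int M w" for \<phi> w
    using sq_int_imp_integrable[OF finM sq_int_continuous_mult[OF continuous_on_of_real[OF that(1)] that(2)]]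
    by (simp add: scaleR_conv_of_real)
  have dd: "continuous_on UNIV (deriv (deriv \<eta>1))" "continuous_on UNIV (deriv (deriv \<eta>2))"
    by (rule test_functionD(3)[OF deriv_test_function[OF t1(1)]], rule test_functionD(3)[OF deriv_test_function[OF t1(2)]])
  have cc: "continuous_on UNIV \<eta>1" "continuous_on UNIV \<eta>2"
    by (rule test_functionD(2)[OF t1(1)], rule test_functionD(2)[OF t1(2)])
  have "(LINT t|M. deriv (deriv \<eta>1) t *\<^sub>R ?u t - \<i> * (deriv (deriv \<eta>2) t *\<^sub>R ?u t))
     = (LINT t|M. deriv (deriv \<eta>1) t *\<^sub>R ?u t) - \<i> * (LINT t|M. deriv (deriv \<eta>2) t *\<^sub>R ?u t)"
    unfolding Bochner_Integration.integral_diff[OF int[OF dd(1) sq_int_rmode] integrable_mult_right[OF int[OF dd(2) sq_int_rmode]]]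
      integral_mult_right_zero ..
  also have "\<dots> = (LINT t|M. \<eta>1 t *\<^sub>R ?G t) - \<i> * (LINT t|M. \<eta>2 t *\<^sub>R ?G t)"
    by (simp only: weak_mode[OF t1(1)] weak_mode[OF t1(2)])
  also have "\<dots> = (LINT t|M. \<eta>1 t *\<^sub>R ?G t - \<i> * (\<eta>2 t *\<^sub>R ?G t))"
    unfolding Bochner_Integration.integral_diff[OF int[OF cc(1) G] integrable_mult_right[OF int[OF cc(2) G]]]
      integral_mult_right_zero ..
  also have "\<dots> = (LINT t|M. of_real ((freq n)\<^sup>2) * (of_real (\<psi> t) * (damped_phase N k t * ?u t))
      + of_real (sqrt (bdry_sq n)) * (of_real (\<psi> t) * (damped_phase N k t * rflux 1 t) + of_real ((- 1) ^ n) * (of_real (\<psi> t) * (damped_phase N k t * rflux (- 1) t))))"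
    by (intro Bochner_Integration.integral_cong refl)
       (simp add: \<eta>1_def \<eta>2_def damped_phase_def scaleR_conv_of_real algebra_simps)
  also have "\<dots> = of_real ((freq n)\<^sup>2) * fourier a (b - a) (localized N \<psi> ?u) k
      + of_real (sqrt (bdry_sq n)) * (fourier a (b - a) (localized N \<psi> (rflux 1)) k + of_real ((- 1) ^ n) * fourier a (b - a) (localized N \<psi> (rflux (- 1))) k)"
    unfolding fourier_localized
    using integrable_damped_phase[OF c(1) sq_int_rmode, of N k n] integrable_damped_phase[OF c(1) sq_int_rflux, of 1 N k] integrable_damped_phase[OF c(1) sq_int_rflux, of "- 1" N k]
    by (simp del: of_real_power of_real_minus)
  finally have rhs: "(LINT t|M. deriv (deriv \<eta>1) t *\<^sub>R ?u t - \<i> * (deriv (deriv \<eta>2) t *\<^sub>R ?u t))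
      = of_real ((freq n)\<^sup>2) * fourier a (b - a) (localized N \<psi> ?u) k
      + of_real (sqrt (bdry_sq n)) * (fourier a (b - a) (localized N \<psi> (rflux 1)) k + of_real ((- 1) ^ n) * fourier a (b - a) (localized N \<psi> (rflux (- 1))) k)" .
  have pw: "deriv (deriv \<eta>1) t *\<^sub>R ?u t - \<i> * (deriv (deriv \<eta>2) t *\<^sub>R ?u t)
     = of_real (?\<psi>2 t) * (damped_phase N k t * ?u t) - 2 * z k * (of_real (?\<psi>1 t) * (damped_phase N k t * ?u t)) + (z k)\<^sup>2 * (of_real (\<psi> t) * (damped_phase N k t * ?u t))" for t
  proof -
    have "of_real (deriv (deriv \<eta>1) t) - \<i> * of_real (deriv (deriv \<eta>2) t)
      = of_real (?\<psi>2 t) * damped_phase N k t - 2 * z k * (of_real (?\<psi>1 t) * damped_phase N k t) + (z k)\<^sup>2 * (of_real (\<psi> t) * damped_phase N k t)"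
      unfolding f1 f2 zz damped_phase_def by (simp add: complex_eq_iff power2_eq_square algebra_simps)
    from arg_cong[OF this, of "\<lambda>y. y * ?u t"] show ?thesis
      by (simp add: scaleR_conv_of_real algebra_simps)
  qed
  have "(LINT t|M. deriv (deriv \<eta>1) t *\<^sub>R ?u t - \<i> * (deriv (deriv \<eta>2) t *\<^sub>R ?u t))
    = fourier a (b - a) (localized N ?\<psi>2 ?u) k - 2 * z k * fourier a (b - a) (localized N ?\<psi>1 ?u) k + (z k)\<^sup>2 * fourier a (b - a) (localized N \<psi> ?u) k"
    unfolding pw fourier_localized
    using integrable_damped_phase[OF c(1) sq_int_rmode, of N k n] integrable_damped_phase[OF c(2) sq_int_rmode, of N k n] integrable_damped_phase[OF c(3) sq_int_rmode, of N k n]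
    by simp
  with rhs show ?thesis by (simp add: algebra_simps)
qed

lemma integrable_normV: "integrable M (\<lambda>t. normV (r t))"
proof (rule Bochner_Integration.integrable_bound)
  interpret finite_measure M by (rule finM)
  show "integrable M (\<lambda>t. 1 + (normV (r t))\<^sup>2)" using normV_int by simp
  have "(\<lambda>t. sqrt ((normV (r t))\<^sup>2)) \<in> borel_measurable M"
    using borel_measurable_integrable[OF normV_int] by measurable
  then show "(\<lambda>t. normV (r t)) \<in> borel_measurable M" by (simp add: normV_nonneg)
  have "x \<le> 1 + x\<^sup>2" for x :: real
    using zero_le_power2[of "x - 1 / 2"] by (simp add: power2_eq_square algebra_simps)
  then show "AE t in M. norm (normV (r t)) \<le> norm (1 + (normV (r t))\<^sup>2)"
    by (intro AE_I2) (simp add: normV_nonneg)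
qed

text \<open>
  The trace series may be integrated term by term, because its partial sums are dominated by
  \<open>normV (r t)\<close>, which is integrable on a bounded interval.
\<close>

lemma trace_fourier:
  assumes s: "s = 1 \<or> s = - 1" and c: "continuous_on UNIV \<psi>"
  shows "(\<lambda>n. of_real (s ^ n * sqrt (bdry_sq n)) * fourier a (b - a) (localized N \<psi> (rmode n)) k) sums fourier a (b - a) (localized N \<psi> (rtrace s)) k"
proof -
  have s1: "\<bar>s\<bar> = 1" using s by auto
  define S where "S m t = (\<Sum>n<m. of_real (s ^ n * sqrt (bdry_sq n)) * rmode n t)" for m t
  have Sq: "sq_int M (S m)" for m
    unfolding S_def[abs_def] by (intro sq_int_sum sq_int_cmult sq_int_rmode) simp
  have hc: "continuous_on UNIV (\<lambda>t. of_real (\<psi> t) * damped_phase N k t)" by (intro continuous_intros c continuous_damped_phase)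
  have "bounded ((\<lambda>t. of_real (\<psi> t) * damped_phase N k t) ` {a..b})"
    by (intro compact_imp_bounded compact_continuous_image continuous_on_subset[OF hc]) auto
  then have "\<exists>B. \<forall>t\<in>{a..b}. norm (of_real (\<psi> t) * damped_phase N k t) \<le> B" unfolding bounded_iff by auto
  then obtain B where B: "\<And>t. t \<in> {a..b} \<Longrightarrow> norm (of_real (\<psi> t) * damped_phase N k t) \<le> B" by blast
  have "(\<lambda>m. LINT t|M. of_real (\<psi> t) * (damped_phase N k t * S m t)) \<longlonglongrightarrow> (LINT t|M. of_real (\<psi> t) * (damped_phase N k t * rtrace s t))"
  proof (rule integral_dominated_convergence)
    show "(\<lambda>t. of_real (\<psi> t) * (damped_phase N k t * rtrace s t)) \<in> borel_measurable M"
      using integrable_damped_phase[OF c sq_int_rtrace[OF s1]] by (rule borel_measurable_integrable)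
    show "(\<lambda>t. of_real (\<psi> t) * (damped_phase N k t * S m t)) \<in> borel_measurable M" for m
      using integrable_damped_phase[OF c Sq] by (rule borel_measurable_integrable)
    show "integrable M (\<lambda>t. B * (sqrt (8 / E_normsq 0) * normV (r t)))"
      by (intro integrable_mult_right integrable_normV)
    show "AE t in M. (\<lambda>m. of_real (\<psi> t) * (damped_phase N k t * S m t)) \<longlonglongrightarrow> of_real (\<psi> t) * (damped_phase N k t * rtrace s t)"
      using r_V
    proof eventually_elim
      case (elim t)
      have "(\<lambda>m. S m t) \<longlonglongrightarrow> rtrace s t"
        using end_trace_sums(1)[OF elim s1] by (simp add: S_def rtrace_def rmode_def sums_def)
      then show ?case by (intro tendsto_intros)
    qed
    show "AE t in M. norm (of_real (\<psi> t) * (damped_phase N k t * S m t)) \<le> B * (sqrt (8 / E_normsq 0) * normV (r t))" for m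
      using r_V AE_space
    proof eventually_elim
      case (elim t)
      have "norm (S m t) \<le> sqrt (8 / E_normsq 0) * normV (r t)"
        using end_trace_sums(2)[OF elim(1) s1, of m] by (simp add: S_def rmode_def)
      moreover have "norm (of_real (\<psi> t) * damped_phase N k t) \<le> B" using elim(2) by (intro B) simp
      ultimately show ?case
        unfolding mult.assoc[symmetric, of "of_real (\<psi> t)"] norm_mult[of _ "S m t"]
        by (intro mult_mono) (auto intro: order_trans[OF norm_ge_zero])
    qed
  qed
  moreover have "(LINT t|M. of_real (\<psi> t) * (damped_phase N k t * S m t)) = (\<Sum>n<m. of_real (s ^ n * sqrt (bdry_sq n)) * fourier a (b - a) (localized N \<psi> (rmode n)) k)" for m
  proof -
    have "(LINT t|M. of_real (\<psi> t) * (damped_phase N k t * S m t)) = (LINT t|M. (\<Sum>n<m. of_real (s ^ n * sqrt (bdry_sq n)) * (of_real (\<psi> t) * (damped_phase N k t * rmode n t))))"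
      by (intro Bochner_Integration.integral_cong refl) (simp add: S_def sum_distrib_left mult_ac)
    also have "\<dots> = (\<Sum>n<m. LINT t|M. of_real (s ^ n * sqrt (bdry_sq n)) * (of_real (\<psi> t) * (damped_phase N k t * rmode n t)))"
      by (intro Bochner_Integration.integral_sum integrable_mult_right integrable_damped_phase c sq_int_rmode)
    finally show ?thesis by (simp only: integral_mult_right_zero fourier_localized)
  qed
  ultimately show ?thesis unfolding sums_def fourier_localized by simp
qed

lemma integrable_weighted:
  assumes c: "continuous_on UNIV \<phi>"
  shows "integrable M (\<lambda>t. (\<phi> t * weight N t)\<^sup>2 * (normH (r t))\<^sup>2)"
proof -
  have hc: "continuous_on UNIV (\<lambda>t. (\<phi> t * weight N t)\<^sup>2)" by (intro continuous_intros c continuous_weight)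
  have "bounded ((\<lambda>t. (\<phi> t * weight N t)\<^sup>2) ` {a..b})"
    by (intro compact_imp_bounded compact_continuous_image continuous_on_subset[OF hc]) auto
  then have "\<exists>B. \<forall>t\<in>{a..b}. norm ((\<phi> t * weight N t)\<^sup>2) \<le> B" unfolding bounded_iff by auto
  then obtain B where B: "\<And>t. t \<in> {a..b} \<Longrightarrow> norm ((\<phi> t * weight N t)\<^sup>2) \<le> B" by blast
  show ?thesis
  proof (rule Bochner_Integration.integrable_bound)
    show "integrable M (\<lambda>t. B * (normH (r t))\<^sup>2)" using normH_int by simp
    show "(\<lambda>t. (\<phi> t * weight N t)\<^sup>2 * (normH (r t))\<^sup>2) \<in> borel_measurable M"
      using measurable_interval_continuous[OF hc] borel_measurable_integrable[OF normH_int] by (intro borel_measurable_times)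
    show "AE t in M. norm ((\<phi> t * weight N t)\<^sup>2 * (normH (r t))\<^sup>2) \<le> norm (B * (normH (r t))\<^sup>2)"
    proof (rule AE_I2)
      fix t assume "t \<in> space M"
      then have "norm ((\<phi> t * weight N t)\<^sup>2) \<le> B" by (intro B) simp
      then have "norm ((\<phi> t * weight N t)\<^sup>2) \<le> norm B" using abs_ge_self[of B] unfolding real_norm_def by linarith
      then show "norm ((\<phi> t * weight N t)\<^sup>2 * (normH (r t))\<^sup>2) \<le> norm (B * (normH (r t))\<^sup>2)"
        unfolding norm_mult by (rule mult_right_mono) simp
    qed
  qed
qed

lemma nsq_localized: "nsq M (localized N \<phi> u) = (LINT t|M. (\<phi> t * weight N t)\<^sup>2 * (norm (u t))\<^sup>2)"
  unfolding nsq_def localized_def norm_mult norm_of_real power_mult_distrib power2_abs ..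

lemma sum_nsq_localized:
  assumes c: "continuous_on UNIV \<phi>"
  shows "(\<Sum>n<m. nsq M (localized N \<phi> (rmode n))) = (LINT t|M. (\<phi> t * weight N t)\<^sup>2 * (\<Sum>n<m. (norm (rmode n t))\<^sup>2))"
    and "integrable M (\<lambda>t. (\<phi> t * weight N t)\<^sup>2 * (\<Sum>n<m. (norm (rmode n t))\<^sup>2))"
proof -
  have i: "integrable M (\<lambda>t. (\<phi> t * weight N t)\<^sup>2 * (norm (rmode n t))\<^sup>2)" for n
    using sq_int_localized[OF c sq_int_rmode, of N n] unfolding sq_int_def localized_def norm_mult norm_of_real power_mult_distrib power2_abs by blast
  show "(\<Sum>n<m. nsq M (localized N \<phi> (rmode n))) = (LINT t|M. (\<phi> t * weight N t)\<^sup>2 * (\<Sum>n<m. (norm (rmode n t))\<^sup>2))"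
    unfolding nsq_localized sum_distrib_left by (rule Bochner_Integration.integral_sum[symmetric]) (rule i)
  show "integrable M (\<lambda>t. (\<phi> t * weight N t)\<^sup>2 * (\<Sum>n<m. (norm (rmode n t))\<^sup>2))"
    unfolding sum_distrib_left by (rule Bochner_Integration.integrable_sum) (rule i)
qed

lemma sum_nsq_localized_le:
  assumes c: "continuous_on UNIV \<phi>"
  shows "(\<Sum>n<m. nsq M (localized N \<phi> (rmode n))) \<le> (LINT t|M. (\<phi> t * weight N t)\<^sup>2 * (normH (r t))\<^sup>2)"
  unfolding sum_nsq_localized(1)[OF c]
proof (rule integral_mono_AE[OF sum_nsq_localized(2)[OF c] integrable_weighted[OF c]])
  show "AE t in M. (\<phi> t * weight N t)\<^sup>2 * (\<Sum>n<m. (norm (rmode n t))\<^sup>2) \<le> (\<phi> t * weight N t)\<^sup>2 * (normH (r t))\<^sup>2"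
    using rmode_bessel by eventually_elim (auto intro!: mult_left_mono)
qed

text \<open>
  Parseval's identity in space, combined with dominated convergence in time.
\<close>

lemma weighted_le_of_modes:
  assumes c: "continuous_on UNIV \<phi>" and X: "\<And>m. (\<Sum>n<m. nsq M (localized N \<phi> (rmode n))) \<le> X"
  shows "(LINT t|M. (\<phi> t * weight N t)\<^sup>2 * (normH (r t))\<^sup>2) \<le> X"
proof (rule LIMSEQ_le_const2)
  show "(\<lambda>m. LINT t|M. (\<phi> t * weight N t)\<^sup>2 * (\<Sum>n<m. (norm (rmode n t))\<^sup>2)) \<longlonglongrightarrow> (LINT t|M. (\<phi> t * weight N t)\<^sup>2 * (normH (r t))\<^sup>2)"
  proof (rule integral_dominated_convergence)
    show "(\<lambda>t. (\<phi> t * weight N t)\<^sup>2 * (normH (r t))\<^sup>2) \<in> borel_measurable M"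
      by (rule borel_measurable_integrable[OF integrable_weighted[OF c]])
    show "(\<lambda>t. (\<phi> t * weight N t)\<^sup>2 * (\<Sum>n<m. (norm (rmode n t))\<^sup>2)) \<in> borel_measurable M" for m
      by (rule borel_measurable_integrable[OF sum_nsq_localized(2)[OF c]])
    show "integrable M (\<lambda>t. (\<phi> t * weight N t)\<^sup>2 * (normH (r t))\<^sup>2)" by (rule integrable_weighted[OF c])
    show "AE t in M. (\<lambda>m. (\<phi> t * weight N t)\<^sup>2 * (\<Sum>n<m. (norm (rmode n t))\<^sup>2)) \<longlonglongrightarrow> (\<phi> t * weight N t)\<^sup>2 * (normH (r t))\<^sup>2"
      using rmode_parseval by eventually_elim (auto intro!: tendsto_intros simp: sums_def)
    show "AE t in M. norm ((\<phi> t * weight N t)\<^sup>2 * (\<Sum>n<m. (norm (rmode n t))\<^sup>2)) \<le> (\<phi> t * weight N t)\<^sup>2 * (normH (r t))\<^sup>2" for m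
      using rmode_bessel by eventually_elim (auto intro!: mult_left_mono simp: abs_mult sum_nonneg)
  qed
  show "\<exists>N'. \<forall>m\<ge>N'. (LINT t|M. (\<phi> t * weight N t)\<^sup>2 * (\<Sum>n<m. (norm (rmode n t))\<^sup>2)) \<le> X"
    using X unfolding sum_nsq_localized(1)[OF c] by blast
qed

lemma carleman_sum:
  assumes \<psi>: "smooth UNIV \<psi>" "compact K" "K \<subseteq> {a<..<b}" "\<And>x. x \<notin> K \<Longrightarrow> \<psi> x = 0"
    and B1: "(LINT t|M. (deriv \<psi> t * weight N t)\<^sup>2 * (normH (r t))\<^sup>2) \<le> B"
    and B2: "(LINT t|M. (deriv (deriv \<psi>) t * weight N t)\<^sup>2 * (normH (r t))\<^sup>2) \<le> B"
    and tau: "tau_threshold * \<mu>\<^sup>2 \<le> tau N"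
  shows "(\<Sum>n<m. nsq M (localized N \<psi> (rmode n))) \<le> carleman_const * B"
proof -
  have s1: "smooth UNIV (deriv \<psi>)" by (rule smooth_deriv(1)[OF open_UNIV \<psi>(1)])
  have c: "continuous_on UNIV \<psi>" "continuous_on UNIV (deriv \<psi>)" "continuous_on UNIV (deriv (deriv \<psi>))"
    by (rule smooth_continuous[OF _ open_UNIV], rule \<psi>(1) s1 smooth_deriv(1)[OF open_UNIV s1])+
  define sg where "sg s = (if s = 1 then 1 else - 1 :: real)" for s :: real
  have sg: "sg s = 1 \<or> sg s = - 1" "\<bar>sg s\<bar> = 1" "sg 1 = 1" "sg (- 1) = - 1" for s by (auto simp: sg_def)
  have ab': "a + (b - a) = b" by simp
  note cm = carleman_modes[where a = a and L = "b - a" and v = "\<lambda>n. localized N \<psi> (rmode n)" and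
        ?f1.0 = "\<lambda>n. localized N (deriv \<psi>) (rmode n)" and ?f2.0 = "\<lambda>n. localized N (deriv (deriv \<psi>)) (rmode n)" and
        c = "\<lambda>s. localized N \<psi> (rtrace (sg s))" and h = "\<lambda>s. localized N \<psi> (rflux (sg s))" and \<mu> = \<mu> and N = N, unfolded ab' sg(3,4)]
  show ?thesis
  proof (rule cm)
    show "0 < b - a" using ab by simp
    show "sq_int M (localized N \<psi> (rmode n))" "sq_int M (localized N (deriv \<psi>) (rmode n))" "sq_int M (localized N (deriv (deriv \<psi>)) (rmode n))" for n
      by (intro sq_int_localized c sq_int_rmode)+
    show "sq_int M (localized N \<psi> (rtrace (sg s)))" "sq_int M (localized N \<psi> (rflux (sg s)))" for s
      by (intro sq_int_localized c sq_int_rtrace sq_int_rflux sg)+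
    show "((zfreq N (b - a) k)\<^sup>2 - of_real ((freq n)\<^sup>2)) * fourier a (b - a) (localized N \<psi> (rmode n)) k
     = of_real (sqrt (bdry_sq n)) * (fourier a (b - a) (localized N \<psi> (rflux 1)) k + of_real ((- 1) ^ n) * fourier a (b - a) (localized N \<psi> (rflux (- 1))) k)
       + 2 * zfreq N (b - a) k * fourier a (b - a) (localized N (deriv \<psi>) (rmode n)) k - fourier a (b - a) (localized N (deriv (deriv \<psi>)) (rmode n)) k" for n k
      by (rule mode_fourier[OF \<psi>])
    show "(\<lambda>n. of_real (s ^ n * sqrt (bdry_sq n)) * fourier a (b - a) (localized N \<psi> (rmode n)) k) sums fourier a (b - a) (localized N \<psi> (rtrace (sg s))) k"
      if "s = 1 \<or> s = - 1" for s k
    proof -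
      have "sg s = s" using that by (auto simp: sg_def)
      then show ?thesis using trace_fourier[OF that c(1)] by simp
    qed
    show "(\<Sum>n<m. nsq M (localized N (deriv \<psi>) (rmode n))) \<le> B" for m
      using sum_nsq_localized_le[OF c(2)] B1 by (rule order_trans)
    show "(\<Sum>n<m. nsq M (localized N (deriv (deriv \<psi>)) (rmode n))) \<le> B" for m
      using sum_nsq_localized_le[OF c(3)] B2 by (rule order_trans)
    show "tau_threshold * \<mu>\<^sup>2 \<le> tau N" by (rule tau)
    have i: "integrable M (\<lambda>t. (\<psi> t * weight N t)\<^sup>2 * (norm (u t))\<^sup>2)" if "sq_int M u" for u
      using sq_int_localized[OF c(1) that, of N] unfolding sq_int_def localized_def norm_mult norm_of_real power_mult_distrib power2_abs by blast
    have ig: "integrable M (\<lambda>t. (\<psi> t * weight N t)\<^sup>2 * (norm (rflux 1 t))\<^sup>2)" "integrable M (\<lambda>t. (\<psi> t * weight N t)\<^sup>2 * (norm (rflux (- 1) t))\<^sup>2)"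
      "integrable M (\<lambda>t. (\<psi> t * weight N t)\<^sup>2 * (norm (rtrace 1 t))\<^sup>2)" "integrable M (\<lambda>t. (\<psi> t * weight N t)\<^sup>2 * (norm (rtrace (- 1) t))\<^sup>2)"
      by (intro i sq_int_rflux sq_int_rtrace; simp)+
    have "nsq M (localized N \<psi> (rflux 1)) + nsq M (localized N \<psi> (rflux (- 1))) = (LINT t|M. (\<psi> t * weight N t)\<^sup>2 * (norm (rflux 1 t))\<^sup>2 + (\<psi> t * weight N t)\<^sup>2 * (norm (rflux (- 1) t))\<^sup>2)"
      unfolding nsq_localized by (rule Bochner_Integration.integral_add[OF ig(1,2), symmetric])
    also have "\<dots> \<le> (LINT t|M. \<mu>\<^sup>2 * ((\<psi> t * weight N t)\<^sup>2 * (norm (rtrace 1 t))\<^sup>2 + (\<psi> t * weight N t)\<^sup>2 * (norm (rtrace (- 1) t))\<^sup>2))"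
    proof (rule integral_mono_AE)
      show "AE t in M. (\<psi> t * weight N t)\<^sup>2 * (norm (rflux 1 t))\<^sup>2 + (\<psi> t * weight N t)\<^sup>2 * (norm (rflux (- 1) t))\<^sup>2
          \<le> \<mu>\<^sup>2 * ((\<psi> t * weight N t)\<^sup>2 * (norm (rtrace 1 t))\<^sup>2 + (\<psi> t * weight N t)\<^sup>2 * (norm (rtrace (- 1) t))\<^sup>2)"
        using rflux_bound
      proof eventually_elim
        case (elim t)
        from mult_left_mono[OF elim zero_le_power2[of "\<psi> t * weight N t"]]
        show ?case by (simp only: distrib_left mult.left_commute[of "\<mu>\<^sup>2"])
      qed
    qed (intro Bochner_Integration.integrable_add integrable_mult_right ig)+
    also have "\<dots> = \<mu>\<^sup>2 * (nsq M (localized N \<psi> (rtrace 1)) + nsq M (localized N \<psi> (rtrace (- 1))))"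
      unfolding nsq_localized integral_mult_right_zero by (simp only: Bochner_Integration.integral_add[OF ig(3,4)])
    finally show "nsq M (localized N \<psi> (rflux 1)) + nsq M (localized N \<psi> (rflux (- 1))) \<le> \<mu>\<^sup>2 * (nsq M (localized N \<psi> (rtrace 1)) + nsq M (localized N \<psi> (rtrace (- 1))))" .
  qed
qed

text \<open>
  A Carleman estimate with the constant independent of \<open>N\<close>, of the interval and of the solution.
\<close>

lemma carleman:
  assumes \<psi>: "smooth UNIV \<psi>" "compact K" "K \<subseteq> {a<..<b}" "\<And>x. x \<notin> K \<Longrightarrow> \<psi> x = 0"
    and B1: "(LINT t|M. (deriv \<psi> t * weight N t)\<^sup>2 * (normH (r t))\<^sup>2) \<le> B"
    and B2: "(LINT t|M. (deriv (deriv \<psi>) t * weight N t)\<^sup>2 * (normH (r t))\<^sup>2) \<le> B"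
    and tau: "tau_threshold * \<mu>\<^sup>2 \<le> tau N"
  shows "(LINT t|M. (\<psi> t * weight N t)\<^sup>2 * (normH (r t))\<^sup>2) \<le> carleman_const * B"
  by (rule weighted_le_of_modes[OF smooth_continuous[OF \<psi>(1) open_UNIV] carleman_sum[OF \<psi> B1 B2 tau]])

end

section \<open>Propagation to the past\<close>

definition time_cutoff :: "real \<Rightarrow> real \<Rightarrow> real \<Rightarrow> real" where
  "time_cutoff \<alpha> \<beta> t = smooth_step (t - \<alpha>) * smooth_step (\<beta> - t)"

lemma smooth_time_cutoff: "smooth UNIV (time_cutoff \<alpha> \<beta>)"
proof -
  have "smooth UNIV (\<lambda>t. smooth_step (1 * t + (- \<alpha>)))" "smooth UNIV (\<lambda>t. smooth_step ((- 1) * t + \<beta>))"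
    by (rule smooth_compose[where U = UNIV and f = smooth_step, OF smooth_smooth_step smooth_affine], simp)+
  from smooth_mult[OF this] show ?thesis by (simp add: time_cutoff_def[abs_def] algebra_simps)
qed

lemma time_cutoff_outside: "t \<notin> {\<alpha>..\<beta>} \<Longrightarrow> time_cutoff \<alpha> \<beta> t = 0"
  by (auto simp: time_cutoff_def smooth_step_eq)

lemma time_cutoff_inside: "\<alpha> + 1 \<le> t \<Longrightarrow> t \<le> \<beta> - 1 \<Longrightarrow> time_cutoff \<alpha> \<beta> t = 1"
  by (auto simp: time_cutoff_def smooth_step_eq)

lemma deriv_time_cutoff:
  assumes ab: "\<alpha> + 1 < \<beta> - 1"
  shows "deriv (time_cutoff \<alpha> \<beta>) = (\<lambda>t. deriv smooth_step (t - \<alpha>) - deriv smooth_step (\<beta> - t))"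
    and "deriv (deriv (time_cutoff \<alpha> \<beta>)) = (\<lambda>t. deriv (deriv smooth_step) (t - \<alpha>) + deriv (deriv smooth_step) (\<beta> - t))"
proof -
  have s1: "smooth UNIV (deriv smooth_step)" by (rule smooth_deriv(1)[OF open_UNIV smooth_smooth_step])
  have d0: "(smooth_step has_real_derivative deriv smooth_step x) (at x)" for x
    by (rule smooth_deriv(2)[OF open_UNIV smooth_smooth_step]) simp
  have d1: "(deriv smooth_step has_real_derivative deriv (deriv smooth_step) x) (at x)" for x
    by (rule smooth_deriv(2)[OF open_UNIV s1]) simp
  have l: "((\<lambda>t. t - \<alpha>) has_real_derivative 1) (at t)" and u: "((\<lambda>t. \<beta> - t) has_real_derivative - 1) (at t)" for t
    by (auto intro!: derivative_eq_intros)
  show D: "deriv (time_cutoff \<alpha> \<beta>) = (\<lambda>t. deriv smooth_step (t - \<alpha>) - deriv smooth_step (\<beta> - t))"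
  proof
    fix t
    have e: "deriv (time_cutoff \<alpha> \<beta>) t = deriv smooth_step (t - \<alpha>) * smooth_step (\<beta> - t) - smooth_step (t - \<alpha>) * deriv smooth_step (\<beta> - t)"
      unfolding time_cutoff_def[abs_def]
      by (rule DERIV_imp_deriv, rule DERIV_cong[OF DERIV_mult[OF DERIV_chain2[OF d0 l] DERIV_chain2[OF d0 u]]]) simp
    \<comment> \<open>the two transition zones are disjoint\<close>
    consider "t - \<alpha> > 1" "deriv smooth_step (t - \<alpha>) = 0" "smooth_step (t - \<alpha>) = 1"
      | "\<beta> - t > 1" "deriv smooth_step (\<beta> - t) = 0" "smooth_step (\<beta> - t) = 1"
      using ab smooth_step_derivs_vanish(1)[of "t - \<alpha>"] smooth_step_derivs_vanish(1)[of "\<beta> - t"]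
        smooth_step_eq(2)[of "t - \<alpha>"] smooth_step_eq(2)[of "\<beta> - t"]
      by (cases "t < \<beta> - 1") auto
    then show "deriv (time_cutoff \<alpha> \<beta>) t = deriv smooth_step (t - \<alpha>) - deriv smooth_step (\<beta> - t)"
      unfolding e by cases simp_all
  qed
  show "deriv (deriv (time_cutoff \<alpha> \<beta>)) = (\<lambda>t. deriv (deriv smooth_step) (t - \<alpha>) + deriv (deriv smooth_step) (\<beta> - t))"
    unfolding D
    by (rule ext, rule DERIV_imp_deriv, rule DERIV_cong[OF DERIV_diff[OF DERIV_chain2[OF d1 l] DERIV_chain2[OF d1 u]]]) simp
qed

lemma time_cutoff_derivs:
  obtains D where "D \<ge> 1"
    "\<And>\<alpha> \<beta> t. \<alpha> + 1 < \<beta> - 1 \<Longrightarrow> \<bar>deriv (time_cutoff \<alpha> \<beta>) t\<bar> \<le> D \<and> \<bar>deriv (deriv (time_cutoff \<alpha> \<beta>)) t\<bar> \<le> D"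
    "\<And>\<alpha> \<beta> t. \<alpha> + 1 < \<beta> - 1 \<Longrightarrow> \<not> (\<alpha> \<le> t \<and> t \<le> \<alpha> + 1) \<Longrightarrow> \<not> (\<beta> - 1 \<le> t \<and> t \<le> \<beta>)
      \<Longrightarrow> deriv (time_cutoff \<alpha> \<beta>) t = 0 \<and> deriv (deriv (time_cutoff \<alpha> \<beta>)) t = 0"
proof -
  obtain B where B: "B \<ge> 1" "\<And>x. \<bar>deriv smooth_step x\<bar> \<le> B" "\<And>x. \<bar>deriv (deriv smooth_step) x\<bar> \<le> B"
    using smooth_step_derivs_bounded by metis
  show ?thesis
  proof (rule that[of "2 * B"])
    show "2 * B \<ge> 1" using B(1) by simp
    fix \<alpha> \<beta> t :: real assume ab: "\<alpha> + 1 < \<beta> - 1"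
    show "\<bar>deriv (time_cutoff \<alpha> \<beta>) t\<bar> \<le> 2 * B \<and> \<bar>deriv (deriv (time_cutoff \<alpha> \<beta>)) t\<bar> \<le> 2 * B"
      unfolding deriv_time_cutoff(2)[OF ab] unfolding deriv_time_cutoff(1)[OF ab]
      using B(2)[of "t - \<alpha>"] B(2)[of "\<beta> - t"] B(3)[of "t - \<alpha>"] B(3)[of "\<beta> - t"] by linarith
    assume "\<not> (\<alpha> \<le> t \<and> t \<le> \<alpha> + 1)" "\<not> (\<beta> - 1 \<le> t \<and> t \<le> \<beta>)"
    then have "t - \<alpha> < 0 \<or> t - \<alpha> > 1" "\<beta> - t < 0 \<or> \<beta> - t > 1" by linarith+
    then show "deriv (time_cutoff \<alpha> \<beta>) t = 0 \<and> deriv (deriv (time_cutoff \<alpha> \<beta>)) t = 0"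
      unfolding deriv_time_cutoff(2)[OF ab] unfolding deriv_time_cutoff(1)[OF ab] by (simp add: smooth_step_derivs_vanish)
  qed
qed

context solution
begin

lemma \<N>_sq:
  assumes I: "I \<in> sets lebesgue" "I \<subseteq> {a<..<b}"
  shows "integrable M (\<lambda>t. indicator I t * (normH (r t))\<^sup>2)"
    and "(LINT t|M. indicator I t * (normH (r t))\<^sup>2) = (\<N> I r)\<^sup>2"
proof -
  have "I \<in> sets M" using I by (auto simp: sets_restrict_space image_iff intro!: bexI[of _ I])
  then show "integrable M (\<lambda>t. indicator I t * (normH (r t))\<^sup>2)"
    using integrable_mult_indicator[OF _ normH_int] by simp
  have i: "(LINT t|lebesgue_on J. (normH (r t))\<^sup>2) = (LINT t|lebesgue. indicator J t * (normH (r t))\<^sup>2)"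
    if "J \<in> sets lebesgue" for J
    using that by (subst integral_restrict_space) auto
  have j: "(LINT t|M. indicator I t * (normH (r t))\<^sup>2) = (LINT t|lebesgue. indicator {a<..<b} t * (indicator I t * (normH (r t))\<^sup>2))"
    by (subst integral_restrict_space) auto
  have k: "indicator {a<..<b} t * (indicator I t * (normH (r t))\<^sup>2) = indicator I t * (normH (r t))\<^sup>2" for t
    using I(2) by (auto simp: indicator_def)
  have "(\<N> I r)\<^sup>2 = (LINT t|lebesgue_on I. (normH (r t))\<^sup>2)"
    unfolding \<N>_def by (rule real_sqrt_pow2) (rule Bochner_Integration.integral_nonneg, simp)
  then show "(LINT t|M. indicator I t * (normH (r t))\<^sup>2) = (\<N> I r)\<^sup>2"
    unfolding j k i[OF I(1)] ..
qed

lemma \<N>_nonneg: "\<N> I u \<ge> 0"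
  unfolding \<N>_def by (rule real_sqrt_ge_zero, rule Bochner_Integration.integral_nonneg) simp

lemma \<N>_mono:
  assumes I: "I \<in> sets lebesgue" "J \<in> sets lebesgue" "I \<subseteq> J" "J \<subseteq> {a<..<b}"
  shows "\<N> I r \<le> \<N> J r"
proof (rule power2_le_imp_le[OF _ \<N>_nonneg])
  have "I \<subseteq> {a<..<b}" using I by auto
  note i = \<N>_sq[OF I(1) this] and j = \<N>_sq[OF I(2,4)]
  show "(\<N> I r)\<^sup>2 \<le> (\<N> J r)\<^sup>2"
    unfolding i(2)[symmetric] j(2)[symmetric]
    by (rule integral_mono[OF i(1) j(1)]) (use I(3) in \<open>auto simp: indicator_def\<close>)
qed

text \<open>
  The derivatives of a cutoff in time live on two short intervals. The first one lies within
  \<open>(a, a + 3)\<close> and starts at distance one from \<open>a\<close>; the second one lies near the right end, where the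
  weight is smallest.
\<close>

lemma weighted_derivative_bound:
  assumes f: "continuous_on UNIV f" "\<And>t. \<bar>f t\<bar> \<le> D"
    and off: "\<And>t. \<not> (a + 1 \<le> t \<and> t \<le> a + 2) \<Longrightarrow> \<not> (b - 2 \<le> t \<and> t \<le> b - 1) \<Longrightarrow> f t = 0"
    and c: "a + 3 \<le> b" "a \<le> c" "c < b - 2"
  shows "(LINT t|M. (f t * weight N t)\<^sup>2 * (normH (r t))\<^sup>2)
    \<le> D\<^sup>2 * ((exp (- tau N) * \<N> {a<..<a + 3} r)\<^sup>2 + (exp (- tau N * (b - 2 - a)) * \<N> {c<..<b} r)\<^sup>2)"
proof -
  let ?w1 = "D\<^sup>2 * (exp (- tau N))\<^sup>2" and ?w2 = "D\<^sup>2 * (exp (- tau N * (b - 2 - a)))\<^sup>2"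
  have ta: "tau N \<ge> 0" by (simp add: tau_def)
  have s: "{a<..<a + 3} \<in> sets lebesgue" "{a<..<a + 3} \<subseteq> {a<..<b}" "{c<..<b} \<in> sets lebesgue" "{c<..<b} \<subseteq> {a<..<b}"
    using c by auto
  note n1 = \<N>_sq[OF s(1,2)] and n2 = \<N>_sq[OF s(3,4)]
  have "(LINT t|M. (f t * weight N t)\<^sup>2 * (normH (r t))\<^sup>2)
    \<le> (LINT t|M. ?w1 * (indicator {a<..<a + 3} t * (normH (r t))\<^sup>2) + ?w2 * (indicator {c<..<b} t * (normH (r t))\<^sup>2))"
  proof (rule integral_mono[OF integrable_weighted[OF f(1)]])
    show "integrable M (\<lambda>t. ?w1 * (indicator {a<..<a + 3} t * (normH (r t))\<^sup>2) + ?w2 * (indicator {c<..<b} t * (normH (r t))\<^sup>2))"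
      by (intro Bochner_Integration.integrable_add integrable_mult_right n1(1) n2(1))
    fix t
    have sq: "(f t * weight N t)\<^sup>2 \<le> D\<^sup>2 * E\<^sup>2" if "weight N t \<le> E" for E
    proof -
      have "\<bar>f t * weight N t\<bar> \<le> D * E"
        unfolding abs_mult using f(2)[of t] that by (intro mult_mono) (auto simp: weight_def intro: order_trans[OF abs_ge_zero])
      from power_mono[OF this abs_ge_zero, of 2] show ?thesis by (simp only: power2_abs power_mult_distrib)
    qed
    have w: "weight N t \<le> exp (- tau N * (d - a))" if "d \<le> t" for d
      using mult_left_mono[OF that ta] by (simp add: weight_def algebra_simps)
    consider "a + 1 \<le> t" "t \<le> a + 2" | "b - 2 \<le> t" "t \<le> b - 1" | "f t = 0" using off[of t] by blast
    then have "(f t * weight N t)\<^sup>2 \<le> ?w1 * indicator {a<..<a + 3} t + ?w2 * indicator {c<..<b} t"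
    proof cases
      case 1
      then have "(f t * weight N t)\<^sup>2 \<le> ?w1 * indicator {a<..<a + 3} t" using sq[OF w[of "a + 1"]] by simp
      then show ?thesis by (rule order_trans) simp
    next
      case 2
      then have "(f t * weight N t)\<^sup>2 \<le> ?w2 * indicator {c<..<b} t" using sq[OF w[of "b - 2"]] c by simp
      then show ?thesis by (rule order_trans) simp
    next
      case 3 then show ?thesis by simp
    qed
    from mult_right_mono[OF this, of "(normH (r t))\<^sup>2"]
    show "(f t * weight N t)\<^sup>2 * (normH (r t))\<^sup>2
      \<le> ?w1 * (indicator {a<..<a + 3} t * (normH (r t))\<^sup>2) + ?w2 * (indicator {c<..<b} t * (normH (r t))\<^sup>2)"
      by (simp only: distrib_right mult.assoc zero_le_power2)
  qed
  also have "\<dots> = ?w1 * (\<N> {a<..<a + 3} r)\<^sup>2 + ?w2 * (\<N> {c<..<b} r)\<^sup>2"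
    unfolding Bochner_Integration.integral_add[OF integrable_mult_right[OF n1(1)] integrable_mult_right[OF n2(1)]]
      integral_mult_right_zero n1(2) n2(2) ..
  finally show ?thesis by (simp only: distrib_left mult.assoc power_mult_distrib)
qed

text \<open>
  The Carleman estimate for a cutoff that equals one on \<open>[a + 2, b - 2]\<close>. On the set \<open>I\<close> to the left
  of \<open>d\<close> the weight is at least \<open>exp (- tau N * (d - a))\<close>.
\<close>

lemma three_interval_inequality:
  assumes D: "D \<ge> 0"
    "\<And>\<alpha> \<beta> t. \<alpha> + 1 < \<beta> - 1 \<Longrightarrow> \<bar>deriv (time_cutoff \<alpha> \<beta>) t\<bar> \<le> D \<and> \<bar>deriv (deriv (time_cutoff \<alpha> \<beta>)) t\<bar> \<le> D"
    "\<And>\<alpha> \<beta> t. \<alpha> + 1 < \<beta> - 1 \<Longrightarrow> \<not> (\<alpha> \<le> t \<and> t \<le> \<alpha> + 1) \<Longrightarrow> \<not> (\<beta> - 1 \<le> t \<and> t \<le> \<beta>)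
      \<Longrightarrow> deriv (time_cutoff \<alpha> \<beta>) t = 0 \<and> deriv (deriv (time_cutoff \<alpha> \<beta>)) t = 0"
    and c: "a + 4 < b" "a \<le> c" "c < b - 2" and tau: "tau_threshold * \<mu>\<^sup>2 \<le> tau N"
    and I: "I \<in> sets lebesgue" "I \<subseteq> {a + 2..b - 2}" "I \<subseteq> {..<d}"
  shows "exp (- tau N * (d - a)) * \<N> I r
    \<le> sqrt carleman_const * D * (exp (- tau N) * \<N> {a<..<a + 3} r + exp (- tau N * (b - 2 - a)) * \<N> {c<..<b} r)"
proof -
  let ?\<psi> = "time_cutoff (a + 1) (b - 1)"
  let ?x = "exp (- tau N) * \<N> {a<..<a + 3} r" and ?y = "exp (- tau N * (b - 2 - a)) * \<N> {c<..<b} r"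
  have ab': "a + 1 + 1 < b - 1 - 1" using c by simp
  have ta: "tau N \<ge> 0" by (simp add: tau_def)
  have xy: "?x \<ge> 0" "?y \<ge> 0" by (simp_all add: \<N>_nonneg)
  have s1: "smooth UNIV (deriv ?\<psi>)" by (rule smooth_deriv(1)[OF open_UNIV smooth_time_cutoff])
  have s2: "smooth UNIV (deriv (deriv ?\<psi>))" by (rule smooth_deriv(1)[OF open_UNIV s1])
  have le: "(LINT t|M. (f t * weight N t)\<^sup>2 * (normH (r t))\<^sup>2) \<le> D\<^sup>2 * (?x\<^sup>2 + ?y\<^sup>2)"
    if "f = deriv ?\<psi> \<or> f = deriv (deriv ?\<psi>)" for f
  proof (rule weighted_derivative_bound)
    show "continuous_on UNIV f" using that smooth_continuous[OF s1 open_UNIV] smooth_continuous[OF s2 open_UNIV] by blast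
    show "\<bar>f t\<bar> \<le> D" for t using that D(2)[OF ab', of t] by blast
    show "f t = 0" if "\<not> (a + 1 \<le> t \<and> t \<le> a + 2)" "\<not> (b - 2 \<le> t \<and> t \<le> b - 1)" for t
    proof -
      have "\<not> (a + 1 \<le> t \<and> t \<le> a + 1 + 1)" "\<not> (b - 1 - 1 \<le> t \<and> t \<le> b - 1)" using that by linarith+
      from D(3)[OF ab' this] show ?thesis using \<open>f = deriv ?\<psi> \<or> f = deriv (deriv ?\<psi>)\<close> by blast
    qed
  qed (use c in auto)
  have main: "(LINT t|M. (?\<psi> t * weight N t)\<^sup>2 * (normH (r t))\<^sup>2) \<le> carleman_const * (D\<^sup>2 * (?x\<^sup>2 + ?y\<^sup>2))"
  proof (rule carleman)
    show "smooth UNIV ?\<psi>" by (rule smooth_time_cutoff)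
    show "compact {a + 1..b - 1}" by simp
    show "{a + 1..b - 1} \<subseteq> {a<..<b}" by auto
    show "?\<psi> x = 0" if "x \<notin> {a + 1..b - 1}" for x using that by (rule time_cutoff_outside)
  qed (use le tau in blast)+
  have Iab: "I \<subseteq> {a<..<b}" using I(2) by auto
  note n = \<N>_sq[OF I(1) Iab]
  have "(exp (- tau N * (d - a)) * \<N> I r)\<^sup>2 = (LINT t|M. (exp (- tau N * (d - a)))\<^sup>2 * (indicator I t * (normH (r t))\<^sup>2))"
    unfolding power_mult_distrib integral_mult_right_zero n(2) ..
  also have "\<dots> \<le> (LINT t|M. (?\<psi> t * weight N t)\<^sup>2 * (normH (r t))\<^sup>2)"
  proof (rule integral_mono[OF integrable_mult_right[OF n(1)] integrable_weighted[OF smooth_continuous[OF smooth_time_cutoff open_UNIV]]])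
    fix t
    show "(exp (- tau N * (d - a)))\<^sup>2 * (indicator I t * (normH (r t))\<^sup>2) \<le> (?\<psi> t * weight N t)\<^sup>2 * (normH (r t))\<^sup>2"
    proof (cases "t \<in> I")
      case True
      then have t: "a + 1 + 1 \<le> t" "t \<le> b - 1 - 1" "t \<le> d" using I by auto
      have "exp (- tau N * (d - a)) \<le> weight N t"
        using mult_left_mono[OF t(3) ta] by (simp add: weight_def algebra_simps)
      then have "(exp (- tau N * (d - a)))\<^sup>2 \<le> (?\<psi> t * weight N t)\<^sup>2"
        unfolding time_cutoff_inside[OF t(1,2)] mult_1 by (rule power_mono) simp
      then show ?thesis using True by (simp add: mult_right_mono)
    qed simp
  qed
  also note main
  also have "carleman_const * (D\<^sup>2 * (?x\<^sup>2 + ?y\<^sup>2)) \<le> carleman_const * (D\<^sup>2 * (?x + ?y)\<^sup>2)"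
    using xy carleman_const_pos by (intro mult_left_mono) (auto simp: power2_sum)
  also have "\<dots> = (sqrt carleman_const * D * (?x + ?y))\<^sup>2"
    using carleman_const_pos by (simp add: power_mult_distrib)
  finally show ?thesis
    by (rule power2_le_imp_le) (use xy D(1) carleman_const_pos in auto)
qed

end

lemma exists_tau_between:
  assumes "x \<ge> 0"
  obtains N where "x \<le> tau N" "tau N \<le> x + 4"
proof (rule that[of "nat \<lceil>x / 2\<rceil>"])
  have c: "real (nat \<lceil>x / 2\<rceil>) = of_int \<lceil>x / 2\<rceil>" using assms by simp
  show "x \<le> tau (nat \<lceil>x / 2\<rceil>)" "tau (nat \<lceil>x / 2\<rceil>) \<le> x + 4"
    unfolding tau_def c using le_of_int_ceiling[of "x / 2"] of_int_ceiling_le_add_one[of "x / 2"] by linarith+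
qed

text \<open>
  The factor \<open>exp (- \<tau>)\<close> between the weights at the times \<open>0\<close> and \<open>1\<close> beats \<open>2 C G / A\<close>. Hence the
  term with \<open>G\<close> is at most half the left-hand side of the inequality for \<open>A\<close>; the same bound for this
  term is then inserted into the inequality for \<open>Nr\<close>.
\<close>

lemma propagation_absorb:
  fixes C A G Nl Nr \<tau> T :: real
  assumes C: "C \<ge> 1" and A: "A > 0" and G: "G \<ge> A" and Nl: "Nl \<ge> 0" and T: "T \<le> - 4"
    and tau: "ln (2 * C * G / A) \<le> \<tau>"
    and eA: "exp (- \<tau> * (3 - T)) * A \<le> C * (exp (- \<tau>) * Nl + exp (- \<tau> * (4 - T)) * G)"
    and er: "exp (- \<tau> * 4) * Nr \<le> C * (exp (- \<tau>) * Nl + exp (- \<tau> * (4 - T)) * G)"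
  shows "A \<le> 2 * C * exp (\<tau> * (2 + \<bar>T\<bar>)) * Nl" and "Nr \<le> 2 * C * exp (\<tau> * 3) * Nl"
proof -
  have p: "2 * C * G / A > 0" using C A G by (auto intro!: divide_pos_pos mult_pos_pos)
  have "2 * C * G / A \<le> exp \<tau>" using tau p by (metis exp_le_cancel_iff exp_ln)
  then have "2 * C * G \<le> exp \<tau> * A" using A by (simp add: field_simps)
  then have "exp (- \<tau> * (4 - T)) * (2 * C * G) \<le> exp (- \<tau> * (4 - T)) * (exp \<tau> * A)"
    by (rule mult_left_mono) simp
  also have "\<dots> = exp (- \<tau> * (3 - T)) * A"
    unfolding mult.assoc[symmetric] exp_add[symmetric] by (simp add: algebra_simps)
  finally have abs: "C * (exp (- \<tau> * (4 - T)) * G) \<le> exp (- \<tau> * (3 - T)) * A / 2" by (simp add: mult_ac)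
  with eA have h: "exp (- \<tau> * (3 - T)) * A / 2 \<le> C * (exp (- \<tau>) * Nl)" by (simp add: distrib_left)
  have "exp (\<tau> * (3 - T)) * (exp (- \<tau> * (3 - T)) * A) \<le> exp (\<tau> * (3 - T)) * (2 * C * (exp (- \<tau>) * Nl))"
    using h by (intro mult_left_mono) auto
  moreover have "exp (\<tau> * (3 - T)) * (exp (- \<tau> * (3 - T)) * A) = A"
    unfolding mult.assoc[symmetric] exp_add[symmetric] by simp
  moreover have "exp (\<tau> * (3 - T)) * (2 * C * (exp (- \<tau>) * Nl)) = 2 * C * (exp (\<tau> * (3 - T)) * exp (- \<tau>)) * Nl" by simp
  moreover have "exp (\<tau> * (3 - T)) * exp (- \<tau>) = exp (\<tau> * (2 + \<bar>T\<bar>))"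
    unfolding exp_add[symmetric] using T by (simp add: algebra_simps)
  ultimately show "A \<le> 2 * C * exp (\<tau> * (2 + \<bar>T\<bar>)) * Nl" by (simp only:)
  have "exp (- \<tau> * 4) * Nr \<le> 2 * C * (exp (- \<tau>) * Nl)"
    using er abs h by (simp add: distrib_left)
  then have "exp (\<tau> * 4) * (exp (- \<tau> * 4) * Nr) \<le> exp (\<tau> * 4) * (2 * C * (exp (- \<tau>) * Nl))"
    by (rule mult_left_mono) simp
  moreover have "exp (\<tau> * 4) * (exp (- \<tau> * 4) * Nr) = Nr"
    unfolding mult.assoc[symmetric] exp_add[symmetric] by simp
  moreover have "exp (\<tau> * 4) * (2 * C * (exp (- \<tau>) * Nl)) = 2 * C * (exp (\<tau> * 4) * exp (- \<tau>)) * Nl" by simp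
  moreover have "exp (\<tau> * 4) * exp (- \<tau>) = exp (\<tau> * 3)"
    unfolding exp_add[symmetric] by (simp add: algebra_simps)
  ultimately show "Nr \<le> 2 * C * exp (\<tau> * 3) * Nl" by (simp only:)
qed

lemma weak_solution_imp_solution:
  assumes "weak_solution \<Gamma> r" "\<Gamma> \<in> borel_measurable (lebesgue_on {..<3})"
    "AE t in lebesgue_on {..<3}. onorm (\<lambda>z. \<Gamma> t *v z) \<le> \<mu>" "a < 3"
  shows "solution a 3 r \<Gamma> \<mu>"
proof
  have s: "{a<..<3} \<subseteq> {..<3::real}" by auto
  show "a < 3" by fact
  show "weak_solution_on {a<..<3} \<Gamma> r" using assms unfolding weak_solution_def by simp
  show "\<Gamma> \<in> borel_measurable (lebesgue_on {a<..<3})"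
    by (rule measurable_restrict_mono[OF assms(2) s])
  have "AE t in lebesgue. t \<in> {..<3} \<longrightarrow> onorm (\<lambda>z. \<Gamma> t *v z) \<le> \<mu>"
    using assms(3) by (subst (asm) AE_restrict_space_iff) auto
  then have "AE t in lebesgue. t \<in> {a<..<3} \<longrightarrow> onorm (\<lambda>z. \<Gamma> t *v z) \<le> \<mu>"
    by eventually_elim auto
  then show "AE t in lebesgue_on {a<..<3}. onorm (\<lambda>z. \<Gamma> t *v z) \<le> \<mu>"
    by (subst AE_restrict_space_iff) auto
qed

text \<open>
  Both conclusions with an explicit exponent \<open>\<tau>\<close> and one constant \<open>C\<close> for all data. The estimate is
  applied on the interval \<open>(T - 3, 3)\<close>.
\<close>

lemma propagation_to_the_past:
  obtains C where "C \<ge> 1"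
    "\<And>\<mu> \<Gamma> r T. \<Gamma> \<in> borel_measurable (lebesgue_on {..<3}) \<Longrightarrow>
     (AE t in lebesgue_on {..<3}. onorm (\<lambda>z. \<Gamma> t *v z) \<le> \<mu>) \<Longrightarrow> weak_solution \<Gamma> r \<Longrightarrow>
     \<N> {-1<..<0} r > 0 \<Longrightarrow> T \<le> - 4 \<Longrightarrow> \<N> {-1<..<0} r \<le> \<N> {-4<..<3} r \<and>
     (\<exists>\<tau>\<ge>0. \<tau> \<le> tau_threshold * \<mu>\<^sup>2 + ln (2 * C * \<N> {-4<..<3} r / \<N> {-1<..<0} r) + 4 \<and>
       \<N> {-1<..<0} r \<le> 2 * C * exp (\<tau> * (2 + \<bar>T\<bar>)) * \<N> {T - 3<..<T} r \<and>
       \<N> {T<..<T + 1} r \<le> 2 * C * exp (\<tau> * 3) * \<N> {T - 3<..<T} r)"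
proof -
  obtain D where D: "D \<ge> 1"
    "\<And>\<alpha> \<beta> t. \<alpha> + 1 < \<beta> - 1 \<Longrightarrow> \<bar>deriv (time_cutoff \<alpha> \<beta>) t\<bar> \<le> D \<and> \<bar>deriv (deriv (time_cutoff \<alpha> \<beta>)) t\<bar> \<le> D"
    "\<And>\<alpha> \<beta> t. \<alpha> + 1 < \<beta> - 1 \<Longrightarrow> \<not> (\<alpha> \<le> t \<and> t \<le> \<alpha> + 1) \<Longrightarrow> \<not> (\<beta> - 1 \<le> t \<and> t \<le> \<beta>)
      \<Longrightarrow> deriv (time_cutoff \<alpha> \<beta>) t = 0 \<and> deriv (deriv (time_cutoff \<alpha> \<beta>)) t = 0"
    by (rule time_cutoff_derivs) blast
  have D0: "D \<ge> 0" using D(1) by simp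
  define C where "C = max 1 (sqrt carleman_const * D)"
  have C: "C \<ge> 1" "sqrt carleman_const * D \<le> C" by (auto simp: C_def)
  show ?thesis
  proof (rule that[OF C(1)])
    fix \<mu> T :: real and \<Gamma> :: "real \<Rightarrow> complex ^ 2 ^ 2" and r :: "real \<Rightarrow> real \<Rightarrow> complex"
    assume G: "\<Gamma> \<in> borel_measurable (lebesgue_on {..<3})" "AE t in lebesgue_on {..<3}. onorm (\<lambda>z. \<Gamma> t *v z) \<le> \<mu>"
      and r: "weak_solution \<Gamma> r" and A: "\<N> {-1<..<0} r > 0" and T: "T \<le> - 4"
    interpret solution "T - 3" 3 r \<Gamma> \<mu>
      by (rule weak_solution_imp_solution[OF r G]) (use T in simp)
    let ?A = "\<N> {-1<..<0} r" and ?G = "\<N> {-4<..<3} r" and ?L = "\<N> {T - 3<..<T} r" and ?R = "\<N> {T<..<T + 1} r"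
    have AG: "?A \<le> ?G" by (rule \<N>_mono) (use T in auto)
    have q: "2 * C * ?G / ?A \<ge> 1"
    proof -
      have "1 * ?A \<le> 2 * C * ?G" using C(1) AG A by (intro mult_mono) auto
      then show ?thesis using A by (simp add: field_simps)
    qed
    have ln0: "ln (2 * C * ?G / ?A) \<ge> 0" using q by simp
    have k0: "tau_threshold * \<mu>\<^sup>2 \<ge> 0" using tau_threshold_pos by simp
    obtain N where N: "tau_threshold * \<mu>\<^sup>2 + ln (2 * C * ?G / ?A) \<le> tau N" "tau N \<le> tau_threshold * \<mu>\<^sup>2 + ln (2 * C * ?G / ?A) + 4"
      using exists_tau_between[of "tau_threshold * \<mu>\<^sup>2 + ln (2 * C * ?G / ?A)"] ln0 k0 by auto
    have carl: "exp (- tau N * (d - (T - 3))) * \<N> I r \<le> C * (exp (- tau N) * ?L + exp (- tau N * (4 - T)) * ?G)"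
      if I: "I \<in> sets lebesgue" "I \<subseteq> {T - 1..1}" "I \<subseteq> {..<d}" for I d
    proof -
      have "exp (- tau N * (d - (T - 3))) * \<N> I r
        \<le> sqrt carleman_const * D * (exp (- tau N) * \<N> {T - 3<..<T - 3 + 3} r + exp (- tau N * (3 - 2 - (T - 3))) * \<N> {-4<..<3} r)"
        by (rule three_interval_inequality[OF D0 D(2,3)]) (use T I N(1) ln0 k0 in auto)
      also have "\<dots> = sqrt carleman_const * D * (exp (- tau N) * ?L + exp (- tau N * (4 - T)) * ?G)" by simp
      also have "\<dots> \<le> C * (exp (- tau N) * ?L + exp (- tau N * (4 - T)) * ?G)"
        by (intro mult_right_mono C(2) add_nonneg_nonneg mult_nonneg_nonneg \<N>_nonneg) auto
      finally show ?thesis .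
    qed
    have eA: "exp (- tau N * (3 - T)) * ?A \<le> C * (exp (- tau N) * ?L + exp (- tau N * (4 - T)) * ?G)"
    proof -
      have I: "{-1<..<0} \<subseteq> {T - 1..1}" "{-1<..<0} \<subseteq> {..<0::real}" using T by auto
      have "0 - (T - 3) = 3 - T" by simp
      with carl[OF fmeasurableD[OF lmeasurable_interval(2)] I] show ?thesis by (simp only:)
    qed
    have eR: "exp (- tau N * 4) * ?R \<le> C * (exp (- tau N) * ?L + exp (- tau N * (4 - T)) * ?G)"
    proof -
      have I: "{T<..<T + 1} \<subseteq> {T - 1..1}" "{T<..<T + 1} \<subseteq> {..<T + 1}" using T by auto
      have "T + 1 - (T - 3) = 4" by simp
      with carl[OF fmeasurableD[OF lmeasurable_interval(2)] I] show ?thesis by (simp only:)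
    qed
    have tl: "ln (2 * C * ?G / ?A) \<le> tau N" using N(1) k0 by linarith
    have "?A \<le> 2 * C * exp (tau N * (2 + \<bar>T\<bar>)) * ?L" "?R \<le> 2 * C * exp (tau N * 3) * ?L"
      by (rule propagation_absorb[OF C(1) A AG \<N>_nonneg T tl eA eR])+
    then show "?A \<le> ?G \<and> (\<exists>\<tau>\<ge>0. \<tau> \<le> tau_threshold * \<mu>\<^sup>2 + ln (2 * C * ?G / ?A) + 4 \<and>
       ?A \<le> 2 * C * exp (\<tau> * (2 + \<bar>T\<bar>)) * ?L \<and> ?R \<le> 2 * C * exp (\<tau> * 3) * ?L)"
      using AG N(2) by (intro conjI exI[of _ "tau N"]) (simp_all add: tau_def)
  qed
qed

theorem proposition15p2:
  "\<exists>C1>0. \<forall>(\<mu>::real) (\<Gamma> :: real \<Rightarrow> complex ^ 2 ^ 2) (r :: real \<Rightarrow> real \<Rightarrow> complex) (G::real) (A::real) (\<Lambda>::real).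
     \<mu> \<ge> 0 \<longrightarrow>
     \<Gamma> \<in> borel_measurable (lebesgue_on {..<3}) \<longrightarrow>
     (AE t in lebesgue_on {..<3}. onorm (\<lambda>z. \<Gamma> t *v z) \<le> \<mu>) \<longrightarrow>
     weak_solution \<Gamma> r \<longrightarrow>
     G = \<N> {-4<..<3} r \<longrightarrow>
     A = \<N> {-1<..<0} r \<longrightarrow>
     \<Lambda> = ln (exp 1 * G / A) \<longrightarrow>
     A > 0 \<longrightarrow>
     (\<forall>T\<le>-4. \<N> {T<..<T+1} r \<le> exp (C1 * (1 + \<mu>\<^sup>2 + \<Lambda>)) * \<N> {T-3<..<T} r) \<and>
     (\<forall>T\<le>-4. \<N> {T-3<..<T} r \<ge> A * exp (- C1 * (1 + \<mu>\<^sup>2 + \<Lambda>) * (1 + \<bar>T\<bar>)))"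
proof -
  obtain C where C: "C \<ge> 1" and past: "\<And>\<mu> \<Gamma> r T. \<Gamma> \<in> borel_measurable (lebesgue_on {..<3}) \<Longrightarrow>
     (AE t in lebesgue_on {..<3}. onorm (\<lambda>z. \<Gamma> t *v z) \<le> \<mu>) \<Longrightarrow> weak_solution \<Gamma> r \<Longrightarrow>
     \<N> {-1<..<0} r > 0 \<Longrightarrow> T \<le> - 4 \<Longrightarrow> \<N> {-1<..<0} r \<le> \<N> {-4<..<3} r \<and>
     (\<exists>\<tau>\<ge>0. \<tau> \<le> tau_threshold * \<mu>\<^sup>2 + ln (2 * C * \<N> {-4<..<3} r / \<N> {-1<..<0} r) + 4 \<and>
       \<N> {-1<..<0} r \<le> 2 * C * exp (\<tau> * (2 + \<bar>T\<bar>)) * \<N> {T - 3<..<T} r \<and>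
       \<N> {T<..<T + 1} r \<le> 2 * C * exp (\<tau> * 3) * \<N> {T - 3<..<T} r)"
    by (rule propagation_to_the_past) blast
  define l where "l = ln (2 * C)"
  have l: "l \<ge> 0" "2 * C = exp l" using C by (auto simp: l_def)
  define D where "D = tau_threshold + l + 4"
  have D: "D \<ge> 4" using l tau_threshold_pos by (simp add: D_def)
  define C1 where "C1 = 3 * D + l"
  have C1: "C1 > 0" using D l by (simp add: C1_def)
  show ?thesis
  proof (intro exI[of _ C1] conjI C1 allI impI)
    fix \<mu> G A \<Lambda> T :: real and \<Gamma> :: "real \<Rightarrow> complex ^ 2 ^ 2" and r :: "real \<Rightarrow> real \<Rightarrow> complex"
    assume hyp: "\<Gamma> \<in> borel_measurable (lebesgue_on {..<3})" "AE t in lebesgue_on {..<3}. onorm (\<lambda>z. \<Gamma> t *v z) \<le> \<mu>"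
      "weak_solution \<Gamma> r" "G = \<N> {-4<..<3} r" "A = \<N> {-1<..<0} r" "\<Lambda> = ln (exp 1 * G / A)" "A > 0" "T \<le> - 4"
    define S where "S = 1 + \<mu>\<^sup>2 + \<Lambda>"
    obtain \<tau> where AG: "A \<le> G" and t: "\<tau> \<ge> 0" "\<tau> \<le> tau_threshold * \<mu>\<^sup>2 + ln (2 * C * G / A) + 4"
      and a: "A \<le> 2 * C * exp (\<tau> * (2 + \<bar>T\<bar>)) * \<N> {T - 3<..<T} r"
      and R: "\<N> {T<..<T + 1} r \<le> 2 * C * exp (\<tau> * 3) * \<N> {T - 3<..<T} r"
      using past[OF hyp(1-3) _ hyp(8)] hyp(4,5,7) by metis
    have N0: "\<N> {T - 3<..<T} r \<ge> 0" unfolding \<N>_def by (rule real_sqrt_ge_zero, rule Bochner_Integration.integral_nonneg) simp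
    have GA: "G / A \<ge> 1" using AG hyp(7) by simp
    have lnGA: "ln (2 * C * G / A) = l + ln (G / A)"
      using ln_mult_pos[of "2 * C" "G / A"] C GA by (simp add: l_def)
    have Lam: "\<Lambda> = 1 + ln (G / A)"
      using ln_mult_pos[of "exp 1" "G / A"] GA hyp(6) by simp
    have S1: "S \<ge> 1" using ln_ge_zero[OF GA] by (simp add: S_def Lam)
    have "\<tau> \<le> tau_threshold * S + l * S + 4 * S"
    proof -
      have "tau_threshold * \<mu>\<^sup>2 \<le> tau_threshold * (\<mu>\<^sup>2 + 1 )" using tau_threshold_pos by simp
      have S2: "S = 2 + \<mu>\<^sup>2 + ln (G / A)" by (simp add: S_def Lam)
      have "tau_threshold * \<mu>\<^sup>2 \<le> tau_threshold * S" using tau_threshold_pos ln_ge_zero[OF GA] unfolding S2 by (intro mult_left_mono) auto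
      moreover have "l * 1 \<le> l * S" using l S1 by (intro mult_left_mono) auto
      moreover have "ln (G / A) + 4 \<le> 4 * S" using ln_ge_zero[OF GA] unfolding S2 by (simp add: algebra_simps)
      ultimately show ?thesis using t(2) unfolding lnGA by linarith
    qed
    then have tD: "\<tau> \<le> D * S" by (simp add: D_def distrib_right)
    have lS: "l \<le> l * S" using mult_left_mono[OF S1 l(1)] by simp
    show "\<N> {T<..<T + 1} r \<le> exp (C1 * (1 + \<mu>\<^sup>2 + \<Lambda>)) * \<N> {T - 3<..<T} r"
    proof (rule order_trans[OF R], rule mult_right_mono[OF _ N0])
      have "l + \<tau> * 3 \<le> C1 * S" using tD lS by (simp add: C1_def algebra_simps)
      then show "2 * C * exp (\<tau> * 3) \<le> exp (C1 * (1 + \<mu>\<^sup>2 + \<Lambda>))"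
        unfolding l(2) exp_add[symmetric] S_def[symmetric] by simp
    qed
    have e: "l + \<tau> * (2 + \<bar>T\<bar>) \<le> C1 * S * (1 + \<bar>T\<bar>)"
    proof -
      have "\<tau> * (2 + \<bar>T\<bar>) \<le> (D * S) * (3 * (1 + \<bar>T\<bar>))" using tD t(1) by (intro mult_mono) auto
      moreover have "l * S * 1 \<le> l * S * (1 + \<bar>T\<bar>)" using l S1 by (intro mult_left_mono) auto
      ultimately show ?thesis using lS unfolding C1_def by (simp add: algebra_simps)
    qed
    have "A * exp (- (C1 * S * (1 + \<bar>T\<bar>))) \<le> exp (l + \<tau> * (2 + \<bar>T\<bar>)) * \<N> {T - 3<..<T} r * exp (- (C1 * S * (1 + \<bar>T\<bar>)))"
      using a unfolding l(2) exp_add by (intro mult_right_mono) auto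
    also have "\<dots> = exp (l + \<tau> * (2 + \<bar>T\<bar>) - C1 * S * (1 + \<bar>T\<bar>)) * \<N> {T - 3<..<T} r"
      by (simp only: exp_diff exp_minus divide_inverse mult_ac)
    also have "\<dots> \<le> 1 * \<N> {T - 3<..<T} r" using e by (intro mult_right_mono N0) auto
    finally show "\<N> {T - 3<..<T} r \<ge> A * exp (- C1 * (1 + \<mu>\<^sup>2 + \<Lambda>) * (1 + \<bar>T\<bar>))"
      unfolding S_def by simp
  qed
qed

end
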